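(* Let $m,n\in\mathbb{N}$ with $m\geqslant 5$, and let $\gamma\in(0,\sqrt[3]{m}\,]$. Put $\mathbb{A}_0=(0,0,\ldots,0)\in\mathbb{C}^n$. Let $\mathbb{A}_k=(a^{(k)}_1,\ldots,a^{(k)}_n)\in\mathbb{C}^n$, $k=1,\ldots,m$, be points such that $\mathbb{A}_1=(1,1,\ldots,1)$ and, for every $p\in\{1,\ldots,n\}$, the points $a^{(1)}_p,\ldots,a^{(m)}_p$ are nonzero and satisfy $$0=\arg a^{(1)}_p<\arg a^{(2)}_p<\ldots<\arg a^{(m)}_p<2\pi .$$ Assume moreover that for every $p\in\{1,\ldots,n\}$ one has $L^{(\gamma)}\big(\{a^{(k)}_p\}_{k=1}^m\big)=1$ and $L^{(0)}\big(\{a^{(k)}_p\}_{k=1}^m\big)=1$ (with $L^{(\cdot)}$ as defined in the context). Let $\mathbb{B}_k=B^{(k)}_1\times\cdots\times B^{(k)}_n\subset\overline{\mathbb{C}}^n$, $k=0,1,\ldots,m$, be polycylindrical domains with $\mathbb{A}_k\in\mathbb{B}_k$ (i.e. $a^{(k)}_p\in B^{(k)}_p$ for all $p$, where $a^{(0)}_p=0$), which are mutually non-overlapping in the sense that for each fixed $p\in\{1,\ldots,n\}$ the domains $B^{(0)}_p,B^{(1)}_p,\ldots,B^{(m)}_p\subset\overline{\mathbb{C}}$ are pairwise disjoint. Then $$\mathbb{R}^{\gamma}(\mathbb{B}_0,\mathbb{A}_0)\prod_{k=1}^m\mathbb{R}(\mathbb{B}_k,\mathbb{A}_k)\leqsl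ant\left(\frac{4}{m}\right)^{m}\frac{\left(\frac{4\gamma}{m^{2}}\right)^{\frac{\gamma}{m}}}{\left(1-\frac{\gamma}{m^{2}}\right)^{m+\frac{\gamma}{m}}}\left(\frac{1-\frac{\sqrt{\gamma}}{m}}{1+\frac{\sqrt{\gamma}}{m}}\right)^{2\sqrt{\gamma}}.$$
   Context: $\overline{\mathbb{C}}=\mathbb{C}\cup\{\infty\}$ and $\overline{\mathbb{C}}^n=\overline{\mathbb{C}}\times\cdots\times\overline{\mathbb{C}}$ ($n$ factors) with the product topology. A polycylindrical domain is a set $\mathbb{B}=B_1\times\cdots\times B_n\subset\overline{\mathbb{C}}^n$ where each $B_k\subset\overline{\mathbb{C}}$ is a domain (its coordinate domains). For a domain $B\subset\overline{\mathbb{C}}$ and a point $a\in B$, $r(B,a)$ denotes the inner (conformal) radius of $B$ at $a$. For a polycylindrical domain $\mathbb{B}=B_1\times\cdots\times B_n$ and a point $\mathbb{A}=(a_1,\ldots,a_n)\in\mathbb{B}$, the generalized inner radius is $\mathbb{R}(\mathbb{B},\mathbb{A})=\big[\prod_{k=1}^n r(B_k,a_k)\big]^{1/n}$. For points $a_1,\ldots,a_m\in\mathbb{C}\setminus\{0\}$ with $0=\arg a_1<\arg a_2<\cdots<\arg a_m<2\pi$ and $\gamma\geqslant 0$, set $a_{m+1}:=a_1$, $\alpha_k:=\frac{1}{\pi}\arg\frac{a_{k+1}}{a_k}\in(0,2)$ for $k=1,\ldots,m$ (arguments taken so that $\sum_{k=1}^m\alpha_k=2$), $\alpha_0:=\alpha_m$,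 $\chi(t)=\frac12(t+t^{-1})$, and $$L^{(\gamma)}(\{a_k\}_{k=1}^m):=\prod_{k=1}^m\left[\chi\!\left(\Big|\frac{a_k}{a_{k+1}}\Big|^{\frac{1}{2\alpha_k}}\right)\right]^{1-\frac12\gamma\alpha_k^2}\prod_{k=1}^m|a_k|^{1+\frac14\gamma(\alpha_k+\alpha_{k-1})}.$$ *)

theory Defs
  imports "HOL-Analysis.Analysis"
begin

text \<open>The extended plane is modelled as complex option: Some z is the finite point z,
  None is the point at infinity. A subset of the extended plane is a complex option set.\<close>

definition finpart :: "complex option set \<Rightarrow> complex set" where
  "finpart B = {z. Some z \<in> B}"

text \<open>Domain (open connected set) in the extended plane. If infinity belongs to B,
  openness at infinity means B contains a neighbourhood of infinity, and connectedness
  is checked in the chart w = 1/z (infinity corresponds to w = 0; removing the point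
  0 of the finite part does not affect connectedness of a domain).\<close>

definition ext_domain :: "complex option set \<Rightarrow> bool" where
  "ext_domain B \<longleftrightarrow> open (finpart B) \<and>
     (if None \<in> B
      then (\<exists>R. \<forall>z. R < cmod z \<longrightarrow> z \<in> finpart B) \<and>
           connected (insert 0 (inverse ` (finpart B - {0})))
      else finpart B \<noteq> {} \<and> connected (finpart B))"

definition harmonic_on :: "(complex \<Rightarrow> real) \<Rightarrow> complex set \<Rightarrow> bool" where
  "harmonic_on u S \<longleftrightarrow> open S \<and>
     (\<forall>z\<in>S. \<exists>e>0. ball z e \<subseteq> S \<and> (\<exists>f. f holomorphic_on ball z e \<and>
        (\<forall>w\<in>ball z e. u w = Re (f w))))"

text \<open>Inner (conformal) radius r(B,a) via the Green function: the Green function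
  g(z,a) is the least positive harmonic function on B minus a with the singularity
  -log|z-a| at a, and log r(B,a) = lim (g(z,a) + log|z-a|). Hence r(B,a) is the infimum
  of exp(v(a)) over all positive harmonic h on B minus a such that v = h + log|z-a|
  extends harmonically to a. If no such h exists (complement of zero capacity) the
  infimum is +infinity.\<close>

definition inner_radius :: "complex option set \<Rightarrow> complex \<Rightarrow> ereal" where
  "inner_radius B a = Inf {ereal (exp (v a)) | h v.
      harmonic_on h (finpart B - {a}) \<and> (\<forall>z\<in>finpart B - {a}. 0 < h z) \<and>
      (\<exists>e>0. ball a e \<subseteq> finpart B \<and> harmonic_on v (ball a e) \<and>
         (\<forall>z\<in>ball a e - {a}. v z = h z + ln (cmod (z - a))))}"

text \<open>Generalized inner radius of a polycylindrical domain B_1 x ... x B_n at (a_1,...,a_n),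
  coordinates indexed by 1..n (assumed finite).\<close>

definition gen_inner_radius :: "nat \<Rightarrow> (nat \<Rightarrow> complex option set) \<Rightarrow> (nat \<Rightarrow> complex) \<Rightarrow> real" where
  "gen_inner_radius n B a = (\<Prod>p=1..n. real_of_ereal (inner_radius (B p) (a p))) powr (1 / real n)"

definition arg0 :: "complex \<Rightarrow> real" where
  "arg0 z = (if Arg z < 0 then Arg z + 2 * pi else Arg z)"

definition chi :: "real \<Rightarrow> real" where
  "chi t = (t + 1 / t) / 2"

definition Lgam :: "real \<Rightarrow> nat \<Rightarrow> (nat \<Rightarrow> complex) \<Rightarrow> real" where
  "Lgam \<gamma> m a =
    (let \<theta> = (\<lambda>k. arg0 (a k));
         anext = (\<lambda>k. if k < m then a (Suc k) else a 1);
         \<alpha> = (\<lambda>k. if k < m then (\<theta> (Suc k) - \<theta> k) / pi else (2 * pi + \<theta> 1 - \<theta> m) / pi);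
         \<alpha>prev = (\<lambda>k. if k = 1 then \<alpha> m else \<alpha> (k - 1))
     in (\<Prod>k=1..m. (chi ((cmod (a k / anext k)) powr (1 / (2 * \<alpha> k)))) powr (1 - \<gamma> / 2 * (\<alpha> k)\<^sup>2))
      * (\<Prod>k=1..m. (cmod (a k)) powr (1 + \<gamma> / 4 * (\<alpha> k + \<alpha>prev k))))"

end

theory Submission
  imports Defs "HOL-Complex_Analysis.Complex_Analysis"
begin

text \<open>
  The inner radius is controlled by energy. On each sector between two consecutive points there is an
  explicit field, the square root of a quadratic differential, with simple poles at the two
  points and at the origin. Pairing it with the gradients of truncated approximate Green functions of the
  disjoint domains gives, by Green's formula, the weighted sum of the levels of truncation; by AM-GM it is
  at most half the total energy of the gradients, again a weighted sum of levels, plus half the energy of the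
  field outside small discs. In the limit this bounds \<open>\<gamma> ln r(B\<^sub>0,0) + \<Sum> ln r(B\<^sub>k,a\<^sub>k)\<close> by the logarithm of \<open>L(\<gamma>)\<close> and a sum
  over the openings \<open>\<alpha>\<^sub>k\<close>. Only lower approximations of the Green functions by
  logarithms of rational functions are needed; Fekete points show that they suffice to bound
  the inner radius. The sum over the openings is largest for equal openings, by a tangent line estimate, unless
  some \<open>\<alpha>\<^sub>k \<ge> 2 / \<surd>\<gamma>\<close>. In that case one uses the sector inequality
  as \<open>\<gamma> \<rightarrow> 0\<close> together with \<open>r(B\<^sub>0,0) r(B\<^sub>k,a\<^sub>k) \<le> |a\<^sub>k|\<^sup>2\<close>.
\<close>

section \<open>Change of variables and iterated integrals in the plane\<close>

text \<open>The inner radius is an infimum over positive harmonic functions on an arbitrary domain,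
  so an upper bound needs one competitor; it arises as a normal family limit of the rational
  approximations. The field has no normal component on the sides of a sector, so only its poles
  contribute to the flux and the sectors can be treated separately. AM-GM sees only the squared
  modulus of the field, so each test function may be paired with its own signs on the two halves of
  each sector. For the domain of the origin the signs differ across the middle line, and the
  resulting boundary term has a favourable sign. The test function at the origin is scaled by
  \<surd>\<gamma> and meets flux weights T = \<surd>\<gamma> \<alpha> / 2, which add up to
  \<surd>\<gamma> because the openings sum to 2; this produces the exponent \<gamma>. The map onto a
  sector needs T < 1, whence the two cases. The bound on \<gamma> enters both: it puts the mean
  \<surd>\<gamma> / m of the T below 0.265, and it makes an exceptional opening at least 2 /
  m^(1/6). The condition on L(\<gamma>) serves the first case, the one on L(0) the second.\<close>

lemma has_integral_basis_iso:
  fixes L :: "'a::euclidean_space \<Rightarrow> 'b::euclidean_space" and f :: "'b \<Rightarrow> real"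
  assumes lin: "linear L" and linM: "linear M" and MLid: "\<And>x. M (L x) = x" and LMid: "\<And>x. L (M x) = x"
    and bij: "bij_betw L Basis Basis" and inn: "\<And>x i. i \<in> Basis \<Longrightarrow> L x \<bullet> L i = x \<bullet> i"
    and int: "(f has_integral y) S"
  shows "((\<lambda>x. f (L x)) has_integral y) (L -` S)"
proof -
  have innM: "M u \<bullet> i = u \<bullet> L i" if "i \<in> Basis" for u i
    using inn[OF that, of "M u"] by (simp add: LMid)
  \<comment> \<open>A linear bijection between the standard bases maps boxes to boxes of equal
    content, which is what \<open>has_integral_twiddle\<close> asks for. It also preserves norms, so
    one radius \<open>B\<close> serves on both sides in the definition of the integral over
    unbounded sets.\<close>
  have boxeq: "L ` cbox u v = cbox (L u) (L v)" for u v
  proof -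
    have "L x \<in> cbox (L u) (L v) \<longleftrightarrow> x \<in> cbox u v" for x
      unfolding mem_box bij_betw_imp_surj_on[OF bij, symmetric] by (simp add: inn)
    moreover have "surj L" by (metis LMid surjI)
    ultimately show ?thesis by (metis (no_types, lifting) ext image_subset_iff subsetI subset_antisym image_iff LMid)
  qed
  have boxeqM: "M ` cbox u v = cbox (M u) (M v)" for u v
    using boxeq[of "M u" "M v"] by (metis (no_types, lifting) LMid MLid image_cong image_ident image_image)
  have cont: "measure lborel (L ` cbox u v) = measure lborel (cbox u v)" for u v
  proof -
    have "(cbox (L u) (L v) = {}) = (cbox u v = {})"
      using boxeq[of u v] by auto
    moreover have "(\<Prod>i\<in>Basis. L v \<bullet> i - L u \<bullet> i) = (\<Prod>i\<in>Basis. v \<bullet> i - u \<bullet> i)"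
      using prod.reindex_bij_betw[OF bij, of "\<lambda>i. L v \<bullet> i - L u \<bullet> i"] by (simp add: inn)
    ultimately show ?thesis unfolding boxeq content_cbox_if by simp
  qed
  have nrm: "norm (M u) = norm u" for u
  proof -
    have "u \<bullet> u = (\<Sum>i\<in>Basis. (u \<bullet> L i) * (u \<bullet> L i))"
      using euclidean_inner[of u u] sum.reindex_bij_betw[OF bij, of "\<lambda>i. (u \<bullet> i) * (u \<bullet> i)"] by simp
    also have "\<dots> = (\<Sum>i\<in>Basis. (M u \<bullet> i) * (M u \<bullet> i))"
      by (rule sum.cong) (auto simp: innM)
    also have "\<dots> = M u \<bullet> M u" using euclidean_inner[of "M u" "M u"] by simp
    finally show ?thesis by (simp add: norm_eq_sqrt_inner)
  qed
  have tw: "((\<lambda>x. g (L x)) has_integral z) (cbox (M a) (M b))" if "(g has_integral z) (cbox a b)" for g :: "'b \<Rightarrow> real" and z a b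
  proof -
    have "((\<lambda>x. g (L x)) has_integral (1/1) *\<^sub>R z) (M ` cbox a b)"
      by (rule has_integral_twiddle[OF _ MLid LMid _ _ _ _ that])
         (use boxeq boxeqM cont lin in \<open>auto simp: linear_continuous_at linear_linear intro: exI\<close>)
    then show ?thesis by (simp add: boxeqM)
  qed
  show ?thesis
  proof (subst has_integral', intro allI impI)
    fix e :: real assume "e > 0"
    then obtain B where "B > 0" and B: "\<And>a b. ball 0 B \<subseteq> cbox a b \<Longrightarrow>
        \<exists>z. ((\<lambda>x. if x \<in> S then f x else 0) has_integral z) (cbox a b) \<and> norm (z - y) < e"
      using int unfolding has_integral'[of f] by blast
    show "\<exists>B>0. \<forall>a b. ball 0 B \<subseteq> cbox a b \<longrightarrow> (\<exists>z. ((\<lambda>x. if x \<in> L -` S then f (L x) else 0) has_integral z) (cbox a b) \<and> norm (z - y) < e)"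
    proof (rule exI[of _ B], intro conjI allI impI \<open>B > 0\<close>)
      fix a b :: 'a assume sub: "ball 0 B \<subseteq> cbox a b"
      have "ball 0 B \<subseteq> cbox (L a) (L b)"
      proof
        fix u :: 'b assume "u \<in> ball 0 B"
        then have "M u \<in> cbox a b" using sub nrm by auto
        then show "u \<in> cbox (L a) (L b)" using boxeq[of a b] by (metis LMid imageI)
      qed
      from B[OF this] obtain z where z: "((\<lambda>x. if x \<in> S then f x else 0) has_integral z) (cbox (L a) (L b))" "norm (z - y) < e" by blast
      from tw[OF z(1)] show "\<exists>z. ((\<lambda>x. if x \<in> L -` S then f (L x) else 0) has_integral z) (cbox a b) \<and> norm (z - y) < e"
        using z(2) by (auto simp: MLid vimage_def)
    qed
  qed
qed

text \<open>Pairs of reals carry the theorem on iterated integrals; \<open>real^2\<close>, in the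
  next lemma, carries the change of variables with determinants. The maps are given by equations so
  that \<open>[OF refl refl]\<close> yields the facts for the explicit terms.\<close>

lemma Complex_pair_iso:
  fixes L :: "real \<times> real \<Rightarrow> complex" and M :: "complex \<Rightarrow> real \<times> real"
  assumes L_def: "L = (\<lambda>u. Complex (fst u) (snd u))" and M_def: "M = (\<lambda>z. (Re z, Im z))"
  shows "linear L" "linear M" "M (L u) = u" "L (M z) = z" "bij_betw L Basis Basis" "bij_betw M Basis Basis"
    "i \<in> Basis \<Longrightarrow> L x \<bullet> L i = x \<bullet> i" "j \<in> Basis \<Longrightarrow> M y \<bullet> M j = y \<bullet> j"
proof -
  show "linear L" "linear M" by (auto simp: L_def M_def linear_iff complex_eq_iff)
  show "M (L u) = u" "L (M z) = z" by (auto simp: L_def M_def)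
  show "bij_betw L Basis Basis" "bij_betw M Basis Basis"
    by (auto simp: L_def M_def bij_betw_def inj_on_def Basis_prod_def Basis_complex_def complex_eq_iff)
  show "i \<in> Basis \<Longrightarrow> L x \<bullet> L i = x \<bullet> i" "j \<in> Basis \<Longrightarrow> M y \<bullet> M j = y \<bullet> j"
    by (auto simp: L_def M_def Basis_prod_def Basis_complex_def inner_complex_def inner_prod_def)
qed

lemma Complex_vec_iso:
  fixes L :: "real^2 \<Rightarrow> complex" and M :: "complex \<Rightarrow> real^2"
  assumes L_def: "L = (\<lambda>u. Complex (u$1) (u$2))" and M_def: "M = (\<lambda>z. vector [Re z, Im z])"
  shows "linear L" "linear M" "M (L u) = u" "L (M z) = z" "bij_betw L Basis Basis" "bij_betw M Basis Basis"
    "i \<in> Basis \<Longrightarrow> L x \<bullet> L i = x \<bullet> i" "j \<in> Basis \<Longrightarrow> M y \<bullet> M j = y \<bullet> j"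
proof -
  have B: "(Basis :: (real^2) set) = {axis 1 1, axis 2 1}"
    by (auto simp: Basis_vec_def exhaust_2) (metis exhaust_2)
  show 1: "linear L" "linear M" by (auto simp: L_def M_def linear_iff complex_eq_iff vec_eq_iff forall_2)
  show 2: "M (L u) = u" "L (M z) = z" for u z by (auto simp: L_def M_def vec_eq_iff forall_2)
  have 3: "L (axis 1 1) = 1" "L (axis 2 1) = \<i>" by (auto simp: L_def axis_def complex_eq_iff)
  then have 4: "M 1 = axis 1 1" "M \<i> = axis 2 1" using 2 by metis+
  have ne: "(axis 1 1 :: real^2) \<noteq> axis 2 1" by (simp add: axis_eq_axis)
  show "bij_betw L Basis Basis" "bij_betw M Basis Basis"
    unfolding bij_betw_def B Basis_complex_def inj_on_def using 3 4 ne by (auto)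
  show "i \<in> Basis \<Longrightarrow> L x \<bullet> L i = x \<bullet> i" "j \<in> Basis \<Longrightarrow> M y \<bullet> M j = y \<bullet> j"
    unfolding B Basis_complex_def using 3 4 
    by (auto simp: inner_axis) (auto simp: L_def M_def inner_complex_def)
qed

lemma integral_complex_cbox_iterated:
  fixes f :: "complex \<Rightarrow> real"
  assumes "continuous_on (cbox (Complex a c) (Complex b d)) f"
  shows "integral (cbox (Complex a c) (Complex b d)) f = integral {a..b} (\<lambda>x. integral {c..d} (\<lambda>y. f (Complex x y)))"
proof -
  let ?L = "\<lambda>u::real \<times> real. Complex (fst u) (snd u)"
  note iso = Complex_pair_iso[OF refl refl]
  have "(f has_integral integral (cbox (Complex a c) (Complex b d)) f) (cbox (Complex a c) (Complex b d))"
    using integrable_continuous[OF assms] by (rule integrable_integral)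
  from has_integral_basis_iso[OF iso(1,2,3,4,5,7) this]
  have "((\<lambda>u. f (?L u)) has_integral integral (cbox (Complex a c) (Complex b d)) f) (?L -` cbox (Complex a c) (Complex b d))" .
  moreover have "?L -` cbox (Complex a c) (Complex b d) = cbox (a,c) (b,d)"
    by (auto simp: in_cbox_complex_iff)
  ultimately have "integral (cbox (a,c) (b,d)) (\<lambda>u. f (?L u)) = integral (cbox (Complex a c) (Complex b d)) f"
    by (simp add: integral_unique)
  moreover have "continuous_on (cbox (a,c) (b,d)) (\<lambda>u. f (?L u))"
    by (rule continuous_on_compose2[OF assms])
       (auto intro!: continuous_intros simp: in_cbox_complex_iff complex_eq_iff linear_continuous_on linear_linear iso(1))
  ultimately show ?thesis using integral_prod_continuous[of a c b d "\<lambda>u. f (?L u)"] by simp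
qed

text \<open>By Cauchy-Riemann, multiplication by \<open>g' z\<close> has real determinant
  \<open>(cmod (g' z))\<^sup>2\<close>. Integrability is part of the equivalence, so continuity of
  the pulled-back density on a box makes the density integrable on the image.\<close>

theorem complex_change_of_variables:
  fixes f :: "complex \<Rightarrow> real" and g :: "complex \<Rightarrow> complex"
  assumes S: "open S"
    and der: "\<And>z. z \<in> S \<Longrightarrow> (g has_field_derivative g' z) (at z)"
    and inj: "inj_on g S"
  shows "(\<lambda>z. (cmod (g' z))\<^sup>2 * f (g z)) absolutely_integrable_on S \<and>
           integral S (\<lambda>z. (cmod (g' z))\<^sup>2 * f (g z)) = b
     \<longleftrightarrow> f absolutely_integrable_on (g ` S) \<and> integral (g ` S) f = b"
proof -
  define L where "L = (\<lambda>u::real^2. Complex (u$1) (u$2))"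
  define M where "M = (\<lambda>z. vector [Re z, Im z] :: real^2)"
  note iso = Complex_vec_iso[OF L_def M_def]
  have isoL: "(h has_integral y) T \<longleftrightarrow> ((\<lambda>x. h (L x)) has_integral y) (L -` T)" for h :: "complex \<Rightarrow> real" and y T
  proof
    show "(h has_integral y) T \<Longrightarrow> ((\<lambda>x. h (L x)) has_integral y) (L -` T)"
      by (rule has_integral_basis_iso[OF iso(1,2,3,4,5,7)])
    assume "((\<lambda>x. h (L x)) has_integral y) (L -` T)"
    from has_integral_basis_iso[OF iso(2,1,4,3,6,8) this]
    show "(h has_integral y) T" by (simp add: iso vimage_def)
  qed
  have integ: "h integrable_on T \<longleftrightarrow> (\<lambda>x. h (L x)) integrable_on (L -` T)" for h :: "complex \<Rightarrow> real" and T
    using isoL[of h _ T] unfolding integrable_on_def by blast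
  have eq: "integral T h = integral (L -` T) (\<lambda>x. h (L x))" for h :: "complex \<Rightarrow> real" and T
  proof (cases "h integrable_on T")
    case True then show ?thesis using isoL[of h _ T] by (metis has_integral_integral integral_unique)
  next
    case False then show ?thesis using integ[of h T] by (simp add: not_integrable_integral)
  qed
  have absint: "h absolutely_integrable_on T \<longleftrightarrow> (\<lambda>x. h (L x)) absolutely_integrable_on (L -` T)" for h :: "complex \<Rightarrow> real" and T
    unfolding absolutely_integrable_on_def using integ[of h T] integ[of "\<lambda>x. norm (h x)" T] by simp
  define G where "G = M \<circ> g \<circ> L"
  define G' where "G' = (\<lambda>u. M \<circ> (*) (g' (L u)) \<circ> L)"
  have detG: "\<bar>det (matrix (G' u))\<bar> = (cmod (g' (L u)))\<^sup>2" for u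
  proof -
    have "det (matrix (G' u)) = (Re (g' (L u)))\<^sup>2 + (Im (g' (L u)))\<^sup>2"
      by (simp add: det_2 matrix_def G'_def M_def L_def axis_def power2_eq_square)
    then show ?thesis by (simp add: cmod_power2)
  qed
  have oL: "open (L -` S)"
    by (rule open_vimage[OF S]) (use iso(1) in \<open>simp add: linear_continuous_on linear_linear\<close>)
  have derG: "(G has_derivative G' u) (at u within L -` S)" if "u \<in> L -` S" for u
  proof -
    have 1: "(g has_derivative (*) (g' (L u))) (at (L u))"
      using der[of "L u"] that by (auto simp: has_field_derivative_def)
    have 2: "(L has_derivative L) (at u within L -` S)"
      using iso(1) by (simp add: linear_imp_has_derivative)
    have 3: "(M has_derivative M) (at (g (L u)))"
      using iso(2) by (simp add: linear_imp_has_derivative)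
    have 4: "((\<lambda>x. g (L x)) has_derivative (\<lambda>x. g' (L u) * L x)) (at u within L -` S)"
      by (rule has_derivative_compose[OF 2 1])
    show ?thesis unfolding G_def G'_def o_def by (rule has_derivative_compose[OF 4 3])
  qed
  have injG: "inj_on G (L -` S)"
    using inj iso(3,4) by (auto simp: inj_on_def G_def) metis
  have img: "L -` (g ` S) = G ` (L -` S)"
  proof -
    have "x \<in> G ` (L -` S)" if "L x = g z" "z \<in> S" for x z
      using that iso(3)[of x] iso(4)[of z] by (auto simp: G_def intro!: image_eqI[of _ _ "M z"])
    moreover have "L x \<in> g ` S" if "x \<in> G ` (L -` S)" for x
      using that iso(4) by (auto simp: G_def)
    ultimately show ?thesis by auto
  qed
  \<comment> \<open>The determinant formula is for integrands with values in \<open>real^'n\<close>,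
    so the scalar integrand is passed through \<open>real^1\<close>.\<close>
  have "(\<lambda>x. \<bar>det (matrix (G' x))\<bar> *\<^sub>R (\<chi> i::1. f (L (G x)))) absolutely_integrable_on (L -` S) \<and>
           integral (L -` S) (\<lambda>x. \<bar>det (matrix (G' x))\<bar> *\<^sub>R (\<chi> i::1. f (L (G x)))) = (\<chi> i::1. b)
     \<longleftrightarrow> (\<lambda>x. \<chi> i::1. f (L x)) absolutely_integrable_on (G ` (L -` S)) \<and> integral (G ` (L -` S)) (\<lambda>x. \<chi> i::1. f (L x)) = (\<chi> i::1. b)"
    using has_absolute_integral_change_of_variables[OF _ derG injG, of "\<lambda>x. \<chi> i::1. f (L x)" "\<chi> i. b"] oL
    by (simp add: borel_open sets_completionI_sets)
  moreover have vec1: "(\<lambda>x. \<chi> i::1. h x) absolutely_integrable_on T \<and> integral T (\<lambda>x. \<chi> i::1. h x) = (\<chi> i::1. b)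
      \<longleftrightarrow> h absolutely_integrable_on T \<and> integral T h = b" for h :: "real^2 \<Rightarrow> real" and T
  proof -
    have i: "(\<lambda>x. \<chi> i::1. h x) integrable_on T \<longleftrightarrow> h integrable_on T"
      by (subst integrable_componentwise_iff) (auto simp: Basis_vec_def inner_axis)
    have n: "norm (\<chi> i::1. h x) = norm (h x)" for x by (simp add: norm_vec_def)
    have "integral T (\<lambda>x. \<chi> i::1. h x) $ 1 = integral T h" if "h integrable_on T"
      using integral_component_eq_cart[of "\<lambda>x. \<chi> i::1. h x" T 1] i that by simp
    then show ?thesis unfolding absolutely_integrable_on_def using i n
      by (auto simp: vec_eq_iff)
  qed
  ultimately show ?thesis
    unfolding absint[where T=S] absint[where T="g ` S"] eq[of S] eq[of "g ` S"] img
    using vec1[where h="\<lambda>x. (cmod (g' (L x)))\<^sup>2 * f (g (L x))" and T="L -` S"] vec1[where h="\<lambda>x. f (L x)" and T="G ` (L -` S)"]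
    by (simp add: detG G_def iso(4) scaleR_vec_def)
qed

section \<open>Fekete points and approximate Green functions\<close>

text \<open>The Green function of \<open>U\<close> is approximated from below by the logarithm of a rational function with pole \<open>a\<close> and zeros \<open>S\<close> that is negative on the frontier of some \<open>\<Omega>\<close> inside \<open>U\<close>; \<open>v\<close> is its Robin constant, a lower bound for the logarithm of the inner radius.\<close>
definition green_approx :: "complex set \<Rightarrow> complex \<Rightarrow> real \<Rightarrow> bool" where
  "green_approx U a v \<longleftrightarrow> (\<exists>\<Omega> S. open \<Omega> \<and> bounded \<Omega> \<and> a \<in> \<Omega> \<and> closure \<Omega> \<subseteq> U \<and>
     finite S \<and> S \<noteq> {} \<and> S \<inter> \<Omega> = {} \<and>
     (\<forall>w\<in>frontier \<Omega>. exp (real (card S) * v) * (\<Prod>s\<in>S. cmod (w - s) / cmod (s - a)) < cmod (w - a) ^ card S))"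

text \<open>The Lagrange interpolant of the constant 1, minus 1, has degree below
  \<open>card S\<close> and vanishes on \<open>S\<close>.\<close>

lemma lagrange_sum_one:
  fixes S :: "'a::field set"
  assumes "finite S" "S \<noteq> {}"
  shows "(\<Sum>s\<in>S. \<Prod>t\<in>S-{s}. (z - t) / (s - t)) = 1"
proof -
  define P where "P = (\<Sum>s\<in>S. smult (inverse (\<Prod>t\<in>S-{s}. (s - t))) (\<Prod>t\<in>S-{s}. [:- t, 1:])) - 1"
  have eval: "poly P x = (\<Sum>s\<in>S. \<Prod>t\<in>S-{s}. (x - t) / (s - t)) - 1" for x
    by (simp add: P_def poly_sum poly_prod prod_dividef) (simp add: divide_inverse mult.commute)
  have root: "poly P x = 0" if "x \<in> S" for x
  proof -
    have "(\<Prod>t\<in>S-{s}. (x - t) / (s - t)) = (if s = x then 1 else 0)" if "s \<in> S" for s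
    proof (cases "s = x")
      case True
      have "(x - t) / (s - t) = 1" if "t \<in> S - {s}" for t
        using that True by (cases "t = x") auto
      then have "(\<Prod>t\<in>S-{s}. (x - t) / (s - t)) = 1"
        by (intro prod.neutral) blast
      then show ?thesis using True by simp
    next
      case False
      then have "x \<in> S - {s}" using \<open>x \<in> S\<close> by auto
      then show ?thesis using False assms(1) by (auto intro!: prod_zero bexI[of _ x])
    qed
    then have "(\<Sum>s\<in>S. \<Prod>t\<in>S-{s}. (x - t) / (s - t)) = (\<Sum>s\<in>S. if s = x then 1 else 0)"
      by (intro sum.cong) auto
    then show ?thesis using that assms(1) by (simp add: eval)
  qed
  have "degree P \<le> card S - 1"
  proof -
    have "degree (\<Prod>t\<in>S-{s}. [:- t, 1:]) \<le> card S - 1" if "s \<in> S" for s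
      using degree_prod_sum_le[of "S-{s}" "\<lambda>t. [:- t, 1:]"] that assms(1) by (simp add: card_Diff_singleton)
    then show ?thesis unfolding P_def
      by (intro degree_diff_le degree_sum_le assms(1)) (auto intro: order.trans[OF degree_smult_le])
  qed
  moreover have "card S > 0" using assms by (simp add: card_gt_0_iff)
  ultimately have "degree P < card S" by linarith
  have "P = 0"
  proof (rule ccontr)
    assume "P \<noteq> 0"
    then have "card {x. poly P x = 0} \<le> degree P" and "finite {x. poly P x = 0}"
      using card_poly_roots_bound poly_roots_finite by blast+
    moreover have "S \<subseteq> {x. poly P x = 0}" using root by auto
    ultimately have "card S \<le> degree P" using card_mono order_trans by blast
    then show False using \<open>degree P < card S\<close> by linarith
  qed
  then show ?thesis using eval[of z] by simp
qed

text \<open>Every unordered pair is counted twice, so for finite \<open>S\<close> this is the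
  squared modulus of the Vandermonde determinant.\<close>

definition vdm :: "complex set \<Rightarrow> real" where
  "vdm S = (\<Prod>s\<in>S. \<Prod>t\<in>S-{s}. cmod (s - t))"

lemma vdm_insert:
  assumes "finite S" "x \<notin> S"
  shows "vdm (insert x S) = (\<Prod>t\<in>S. cmod (x - t))\<^sup>2 * vdm S"
proof -
  have "(\<Prod>t\<in>insert x S - {s}. cmod (s - t)) = cmod (x - s) * (\<Prod>t\<in>S-{s}. cmod (s - t))" if "s \<in> S" for s
  proof -
    have "insert x S - {s} = insert x (S - {s})" using that assms by auto
    then show ?thesis using assms by (simp add: norm_minus_commute)
  qed
  then have "(\<Prod>s\<in>S. \<Prod>t\<in>insert x S-{s}. cmod (s - t)) = (\<Prod>s\<in>S. cmod (x - s)) * vdm S"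
    by (simp add: vdm_def prod.distrib)
  moreover have "insert x S - {x} = S" using assms by auto
  ultimately show ?thesis unfolding vdm_def[of "insert x S"] using assms by (simp add: power2_eq_square)
qed

text \<open>Near-maximality (up to a factor) of the Vandermonde product suffices, so no compactness of
  configuration space is needed.\<close>

lemma almost_fekete_points:
  fixes K :: "complex set"
  assumes inf: "infinite K" and D: "\<And>x y. x \<in> K \<Longrightarrow> y \<in> K \<Longrightarrow> cmod (x - y) \<le> D"
  obtains S where "S \<subseteq> K" "finite S" "card S = Suc N"
    "\<And>s x. s \<in> S \<Longrightarrow> x \<in> K \<Longrightarrow> (\<Prod>t\<in>S-{s}. cmod (x - t)) \<le> 2 * (\<Prod>t\<in>S-{s}. cmod (s - t))"
proof -
  define F where "F = {S. S \<subseteq> K \<and> finite S \<and> card S = Suc N}"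
  have D0: "0 \<le> D" using D inf by (metis infinite_imp_nonempty norm_ge_zero order_trans ex_in_conv)
  have bdd: "vdm S \<le> (D ^ N) ^ Suc N" if "S \<in> F" for S
  proof -
    have "(\<Prod>t\<in>S-{s}. cmod (s - t)) \<le> D ^ N" if "s \<in> S" for s
    proof -
      have "(\<Prod>t\<in>S-{s}. cmod (s - t)) \<le> (\<Prod>t\<in>S-{s}. D)"
        using \<open>S \<in> F\<close> that D by (intro prod_mono) (auto simp: F_def)
      then show ?thesis using \<open>S \<in> F\<close> that by (simp add: F_def card_Diff_singleton)
    qed
    then have "vdm S \<le> (\<Prod>s\<in>S. D ^ N)" unfolding vdm_def
      by (intro prod_mono) (auto intro: prod_nonneg)
    then show ?thesis using that by (simp add: F_def)
  qed
  obtain S0 where S0: "S0 \<in> F" using infinite_arbitrarily_large[OF inf, of "Suc N"] by (auto simp: F_def)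
  have pos: "vdm S > 0" if "finite S" for S
    unfolding vdm_def by (intro prod_pos) auto
  define m where "m = Sup (vdm ` F)"
  have le: "vdm S \<le> m" if "S \<in> F" for S unfolding m_def using that bdd by (intro cSUP_upper) (auto simp: bdd_above_def)
  have m0: "m > 0" using le[OF S0] pos[of S0] S0 by (auto simp: F_def)
  \<comment> \<open>Exchanging a point changes \<open>vdm\<close> by the square of a product of
    distances (\<open>vdm_insert\<close>), so a loss of 4 here becomes the factor 2 in the
    conclusion.\<close>
  have "m / 4 < m" using m0 by simp
  then obtain S where S: "S \<in> F" "m / 4 < vdm S"
    unfolding m_def using S0 less_cSupD[of "vdm ` F" "m/4"] m_def by auto
  have "(\<Prod>t\<in>S-{s}. cmod (x - t)) \<le> 2 * (\<Prod>t\<in>S-{s}. cmod (s - t))" if "s \<in> S" "x \<in> K" for s x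
  proof (cases "x \<in> S - {s}")
    case True
    then have "(\<Prod>t\<in>S-{s}. cmod (x - t)) = 0" using S by (intro prod_zero) (auto simp: F_def)
    then show ?thesis by (simp add: prod_nonneg)
  next
    case False
    define T where "T = S - {s}"
    have T: "finite T" "x \<notin> T" "s \<notin> T" "S = insert s T" using S that False by (auto simp: T_def F_def)
    have "insert x T \<in> F" using S that T by (auto simp: F_def)
    then have "vdm (insert x T) \<le> m" by (rule le)
    also have "m < 4 * vdm (insert s T)" using S T by simp
    finally have "(\<Prod>t\<in>T. cmod (x - t))\<^sup>2 * vdm T < 4 * ((\<Prod>t\<in>T. cmod (s - t))\<^sup>2 * vdm T)"
      using vdm_insert T by simp
    then have "(\<Prod>t\<in>T. cmod (x - t))\<^sup>2 < (2 * (\<Prod>t\<in>T. cmod (s - t)))\<^sup>2"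
      using pos[OF T(1)] by (simp add: power_mult_distrib)
    then have "(\<Prod>t\<in>T. cmod (x - t)) < 2 * (\<Prod>t\<in>T. cmod (s - t))"
      by (rule power2_less_imp_less) (simp add: prod_nonneg)
    then show ?thesis by (simp add: T_def)
  qed
  then show ?thesis using that[of S] S by (auto simp: F_def)
qed

text \<open>Let P be the monic polynomial with zeros \<open>S\<close>, and \<open>\<mu>\<close> the
  least modulus of its derivative on \<open>S\<close>. Splitting off the factor of the minimising
  point bounds P above on \<open>K\<close>; Lagrange interpolation of 1 bounds P below away from
  \<open>S\<close>. Both bounds are \<open>\<mu>\<close> up to factors whose roots of order
  \<open>Suc N\<close> tend to 1, and the Green function involves only those roots.\<close>

lemma almost_fekete_polynomial:
  fixes K :: "complex set"
  assumes inf: "infinite K" and D: "\<And>x y. x \<in> K \<Longrightarrow> y \<in> K \<Longrightarrow> cmod (x - y) \<le> D"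
  obtains S \<mu> where "S \<subseteq> K" "finite S" "card S = Suc N" "\<mu> > 0"
    "\<And>x. x \<in> K \<Longrightarrow> (\<Prod>t\<in>S. cmod (x - t)) \<le> 2 * D * \<mu>"
    "\<And>z \<delta>. \<delta> > 0 \<Longrightarrow> (\<And>s. s \<in> S \<Longrightarrow> \<delta> \<le> cmod (z - s)) \<Longrightarrow> \<delta> * \<mu> / Suc N \<le> (\<Prod>t\<in>S. cmod (z - t))"
proof -
  obtain S where S: "S \<subseteq> K" "finite S" "card S = Suc N"
    "\<And>s x. s \<in> S \<Longrightarrow> x \<in> K \<Longrightarrow> (\<Prod>t\<in>S-{s}. cmod (x - t)) \<le> 2 * (\<Prod>t\<in>S-{s}. cmod (s - t))"
    using almost_fekete_points[OF assms, of N] by metis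
  have ne: "S \<noteq> {}" using S by auto
  define M where "M s = (\<Prod>t\<in>S-{s}. cmod (s - t))" for s
  have Mpos: "M s > 0" for s unfolding M_def by (intro prod_pos) auto
  define \<mu> where "\<mu> = Min (M ` S)"
  have mle: "\<mu> \<le> M s" if "s \<in> S" for s unfolding \<mu>_def using S that by auto
  have "\<mu> \<in> M ` S" unfolding \<mu>_def using S ne by (intro Min_in) auto
  then obtain s0 where s0: "s0 \<in> S" "\<mu> = M s0" by auto
  have split: "(\<Prod>t\<in>S. cmod (z - t)) = cmod (z - s) * (\<Prod>t\<in>S-{s}. cmod (z - t))" if "s \<in> S" for s z
    using S that by (simp add: prod.remove)
  show ?thesis
  proof (rule that[of S \<mu>])
    show "\<mu> > 0" using s0 Mpos by simp
    show "(\<Prod>t\<in>S. cmod (x - t)) \<le> 2 * D * \<mu>" if "x \<in> K" for x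
    proof -
      have "cmod (x - s0) * (\<Prod>t\<in>S-{s0}. cmod (x - t)) \<le> D * (2 * \<mu>)"
        using S(4)[OF s0(1) that] D[OF that, of s0] S(1) s0 
        by (intro mult_mono) (auto simp: M_def prod_nonneg intro: order_trans[OF norm_ge_zero])
      then show ?thesis using split[OF s0(1), of x] by simp
    qed
    fix z :: complex and \<delta> :: real assume \<delta>: "\<delta> > 0" "\<And>s. s \<in> S \<Longrightarrow> \<delta> \<le> cmod (z - s)"
    define P where "P = (\<Prod>t\<in>S. cmod (z - t))"
    have P0: "P \<ge> 0" by (simp add: P_def prod_nonneg)
    have "1 = cmod (\<Sum>s\<in>S. \<Prod>t\<in>S-{s}. (z - t) / (s - t))" using lagrange_sum_one[OF S(2) ne, of z] by simp
    also have "\<dots> \<le> (\<Sum>s\<in>S. cmod (\<Prod>t\<in>S-{s}. (z - t) / (s - t)))" by (rule norm_sum)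
    also have "\<dots> \<le> (\<Sum>s\<in>S. P / (\<delta> * \<mu>))"
    proof (rule sum_mono)
      fix s assume s: "s \<in> S"
      have "cmod (\<Prod>t\<in>S-{s}. (z - t) / (s - t)) = (\<Prod>t\<in>S-{s}. cmod (z - t)) / M s"
        by (simp add: prod_norm[symmetric] norm_divide prod_dividef M_def)
      also have "(\<Prod>t\<in>S-{s}. cmod (z - t)) = P / cmod (z - s)"
      proof -
        have "z \<noteq> s" using \<delta>(2)[OF s] \<delta>(1) by auto
        then show ?thesis using split[OF s, of z] by (simp add: P_def field_simps)
      qed
      also have "P / cmod (z - s) / M s = P / (cmod (z - s) * M s)" by simp
      also have "\<dots> \<le> P / (\<delta> * \<mu>)"
        using \<delta>(2)[OF s] \<delta>(1) mle[OF s] Mpos[of s] \<open>\<mu> = M s0\<close> Mpos[of s0] P0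
        by (intro divide_left_mono mult_mono mult_pos_pos) auto
      finally show "cmod (\<Prod>t\<in>S-{s}. (z - t) / (s - t)) \<le> P / (\<delta> * \<mu>)" .
    qed
    also have "\<dots> = Suc N * P / (\<delta> * \<mu>)" using S by simp
    finally show "\<delta> * \<mu> / Suc N \<le> (\<Prod>t\<in>S. cmod (z - t))"
      using \<delta>(1) \<open>\<mu> = M s0\<close> Mpos[of s0] by (simp add: P_def[symmetric] field_simps)
  qed (use S in auto)
qed

text \<open>Every vertical line slightly to the right of \<open>a\<close> meets
  \<open>\<Omega>\<close> without being contained in it, so the projection of the frontier contains
  an interval.\<close>

lemma infinite_frontier_bounded_open:
  fixes \<Omega> :: "complex set"
  assumes "open \<Omega>" "bounded \<Omega>" "a \<in> \<Omega>"
  shows "infinite (frontier \<Omega>)"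
proof -
  obtain e where e: "e > 0" "ball a e \<subseteq> \<Omega>" using assms open_contains_ball by blast
  have "{Re a <..< Re a + e} \<subseteq> Re ` frontier \<Omega>"
  proof
    fix x assume x: "x \<in> {Re a <..< Re a + e}"
    define T where "T = range (\<lambda>y. Complex x y)"
    have "connected T" unfolding T_def
      by (intro connected_continuous_image continuous_intros) auto
    moreover have "Complex x (Im a) \<in> ball a e" using x by (simp add: dist_norm cmod_def)
    then have "Complex x (Im a) \<in> T \<inter> \<Omega>" using e(2) by (auto simp: T_def)
    then have "T \<inter> \<Omega> \<noteq> {}" by blast
    moreover have "\<not> T \<subseteq> \<Omega>"
    proof
      assume "T \<subseteq> \<Omega>"
      then have "bounded T" using assms(2) bounded_subset by blast
      then obtain B where B: "\<And>z. z \<in> T \<Longrightarrow> cmod z \<le> B" by (auto simp: bounded_iff)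
      have "cmod (Complex x (\<bar>B\<bar> + 1)) \<ge> \<bar>B\<bar> + 1" using abs_Im_le_cmod[of "Complex x (\<bar>B\<bar> + 1)"] by simp
      then show False using B[of "Complex x (\<bar>B\<bar> + 1)"] by (auto simp: T_def)
    qed
    ultimately have "T \<inter> frontier \<Omega> \<noteq> {}" using connected_Int_frontier by blast
    then show "x \<in> Re ` frontier \<Omega>" by (force simp: T_def)
  qed
  moreover have "infinite {Re a <..< Re a + e}" using e by (simp add: infinite_Ioo)
  ultimately show ?thesis using finite_surj infinite_super by (metis finite_imageI)
qed

section \<open>Approximate Green functions bound the inner radius\<close>

text \<open>The inversion \<open>1 / (w - a)\<close> moves the pole to infinity, where the logarithm
  of an almost-Fekete polynomial of the inverted frontier approximates the Green function. Its upper
  bound on the frontier gives a \<open>green_approx\<close> with constant \<open>c \<le> C\<close>;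
  its lower bound away from the zeros keeps the function above \<open>- \<epsilon>\<close> on
  \<open>K - {a}\<close> once the degree is large.\<close>

lemma green_approx_stage:
  fixes a :: complex
  assumes U: "open U" and K2: "compact K2" "K2 \<subseteq> U" and K: "compact K" "K \<subseteq> interior K2" "a \<in> K"
    and C: "\<And>v. green_approx U a v \<Longrightarrow> v \<le> C" and \<epsilon>: "\<epsilon> > 0"
  obtains S where "finite S" "S \<noteq> {}" "S \<inter> interior K2 = {}"
    "\<And>w. w \<in> K - {a} \<Longrightarrow> C - ln (cmod (w - a)) + (\<Sum>s\<in>S. ln (cmod (w - s) / cmod (s - a))) / card S \<ge> - \<epsilon>"
proof -
  define \<Omega> where "\<Omega> = interior K2"
  have op: "open \<Omega>" and aO: "a \<in> \<Omega>" using K by (auto simp: \<Omega>_def)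
  have bd: "bounded \<Omega>" using K2 bounded_interior compact_imp_bounded by (auto simp: \<Omega>_def)
  have clos: "closure \<Omega> \<subseteq> K2" unfolding \<Omega>_def
    by (intro closure_minimal interior_subset compact_imp_closed K2)
  define F where "F = frontier \<Omega>"
  have F: "compact F" "infinite F" unfolding F_def
    using bd infinite_frontier_bounded_open[OF op bd aO] by (auto simp: compact_frontier_bounded)
  have FK: "F \<inter> \<Omega> = {}" using op by (auto simp: F_def frontier_def interior_open)
  have FK2: "F \<subseteq> K2" using clos by (auto simp: F_def frontier_def)
  obtain R where R: "R > 0" "\<And>w. w \<in> K2 \<Longrightarrow> cmod (w - a) \<le> R"
  proof -
    have "bounded ((\<lambda>w. w - a) ` K2)" using K2 by (auto intro!: compact_imp_bounded compact_continuous_image continuous_intros)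
    then show ?thesis using that unfolding bounded_pos by auto
  qed
  obtain d where d: "d > 0" "\<And>w s. w \<in> K \<Longrightarrow> s \<in> F \<Longrightarrow> d \<le> cmod (w - s)"
  proof -
    have "K \<inter> F = {}" using K(2) FK by (auto simp: \<Omega>_def)
    then show ?thesis using separate_compact_closed[OF K(1) compact_imp_closed[OF F(1)]] that
      by (auto simp: dist_norm)
  qed
  define \<phi> where "\<phi> = (\<lambda>w. inverse (w - a))"
  have inj: "inj_on \<phi> F" by (auto simp: inj_on_def \<phi>_def)
  have nz: "w \<noteq> a" if "w \<in> F" for w using that FK aO by auto
  have bnd: "cmod (\<phi> w) \<le> 1 / d" if "w \<in> F" for w
    using d(1) d(2)[OF K(3) that] nz[OF that] by (simp add: \<phi>_def norm_inverse norm_minus_commute divide_inverse le_imp_inverse_le)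
  define D where "D = 2 / d"
  have D: "cmod (x - y) \<le> D" if "x \<in> \<phi> ` F" "y \<in> \<phi> ` F" for x y
  proof -
    have "cmod x \<le> 1 / d" "cmod y \<le> 1 / d" using that bnd by auto
    then show ?thesis using norm_triangle_ineq4[of x y] by (simp add: D_def)
  qed
  have D0: "D > 0" using d by (simp add: D_def)
  have infi: "infinite (\<phi> ` F)" using F(2) inj finite_imageD by blast
  \<comment> \<open>After inversion the distance of \<open>w\<close> and \<open>s\<close> is
    \<open>cmod (w - s) / (cmod (w - a) * cmod (s - a))\<close>, hence at least
    \<open>d / (R * R)\<close>.\<close>
  define \<delta> where "\<delta> = d / (R * R)"
  have \<delta>: "\<delta> > 0" using d R by (simp add: \<delta>_def)
  \<comment> \<open>The gap between the lower bound \<open>\<delta> * \<mu> / Suc N\<close> and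
    \<open>3 * D * \<mu>\<close>, after taking logarithms and dividing by the degree.\<close>
  obtain N where N: "ln (\<delta> / (3 * D)) / real (Suc N) - ln (real (Suc N)) / real (Suc N) > - \<epsilon>"
  proof -
    have "(\<lambda>n. ln (\<delta> / (3 * D)) / real (Suc n) - ln (real (Suc n)) / real (Suc n)) \<longlonglongrightarrow> 0 - 0"
      by (intro tendsto_diff LIMSEQ_Suc[OF lim_ln_over_n] LIMSEQ_Suc[OF lim_const_over_n])
    then have "eventually (\<lambda>n. ln (\<delta> / (3 * D)) / real (Suc n) - ln (real (Suc n)) / real (Suc n) > - \<epsilon>) sequentially"
      by (rule order_tendstoD) (use \<epsilon> in simp)
    then show ?thesis using that eventually_happens' by (metis (no_types, lifting) sequentially_bot)
  qed
  obtain T \<mu> where T: "T \<subseteq> \<phi> ` F" "finite T" "card T = Suc N" "\<mu> > 0"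
    "\<And>x. x \<in> \<phi> ` F \<Longrightarrow> (\<Prod>t\<in>T. cmod (x - t)) \<le> 2 * D * \<mu>"
    "\<And>z \<delta>. \<delta> > 0 \<Longrightarrow> (\<And>s. s \<in> T \<Longrightarrow> \<delta> \<le> cmod (z - s)) \<Longrightarrow> \<delta> * \<mu> / Suc N \<le> (\<Prod>t\<in>T. cmod (z - t))"
    using almost_fekete_polynomial[OF infi D, where N=N] by metis
  obtain S where S: "S \<subseteq> F" "T = \<phi> ` S" by (metis T(1) subset_imageE)
  have injS: "inj_on \<phi> S" using inj S(1) inj_on_subset by blast
  have finS: "finite S" using T(2) S injS finite_imageD by blast
  have cardS: "card S = Suc N" using T(3) S injS card_image by metis
  have dist\<phi>: "cmod (w - s) / cmod (s - a) = cmod (\<phi> w - \<phi> s) * cmod (w - a)" if "s \<in> S" "w \<noteq> a" for s w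
  proof -
    have "s \<noteq> a" using that S nz by auto
    then have "\<phi> w - \<phi> s = (s - w) / ((w - a) * (s - a))" using that by (simp add: \<phi>_def field_simps)
    then show ?thesis using that \<open>s \<noteq> a\<close> by (simp add: norm_divide norm_mult norm_minus_commute)
  qed
  have prodeq: "(\<Prod>s\<in>S. cmod (w - s) / cmod (s - a)) = (\<Prod>t\<in>T. cmod (\<phi> w - t)) * cmod (w - a) ^ Suc N" if "w \<noteq> a" for w
  proof -
    have "(\<Prod>s\<in>S. cmod (w - s) / cmod (s - a)) = (\<Prod>s\<in>S. cmod (\<phi> w - \<phi> s) * cmod (w - a))"
      using dist\<phi> that by (intro prod.cong) auto
    also have "\<dots> = (\<Prod>s\<in>S. cmod (\<phi> w - \<phi> s)) * cmod (w - a) ^ Suc N"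
      by (simp add: prod.distrib cardS)
    also have "(\<Prod>s\<in>S. cmod (\<phi> w - \<phi> s)) = (\<Prod>t\<in>T. cmod (\<phi> w - t))"
      unfolding S(2) by (simp add: prod.reindex[OF injS])
    finally show ?thesis .
  qed
  \<comment> \<open>The polynomial is at most \<open>2 * D * \<mu>\<close> on the frontier; 3 in
    place of 2 makes the inequality of \<open>green_approx\<close> strict.\<close>
  define c where "c = - ln (3 * D * \<mu>) / Suc N"
  have "green_approx U a c" unfolding green_approx_def
  proof (rule exI[of _ \<Omega>], rule exI[of _ S], intro conjI ballI)
    fix w assume w: "w \<in> frontier \<Omega>"
    then have "w \<noteq> a" using nz by (auto simp: F_def)
    have "real (card S) * c = - ln (3 * D * \<mu>)" by (simp add: cardS c_def del: of_nat_Suc)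
    then have "exp (real (card S) * c) = 1 / (3 * D * \<mu>)"
      using D0 T(4) by (simp add: exp_minus inverse_eq_divide)
    moreover have "(\<Prod>t\<in>T. cmod (\<phi> w - t)) \<le> 2 * D * \<mu>" using T(5) w by (auto simp: F_def)
    moreover have "cmod (w - a) ^ Suc N > 0" using \<open>w \<noteq> a\<close> by simp
    ultimately have "exp (real (card S) * c) * (\<Prod>s\<in>S. cmod (w - s) / cmod (s - a)) \<le> 1 / (3 * D * \<mu>) * (2 * D * \<mu> * cmod (w - a) ^ Suc N)"
      unfolding prodeq[OF \<open>w \<noteq> a\<close>] using D0 T(4) by (intro mult_mono mult_right_mono) (auto intro!: prod_nonneg mult_nonneg_nonneg)
    also have "\<dots> = 2/3 * cmod (w - a) ^ Suc N" using D0 T(4) by (simp add: field_simps)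
    also have "\<dots> < cmod (w - a) ^ card S" using \<open>cmod (w - a) ^ Suc N > 0\<close> unfolding cardS by linarith
    finally show "exp (real (card S) * c) * (\<Prod>s\<in>S. cmod (w - s) / cmod (s - a)) < cmod (w - a) ^ card S" .
  qed (use op bd aO clos K2 finS cardS S FK in auto)
  then have cC: "c \<le> C" by (rule C)
  show ?thesis
  proof (rule that[of S])
    show "S \<inter> interior K2 = {}" using S FK by (auto simp: \<Omega>_def)
    fix w assume w: "w \<in> K - {a}"
    then have wa: "w \<noteq> a" by simp
    have K2w: "w \<in> K2" using w K interior_subset by blast
    have far: "\<delta> \<le> cmod (\<phi> w - t)" if t: "t \<in> T" for t
    proof -
      obtain s where s: "s \<in> S" "t = \<phi> s" using t S by auto
      then have sF: "s \<in> F" using S by auto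
      have "cmod (w - s) / (cmod (s - a) * cmod (w - a)) = cmod (\<phi> w - t)" 
        unfolding divide_divide_eq_left[symmetric] dist\<phi>[OF s(1) wa] using wa s by simp
      moreover have "d / (R * R) \<le> cmod (w - s) / (cmod (s - a) * cmod (w - a))"
        using d(2)[of w s] w sF d(1) R(2)[OF K2w] R(2)[of s] FK2 R(1) wa nz[OF sF]
        by (intro frac_le mult_mono mult_pos_pos) auto
      ultimately show ?thesis by (simp add: \<delta>_def)
    qed
    have P: "\<delta> * \<mu> / Suc N \<le> (\<Prod>t\<in>T. cmod (\<phi> w - t))" by (rule T(6)[OF \<delta> far])
    have Ppos: "0 < (\<Prod>t\<in>T. cmod (\<phi> w - t))" using P \<delta> T(4) by (smt (verit) divide_pos_pos mult_pos_pos of_nat_0_less_iff zero_less_Suc)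
    have spos: "0 < cmod (w - s) / cmod (s - a)" if "s \<in> S" for s
      using dist\<phi>[OF that wa] far[of "\<phi> s"] \<delta> that S wa by (auto intro!: mult_pos_pos)
    have "(\<Sum>s\<in>S. ln (cmod (w - s) / cmod (s - a))) = ln (\<Prod>s\<in>S. cmod (w - s) / cmod (s - a))"
      by (rule ln_prod[symmetric]) (use finS spos in force)+
    also have "\<dots> = ln (\<Prod>t\<in>T. cmod (\<phi> w - t)) + Suc N * ln (cmod (w - a))"
      unfolding prodeq[OF wa] using Ppos wa by (simp add: ln_mult ln_realpow del: power_Suc of_nat_Suc)
    finally have eqs: "(\<Sum>s\<in>S. ln (cmod (w - s) / cmod (s - a))) = ln (\<Prod>t\<in>T. cmod (\<phi> w - t)) + real (Suc N) * ln (cmod (w - a))"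
      by simp
    have "ln (\<delta> * \<mu> / Suc N) \<le> ln (\<Prod>t\<in>T. cmod (\<phi> w - t))"
      using P \<delta> T(4) Ppos by (subst ln_le_cancel_iff) (auto simp del: of_nat_Suc)
    then have "ln (\<delta> * \<mu> / Suc N) + Suc N * ln (cmod (w - a)) \<le> (\<Sum>s\<in>S. ln (cmod (w - s) / cmod (s - a)))"
      unfolding eqs by simp
    then have "(ln (\<delta> * \<mu> / Suc N) + Suc N * ln (cmod (w - a))) / Suc N \<le> (\<Sum>s\<in>S. ln (cmod (w - s) / cmod (s - a))) / card S"
      unfolding cardS by (intro divide_right_mono) auto
    moreover have "(ln (\<delta> * \<mu> / Suc N) + Suc N * ln (cmod (w - a))) / Suc N = ln (\<delta> * \<mu> / Suc N) / Suc N + ln (cmod (w - a))"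
      by (simp add: add_divide_distrib del: of_nat_Suc)
    moreover have "ln (\<delta> * \<mu> / Suc N) = ln (\<delta> / (3 * D)) - ln (real (Suc N)) + ln (3 * D * \<mu>)"
      using \<delta> T(4) D0 by (simp add: ln_div ln_mult del: of_nat_Suc)
    ultimately have "c - ln (cmod (w - a)) + (\<Sum>s\<in>S. ln (cmod (w - s) / cmod (s - a))) / card S \<ge> 
        (ln (\<delta> / (3 * D)) - ln (real (Suc N)) + ln (3 * D * \<mu>)) / Suc N - ln (3 * D * \<mu>) / Suc N"
      by (simp add: c_def del: of_nat_Suc)
    also have "(ln (\<delta> / (3 * D)) - ln (real (Suc N)) + ln (3 * D * \<mu>)) / Suc N - ln (3 * D * \<mu>) / Suc N
       = ln (\<delta> / (3 * D)) / real (Suc N) - ln (real (Suc N)) / real (Suc N)"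
      by (simp add: add_divide_distrib diff_divide_distrib del: of_nat_Suc)
    finally show "C - ln (cmod (w - a)) + (\<Sum>s\<in>S. ln (cmod (w - s) / cmod (s - a))) / card S \<ge> - \<epsilon>"
      using N cC by linarith
  qed (use finS cardS in auto)
qed

text \<open>It vanishes at \<open>a\<close> when \<open>a\<close> is outside \<open>S\<close>, so
  adding it to \<open>C - ln (cmod (w - a))\<close> leaves the Robin constant equal to
  \<open>C\<close>.\<close>

definition avg_log :: "complex \<Rightarrow> complex set \<Rightarrow> complex \<Rightarrow> real" where
  "avg_log a S w = (\<Sum>s\<in>S. ln (cmod (w - s) / cmod (s - a))) / card S"

text \<open>The quotient of \<open>|z - s|\<close> and \<open>|s - a|\<close> and its inverse are
  both at most 1 plus a bounded quantity, and \<open>ln (1 + x) \<le> x\<close>. The bound is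
  independent of the number of points, as Montel's theorem requires.\<close>

lemma avg_log_bounded:
  assumes S: "finite S" and r: "0 < r" "\<And>s. s \<in> S \<Longrightarrow> r \<le> cmod (s - a)"
    and e: "0 < e" "\<And>s. s \<in> S \<Longrightarrow> e \<le> cmod (z - s)"
  shows "\<bar>avg_log a S z\<bar> \<le> cmod (z - a) / r + cmod (z - a) / e"
proof -
  have "\<bar>ln (cmod (z - s) / cmod (s - a))\<bar> \<le> cmod (z - a) / r + cmod (z - a) / e" if s: "s \<in> S" for s
  proof -
    have p: "0 < cmod (z - s)" "0 < cmod (s - a)" using r e s by force+
    have "cmod (z - s) / cmod (s - a) \<le> 1 + cmod (z - a) / cmod (s - a)"
      using p norm_triangle_ineq4[of "z - a" "s - a"] by (simp add: field_simps)
    then have "ln (cmod (z - s) / cmod (s - a)) \<le> ln (1 + cmod (z - a) / cmod (s - a))"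
      using p by (subst ln_le_cancel_iff) (auto intro!: add_pos_nonneg)
    also have "\<dots> \<le> cmod (z - a) / cmod (s - a)" by (intro ln_add_one_self_le_self) auto
    also have "\<dots> \<le> cmod (z - a) / r" using r s p by (intro divide_left_mono) auto
    finally have 1: "ln (cmod (z - s) / cmod (s - a)) \<le> cmod (z - a) / r" .
    have "cmod (s - a) / cmod (z - s) \<le> 1 + cmod (z - a) / cmod (z - s)"
      using p norm_triangle_ineq4[of "z - a" "z - s"] by (simp add: field_simps)
    then have "ln (cmod (s - a) / cmod (z - s)) \<le> ln (1 + cmod (z - a) / cmod (z - s))"
      using p by (subst ln_le_cancel_iff) (auto intro!: add_pos_nonneg)
    also have "\<dots> \<le> cmod (z - a) / cmod (z - s)" by (intro ln_add_one_self_le_self) auto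
    also have "\<dots> \<le> cmod (z - a) / e" using e s p by (intro divide_left_mono) auto
    finally have "ln (cmod (s - a) / cmod (z - s)) \<le> cmod (z - a) / e" .
    then have 2: "- ln (cmod (z - s) / cmod (s - a)) \<le> cmod (z - a) / e"
      using p by (simp add: ln_div)
    have "0 \<le> cmod (z - a) / r" "0 \<le> cmod (z - a) / e" using r e by auto
    then show ?thesis using 1 2 by linarith
  qed
  then have "\<bar>\<Sum>s\<in>S. ln (cmod (z - s) / cmod (s - a))\<bar> \<le> (\<Sum>s\<in>S. cmod (z - a) / r + cmod (z - a) / e)"
    by (intro order.trans[OF sum_abs] sum_mono)
  moreover have "0 \<le> cmod (z - a) / r + cmod (z - a) / e" using r e by auto
  ultimately show ?thesis unfolding avg_log_def by (cases "S = {}") (auto simp: abs_divide divide_le_eq mult.commute card_gt_0_iff S)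
qed

text \<open>Dividing by the value at the centre keeps \<open>(w - s) / (z - s)\<close> within 1/4 of
  1, so its principal logarithm is holomorphic and bounded by 1; the average over \<open>S\<close>
  inherits both.\<close>

lemma avg_log_Re_holomorphic:
  assumes S: "finite S" "S \<noteq> {}" and far: "\<And>s. s \<in> S \<Longrightarrow> 4 * e \<le> cmod (z - s)" and e: "0 < e"
    and a: "a \<notin> S"
  defines "f \<equiv> (\<lambda>w. of_real (avg_log a S z) + (\<Sum>s\<in>S. Ln ((w - s) / (z - s))) / of_nat (card S))"
  shows "f holomorphic_on ball z e" "w \<in> ball z e \<Longrightarrow> Re (f w) = avg_log a S w"
    "w \<in> ball z e \<Longrightarrow> cmod (f w) \<le> \<bar>avg_log a S z\<bar> + 1"
proof -
  have eq: "(w - s) / (z - s) = 1 + (w - z) / (z - s)" and sm: "cmod ((w - z) / (z - s)) \<le> 1/4" if "s \<in> S" "w \<in> ball z e" for s w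
  proof -
    have "z \<noteq> s" using far[OF that(1)] e by auto
    then show "(w - s) / (z - s) = 1 + (w - z) / (z - s)" by (simp add: field_simps)
    have "cmod (w - z) \<le> e" using that by (simp add: dist_norm norm_minus_commute)
    then have "cmod (w - z) * 4 \<le> cmod (z - s)" using far[OF that(1)] by linarith
    then show "cmod ((w - z) / (z - s)) \<le> 1/4" using \<open>z \<noteq> s\<close> by (simp add: norm_divide divide_le_eq)
  qed
  have Rep: "Re ((w - s) / (z - s)) > 0" if "s \<in> S" "w \<in> ball z e" for s w
    unfolding eq[OF that] using sm[OF that] abs_Re_le_cmod[of "(w - z) / (z - s)"] by simp
  have np: "(w - s) / (z - s) \<notin> \<real>\<^sub>\<le>\<^sub>0" if "s \<in> S" "w \<in> ball z e" for s w
    using Rep[OF that] by (auto simp: complex_nonpos_Reals_iff)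
  show "f holomorphic_on ball z e" unfolding f_def
    using far e np by (intro holomorphic_intros) auto
  have zs: "z \<noteq> s" if "s \<in> S" for s using far[OF that] e by auto
  show "Re (f w) = avg_log a S w" if w: "w \<in> ball z e"
  proof -
    have "Re (Ln ((w - s) / (z - s))) = ln (cmod (w - s) / cmod (s - a)) - ln (cmod (z - s) / cmod (s - a))" if s: "s \<in> S" for s
    proof -
      have "w \<noteq> s" using Rep[OF s w] by auto
      moreover have "s \<noteq> a" using s a by auto
      ultimately show ?thesis using zs[OF s] by (simp add: norm_divide ln_div)
    qed
    then have "Re (\<Sum>s\<in>S. Ln ((w - s) / (z - s))) = (\<Sum>s\<in>S. ln (cmod (w - s) / cmod (s - a))) - (\<Sum>s\<in>S. ln (cmod (z - s) / cmod (s - a)))"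
      by (simp add: sum_subtractf)
    then show ?thesis by (simp add: f_def avg_log_def diff_divide_distrib)
  qed
  show "cmod (f w) \<le> \<bar>avg_log a S z\<bar> + 1" if w: "w \<in> ball z e"
  proof -
    have "cmod (Ln ((w - s) / (z - s))) \<le> 1" if s: "s \<in> S" for s
      using norm_Ln_le[of "(w - z) / (z - s)"] sm[OF s w] unfolding eq[OF s w] by linarith
    then have "cmod (\<Sum>s\<in>S. Ln ((w - s) / (z - s))) \<le> (\<Sum>s\<in>S. 1)"
      by (intro order.trans[OF norm_sum] sum_mono)
    moreover have "card S > 0" using S by (simp add: card_gt_0_iff)
    ultimately have "cmod ((\<Sum>s\<in>S. Ln ((w - s) / (z - s))) / of_nat (card S)) \<le> 1"
      by (simp add: norm_divide divide_le_eq)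
    then show ?thesis unfolding f_def using norm_triangle_ineq[of "of_real (avg_log a S z)"] 
      by (smt (verit) norm_of_real)
  qed
qed

text \<open>One competitor in the infimum is enough. Along an exhaustion of \<open>U\<close> the
  functions \<open>avg_log\<close> of \<open>green_approx_stage\<close> are, from some index on,
  bounded near each point of \<open>U\<close>. By Montel a subsequence converges, and its limit
  yields a nonnegative harmonic function with Robin constant \<open>C\<close>.\<close>

theorem inner_radius_le_exp:
  fixes a :: complex
  assumes U: "open U" "a \<in> U" "finpart B = U" and C: "\<And>v. green_approx U a v \<Longrightarrow> v \<le> C"
  shows "inner_radius B a \<le> ereal (exp C)"
proof -
  obtain K0 where K0: "\<And>n. compact (K0 n)" "\<And>n. K0 n \<subseteq> U" "\<And>n. K0 n \<subseteq> interior (K0 (Suc n))"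
    "\<Union>(range K0) = U" "\<And>K. compact K \<Longrightarrow> K \<subseteq> U \<Longrightarrow> \<exists>N. \<forall>n\<ge>N. K \<subseteq> K0 n"
    using open_Union_compact_subsets[OF U(1)] by metis
  obtain n0 where n0: "\<And>n. n \<ge> n0 \<Longrightarrow> {a} \<subseteq> K0 n" using K0(5)[of "{a}"] U by auto
  define K where "K n = K0 (n + n0)" for n
  have K: "compact (K n)" "K n \<subseteq> U" "K n \<subseteq> interior (K (Suc n))" "a \<in> K n" for n
    using K0 n0[of "n + n0"] by (auto simp: K_def)
  have Kcov: "\<exists>N. \<forall>n\<ge>N. L \<subseteq> K n" if "compact L" "L \<subseteq> U" for L
    using K0(5)[OF that] by (metis K_def trans_le_add1)
  have "\<exists>S. finite S \<and> S \<noteq> {} \<and> S \<inter> interior (K (Suc n)) = {} \<and> (\<forall>w\<in>K n - {a}. C - ln (cmod (w - a)) + avg_log a S w \<ge> - (1 / Suc n))" for n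
  proof -
    have "0 < 1 / real (Suc n)" by simp
    from green_approx_stage[OF U(1) K(1)[of "Suc n"] K(2)[of "Suc n"] K(1)[of n] K(3)[of n] K(4)[of n] C this]
    obtain S where S: "finite S" "S \<noteq> {}" "S \<inter> interior (K (Suc n)) = {}"
      "\<And>w. w \<in> K n - {a} \<Longrightarrow> C - ln (cmod (w - a)) + (\<Sum>s\<in>S. ln (cmod (w - s) / cmod (s - a))) / card S \<ge> - (1 / real (Suc n))" by blast
    show ?thesis by (rule exI[of _ S], intro conjI ballI) (simp_all only: S avg_log_def not_False_eq_True)
  qed
  then obtain S where S: "\<And>n. finite (S n)" "\<And>n. S n \<noteq> {}" "\<And>n. S n \<inter> interior (K (Suc n)) = {}"
     "\<And>n w. w \<in> K n - {a} \<Longrightarrow> C - ln (cmod (w - a)) + avg_log a (S n) w \<ge> - (1 / Suc n)" by metis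
  have mono: "K m \<subseteq> K n" if "m \<le> n" for m n
    using that by (induction n) (auto simp: le_Suc_eq dest: K(3)[THEN subsetD] interior_subset[THEN subsetD])
  obtain r where r: "r > 0" "\<And>n s. s \<in> S n \<Longrightarrow> r \<le> cmod (s - a)"
  proof -
    obtain r where "r > 0" "ball a r \<subseteq> interior (K 1)" using K(3)[of 0] K(4)[of 0] open_contains_ball[of "interior (K 1)"] by (metis One_nat_def open_interior subsetD)
    moreover have "interior (K 1) \<subseteq> interior (K (Suc n))" for n by (intro interior_mono mono) auto
    ultimately have "S n \<inter> ball a r = {}" for n using S(3)[of n] by blast
    then have "r \<le> cmod (s - a)" if "s \<in> S n" for n s using that by (force simp: dist_norm norm_minus_commute)
    then show ?thesis using that \<open>r > 0\<close> by blast
  qed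
  have aS: "a \<notin> S n" for n using r by force
  have "\<exists>e N. e > 0 \<and> cball z (4 * e) \<subseteq> U \<and> (\<forall>n\<ge>N. \<forall>s\<in>S n. 4 * e \<le> cmod (z - s))" if z: "z \<in> U" for z
  proof -
    obtain e where e: "e > 0" "cball z e \<subseteq> U" using open_contains_cball U(1) z by blast
    obtain N where N: "\<And>n. n \<ge> N \<Longrightarrow> cball z e \<subseteq> K n" using Kcov[OF compact_cball e(2)] by auto
    have "e \<le> cmod (z - s)" if "n \<ge> N" "s \<in> S n" for n s
    proof (rule ccontr)
      assume "\<not> ?thesis"
      then have "s \<in> cball z e" by (simp add: dist_norm)
      then show False using N[OF that(1)] K(3)[of n] S(3)[of n] that(2) by blast
    qed
    then show ?thesis using e by (intro exI[of _ "e/4"] exI[of _ N]) auto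
  qed
  then obtain e N where eN: "\<And>z. z \<in> U \<Longrightarrow> e z > 0" "\<And>z. z \<in> U \<Longrightarrow> cball z (4 * e z) \<subseteq> U"
     "\<And>z n s. z \<in> U \<Longrightarrow> n \<ge> N z \<Longrightarrow> s \<in> S n \<Longrightarrow> 4 * e z \<le> cmod (z - s)" by metis
  \<comment> \<open>For \<open>n\<close> below \<open>N z\<close>, points of \<open>S n\<close> may
    come close to \<open>z\<close>; the value 0 keeps the whole sequence holomorphic and bounded on
    the ball.\<close>
  define f where "f z n w = (if N z \<le> n then of_real (avg_log a (S n) z) + (\<Sum>s\<in>S n. Ln ((w - s) / (z - s))) / of_nat (card (S n)) else 0)" for z n w
  have fhol: "f z n holomorphic_on ball z (e z)" and fRe: "w \<in> ball z (e z) \<Longrightarrow> N z \<le> n \<Longrightarrow> Re (f z n w) = avg_log a (S n) w"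
    and fbd: "w \<in> ball z (e z) \<Longrightarrow> cmod (f z n w) \<le> cmod (z - a) / r + cmod (z - a) / (4 * e z) + 1" if z: "z \<in> U" for z n w
  proof -
    have b0: "0 \<le> cmod (z - a) / r + cmod (z - a) / (4 * e z)" using r eN(1)[OF z] by auto
    have "f z n holomorphic_on ball z (e z) \<and> (w \<in> ball z (e z) \<longrightarrow> N z \<le> n \<longrightarrow> Re (f z n w) = avg_log a (S n) w)
       \<and> (w \<in> ball z (e z) \<longrightarrow> cmod (f z n w) \<le> cmod (z - a) / r + cmod (z - a) / (4 * e z) + 1)"
    proof (cases "N z \<le> n")
      case True
      note far = eN(3)[OF z True]
      note H = avg_log_Re_holomorphic[OF S(1,2) far eN(1)[OF z] aS]
      have "f z n = (\<lambda>w. of_real (avg_log a (S n) z) + (\<Sum>s\<in>S n. Ln ((w - s) / (z - s))) / of_nat (card (S n)))"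
        using True by (auto simp: f_def)
      moreover have "\<bar>avg_log a (S n) z\<bar> \<le> cmod (z - a) / r + cmod (z - a) / (4 * e z)"
        by (rule avg_log_bounded[OF S(1) r(1) r(2) _ far]) (use eN(1)[OF z] in auto)
      ultimately show ?thesis using H by fastforce
    next
      case False
      then have "f z n = (\<lambda>w. 0)" by (auto simp: f_def)
      then show ?thesis using b0 False by auto
    qed
    then show "f z n holomorphic_on ball z (e z)" "w \<in> ball z (e z) \<Longrightarrow> N z \<le> n \<Longrightarrow> Re (f z n w) = avg_log a (S n) w"
     "w \<in> ball z (e z) \<Longrightarrow> cmod (f z n w) \<le> cmod (z - a) / r + cmod (z - a) / (4 * e z) + 1" by blast+
  qed
  \<comment> \<open>The diagonal subsequence handles countably many balls, hence the appeal to the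
    Lindelof property.\<close>
  obtain Z where Z: "countable Z" "Z \<subseteq> U" "U \<subseteq> (\<Union>z\<in>Z. ball z (e z))"
  proof -
    obtain F where F: "F \<subseteq> (\<lambda>z. ball z (e z)) ` U" "countable F" "\<Union>F = \<Union>((\<lambda>z. ball z (e z)) ` U)"
    proof (rule Lindelof[of "(\<lambda>z. ball z (e z)) ` U"])
      show "open S" if "S \<in> (\<lambda>z. ball z (e z)) ` U" for S using that by auto
    qed blast
    obtain Z where "countable Z" "Z \<subseteq> U" "F = (\<lambda>z. ball z (e z)) ` Z"
      using countable_subset_image[THEN iffD1, OF conjI[OF F(2) F(1)]] by blast
    moreover have "U \<subseteq> \<Union>F" unfolding F(3) using eN(1) by (auto intro!: bexI centre_in_ball[THEN iffD2])
    ultimately show ?thesis using that by blast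
  qed
  have Zne: "Z \<noteq> {}" using Z U by auto
  define zz where "zz = from_nat_into Z"
  have zz: "zz i \<in> U" for i using from_nat_into[OF Zne] Z by (auto simp: zz_def)
  define P where "P i (s::nat\<Rightarrow>nat) \<longleftrightarrow> (\<exists>g. g holomorphic_on ball (zz i) (e (zz i)) \<and> (\<forall>w\<in>ball (zz i) (e (zz i)). (\<lambda>n. f (zz i) (s n) w) \<longlonglongrightarrow> g w))" for i s
  obtain k :: "nat \<Rightarrow> nat" where k: "strict_mono k" "\<And>i. P i (id \<circ> k)"
  proof (rule subsequence_diagonalization_lemma[of P id])
    fix i and q :: "nat \<Rightarrow> nat"
    define \<F> where "\<F> n = f (zz i) (q n)" for n
    obtain g \<rho> where "g holomorphic_on ball (zz i) (e (zz i))" "strict_mono (\<rho> :: nat \<Rightarrow> nat)"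
          "\<And>x. x \<in> ball (zz i) (e (zz i)) \<Longrightarrow> ((\<lambda>n. \<F> (\<rho> n) x) \<longlongrightarrow> g x) sequentially"
    proof (rule Montel[of "ball (zz i) (e (zz i))" "range \<F>" \<F>])
      show "h holomorphic_on ball (zz i) (e (zz i))" if "h \<in> range \<F>" for h
        using that fhol[OF zz] by (auto simp: \<F>_def)
      show "\<exists>B. \<forall>h\<in>range \<F>. \<forall>z\<in>K. cmod (h z) \<le> B" if "K \<subseteq> ball (zz i) (e (zz i))" for K
        using that fbd[OF zz[of i]] by (intro exI[of _ "cmod (zz i - a) / r + cmod (zz i - a) / (4 * e (zz i)) + 1"]) (auto simp: \<F>_def)
    qed (auto)
    then show "\<exists>k. strict_mono k \<and> P i (q \<circ> k)" unfolding P_def \<F>_def o_def by blast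
  next
    fix i and q :: "nat \<Rightarrow> nat" and k1 k2 N
    assume P1: "P i (q \<circ> k1)" and k2: "\<And>j. N \<le> j \<Longrightarrow> \<exists>j'. j \<le> j' \<and> k2 j = k1 j'"
    obtain g where g: "g holomorphic_on ball (zz i) (e (zz i))" "\<And>w. w\<in>ball (zz i) (e (zz i)) \<Longrightarrow> (\<lambda>n. f (zz i) ((q \<circ> k1) n) w) \<longlonglongrightarrow> g w"
      using P1 unfolding P_def by blast
    have "(\<lambda>n. f (zz i) ((q \<circ> k2) n) w) \<longlonglongrightarrow> g w" if w: "w\<in>ball (zz i) (e (zz i))" for w
      unfolding lim_sequentially
    proof (intro allI impI)
      fix \<epsilon> :: real assume "\<epsilon> > 0"
      then obtain M where "\<And>n. n \<ge> M \<Longrightarrow> dist (f (zz i) ((q \<circ> k1) n) w) (g w) < \<epsilon>" using g(2)[OF w] unfolding lim_sequentially by blast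
      then show "\<exists>no. \<forall>n\<ge>no. dist (f (zz i) ((q \<circ> k2) n) w) (g w) < \<epsilon>"
        using k2 by (intro exI[of _ "max M N"]) (metis comp_apply max.bounded_iff order_trans)
    qed
    then show "P i (q \<circ> k2)" unfolding P_def using g by blast
  qed auto
  \<comment> \<open>The limit is that of \<open>avg_log\<close> itself, not of the local holomorphic
    functions: these depend on the ball through imaginary constants, but their real parts
    agree.\<close>
  define E where "E w = lim (\<lambda>n. avg_log a (S (k n)) w)" for w
  have kN: "eventually (\<lambda>n. M \<le> k n) sequentially" for M
    using filterlim_subseq[OF k(1)] by (simp add: filterlim_at_top)
  have loc: "\<exists>i g. z \<in> ball (zz i) (e (zz i)) \<and> g holomorphic_on ball (zz i) (e (zz i)) \<and>
      (\<forall>w\<in>ball (zz i) (e (zz i)). (\<lambda>n. avg_log a (S (k n)) w) \<longlonglongrightarrow> Re (g w))" if z: "z \<in> U" for z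
  proof -
    obtain y where y: "y \<in> Z" "z \<in> ball y (e y)" using z Z by auto
    obtain i where i: "zz i = y" using from_nat_into_surj[OF Z(1) y(1)] by (auto simp: zz_def)
    obtain g where g: "g holomorphic_on ball y (e y)" "\<And>w. w\<in>ball y (e y) \<Longrightarrow> (\<lambda>n. f y (k n) w) \<longlonglongrightarrow> g w"
      using k(2)[of i] i unfolding P_def by auto
    have "(\<lambda>n. avg_log a (S (k n)) w) \<longlonglongrightarrow> Re (g w)" if w: "w\<in>ball y (e y)" for w
    proof (rule Lim_transform_eventually)
      show "(\<lambda>n. Re (f y (k n) w)) \<longlonglongrightarrow> Re (g w)" using g(2)[OF w] by (rule tendsto_Re)
      show "\<forall>\<^sub>F n in sequentially. Re (f y (k n) w) = avg_log a (S (k n)) w"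
        using kN[of "N y"] by eventually_elim (use w y Z fRe in auto)
    qed
    then show ?thesis using g y i by blast
  qed
  have Elim: "(\<lambda>n. avg_log a (S (k n)) z) \<longlonglongrightarrow> E z" if "z \<in> U" for z
    using loc[OF that] unfolding E_def by (metis limI)
  have Eharm: "\<exists>\<rho>>0. \<exists>g. ball z \<rho> \<subseteq> U \<and> g holomorphic_on ball z \<rho> \<and> (\<forall>w\<in>ball z \<rho>. E w = Re (g w))" if z: "z \<in> U" for z
  proof -
    obtain i g where ig: "z \<in> ball (zz i) (e (zz i))" "g holomorphic_on ball (zz i) (e (zz i))"
      "\<And>w. w\<in>ball (zz i) (e (zz i)) \<Longrightarrow> (\<lambda>n. avg_log a (S (k n)) w) \<longlonglongrightarrow> Re (g w)" using loc[OF z] by blast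
    obtain \<rho> where \<rho>: "\<rho> > 0" "ball z \<rho> \<subseteq> ball (zz i) (e (zz i))" using ig(1) open_contains_ball[THEN iffD1, OF open_ball] by blast
    have sub: "ball (zz i) (e (zz i)) \<subseteq> U" using eN(1,2)[OF zz[of i]] by (force simp: dist_norm)
    have "E w = Re (g w)" if "w \<in> ball z \<rho>" for w
      unfolding E_def by (rule limI, rule ig(3)) (use \<rho>(2) that in blast)
    moreover have "ball z \<rho> \<subseteq> U" "g holomorphic_on ball z \<rho>"
      using \<rho>(2) sub ig(2) holomorphic_on_subset by blast+
    ultimately show ?thesis using \<rho>(1) by blast
  qed
  have Ea: "E a = 0"
  proof -
    have "avg_log a (S n) a = 0" for n
    proof -
      have "ln (cmod (a - s) / cmod (s - a)) = 0" if "s \<in> S n" for s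
      proof -
        have "cmod (s - a) \<noteq> 0" using that aS by auto
        then show ?thesis by (simp add: norm_minus_commute[of a s])
      qed
      then show ?thesis by (simp add: avg_log_def)
    qed
    then have "(\<lambda>n. avg_log a (S (k n)) a) \<longlonglongrightarrow> 0" by simp
    then show ?thesis using Elim[OF U(2)] LIMSEQ_unique by blast
  qed
  have hge: "C - ln (cmod (w - a)) + E w \<ge> 0" if w: "w \<in> U - {a}" for w
  proof -
    obtain M where M: "\<And>n. n \<ge> M \<Longrightarrow> w \<in> K n" using Kcov[of "{w}"] w by auto
    have 1: "(\<lambda>n. C - ln (cmod (w - a)) + avg_log a (S (k n)) w) \<longlonglongrightarrow> C - ln (cmod (w - a)) + E w"
      using w by (intro tendsto_intros Elim) auto
    have "(\<lambda>n. 1 / real (Suc (k n))) \<longlonglongrightarrow> 0"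
      using LIMSEQ_subseq_LIMSEQ[OF LIMSEQ_Suc[OF lim_1_over_n] k(1)] by (simp add: o_def)
    then have 2: "(\<lambda>n. - (1 / real (Suc (k n)))) \<longlonglongrightarrow> 0"
      using tendsto_minus by fastforce
    have 3: "eventually (\<lambda>n. - (1 / real (Suc (k n))) \<le> C - ln (cmod (w - a)) + avg_log a (S (k n)) w) sequentially"
      using kN[of M]
    proof eventually_elim
      case (elim n)
      then show ?case using S(4)[of w "k n"] M[of "k n"] w by auto
    qed
    show ?thesis by (rule tendsto_le[OF sequentially_bot 1 2 3])
  qed
  \<comment> \<open>The limit function is only known to be nonnegative, while the definition asks
    for a strictly positive one. The summand \<epsilon> makes up for this and is sent to 0 at the
    end.\<close>
  have le: "inner_radius B a \<le> ereal (exp (C + \<epsilon>))" if \<epsilon>: "\<epsilon> > 0" for \<epsilon>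
  proof -
    define h where "h w = C + \<epsilon> - ln (cmod (w - a)) + E w" for w
    define v where "v w = C + \<epsilon> + E w" for w
    have h: "harmonic_on h (finpart B - {a})" unfolding harmonic_on_def U(3)
    proof (intro conjI ballI)
      show "open (U - {a})" using U by auto
      fix z assume z: "z \<in> U - {a}"
      then obtain \<rho> g where g: "\<rho> > 0" "ball z \<rho> \<subseteq> U" "g holomorphic_on ball z \<rho>" "\<And>w. w\<in>ball z \<rho> \<Longrightarrow> E w = Re (g w)"
        using Eharm[of z] by auto
      define \<sigma> where "\<sigma> = min \<rho> (cmod (z - a))"
      have \<sigma>: "\<sigma> > 0" using g z by (simp add: \<sigma>_def)
      have Rep: "Re ((w - a) / (z - a)) > 0" if "w \<in> ball z \<sigma>" for w
      proof -
        have "cmod (w - z) < cmod (z - a)" using that by (simp add: \<sigma>_def dist_norm norm_minus_commute)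
        moreover have "0 < cmod (z - a)" using z by simp
        ultimately have "cmod ((w - z) / (z - a)) < 1" by (simp only: norm_divide divide_less_eq_1_pos)
        then have "\<bar>Re ((w - z) / (z - a))\<bar> < 1" using abs_Re_le_cmod order_le_less_trans by blast
        moreover have "(w - a) / (z - a) = 1 + (w - z) / (z - a)" using z by (simp add: field_simps)
        ultimately show ?thesis by (simp add: abs_less_iff)
      qed
      then have np: "(w - a) / (z - a) \<notin> \<real>\<^sub>\<le>\<^sub>0" if "w \<in> ball z \<sigma>" for w
        using that by (force simp: complex_nonpos_Reals_iff)
      define F where "F w = of_real (C + \<epsilon> - ln (cmod (z - a))) - Ln ((w - a) / (z - a)) + g w" for w
      have "F holomorphic_on ball z \<sigma>" unfolding F_def
        using np z g(3) by (intro holomorphic_intros) (auto intro: holomorphic_on_subset simp: \<sigma>_def)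
      moreover have "h w = Re (F w)" if w: "w \<in> ball z \<sigma>" for w
      proof -
        have "w \<noteq> a" using Rep[OF w] by auto
        then show ?thesis using w g(4)[of w] z by (simp add: h_def F_def norm_divide ln_div \<sigma>_def)
      qed
      moreover have "ball z \<sigma> \<subseteq> U - {a}" using g(2) by (auto simp: \<sigma>_def dist_norm)
      ultimately show "\<exists>e>0. ball z e \<subseteq> U - {a} \<and> (\<exists>f. f holomorphic_on ball z e \<and> (\<forall>w\<in>ball z e. h w = Re (f w)))"
        using \<sigma> by blast
    qed
    obtain \<rho> g where g: "\<rho> > 0" "ball a \<rho> \<subseteq> U" "g holomorphic_on ball a \<rho>" "\<And>w. w\<in>ball a \<rho> \<Longrightarrow> E w = Re (g w)"
        using Eharm[OF U(2)] by auto
    have v: "harmonic_on v (ball a \<rho>)" unfolding harmonic_on_def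
    proof (intro conjI ballI)
      fix z assume "z \<in> ball a \<rho>"
      then obtain \<sigma> where \<sigma>: "\<sigma> > 0" "ball z \<sigma> \<subseteq> ball a \<rho>" using open_contains_ball[THEN iffD1, OF open_ball] by blast
      have "(\<lambda>w. of_real (C + \<epsilon>) + g w) holomorphic_on ball z \<sigma>"
        using g(3) \<sigma> by (intro holomorphic_intros) (auto intro: holomorphic_on_subset)
      moreover have "\<forall>w\<in>ball z \<sigma>. v w = Re (of_real (C + \<epsilon>) + g w)" using \<sigma> g(4) by (auto simp: v_def)
      ultimately show "\<exists>e>0. ball z e \<subseteq> ball a \<rho> \<and> (\<exists>f. f holomorphic_on ball z e \<and> (\<forall>w\<in>ball z e. v w = Re (f w)))"
        using \<sigma> by blast
    qed auto
    have "inner_radius B a \<le> ereal (exp (v a))" unfolding inner_radius_def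
    proof (rule Inf_lower, rule CollectI, rule exI[of _ h], rule exI[of _ v], intro conjI)
      show "\<forall>z\<in>finpart B - {a}. 0 < h z" using hge \<epsilon> U(3) by (force simp: h_def)
      show "\<exists>e>0. ball a e \<subseteq> finpart B \<and> harmonic_on v (ball a e) \<and> (\<forall>z\<in>ball a e - {a}. v z = h z + ln (cmod (z - a)))"
        using g v U(3) by (intro exI[of _ \<rho>]) (auto simp: v_def h_def)
    qed (use h in auto)
    then show ?thesis by (simp add: v_def Ea)
  qed
  have "(\<lambda>n. ereal (exp (C + 1 / real (Suc n)))) \<longlonglongrightarrow> ereal (exp (C + 0))"
    using LIMSEQ_Suc[OF lim_1_over_n] by (intro tendsto_intros) auto
  then have lim: "(\<lambda>n. ereal (exp (C + 1 / real (Suc n)))) \<longlonglongrightarrow> ereal (exp C)" by simp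
  show ?thesis
  proof (rule LIMSEQ_le_const[OF lim], intro exI allI impI)
    show "inner_radius B a \<le> ereal (exp (C + 1 / real (Suc n)))" for n by (rule le) simp
  qed
qed

section \<open>Gradients in complex notation\<close>

lemma integral_complex_cbox_iterated2:
  fixes f :: "complex \<Rightarrow> real"
  assumes "continuous_on (cbox (Complex a c) (Complex b d)) f"
  shows "integral (cbox (Complex a c) (Complex b d)) f = integral {c..d} (\<lambda>y. integral {a..b} (\<lambda>x. f (Complex x y)))"
proof -
  have "continuous_on (cbox (a,c) (b,d)) (\<lambda>u. f (Complex (fst u) (snd u)))"
    by (rule continuous_on_compose2[OF assms])
       (auto intro!: linear_continuous_on linear_linear[THEN iffD2, OF Complex_pair_iso(1)[OF refl refl]] simp: in_cbox_complex_iff)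
  then have "integral (cbox a b) (\<lambda>x. integral (cbox c d) (\<lambda>y. f (Complex x y))) = integral (cbox c d) (\<lambda>y. integral (cbox a b) (\<lambda>x. f (Complex x y)))"
    by (intro integral_swap_continuous) (simp add: case_prod_beta)
  then show ?thesis using integral_complex_cbox_iterated[OF assms] by simp
qed

text \<open>\<open>K\<close> is a continuously differentiable truncation: slope 1 between the levels
  \<open>A\<close> and \<open>B\<close>, constant beyond a margin \<open>\<tau>\<close>. Composed
  with a potential it keeps a continuous gradient, and the level is altered by at most the
  margins.\<close>

lemma trapezoid_antiderivative:
  fixes A B \<tau> :: real
  assumes "A < B" "\<tau> > 0"
  obtains k K :: "real \<Rightarrow> real" where "continuous_on UNIV k" "\<And>x. 0 \<le> k x" "\<And>x. k x \<le> 1"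
    "\<And>x. A \<le> x \<Longrightarrow> x \<le> B \<Longrightarrow> k x = 1" "\<And>x. x \<le> A - \<tau> \<Longrightarrow> k x = 0" "\<And>x. x \<ge> B + \<tau> \<Longrightarrow> k x = 0"
    "\<And>x. (K has_real_derivative k x) (at x)" "K 0 = 0"
    "\<And>x. x \<le> A - \<tau> \<Longrightarrow> K x = K (A - \<tau>)" "\<And>x. x \<ge> B + \<tau> \<Longrightarrow> K x = K (B + \<tau>)"
    "\<And>x y. x \<le> y \<Longrightarrow> K x \<le> K y" "\<And>x y. x \<le> y \<Longrightarrow> K y - K x \<le> y - x" "K B - K A = B - A"
proof -
  define k where "k x = max 0 (min 1 (min ((x - A) / \<tau> + 1) ((B - x) / \<tau> + 1)))" for x
  have cont: "continuous_on S k" for S unfolding k_def by (intro continuous_intros) (use assms in auto)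
  have k01: "0 \<le> k x" "k x \<le> 1" for x by (auto simp: k_def)
  have k1: "k x = 1" if "A \<le> x" "x \<le> B" for x using that assms by (auto simp: k_def min_def max_def)
  have kl: "k x = 0" if "x \<le> A - \<tau>" for x
  proof -
    have "(x - A) / \<tau> + 1 \<le> 0" using that assms by (simp add: field_simps)
    then show ?thesis by (auto simp: k_def)
  qed
  have kr: "k x = 0" if "x \<ge> B + \<tau>" for x
  proof -
    have "(B - x) / \<tau> + 1 \<le> 0" using that assms by (simp add: field_simps)
    then show ?thesis by (auto simp: k_def)
  qed
  obtain K0 where K0: "\<And>x. (K0 has_real_derivative k x) (at x)"
  proof -
    have "\<forall>x. isCont k x" using cont[of UNIV] by (simp add: continuous_on_eq_continuous_at)
    then obtain g where "\<forall>x. (g has_vector_derivative k x) (at x)"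
      using einterval_antiderivative[of "-\<infinity>" \<infinity> k] by auto
    then show ?thesis using that by (auto simp: has_real_derivative_iff_has_vector_derivative)
  qed
  define K where "K x = K0 x - K0 0" for x
  have K: "(K has_real_derivative k x) (at x)" for x unfolding K_def by (auto intro!: derivative_eq_intros K0)
  have mvt: "\<exists>z. x \<le> z \<and> z \<le> y \<and> K y - K x = (y - x) * k z" if le: "x \<le> y" for x y
  proof (cases "x = y")
    case False
    then obtain z where "z > x" "z < y" "K y - K x = (y - x) * k z" using MVT2[of x y K k] K le by fastforce
    then show ?thesis by (intro exI[of _ z]) auto
  qed auto
  show ?thesis
  proof (rule that[of k K])
    show "K x = K (A - \<tau>)" if "x \<le> A - \<tau>" for x using mvt[OF that] kl by force
    show "K x = K (B + \<tau>)" if "x \<ge> B + \<tau>" for x using mvt[of "B + \<tau>" x] that kr by force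
    show "K x \<le> K y" if "x \<le> y" for x y using mvt[OF that] k01 that by (metis diff_ge_0_iff_ge mult_nonneg_nonneg)
    show "K y - K x \<le> y - x" if "x \<le> y" for x y using mvt[OF that] k01 that by (metis diff_ge_0_iff_ge mult_left_le)
    show "K B - K A = B - A" using mvt[of A B] k1 assms by force
  qed (use cont k01 k1 kl kr K in \<open>auto simp: K_def\<close>)
qed

text \<open>\<open>D\<close> is twice the Wirtinger derivative of \<open>u\<close>, the conjugate of the real gradient, so that composition with a holomorphic map multiplies it by the derivative.\<close>
definition grad :: "(complex \<Rightarrow> real) \<Rightarrow> complex \<Rightarrow> complex \<Rightarrow> bool" where
  "grad u D z \<longleftrightarrow> (u has_derivative (\<lambda>v. Re (D * v))) (at z)"

lemma grad_compose_holomorphic: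
  assumes "grad u D (g z)" "(g has_field_derivative g') (at z)"
  shows "grad (\<lambda>z. u (g z)) (D * g') z"
  using has_derivative_compose[of g "(*) g'" z UNIV u "\<lambda>v. Re (D * v)"] assms
  by (simp add: grad_def has_field_derivative_def mult.assoc)

lemma grad_Re_holomorphic:
  assumes "(g has_field_derivative g') (at z)"
  shows "grad (\<lambda>z. Re (g z)) g' z"
  using has_derivative_Re[OF assms[unfolded has_field_derivative_def]] by (simp add: grad_def)

lemma grad_compose_real:
  assumes "grad u D z" "(\<psi> has_real_derivative k) (at (u z))"
  shows "grad (\<lambda>z. \<psi> (u z)) (of_real k * D) z"
  using has_derivative_compose[of u "\<lambda>v. Re (D * v)" z UNIV \<psi> "(*) k"] assms
  by (simp add: grad_def has_field_derivative_def mult.assoc Re_complex_of_real)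

lemma grad_ln_cmod:
  assumes "z \<noteq> p"
  shows "grad (\<lambda>w. ln (cmod (w - p))) (1 / (z - p)) z"
proof -
  \<comment> \<open>Dividing by \<open>z - p\<close> puts the argument of \<open>Ln\<close> near 1,
    away from the cut, whatever \<open>z\<close> is.\<close>
  define F where "F w = Ln ((w - p) / (z - p)) + of_real (ln (cmod (z - p)))" for w
  have "(F has_field_derivative 1 / (z - p)) (at z)"
    unfolding F_def using assms by (auto intro!: derivative_eq_intros simp: complex_nonpos_Reals_iff)
  then have "grad (\<lambda>z. Re (F z)) (1 / (z - p)) z" by (rule grad_Re_holomorphic)
  moreover have "Re (F w) = ln (cmod (w - p))" if "w \<in> - {p}" for w
    using that assms by (simp add: F_def norm_divide ln_div)
  moreover have "open (- {p})" by auto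
  ultimately show ?thesis unfolding grad_def
    using has_derivative_transform_within_open[of "\<lambda>z. Re (F z)" _ z UNIV "-{p}"] assms by force
qed

lemma grad_cong_open:
  assumes "grad u D z" "open S" "z \<in> S" "\<And>w. w \<in> S \<Longrightarrow> u w = v w"
  shows "grad v D z"
  using assms has_derivative_transform_within_open unfolding grad_def by blast

lemma grad_const: "grad (\<lambda>_. c) 0 z"
  by (simp add: grad_def)

lemma grad_unique: "grad u D z \<Longrightarrow> grad u D' z \<Longrightarrow> D = D'"
proof -
  assume "grad u D z" "grad u D' z"
  then have "(\<lambda>v. Re (D * v)) = (\<lambda>v. Re (D' * v))" unfolding grad_def by (rule has_derivative_unique)
  then have "Re (D * 1) = Re (D' * 1)" "Re (D * \<i>) = Re (D' * \<i>)" by metis+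
  then show ?thesis by (simp add: complex_eq_iff)
qed

lemma grad_partial:
  assumes "grad u D (Complex x y)"
  shows "((\<lambda>x. u (Complex x y)) has_real_derivative Re D) (at x)"
    and "((\<lambda>y. u (Complex x y)) has_real_derivative - Im D) (at y)"
proof -
  have "((\<lambda>x. Complex x y) has_derivative (\<lambda>t. of_real t)) (at x)"
    unfolding Complex_eq by (auto intro!: derivative_eq_intros)
  from has_derivative_compose[OF this assms[unfolded grad_def]]
  show "((\<lambda>x. u (Complex x y)) has_real_derivative Re D) (at x)"
    by (simp add: has_field_derivative_def mult.commute[of _ "Re D"])
  have "((\<lambda>y. Complex x y) has_derivative (\<lambda>t. \<i> * of_real t)) (at y)"
    unfolding Complex_eq by (auto intro!: derivative_eq_intros)
  from has_derivative_compose[OF this assms[unfolded grad_def]]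
  have "((\<lambda>y. u (Complex x y)) has_derivative (\<lambda>t. Re (D * (\<i> * of_real t)))) (at y)" .
  moreover have "(\<lambda>t. Re (D * (\<i> * of_real t))) = (*) (- Im D)" by auto
  ultimately show "((\<lambda>y. u (Complex x y)) has_real_derivative - Im D) (at y)"
    by (simp only: has_field_derivative_def)
qed

text \<open>The logarithm as a fundamental solution. In the coordinates \<open>z = p + exp s\<close>
  the area factor turns the kernel into \<open>exp s\<close>, so the integrand becomes the
  derivative of \<open>\<phi>\<close> along \<open>Re s\<close>. On each horizontal segment it
  integrates to \<open>0 - \<phi> p\<close>, and the segments fill a height of
  \<open>2 * pi\<close>.\<close>

lemma integral_log_kernel:
  fixes \<phi> :: "complex \<Rightarrow> real"
  assumes gr: "\<And>z. grad \<phi> (D z) z" and cD: "continuous_on UNIV D"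
    and R: "\<And>z. R \<le> cmod z \<Longrightarrow> \<phi> z = 0" and \<rho>: "\<rho> > 0" "\<And>z. z \<in> ball p \<rho> \<Longrightarrow> \<phi> z = \<phi> p"
  shows "(\<lambda>z. Re (D z * cnj (1 / (z - p)))) absolutely_integrable_on UNIV"
    and "integral UNIV (\<lambda>z. Re (D z * cnj (1 / (z - p)))) = - 2 * pi * \<phi> p"
proof -
  define \<theta> where "\<theta> z = Re (D z * cnj (1 / (z - p)))" for z
  have D0: "D z = 0" if "z \<in> ball p \<rho>" for z
    by (rule grad_unique[OF gr grad_cong_open[OF grad_const[of "\<phi> p"] open_ball that]]) (use \<rho>(2) in simp)
  have DR: "D z = 0" if "R < cmod z" for z
  proof (rule grad_unique[OF gr grad_cong_open[OF grad_const[of 0]]])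
    show "open {z. R < cmod z}" by (intro open_Collect_less continuous_intros)
  qed (use that R in auto)
  \<comment> \<open>So large that \<open>\<phi>\<close> equals \<open>\<phi> p\<close> on the left
    side of the rectangle and 0 on its right side.\<close>
  define X where "X = max (\<bar>ln \<rho>\<bar>) (ln (\<bar>R\<bar> + cmod p + 1)) + 1"
  have X: "exp (- X) < \<rho>" "exp X > \<bar>R\<bar> + cmod p + 1" "X > 0"
  proof -
    have "- X < ln \<rho>" by (auto simp: X_def)
    then show "exp (- X) < \<rho>" using \<rho>(1) by (metis exp_less_cancel_iff exp_ln)
    have "ln (\<bar>R\<bar> + cmod p + 1) < X" by (auto simp: X_def)
    moreover have "\<bar>R\<bar> + cmod p + 1 > 0" by (simp add: add_nonneg_pos)
    ultimately show "exp X > \<bar>R\<bar> + cmod p + 1" by (metis exp_less_cancel_iff exp_ln)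
    show "X > 0" by (auto simp: X_def)
  qed
  define a b where "a = Complex (- X) 0" and "b = Complex X (2 * pi)"
  define g where "g s = p + exp s" for s :: complex
  have gder: "(g has_field_derivative exp s) (at s)" for s unfolding g_def by (auto intro!: derivative_eq_intros)
  have inj: "inj_on g (box a b)"
  proof (rule inj_onI)
    fix s t assume st: "s \<in> box a b" "t \<in> box a b" "g s = g t"
    then have "exp s = exp t" by (simp add: g_def)
    moreover have "\<bar>Im s - Im t\<bar> < 2 * pi" using st by (auto simp: in_box_complex_iff a_def b_def)
    ultimately show "s = t" using exp_complex_eqI by blast
  qed
  have Geq: "(cmod (exp s))\<^sup>2 * \<theta> (g s) = Re (D (p + exp s) * exp s)" for s
  proof -
    have "of_real ((cmod E)\<^sup>2) * cnj (1 / E) = E" if "E \<noteq> 0" for E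
      using that unfolding complex_norm_square by simp
    from this[of "exp s"] have "of_real ((cmod (exp s))\<^sup>2) * cnj (1 / exp s) = exp s" using exp_not_eq_zero by blast
    then have "Re (D (p + exp s) * exp s) = Re (of_real ((cmod (exp s))\<^sup>2) * (D (p + exp s) * cnj (1 / exp s)))"
      by (metis mult.left_commute)
    also have "\<dots> = (cmod (exp s))\<^sup>2 * Re (D (p + exp s) * cnj (1 / exp s))"
      by (metis Re_complex_of_real Im_complex_of_real complex.sel(1) times_complex.simps(1) diff_zero mult_zero_left)
    finally show ?thesis by (simp only: \<theta>_def g_def add_diff_cancel_left')
  qed
  define G where "G s = Re (D (p + exp s) * exp s)" for s
  have cG: "continuous_on S G" for S unfolding G_def
    by (intro continuous_intros continuous_on_compose2[OF cD]) auto
  have "G absolutely_integrable_on cbox a b" by (rule absolutely_integrable_continuous[OF cG])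
  then have "G absolutely_integrable_on box a b"
    by (rule set_integrable_subset) (auto simp: box_subset_cbox)
  moreover have "integral (box a b) G = integral (cbox a b) G" by (rule integral_open_interval)
  moreover have "integral (cbox a b) G = integral {0..2 * pi} (\<lambda>y. integral {-X..X} (\<lambda>x. G (Complex x y)))"
    unfolding a_def b_def by (rule integral_complex_cbox_iterated2[OF cG])
  moreover have "integral {-X..X} (\<lambda>x. G (Complex x y)) = - \<phi> p" for y
  proof -
    have "((\<lambda>x. G (Complex x y)) has_integral \<phi> (p + exp (Complex X y)) - \<phi> (p + exp (Complex (-X) y))) {-X..X}"
    proof (rule fundamental_theorem_of_calculus)
      fix x
      have "grad (\<lambda>s. \<phi> (g s)) (D (g (Complex x y)) * exp (Complex x y)) (Complex x y)"
        by (rule grad_compose_holomorphic[OF gr gder])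
      from grad_partial(1)[OF this]
      show "((\<lambda>x. \<phi> (p + exp (Complex x y))) has_vector_derivative G (Complex x y)) (at x within {- X..X})"
        by (simp add: g_def G_def has_real_derivative_iff_has_vector_derivative has_vector_derivative_at_within)
    qed (use X in auto)
    moreover have "\<phi> (p + exp (Complex X y)) = 0"
    proof (rule R)
      have "cmod (exp (Complex X y)) = exp X" by simp
      then show "R \<le> cmod (p + exp (Complex X y))"
        using X(2) norm_triangle_ineq4[of "p + exp (Complex X y)" p] by (simp del: norm_exp_eq_Re)
    qed
    moreover have "\<phi> (p + exp (Complex (-X) y)) = \<phi> p"
      by (rule \<rho>(2)) (use X(1) in \<open>simp add: dist_norm\<close>)
    ultimately show ?thesis by (simp add: integral_unique)
  qed
  ultimately have "(\<lambda>s. (cmod (exp s))\<^sup>2 * \<theta> (g s)) absolutely_integrable_on (box a b) \<and> integral (box a b) (\<lambda>s. (cmod (exp s))\<^sup>2 * \<theta> (g s)) = - 2 * pi * \<phi> p"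
    unfolding Geq G_def[symmetric] by simp
  then have 1: "\<theta> absolutely_integrable_on (g ` box a b)" "integral (g ` box a b) \<theta> = - 2 * pi * \<phi> p"
    using complex_change_of_variables[OF open_box gder inj, of \<theta>] by auto
  \<comment> \<open>The image of the open rectangle misses the ray from \<open>p\<close> in the
    direction 1; the whole horizontal line through \<open>p\<close>, a null set, is discarded
    instead.\<close>
  have negl: "negligible {z. Im z = Im p}"
    using negligible_hyperplane[of \<i> "Im p"] by (simp add: inner_complex_def)
  have zero: "\<theta> z = 0" if "z \<notin> g ` box a b" "Im z \<noteq> Im p" for z
  proof (cases "\<rho> > cmod (z - p) \<or> R < cmod z")
    case True
    then show ?thesis using D0[of z] DR[of z] by (auto simp: \<theta>_def dist_norm norm_minus_commute)
  next
    case False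
    have "z \<noteq> p" using that by auto
    have "z \<in> g ` box a b"
    proof (rule image_eqI)
      define s where "s = Complex (ln (cmod (z - p))) (if Im (z - p) > 0 then Arg (z - p) else Arg (z - p) + 2 * pi)"
      have "exp s = z - p"
      proof -
        have "exp (Complex (ln (cmod (z - p))) (Arg (z - p))) = of_real (cmod (z - p)) * exp (\<i> * of_real (Arg (z - p)))"
          using \<open>z \<noteq> p\<close> by (simp add: Complex_eq exp_add exp_of_real)
        then have "exp (Complex (ln (cmod (z - p))) (Arg (z - p))) = z - p"
          using Arg_eq[of "z - p"] \<open>z \<noteq> p\<close> by simp
        moreover have "exp (Complex r (t + 2 * pi)) = exp (Complex r t)" for r t
          by (simp add: exp_eq_polar cis_mult[symmetric])
        ultimately show ?thesis by (auto simp: s_def)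
      qed
      then show "z = g s" by (simp add: g_def)
      have "ln (cmod (z - p)) < X"
      proof -
        have "cmod (z - p) \<le> R + cmod p" using False norm_triangle_ineq4[of z p] by simp
        then have "cmod (z - p) < exp X" using X(2) by linarith
        then show ?thesis using \<open>z \<noteq> p\<close> by (metis exp_less_cancel_iff exp_ln zero_less_norm_iff right_minus_eq)
      qed
      moreover have "- X < ln (cmod (z - p))"
      proof -
        have "exp (- X) < cmod (z - p)" using X(1) False by linarith
        then show ?thesis using \<open>z \<noteq> p\<close> by (metis exp_less_cancel_iff exp_ln zero_less_norm_iff right_minus_eq)
      qed
      moreover have "0 < Im s \<and> Im s < 2 * pi"
      proof (cases "Im (z - p) > 0")
        case True
        then have "0 < Arg (z - p)" using Arg_lt_pi[of "z - p"] by auto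
        then show ?thesis using True Arg_le_pi[of "z - p"] pi_gt_zero by (auto simp: s_def)
      next
        case False
        then have "Im (z - p) < 0" using that by auto
        then have "Arg (z - p) < 0" using Arg_lt_pi[of "z - p"] Arg_less_0[of "z - p"] by auto
        then show ?thesis using False mpi_less_Arg[of "z - p"] pi_gt_zero by (auto simp: s_def)
      qed
      ultimately show "s \<in> box a b" by (auto simp: s_def in_box_complex_iff a_def b_def)
    qed
    then show ?thesis using that by simp
  qed
  have eqi: "(f has_integral y) UNIV" if "(f has_integral y) (g ` box a b)" "\<And>z. \<theta> z = 0 \<Longrightarrow> f z = 0" for f :: "complex \<Rightarrow> real" and y
  proof -
    have "((\<lambda>z. if z \<in> g ` box a b then f z else 0) has_integral y) UNIV"
      using that(1) by (rule has_integral_restrict_UNIV[THEN iffD2])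
    then show ?thesis
      by (rule has_integral_spike[OF negl, rotated]) (use zero that(2) in auto)
  qed
  have "\<theta> integrable_on g ` box a b" "(\<lambda>z. norm (\<theta> z)) integrable_on g ` box a b"
    using 1(1) unfolding absolutely_integrable_on_def by auto
  then have "(\<theta> has_integral - 2 * pi * \<phi> p) UNIV" "(\<lambda>z. norm (\<theta> z)) integrable_on UNIV"
    using eqi[of \<theta>] eqi[of "\<lambda>z. norm (\<theta> z)"] 1(2) unfolding integrable_on_def by (auto simp: integral_unique)
  then show "(\<lambda>z. Re (D z * cnj (1 / (z - p)))) absolutely_integrable_on UNIV"
    and "integral UNIV (\<lambda>z. Re (D z * cnj (1 / (z - p)))) = - 2 * pi * \<phi> p"
    unfolding \<theta>_def[symmetric] absolutely_integrable_on_def by (auto simp: integral_unique)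
qed

section \<open>Poisson kernel limits and the flux through a rectangle\<close>

text \<open>Widths and heights are tied together by \<open>\<delta> = 1/n\<^sup>2\<close> so that crude bounds on the tails suffice.\<close>

lemma poisson_limit_interior:
  fixes \<phi> :: "complex \<Rightarrow> real"
  assumes p: "p > 0" and \<rho>: "\<rho> > 0" "\<And>z. Im z > 0 \<Longrightarrow> z \<in> ball (of_real p) \<rho> \<Longrightarrow> \<phi> z = c"
    and bd: "\<And>z. Im z > 0 \<Longrightarrow> \<bar>\<phi> z\<bar> \<le> Bd" and cont: "continuous_on {z. Im z > 0} \<phi>"
  shows "(\<lambda>n. integral {0..real n} (\<lambda>x. \<phi> (Complex x (1 / (real n)\<^sup>2)) * ((1 / (real n)\<^sup>2) / ((x - p)\<^sup>2 + (1 / (real n)\<^sup>2)\<^sup>2)))) \<longlonglongrightarrow> pi * c"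
proof -
  define d where "d n = 1 / (real n)\<^sup>2" for n :: nat
  define P where "P n x = d n / ((x - p)\<^sup>2 + (d n)\<^sup>2)" for n x
  have dpos: "d n > 0" if "n \<ge> 1" for n using that by (simp add: d_def)
  have den: "(x - p)\<^sup>2 + (d n)\<^sup>2 > 0" if "n \<ge> 1" for n x
    using dpos[OF that] by (simp add: add_nonneg_pos)
  have d0: "d \<longlonglongrightarrow> 0"
  proof -
    have "(\<lambda>n. (1 / real n)\<^sup>2) \<longlonglongrightarrow> 0\<^sup>2" by (intro tendsto_intros lim_1_over_n)
    then show ?thesis unfolding d_def by (simp add: power_divide)
  qed
  have Pint: "(P n has_integral (arctan ((real n - p) / d n) + arctan (p / d n))) {0..real n}" if n: "n \<ge> 1" for n
  proof -
    have "((\<lambda>x. arctan ((x - p) / d n)) has_vector_derivative P n x) (at x within {0..real n})" for x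
    proof -
      have "((\<lambda>x. arctan ((x - p) / d n)) has_real_derivative (inverse (1 + ((x - p) / d n)\<^sup>2) * (1 / d n))) (at x)"
        using dpos[OF n] by (auto intro!: derivative_eq_intros)
      also have "inverse (1 + ((x - p) / d n)\<^sup>2) * (1 / d n) = P n x"
        using dpos[OF n] den[OF n, of x] by (simp add: P_def field_simps power2_eq_square)
      finally show ?thesis by (simp add: has_real_derivative_iff_has_vector_derivative has_vector_derivative_at_within)
    qed
    from fundamental_theorem_of_calculus[OF _ this]
    have "(P n has_integral arctan ((real n - p) / d n) - arctan ((0 - p) / d n)) {0..real n}" by auto
    then show ?thesis by (simp add: arctan_minus)
  qed
  have lim1: "(\<lambda>n. arctan ((real n - p) / d n) + arctan (p / d n)) \<longlonglongrightarrow> pi / 2 + pi / 2"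
  proof (intro tendsto_add filterlim_compose[OF tendsto_arctan_at_top])
    have eq: "x / d n = x * (real n)\<^sup>2" for n x by (simp add: d_def)
    have sq: "filterlim (\<lambda>n. (real n)\<^sup>2) at_top sequentially"
      by (rule filterlim_pow_at_top[OF _ filterlim_real_sequentially]) simp
    show "filterlim (\<lambda>n. p / d n) at_top sequentially"
      unfolding eq by (rule filterlim_tendsto_pos_mult_at_top[OF tendsto_const p sq])
    have "filterlim (\<lambda>n. - p + real n) at_top sequentially"
      by (rule filterlim_tendsto_add_at_top[OF tendsto_const filterlim_real_sequentially])
    then show "filterlim (\<lambda>n. (real n - p) / d n) at_top sequentially"
      unfolding eq by (intro filterlim_at_top_mult_at_top sq) (simp add: add.commute[of "-p"])
  qed
  define E where "E n x = (\<phi> (Complex x (d n)) - c) * P n x" for n x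
  have cphi: "continuous_on S (\<lambda>x. \<phi> (Complex x (d n)))" if "n \<ge> 1" for n S
    by (rule continuous_on_compose2[OF cont])
       (use dpos[OF that] in \<open>auto intro!: continuous_intros simp: Complex_eq\<close>)
  have cP: "continuous_on S (P n)" if "n \<ge> 1" for n S
    unfolding P_def using den[OF that] by (intro continuous_intros) (metis less_irrefl)
  have Eint: "E n integrable_on {0..real n}" if "n \<ge> 1" for n
    unfolding E_def by (intro integrable_continuous_real continuous_intros cphi cP that)
  have Bc: "0 \<le> Bd + \<bar>c\<bar>" using bd[of \<i>] by (simp add: abs_ge_zero order_trans add_nonneg_nonneg)
  \<comment> \<open>The error is 0 near \<open>p\<close>, where \<open>\<phi>\<close> equals
    \<open>c\<close>. Elsewhere the kernel is at most \<open>4 / \<rho>\<^sup>2 * d n\<close>, and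
    over a length \<open>n\<close> there remains \<open>d n * n = 1 / n\<close>.\<close>
  have Ebd: "\<bar>E n x\<bar> \<le> (Bd + \<bar>c\<bar>) * (4 / \<rho>\<^sup>2) * d n" if n: "n \<ge> 1" and small: "d n < \<rho> / 2" for n x
  proof (cases "\<bar>x - p\<bar> < \<rho> / 2")
    case True
    have "Complex x (d n) - of_real p = Complex (x - p) (d n)" by (simp add: complex_eq_iff)
    then have "cmod (Complex x (d n) - of_real p) \<le> \<bar>x - p\<bar> + \<bar>d n\<bar>"
      using cmod_le[of "Complex (x - p) (d n)"] by simp
    also have "\<dots> < \<rho>" using True small dpos[OF n] by simp
    finally have "\<phi> (Complex x (d n)) = c"
      using \<rho>(2)[of "Complex x (d n)"] dpos[OF n] by (simp add: dist_norm norm_minus_commute)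
    then show ?thesis using Bc dpos[OF n] \<rho>(1) by (simp add: E_def)
  next
    case False
    then have "(\<rho> / 2)\<^sup>2 \<le> (x - p)\<^sup>2" using \<rho>(1) by (metis abs_le_square_iff abs_of_pos half_gt_zero not_less)
    then have "P n x \<le> d n / (\<rho> / 2)\<^sup>2" unfolding P_def using dpos[OF n] \<rho>(1)
      by (intro divide_left_mono) (auto intro!: mult_pos_pos add_nonneg_pos simp: add_increasing2)
    moreover have "0 \<le> P n x" unfolding P_def using dpos[OF n] by simp
    moreover have "\<bar>\<phi> (Complex x (d n)) - c\<bar> \<le> Bd + \<bar>c\<bar>" using bd[of "Complex x (d n)"] dpos[OF n] by simp
    ultimately have "\<bar>E n x\<bar> \<le> (Bd + \<bar>c\<bar>) * (d n / (\<rho> / 2)\<^sup>2)"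
      unfolding E_def abs_mult using Bc by (intro mult_mono) auto
    then show ?thesis by (simp add: power2_eq_square algebra_simps)
  qed
  have limE: "(\<lambda>n. integral {0..real n} (E n)) \<longlonglongrightarrow> 0"
  proof (rule Lim_null_comparison)
    show "(\<lambda>n. (Bd + \<bar>c\<bar>) * (4 / \<rho>\<^sup>2) * (1 / real n)) \<longlonglongrightarrow> 0"
      using tendsto_mult_right_zero[OF lim_1_over_n] by blast
    have "eventually (\<lambda>n. d n < \<rho> / 2) sequentially" by (rule order_tendstoD(2)[OF d0]) (use \<rho>(1) in simp)
    then show "\<forall>\<^sub>F n in sequentially. norm (integral {0..real n} (E n)) \<le> (Bd + \<bar>c\<bar>) * (4 / \<rho>\<^sup>2) * (1 / real n)"
      using eventually_ge_at_top[of 1]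
    proof eventually_elim
      case (elim n)
      have "norm (integral (cbox 0 (real n)) (E n)) \<le> (Bd + \<bar>c\<bar>) * (4 / \<rho>\<^sup>2) * d n * measure lborel (cbox 0 (real n))"
        by (rule integrable_bound) (use Ebd[OF elim(2,1)] Eint[OF elim(2)] Bc dpos[OF elim(2)] in auto)
      also have "\<dots> = (Bd + \<bar>c\<bar>) * (4 / \<rho>\<^sup>2) * (d n * real n)" by simp
      also have "d n * real n = 1 / real n" using elim(2) by (simp add: d_def power2_eq_square)
      finally show ?case by simp
    qed
  qed
  have "(\<lambda>n. integral {0..real n} (E n) + c * (arctan ((real n - p) / d n) + arctan (p / d n))) \<longlonglongrightarrow> 0 + c * (pi / 2 + pi / 2)"
    by (intro tendsto_intros limE lim1)
  moreover have "\<forall>\<^sub>F n in sequentially. integral {0..real n} (E n) + c * (arctan ((real n - p) / d n) + arctan (p / d n)) =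
     integral {0..real n} (\<lambda>x. \<phi> (Complex x (1 / (real n)\<^sup>2)) * ((1 / (real n)\<^sup>2) / ((x - p)\<^sup>2 + (1 / (real n)\<^sup>2)\<^sup>2)))"
    using eventually_ge_at_top[of 1]
  proof eventually_elim
    case (elim n)
    have "integral {0..real n} (\<lambda>x. E n x + c * P n x) = integral {0..real n} (E n) + c * (arctan ((real n - p) / d n) + arctan (p / d n))"
      using Eint[OF elim] Pint[OF elim] by (subst integral_add) (auto simp: integral_unique intro: integrable_on_mult_right)
    moreover have "(\<lambda>x. E n x + c * P n x) = (\<lambda>x. \<phi> (Complex x (d n)) * P n x)" by (auto simp: E_def algebra_simps)
    ultimately show ?case unfolding P_def d_def by simp
  qed
  ultimately have "(\<lambda>n. integral {0..real n} (\<lambda>x. \<phi> (Complex x (1 / (real n)\<^sup>2)) * ((1 / (real n)\<^sup>2) / ((x - p)\<^sup>2 + (1 / (real n)\<^sup>2)\<^sup>2)))) \<longlonglongrightarrow> 0 + c * (pi / 2 + pi / 2)"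
    by (rule Lim_transform_eventually)
  then show ?thesis by (simp add: mult.commute)
qed

text \<open>The pole lies off the half-line of integration: the kernel is at most the height divided
  by \<open>p\<^sup>2\<close>, on an interval of length \<open>n\<close>, and the height is
  \<open>1 / n\<^sup>2\<close>.\<close>

lemma poisson_limit_exterior:
  fixes \<phi> :: "complex \<Rightarrow> real"
  assumes p: "p < 0" 
    and bd: "\<And>z. Im z > 0 \<Longrightarrow> \<bar>\<phi> z\<bar> \<le> Bd" and cont: "continuous_on {z. Im z > 0} \<phi>"
  shows "(\<lambda>n. integral {0..real n} (\<lambda>x. \<phi> (Complex x (1 / (real n)\<^sup>2)) * ((1 / (real n)\<^sup>2) / ((x - p)\<^sup>2 + (1 / (real n)\<^sup>2)\<^sup>2)))) \<longlonglongrightarrow> 0"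
proof (rule Lim_null_comparison)
  have Bd: "0 \<le> Bd" using bd[of \<i>] by simp
  show "(\<lambda>n. (Bd / p\<^sup>2) * (1 / real n)) \<longlonglongrightarrow> 0"
    using tendsto_mult_right_zero[OF lim_1_over_n] by blast
  show "\<forall>\<^sub>F n in sequentially. norm (integral {0..real n} (\<lambda>x. \<phi> (Complex x (1 / (real n)\<^sup>2)) * ((1 / (real n)\<^sup>2) / ((x - p)\<^sup>2 + (1 / (real n)\<^sup>2)\<^sup>2)))) \<le> (Bd / p\<^sup>2) * (1 / real n)"
    using eventually_ge_at_top[of 1]
  proof eventually_elim
    case (elim n)
    define d where "d = 1 / (real n)\<^sup>2"
    have d: "d > 0" using elim by (simp add: d_def)
    have den: "(x - p)\<^sup>2 + d\<^sup>2 > 0" for x using d by (simp add: add_nonneg_pos)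
    have ci: "(\<lambda>x. \<phi> (Complex x d) * (d / ((x - p)\<^sup>2 + d\<^sup>2))) integrable_on {0..real n}"
    proof (intro integrable_continuous_real continuous_intros)
      show "continuous_on {0..real n} (\<lambda>x. \<phi> (Complex x d))"
        by (rule continuous_on_compose2[OF cont]) (use d in \<open>auto intro!: continuous_intros simp: Complex_eq\<close>)
    qed (use den in \<open>metis less_irrefl\<close>)
    have "norm (integral (cbox 0 (real n)) (\<lambda>x. \<phi> (Complex x d) * (d / ((x - p)\<^sup>2 + d\<^sup>2)))) \<le> Bd * (d / p\<^sup>2) * measure lborel (cbox 0 (real n))"
    proof (rule integrable_bound)
      fix x assume "x \<in> cbox 0 (real n)"
      then have "p\<^sup>2 \<le> (x - p)\<^sup>2" using p by (intro power2_le_iff_abs_le[THEN iffD2]) auto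
      then have "d / ((x - p)\<^sup>2 + d\<^sup>2) \<le> d / p\<^sup>2" using p d
        by (intro divide_left_mono) (auto intro!: mult_pos_pos add_nonneg_pos simp: add_increasing2)
      moreover have "0 \<le> d / ((x - p)\<^sup>2 + d\<^sup>2)" using d den by simp
      moreover have "\<bar>\<phi> (Complex x d)\<bar> \<le> Bd" using bd d by simp
      ultimately show "norm (\<phi> (Complex x d) * (d / ((x - p)\<^sup>2 + d\<^sup>2))) \<le> Bd * (d / p\<^sup>2)"
        unfolding real_norm_def abs_mult using Bd by (intro mult_mono) auto
    qed (use ci Bd d in auto)
    also have "\<dots> = (Bd / p\<^sup>2) * (d * real n)" by simp
    also have "d * real n = 1 / real n" using elim by (simp add: d_def power2_eq_square)
    finally show ?case by (simp add: d_def)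
  qed
qed

text \<open>Green's formula. The vector field with components \<open>Re f\<close> and
  \<open>- Im f\<close> is divergence free by Cauchy-Riemann, so the integrand is
  \<open>P - Q\<close>, where \<open>P\<close> is the x-derivative of \<open>\<phi> * Re f\<close>
  and \<open>Q\<close> the y-derivative of \<open>\<phi> * Im f\<close>; the terms with
  \<open>deriv f\<close> cancel.\<close>

lemma rectangle_flux:
  fixes \<phi> :: "complex \<Rightarrow> real" and f :: "complex \<Rightarrow> complex"
  assumes S: "open S" "cbox (Complex a c) (Complex b d) \<subseteq> S" "a \<le> b" "c \<le> d"
    and f: "f holomorphic_on S" and gr: "\<And>z. z \<in> S \<Longrightarrow> grad \<phi> (D z) z" and cD: "continuous_on S D"
  shows "integral (cbox (Complex a c) (Complex b d)) (\<lambda>z. Re (D z * cnj (f z))) =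
    integral {c..d} (\<lambda>y. \<phi> (Complex b y) * Re (f (Complex b y))) - integral {c..d} (\<lambda>y. \<phi> (Complex a y) * Re (f (Complex a y)))
   - (integral {a..b} (\<lambda>x. \<phi> (Complex x d) * Im (f (Complex x d))) - integral {a..b} (\<lambda>x. \<phi> (Complex x c) * Im (f (Complex x c))))"
proof -
  let ?R = "cbox (Complex a c) (Complex b d)"
  have inR: "Complex x y \<in> ?R \<longleftrightarrow> a \<le> x \<and> x \<le> b \<and> c \<le> y \<and> y \<le> d" for x y
    by (auto simp: in_cbox_complex_iff)
  have c\<phi>: "continuous_on S \<phi>"
    using gr has_derivative_continuous by (force simp: grad_def continuous_on_eq_continuous_at[OF S(1)])
  have cf: "continuous_on S f" by (rule holomorphic_on_imp_continuous_on[OF f])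
  have cf': "continuous_on S (deriv f)"
    by (intro holomorphic_on_imp_continuous_on holomorphic_deriv f S)
  have df: "(f has_field_derivative deriv f z) (at z)" if "z \<in> S" for z
    using f S(1) that by (simp add: holomorphic_derivI)
  define P where "P z = Re (D z) * Re (f z) + \<phi> z * Re (deriv f z)" for z
  define Q where "Q z = - Im (D z) * Im (f z) + \<phi> z * Re (deriv f z)" for z
  have cP: "continuous_on ?R P" and cQ: "continuous_on ?R Q" unfolding P_def Q_def
    by (intro continuous_intros continuous_on_subset[OF _ S(2)] c\<phi> cf cf' cD)+
  have eq: "Re (D z * cnj (f z)) = P z - Q z" for z by (simp add: P_def Q_def)
  have "integral ?R (\<lambda>z. Re (D z * cnj (f z))) = integral ?R P - integral ?R Q"
    unfolding eq by (intro integral_diff integrable_continuous cP cQ)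
  also have "integral ?R P = integral {c..d} (\<lambda>y. integral {a..b} (\<lambda>x. P (Complex x y)))"
    by (rule integral_complex_cbox_iterated2[OF cP])
  also have "\<dots> = integral {c..d} (\<lambda>y. \<phi> (Complex b y) * Re (f (Complex b y)) - \<phi> (Complex a y) * Re (f (Complex a y)))"
  proof (rule integral_cong)
    fix y assume y: "y \<in> {c..d}"
    have "((\<lambda>x. P (Complex x y)) has_integral \<phi> (Complex b y) * Re (f (Complex b y)) - \<phi> (Complex a y) * Re (f (Complex a y))) {a..b}"
    proof (rule fundamental_theorem_of_calculus[OF S(3)])
      fix x assume x: "x \<in> {a..b}"
      then have zS: "Complex x y \<in> S" using inR y S(2) by auto
      have "((\<lambda>x. \<phi> (Complex x y) * Re (f (Complex x y))) has_real_derivative P (Complex x y)) (at x)"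
        unfolding P_def using DERIV_mult[OF grad_partial(1)[OF gr[OF zS]] grad_partial(1)[OF grad_Re_holomorphic[OF df[OF zS]]]]
        by (simp add: mult.commute add.commute)
      then show "((\<lambda>x. \<phi> (Complex x y) * Re (f (Complex x y))) has_vector_derivative P (Complex x y)) (at x within {a..b})"
        by (simp add: has_real_derivative_iff_has_vector_derivative has_vector_derivative_at_within)
    qed
    then show "integral {a..b} (\<lambda>x. P (Complex x y)) = \<phi> (Complex b y) * Re (f (Complex b y)) - \<phi> (Complex a y) * Re (f (Complex a y))"
      by (rule integral_unique)
  qed
  also have "\<dots> = integral {c..d} (\<lambda>y. \<phi> (Complex b y) * Re (f (Complex b y))) - integral {c..d} (\<lambda>y. \<phi> (Complex a y) * Re (f (Complex a y)))"
  proof (intro integral_diff integrable_continuous_real continuous_intros)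
    have 1: "continuous_on {c..d} (\<lambda>y. Complex b y)" "continuous_on {c..d} (\<lambda>y. Complex a y)"
      unfolding Complex_eq by (intro continuous_intros)+
    have 2: "(\<lambda>y. Complex b y) ` {c..d} \<subseteq> S" "(\<lambda>y. Complex a y) ` {c..d} \<subseteq> S" using inR S by auto
    show "continuous_on {c..d} (\<lambda>y. \<phi> (Complex b y))" "continuous_on {c..d} (\<lambda>y. f (Complex b y))"
      "continuous_on {c..d} (\<lambda>y. \<phi> (Complex a y))" "continuous_on {c..d} (\<lambda>y. f (Complex a y))"
      by (rule continuous_on_compose2[OF c\<phi> 1(1) 2(1)] continuous_on_compose2[OF cf 1(1) 2(1)] continuous_on_compose2[OF c\<phi> 1(2) 2(2)] continuous_on_compose2[OF cf 1(2) 2(2)])+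
  qed
  also have "integral ?R Q = integral {a..b} (\<lambda>x. integral {c..d} (\<lambda>y. Q (Complex x y)))"
    by (rule integral_complex_cbox_iterated[OF cQ])
  also have "\<dots> = integral {a..b} (\<lambda>x. \<phi> (Complex x d) * Im (f (Complex x d)) - \<phi> (Complex x c) * Im (f (Complex x c)))"
  proof (rule integral_cong)
    fix x assume x: "x \<in> {a..b}"
    have "((\<lambda>y. Q (Complex x y)) has_integral \<phi> (Complex x d) * Im (f (Complex x d)) - \<phi> (Complex x c) * Im (f (Complex x c))) {c..d}"
    proof (rule fundamental_theorem_of_calculus[OF S(4)])
      fix y assume y: "y \<in> {c..d}"
      then have zS: "Complex x y \<in> S" using inR x S(2) by auto
      have "((\<lambda>z. - \<i> * f z) has_field_derivative - \<i> * deriv f (Complex x y)) (at (Complex x y))"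
        by (intro DERIV_cmult df zS)
      from grad_partial(2)[OF grad_Re_holomorphic[OF this]]
      have "((\<lambda>y. Im (f (Complex x y))) has_real_derivative Re (deriv f (Complex x y))) (at y)" by simp
      then have "((\<lambda>y. \<phi> (Complex x y) * Im (f (Complex x y))) has_real_derivative Q (Complex x y)) (at y)"
        unfolding Q_def using DERIV_mult[OF grad_partial(2)[OF gr[OF zS]]] by (fastforce simp: mult.commute add.commute)
      then show "((\<lambda>y. \<phi> (Complex x y) * Im (f (Complex x y))) has_vector_derivative Q (Complex x y)) (at y within {c..d})"
        by (simp add: has_real_derivative_iff_has_vector_derivative has_vector_derivative_at_within)
    qed
    then show "integral {c..d} (\<lambda>y. Q (Complex x y)) = \<phi> (Complex x d) * Im (f (Complex x d)) - \<phi> (Complex x c) * Im (f (Complex x c))"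
      by (rule integral_unique)
  qed
  also have "\<dots> = integral {a..b} (\<lambda>x. \<phi> (Complex x d) * Im (f (Complex x d))) - integral {a..b} (\<lambda>x. \<phi> (Complex x c) * Im (f (Complex x c)))"
  proof (intro integral_diff integrable_continuous_real continuous_intros)
    have 1: "continuous_on {a..b} (\<lambda>x. Complex x d)" "continuous_on {a..b} (\<lambda>x. Complex x c)"
      unfolding Complex_eq by (intro continuous_intros)+
    have 2: "(\<lambda>x. Complex x d) ` {a..b} \<subseteq> S" "(\<lambda>x. Complex x c) ` {a..b} \<subseteq> S" using inR S by auto
    show "continuous_on {a..b} (\<lambda>x. \<phi> (Complex x d))" "continuous_on {a..b} (\<lambda>x. f (Complex x d))"
      "continuous_on {a..b} (\<lambda>x. \<phi> (Complex x c))" "continuous_on {a..b} (\<lambda>x. f (Complex x c))"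
      by (rule continuous_on_compose2[OF c\<phi> 1(1) 2(1)] continuous_on_compose2[OF cf 1(1) 2(1)] continuous_on_compose2[OF c\<phi> 1(2) 2(2)] continuous_on_compose2[OF cf 1(2) 2(2)])+
  qed
  finally show ?thesis .
qed

section \<open>Flux of the model field\<close>

text \<open>The square root of the quadratic differential: \<open>potential\<close> below is a primitive of its real part, with poles of weight 1 at the preimages \<open>\<plusminus> 1\<close> of two consecutive points and of weight \<open>T\<close> at the preimages \<open>\<plusminus> T\<close> of the origin.\<close>
definition model_field :: "real \<Rightarrow> complex \<Rightarrow> complex" where
  "model_field T z = 1 / (1 + z) + 1 / (1 - z) + of_real T / (z - of_real T) - of_real T / (z + of_real T)"

lemma model_field_holomorphic: "model_field T holomorphic_on {z. Im z > 0}"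
proof -
  have "1 + z \<noteq> 0" "1 - z \<noteq> 0" "z - of_real T \<noteq> 0" "z + of_real T \<noteq> 0" if "Im z > 0" for z
    using that by (auto simp: complex_eq_iff)
  then show ?thesis unfolding model_field_def by (intro holomorphic_intros) auto
qed

text \<open>The partial fractions hide the double zero at 0 and the decay of order
  \<open>1 / z\<^sup>2\<close> at infinity. The decay makes the far sides of the rectangles
  negligible.\<close>

lemma model_field_closed_form:
  assumes "Im z > 0"
  shows "model_field T z = 2 * z\<^sup>2 * (1 - of_real T ^ 2) / ((1 - z\<^sup>2) * (z\<^sup>2 - of_real T ^ 2))"
proof -
  have nz: "1 + z \<noteq> 0" "1 - z \<noteq> 0" "z - of_real T \<noteq> 0" "z + of_real T \<noteq> 0"
    using assms by (auto simp: complex_eq_iff)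
  have "1 / (1 + z) + 1 / (1 - z) = 2 / (1 - z\<^sup>2)"
    using nz by (simp add: field_simps power2_eq_square)
  moreover have "of_real T / (z - of_real T) - of_real T / (z + of_real T) = 2 * of_real T ^ 2 / (z\<^sup>2 - of_real T ^ 2)"
  proof -
    have fac: "z\<^sup>2 - of_real T ^ 2 = (z - of_real T) * (z + of_real T)" by (simp add: algebra_simps power2_eq_square)
    have num: "of_real T * (z + of_real T) - of_real T * (z - of_real T) = 2 * (of_real T)\<^sup>2" by (simp add: algebra_simps power2_eq_square)
    show ?thesis unfolding fac diff_frac_eq[OF nz(3,4)] num ..
  qed
  moreover have "1 - z\<^sup>2 \<noteq> 0" "z\<^sup>2 - of_real T ^ 2 \<noteq> 0"
  proof -
    have "1 - z\<^sup>2 = (1 - z) * (1 + z)" "z\<^sup>2 - of_real T ^ 2 = (z - of_real T) * (z + of_real T)"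
      by (simp_all add: algebra_simps power2_eq_square)
    then show "1 - z\<^sup>2 \<noteq> 0" "z\<^sup>2 - of_real T ^ 2 \<noteq> 0" using nz by auto
  qed
  ultimately have "model_field T z = (2 * (z\<^sup>2 - of_real T ^ 2) + 2 * of_real T ^ 2 * (1 - z\<^sup>2)) / ((1 - z\<^sup>2) * (z\<^sup>2 - of_real T ^ 2))"
    unfolding model_field_def using add_frac_eq by (simp only: add_diff_eq[symmetric]) blast
  also have "2 * (z\<^sup>2 - of_real T ^ 2) + 2 * of_real T ^ 2 * (1 - z\<^sup>2) = 2 * z\<^sup>2 * (1 - of_real T ^ 2)"
    by (simp add: algebra_simps)
  finally show ?thesis .
qed

lemma model_field_bound:
  assumes "Im z > 0" "cmod z \<ge> 2" "0 \<le> T" "T < 1"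
  shows "cmod (model_field T z) \<le> 4 / (cmod z)\<^sup>2"
proof -
  define r where "r = (cmod z)\<^sup>2"
  have r: "r \<ge> 4" using assms(2) power_mono[of 2 "cmod z" 2] by (simp add: r_def)
  have T2: "0 \<le> T\<^sup>2" "T\<^sup>2 \<le> 1" using assms by (auto simp: power_le_one)
  have a: "cmod (1 - z\<^sup>2) \<ge> 3/4 * r" using norm_triangle_ineq2[of "z\<^sup>2" 1] r by (simp add: r_def norm_power norm_minus_commute)
  have "cmod (z\<^sup>2 - of_real T ^ 2) \<ge> cmod (z\<^sup>2) - cmod (of_real T ^ 2)" by (rule norm_triangle_ineq2)
  then have b: "cmod (z\<^sup>2 - of_real T ^ 2) \<ge> 3/4 * r" using r T2 by (simp add: r_def norm_power)
  have c: "cmod (1 - of_real T ^ 2) \<le> 1"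
  proof -
    have "(1 - of_real T ^ 2 :: complex) = of_real (1 - T\<^sup>2)" by simp
    then show ?thesis using T2 by (metis abs_of_nonneg diff_ge_0_iff_ge diff_le_eq le_add_same_cancel1 norm_of_real)
  qed
  have "cmod (model_field T z) = 2 * r * cmod (1 - of_real T ^ 2) / (cmod (1 - z\<^sup>2) * cmod (z\<^sup>2 - of_real T ^ 2))"
    unfolding model_field_closed_form[OF assms(1)] by (simp add: norm_divide norm_mult norm_power r_def)
  also have "\<dots> \<le> 2 * r * 1 / ((3/4 * r) * (3/4 * r))"
    using a b c r by (intro frac_le mult_mono mult_left_mono) auto
  also have "\<dots> \<le> 4 / r" using r by (simp add: field_simps)
  finally show ?thesis by (simp add: r_def)
qed

lemma model_field_reflect: "model_field T (- cnj z) = cnj (model_field T z)"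
proof -
  have "cnj (model_field T z) = 1 / (1 + cnj z) + 1 / (1 - cnj z) + of_real T / (cnj z - of_real T) - of_real T / (cnj z + of_real T)"
    by (simp add: model_field_def)
  moreover have "of_real T / (- cnj z - of_real T) = - (of_real T / (cnj z + of_real T))"
    by (metis (no_types, opaque_lifting) add_uminus_conv_diff divide_minus_right minus_add_distrib)
  moreover have "of_real T / (- cnj z + of_real T) = - (of_real T / (cnj z - of_real T))"
    by (metis divide_minus_right minus_diff_eq uminus_add_conv_diff)
  ultimately show ?thesis by (simp add: model_field_def)
qed

text \<open>This sign allows the boundary terms on the imaginary axis to be dropped, by way of
  \<open>axis_term_nonneg\<close>.\<close>

lemma model_field_imaginary_axis:
  assumes "y > 0" "0 \<le> T" "T < 1"
  shows "Re (model_field T (Complex 0 y)) \<ge> 0"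
proof -
  have sq: "(Complex 0 y)\<^sup>2 = of_real (- y\<^sup>2)" by (simp add: complex_eq_iff power2_eq_square)
  have "model_field T (Complex 0 y) = of_real (2 * (- y\<^sup>2) * (1 - T\<^sup>2) / ((1 + y\<^sup>2) * (- y\<^sup>2 - T\<^sup>2)))"
    using assms by (subst model_field_closed_form) (auto simp: sq)
  also have "2 * (- y\<^sup>2) * (1 - T\<^sup>2) / ((1 + y\<^sup>2) * (- y\<^sup>2 - T\<^sup>2)) = 2 * y\<^sup>2 * (1 - T\<^sup>2) / ((1 + y\<^sup>2) * (y\<^sup>2 + T\<^sup>2))"
  proof -
    have "2 * (- y\<^sup>2) * (1 - T\<^sup>2) = - (2 * y\<^sup>2 * (1 - T\<^sup>2))" "(1 + y\<^sup>2) * (- y\<^sup>2 - T\<^sup>2) = - ((1 + y\<^sup>2) * (y\<^sup>2 + T\<^sup>2))"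
      by (simp_all add: algebra_simps)
    then show ?thesis by (simp only: minus_divide_divide)
  qed
  moreover have "2 * y\<^sup>2 * (1 - T\<^sup>2) / ((1 + y\<^sup>2) * (y\<^sup>2 + T\<^sup>2)) \<ge> 0"
    using assms by (intro divide_nonneg_nonneg mult_nonneg_nonneg) (auto simp: power_le_one)
  ultimately show ?thesis by simp
qed

text \<open>On a horizontal line the imaginary part is a combination of Poisson kernels at the four
  poles. As the line descends to the real axis, only the values of the test function at the poles
  survive.\<close>

lemma Im_model_field:
  assumes "d > 0"
  shows "Im (model_field T (Complex x d)) = - (d / ((x - (-1))\<^sup>2 + d\<^sup>2)) + d / ((x - 1)\<^sup>2 + d\<^sup>2)
     - T * (d / ((x - T)\<^sup>2 + d\<^sup>2)) + T * (d / ((x - (-T))\<^sup>2 + d\<^sup>2))"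
  unfolding model_field_def by (simp add: Im_divide Re_divide power2_eq_square) (simp add: algebra_simps)

abbreviation rquad :: "nat \<Rightarrow> complex set" where
  "rquad n \<equiv> cbox (Complex 0 (1 / (real n)\<^sup>2)) (Complex (real n) (real n))"
abbreviation lquad :: "nat \<Rightarrow> complex set" where
  "lquad n \<equiv> cbox (Complex (- real n) (1 / (real n)\<^sup>2)) (Complex 0 (real n))"

text \<open>By the decay of the field the right and top sides of the rectangle contribute at most a
  multiple of \<open>1 / n\<close>. The bottom side tends to the values at 1 and \<open>T\<close>,
  the poles of the right quadrant. The side on the imaginary axis is kept in the statement, to be
  compared with that of the left quadrant.\<close>

lemma quadrant_flux:
  fixes \<phi> :: "complex \<Rightarrow> real"
  assumes T: "0 < T" "T < 1"
    and gr: "\<And>z. Im z > 0 \<Longrightarrow> grad \<phi> (D z) z" and cD: "continuous_on {z. Im z > 0} D"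
    and bd: "\<And>z. Im z > 0 \<Longrightarrow> \<bar>\<phi> z\<bar> \<le> Bd"
    and \<rho>: "\<rho> > 0" "\<And>z. Im z > 0 \<Longrightarrow> z \<in> ball 1 \<rho> \<Longrightarrow> \<phi> z = c1" "\<And>z. Im z > 0 \<Longrightarrow> z \<in> ball (of_real T) \<rho> \<Longrightarrow> \<phi> z = c0"
  shows "(\<lambda>n. integral (rquad n) (\<lambda>z. Re (D z * cnj (model_field T z)))
     + integral {1 / (real n)\<^sup>2..real n} (\<lambda>y. \<phi> (Complex 0 y) * Re (model_field T (Complex 0 y)))) \<longlonglongrightarrow> pi * (c1 - T * c0)"
proof -
  let ?f = "model_field T"
  define d where "d n = 1 / (real n)\<^sup>2" for n :: nat
  have op: "open {z. Im z > 0}" by (simp add: open_halfspace_Im_gt)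
  have c\<phi>: "continuous_on {z. Im z > 0} \<phi>"
    using gr has_derivative_continuous by (force simp: grad_def continuous_on_eq_continuous_at[OF op])
  have cf: "continuous_on {z. Im z > 0} ?f" by (rule holomorphic_on_imp_continuous_on[OF model_field_holomorphic])
  have Bd0: "0 \<le> Bd" using bd[of \<i>] by simp
  have d: "0 < d n" "d n \<le> 1" if "n \<ge> 1" for n
  proof -
    have "1 \<le> (real n)\<^sup>2" using that by (simp add: one_le_power)
    then show "0 < d n" "d n \<le> 1" using that by (auto simp: d_def divide_le_eq_1 zero_less_divide_iff)
  qed
  define R1 where "R1 n = integral {d n..real n} (\<lambda>y. \<phi> (Complex (real n) y) * Re (?f (Complex (real n) y)))" for n
  define R2 where "R2 n = integral {0..real n} (\<lambda>x. \<phi> (Complex x (real n)) * Im (?f (Complex x (real n))))" for n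
  define R3 where "R3 n = integral {0..real n} (\<lambda>x. \<phi> (Complex x (d n)) * Im (?f (Complex x (d n))))" for n
  have id: "integral (rquad n) (\<lambda>z. Re (D z * cnj (?f z)))
     + integral {1 / (real n)\<^sup>2..real n} (\<lambda>y. \<phi> (Complex 0 y) * Re (?f (Complex 0 y))) = R1 n - R2 n + R3 n" if n: "n \<ge> 2" for n
  proof -
    have sub: "rquad n \<subseteq> {z. Im z > 0}" using less_le_trans[OF d(1)[of n]] n by (auto simp: in_cbox_complex_iff d_def)
    have "d n \<le> real n" using d(2)[of n] n by linarith
    then have le: "1 / (real n)\<^sup>2 \<le> real n" by (simp only: d_def)
    have n0: "0 \<le> real n" by simp
    from rectangle_flux[OF op sub n0 le model_field_holomorphic[of T], of \<phi> D] gr cD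
    have "integral (rquad n) (\<lambda>z. Re (D z * cnj (?f z))) = R1 n - integral {1 / (real n)\<^sup>2..real n} (\<lambda>y. \<phi> (Complex 0 y) * Re (?f (Complex 0 y))) - (R2 n - R3 n)"
      unfolding R1_def R2_def R3_def d_def by blast
    then show ?thesis by linarith
  qed
  have bnd: "\<bar>\<phi> z\<bar> * cmod (?f z) \<le> Bd * (4 / (real n)\<^sup>2)" if "Im z > 0" "real n \<le> cmod z" "n \<ge> 2" for z n
  proof -
    have "cmod (?f z) \<le> 4 / (cmod z)\<^sup>2" using model_field_bound[of z T] that T by auto
    also have "\<dots> \<le> 4 / (real n)\<^sup>2" using that by (intro divide_left_mono) (auto intro!: mult_pos_pos power_mono)
    finally show ?thesis using bd[OF that(1)] Bd0 by (intro mult_mono) auto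
  qed
  have R1: "R1 \<longlonglongrightarrow> 0" and R2: "R2 \<longlonglongrightarrow> 0"
  proof -
    have lim: "(\<lambda>n. (4 * Bd) * (1 / real n)) \<longlonglongrightarrow> 0" using tendsto_mult_right_zero[OF lim_1_over_n] by blast
    have "\<forall>\<^sub>F n in sequentially. norm (R1 n) \<le> (4 * Bd) * (1 / real n)" using eventually_ge_at_top[of 2]
    proof eventually_elim
      case (elim n)
      have dn: "0 < d n" "d n \<le> real n" using d[of n] elim by auto
      have "norm (integral (cbox (d n) (real n)) (\<lambda>y. \<phi> (Complex (real n) y) * Re (?f (Complex (real n) y)))) \<le> Bd * (4 / (real n)\<^sup>2) * measure lborel (cbox (d n) (real n))"
      proof (rule integrable_bound)
        have "continuous_on (cbox (d n) (real n)) (\<lambda>y. Complex (real n) y)" unfolding Complex_eq by (intro continuous_intros)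
        moreover have "(\<lambda>y. Complex (real n) y) ` cbox (d n) (real n) \<subseteq> {z. Im z > 0}" using dn by auto
        ultimately show "(\<lambda>y. \<phi> (Complex (real n) y) * Re (?f (Complex (real n) y))) integrable_on cbox (d n) (real n)"
          by (intro integrable_continuous continuous_intros continuous_on_compose2[OF c\<phi>] continuous_on_compose2[OF cf]) auto
        fix y assume y: "y \<in> cbox (d n) (real n)"
        have "real n \<le> cmod (Complex (real n) y)" using abs_Re_le_cmod[of "Complex (real n) y"] by simp
        then have "\<bar>\<phi> (Complex (real n) y)\<bar> * cmod (?f (Complex (real n) y)) \<le> Bd * (4 / (real n)\<^sup>2)" using bnd[of "Complex (real n) y" n] y dn elim by auto
        moreover have "\<bar>\<phi> (Complex (real n) y)\<bar> * \<bar>Re (?f (Complex (real n) y))\<bar> \<le> \<bar>\<phi> (Complex (real n) y)\<bar> * cmod (?f (Complex (real n) y))"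
          by (intro mult_left_mono abs_Re_le_cmod) auto
        ultimately show "norm (\<phi> (Complex (real n) y) * Re (?f (Complex (real n) y))) \<le> Bd * (4 / (real n)\<^sup>2)" by (simp add: abs_mult)
      qed (use Bd0 in auto)
      also have "\<dots> \<le> Bd * (4 / (real n)\<^sup>2) * real n" using dn Bd0 by (intro mult_left_mono) auto
      finally show ?case using elim by (simp add: R1_def power2_eq_square mult.commute)
    qed
    then show "R1 \<longlonglongrightarrow> 0" by (rule Lim_null_comparison[OF _ lim])
    have "\<forall>\<^sub>F n in sequentially. norm (R2 n) \<le> (4 * Bd) * (1 / real n)" using eventually_ge_at_top[of 2]
    proof eventually_elim
      case (elim n)
      have "norm (integral (cbox 0 (real n)) (\<lambda>x. \<phi> (Complex x (real n)) * Im (?f (Complex x (real n))))) \<le> Bd * (4 / (real n)\<^sup>2) * measure lborel (cbox 0 (real n))"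
      proof (rule integrable_bound)
        have "continuous_on (cbox 0 (real n)) (\<lambda>x. Complex x (real n))" unfolding Complex_eq by (intro continuous_intros)
        moreover have "(\<lambda>x. Complex x (real n)) ` cbox 0 (real n) \<subseteq> {z. Im z > 0}" using elim by auto
        ultimately show "(\<lambda>x. \<phi> (Complex x (real n)) * Im (?f (Complex x (real n)))) integrable_on cbox 0 (real n)"
          by (intro integrable_continuous continuous_intros continuous_on_compose2[OF c\<phi>] continuous_on_compose2[OF cf]) auto
        fix x assume x: "x \<in> cbox 0 (real n)"
        have "real n \<le> cmod (Complex x (real n))" using abs_Im_le_cmod[of "Complex x (real n)"] by simp
        then have "\<bar>\<phi> (Complex x (real n))\<bar> * cmod (?f (Complex x (real n))) \<le> Bd * (4 / (real n)\<^sup>2)" using bnd[of "Complex x (real n)" n] elim by auto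
        moreover have "\<bar>\<phi> (Complex x (real n))\<bar> * \<bar>Im (?f (Complex x (real n)))\<bar> \<le> \<bar>\<phi> (Complex x (real n))\<bar> * cmod (?f (Complex x (real n)))"
          by (intro mult_left_mono abs_Im_le_cmod) auto
        ultimately show "norm (\<phi> (Complex x (real n)) * Im (?f (Complex x (real n)))) \<le> Bd * (4 / (real n)\<^sup>2)" by (simp add: abs_mult)
      qed (use Bd0 in auto)
      then show ?case using elim by (simp add: R2_def power2_eq_square mult.commute)
    qed
    then show "R2 \<longlonglongrightarrow> 0" by (rule Lim_null_comparison[OF _ lim])
  qed
  define P where "P p n = integral {0..real n} (\<lambda>x. \<phi> (Complex x (d n)) * (d n / ((x - p)\<^sup>2 + (d n)\<^sup>2)))" for p n
  have P1: "P 1 \<longlonglongrightarrow> pi * c1" unfolding P_def d_def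
    by (rule poisson_limit_interior[OF _ \<rho>(1) _ bd c\<phi>]) (use \<rho>(2) in auto)
  have PT: "P T \<longlonglongrightarrow> pi * c0" unfolding P_def d_def
    by (rule poisson_limit_interior[OF T(1) \<rho>(1) _ bd c\<phi>]) (use \<rho>(3) in auto)
  have P1': "P (-1) \<longlonglongrightarrow> 0" "P (-T) \<longlonglongrightarrow> 0" unfolding P_def d_def
    by (rule poisson_limit_exterior[OF _ bd c\<phi>]; use T in simp)+
  have R3: "R3 n = - P (-1) n + P 1 n - T * P T n + T * P (-T) n" if n: "n \<ge> 1" for n
  proof -
    have dn: "0 < d n" using d[OF n] by simp
    have ci: "(\<lambda>x. \<phi> (Complex x (d n)) * (d n / ((x - p)\<^sup>2 + (d n)\<^sup>2))) integrable_on {0..real n}" for p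
    proof (intro integrable_continuous_real continuous_intros)
      show "continuous_on {0..real n} (\<lambda>x. \<phi> (Complex x (d n)))"
        by (rule continuous_on_compose2[OF c\<phi>]) (use dn in \<open>auto intro!: continuous_intros simp: Complex_eq\<close>)
      show "\<forall>x\<in>{0..real n}. (x - p)\<^sup>2 + (d n)\<^sup>2 \<noteq> 0" using dn by (auto simp: sum_power2_eq_zero_iff)
    qed
    have "((\<lambda>x. - (\<phi> (Complex x (d n)) * (d n / ((x - (-1))\<^sup>2 + (d n)\<^sup>2))) + \<phi> (Complex x (d n)) * (d n / ((x - 1)\<^sup>2 + (d n)\<^sup>2))
       - T * (\<phi> (Complex x (d n)) * (d n / ((x - T)\<^sup>2 + (d n)\<^sup>2))) + T * (\<phi> (Complex x (d n)) * (d n / ((x - (-T))\<^sup>2 + (d n)\<^sup>2))))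
       has_integral (- P (-1) n + P 1 n - T * P T n + T * P (-T) n)) {0..real n}"
      unfolding P_def by (intro has_integral_add has_integral_diff has_integral_neg has_integral_mult_right integrable_integral ci)
    moreover have "(\<lambda>x. - (\<phi> (Complex x (d n)) * (d n / ((x - (-1))\<^sup>2 + (d n)\<^sup>2))) + \<phi> (Complex x (d n)) * (d n / ((x - 1)\<^sup>2 + (d n)\<^sup>2))
       - T * (\<phi> (Complex x (d n)) * (d n / ((x - T)\<^sup>2 + (d n)\<^sup>2))) + T * (\<phi> (Complex x (d n)) * (d n / ((x - (-T))\<^sup>2 + (d n)\<^sup>2))))
       = (\<lambda>x. \<phi> (Complex x (d n)) * Im (?f (Complex x (d n))))"
      unfolding Im_model_field[OF dn] by (auto simp: algebra_simps)
    ultimately show ?thesis unfolding R3_def by (simp add: integral_unique)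
  qed
  have "(\<lambda>n. R1 n - R2 n + (- P (-1) n + P 1 n - T * P T n + T * P (-T) n)) \<longlonglongrightarrow> 0 - 0 + (- 0 + pi * c1 - T * (pi * c0) + T * 0)"
    by (intro tendsto_intros R1 R2 P1 PT P1')
  then have "(\<lambda>n. R1 n - R2 n + (- P (-1) n + P 1 n - T * P T n + T * P (-T) n)) \<longlonglongrightarrow> pi * (c1 - T * c0)"
    by (simp add: algebra_simps)
  moreover have "\<forall>\<^sub>F n in sequentially. R1 n - R2 n + (- P (-1) n + P 1 n - T * P T n + T * P (-T) n) =
     integral (rquad n) (\<lambda>z. Re (D z * cnj (?f z))) + integral {1 / (real n)\<^sup>2..real n} (\<lambda>y. \<phi> (Complex 0 y) * Re (?f (Complex 0 y)))"
    using eventually_ge_at_top[of 2] by eventually_elim (use id R3 in auto)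
  ultimately show ?thesis by (rule Lim_transform_eventually)
qed

lemma grad_reflect:
  assumes "grad u D (- cnj z)"
  shows "grad (\<lambda>z. u (- cnj z)) (- cnj D) z"
proof -
  have "((\<lambda>z. - cnj z) has_derivative (\<lambda>v. - cnj v)) (at z)"
    by (auto intro!: derivative_eq_intros has_derivative_cnj)
  from has_derivative_compose[OF this assms[unfolded grad_def]]
  have "((\<lambda>z. u (- cnj z)) has_derivative (\<lambda>v. Re (D * (- cnj v)))) (at z)" .
  moreover have "(\<lambda>v. Re (D * (- cnj v))) = (\<lambda>v. Re (- cnj D * v))" by auto
  ultimately show ?thesis by (simp only: grad_def)
qed

text \<open>Reflection in the imaginary axis conjugates the field and reverses the sign of the
  pairing, so the axis term and the limit enter with the opposite sign.\<close>

lemma quadrant_flux_left: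
  fixes \<phi> :: "complex \<Rightarrow> real"
  assumes T: "0 < T" "T < 1"
    and gr: "\<And>z. Im z > 0 \<Longrightarrow> grad \<phi> (D z) z" and cD: "continuous_on {z. Im z > 0} D"
    and bd: "\<And>z. Im z > 0 \<Longrightarrow> \<bar>\<phi> z\<bar> \<le> Bd"
    and \<rho>: "\<rho> > 0" "\<And>z. Im z > 0 \<Longrightarrow> z \<in> ball (-1) \<rho> \<Longrightarrow> \<phi> z = c1" "\<And>z. Im z > 0 \<Longrightarrow> z \<in> ball (- of_real T) \<rho> \<Longrightarrow> \<phi> z = c0"
  shows "(\<lambda>n. integral (lquad n) (\<lambda>z. Re (D z * cnj (model_field T z)))
     - integral {1 / (real n)\<^sup>2..real n} (\<lambda>y. \<phi> (Complex 0 y) * Re (model_field T (Complex 0 y)))) \<longlonglongrightarrow> - pi * (c1 - T * c0)"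
proof -
  let ?f = "model_field T"
  define \<phi>' where "\<phi>' z = \<phi> (- cnj z)" for z
  define D' where "D' z = - cnj (D (- cnj z))" for z
  have refl: "- cnj (Complex x y) = Complex (- x) y" for x y by (simp add: complex_eq_iff)
  have H: "(\<lambda>n. integral (rquad n) (\<lambda>z. Re (D' z * cnj (?f z)))
     + integral {1 / (real n)\<^sup>2..real n} (\<lambda>y. \<phi>' (Complex 0 y) * Re (?f (Complex 0 y)))) \<longlonglongrightarrow> pi * (c1 - T * c0)"
  proof (rule quadrant_flux[OF T _ _ _ \<rho>(1)])
    show "grad \<phi>' (D' z) z" if "Im z > 0" for z
      unfolding \<phi>'_def D'_def by (rule grad_reflect) (use gr that in auto)
    show "continuous_on {z. Im z > 0} D'" unfolding D'_def
      by (intro continuous_intros continuous_on_compose2[OF cD]) auto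
    show "\<bar>\<phi>' z\<bar> \<le> Bd" if "Im z > 0" for z using bd that by (simp add: \<phi>'_def)
    have dc: "cmod (p - - cnj z) = cmod (- cnj p - z)" for p z
      by (metis complex_cnj_cnj complex_cnj_diff complex_cnj_minus complex_mod_cnj minus_diff_eq minus_minus norm_minus_cancel diff_minus_eq_add add.commute uminus_add_conv_diff)
    show "\<phi>' z = c1" if "Im z > 0" "z \<in> ball 1 \<rho>" for z
      unfolding \<phi>'_def by (rule \<rho>(2)) (use that dc[of "-1" z] in \<open>auto simp: dist_norm\<close>)
    show "\<phi>' z = c0" if "Im z > 0" "z \<in> ball (of_real T) \<rho>" for z
      unfolding \<phi>'_def by (rule \<rho>(3)) (use that dc[of "- of_real T" z] in \<open>auto simp: dist_norm\<close>)
  qed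
  have eq: "integral (lquad n) (\<lambda>z. Re (D z * cnj (?f z))) = - integral (rquad n) (\<lambda>z. Re (D' z * cnj (?f z)))" if n: "n \<ge> 1" for n
  proof -
    have dn: "1 / (real n)\<^sup>2 > 0" using n by simp
    have cf: "continuous_on {z. Im z > 0} ?f" by (rule holomorphic_on_imp_continuous_on[OF model_field_holomorphic])
    have sub: "lquad n \<subseteq> {z. Im z > 0}" "rquad n \<subseteq> {z. Im z > 0}" by (auto simp: in_cbox_complex_iff intro: less_le_trans[OF dn])
    have "continuous_on {z. Im z > 0} D'" unfolding D'_def
      by (intro continuous_intros continuous_on_compose2[OF cD]) auto
    then have c2: "continuous_on (rquad n) (\<lambda>z. Re (D' z * cnj (?f z)))"
      by (intro continuous_intros continuous_on_subset[OF cf sub(2)]) (rule continuous_on_subset[OF _ sub(2)])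
    have c1: "continuous_on (lquad n) (\<lambda>z. Re (D z * cnj (?f z)))"
      by (intro continuous_intros continuous_on_subset[OF cf sub(1)] continuous_on_subset[OF cD sub(1)])
    have pt: "Re (D (Complex (- x) y) * cnj (?f (Complex (- x) y))) = - Re (D' (Complex x y) * cnj (?f (Complex x y)))" for x y
      using model_field_reflect[of T "Complex x y"] unfolding refl D'_def by simp
    have "integral (lquad n) (\<lambda>z. Re (D z * cnj (?f z))) = integral {1 / (real n)\<^sup>2..real n} (\<lambda>y. integral {- real n..0} (\<lambda>x. Re (D (Complex x y) * cnj (?f (Complex x y)))))"
      by (rule integral_complex_cbox_iterated2[OF c1])
    also have "\<dots> = integral {1 / (real n)\<^sup>2..real n} (\<lambda>y. integral {0..real n} (\<lambda>x. Re (D (Complex (- x) y) * cnj (?f (Complex (- x) y)))))"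
    proof (rule integral_cong)
      have refl: "integral {- real n..0} h = integral {0..real n} (\<lambda>x. h (- x))" for h :: "real \<Rightarrow> real"
        using Henstock_Kurzweil_Integration.integral_reflect_real[of 0 "- real n" h] by simp
      show "integral {- real n..0} (\<lambda>x. Re (D (Complex x y) * cnj (?f (Complex x y)))) = integral {0..real n} (\<lambda>x. Re (D (Complex (- x) y) * cnj (?f (Complex (- x) y))))" for y
        by (rule refl)
    qed
    also have "\<dots> = - integral {1 / (real n)\<^sup>2..real n} (\<lambda>y. integral {0..real n} (\<lambda>x. Re (D' (Complex x y) * cnj (?f (Complex x y)))))"
      by (simp only: pt Henstock_Kurzweil_Integration.integral_neg)
    also have "\<dots> = - integral (rquad n) (\<lambda>z. Re (D' z * cnj (?f z)))"
      by (simp only: integral_complex_cbox_iterated2[OF c2])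
    finally show ?thesis .
  qed
  have "(\<lambda>n. - (integral (rquad n) (\<lambda>z. Re (D' z * cnj (?f z)))
     + integral {1 / (real n)\<^sup>2..real n} (\<lambda>y. \<phi>' (Complex 0 y) * Re (?f (Complex 0 y))))) \<longlonglongrightarrow> - (pi * (c1 - T * c0))"
    by (intro tendsto_minus H)
  then have lim: "(\<lambda>n. - (integral (rquad n) (\<lambda>z. Re (D' z * cnj (?f z)))
     + integral {1 / (real n)\<^sup>2..real n} (\<lambda>y. \<phi>' (Complex 0 y) * Re (?f (Complex 0 y))))) \<longlonglongrightarrow> - pi * (c1 - T * c0)" by simp
  have \<phi>'0: "\<phi>' (Complex 0 y) = \<phi> (Complex 0 y)" for y by (simp add: \<phi>'_def refl)
  have "\<forall>\<^sub>F n in sequentially. - (integral (rquad n) (\<lambda>z. Re (D' z * cnj (?f z)))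
     + integral {1 / (real n)\<^sup>2..real n} (\<lambda>y. \<phi>' (Complex 0 y) * Re (?f (Complex 0 y)))) = 
     integral (lquad n) (\<lambda>z. Re (D z * cnj (?f z))) - integral {1 / (real n)\<^sup>2..real n} (\<lambda>y. \<phi> (Complex 0 y) * Re (?f (Complex 0 y)))"
    using eventually_ge_at_top[of 1] by eventually_elim (simp only: eq \<phi>'0 minus_add_distrib diff_conv_add_uminus)
  from Lim_transform_eventually[OF lim this] show ?thesis .
qed

section \<open>Test functions\<close>

lemma grad_add: "grad u A z \<Longrightarrow> grad v B z \<Longrightarrow> grad (\<lambda>w. u w + v w) (A + B) z"
  unfolding grad_def by (drule (1) has_derivative_add) (simp add: algebra_simps)

lemma grad_diff: "grad u A z \<Longrightarrow> grad v B z \<Longrightarrow> grad (\<lambda>w. u w - v w) (A - B) z"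
  unfolding grad_def by (drule (1) has_derivative_diff) (simp add: algebra_simps)

lemma grad_divide:
  assumes "grad u A z"
  shows "grad (\<lambda>w. u w / c) (A / of_real c) z"
proof -
  have "((\<lambda>w. u w * inverse c) has_derivative (\<lambda>v. Re (A * v) * inverse c)) (at z)"
    using assms unfolding grad_def by (rule has_derivative_mult_left)
  moreover have "Re (A * v) * inverse c = Re (A / of_real c * v)" for v
    by (simp add: divide_inverse Re_divide_of_real flip: of_real_inverse) (simp add: algebra_simps)
  ultimately show ?thesis by (simp add: grad_def divide_inverse)
qed

lemma grad_sum: "finite S \<Longrightarrow> (\<And>s. s \<in> S \<Longrightarrow> grad (u s) (A s) z) \<Longrightarrow> grad (\<lambda>w. \<Sum>s\<in>S. u s w) (\<Sum>s\<in>S. A s) z"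
  by (induction S rule: finite_induct) (auto intro: grad_add grad_const)

text \<open>The truncated approximate Green function \<open>\<phi>\<close>, of Dirichlet energy \<open>2 \<pi> \<Psi>\<close>. The density \<open>e\<close> is its energy, \<open>q\<close> a cutoff supported where the gradient lives; the last conjunct is the AM-GM inequality that pairs the gradient with a field \<open>\<xi>\<close>.\<close>
lemma green_approx_test_function:
  assumes G: "green_approx U a v" and \<tau>: "\<tau> > 0"
  shows "\<exists>\<epsilon>0>0. \<forall>\<epsilon>. 0 < \<epsilon> \<and> \<epsilon> < \<epsilon>0 \<longrightarrow> (\<exists>\<phi> D e q \<Psi>. v + ln (1 / \<epsilon>) - \<tau> \<le> \<Psi> \<and> 0 \<le> \<Psi> \<and>
     (\<forall>z. grad \<phi> (D z) z) \<and> continuous_on UNIV D \<and> (\<forall>z. 0 \<le> \<phi> z \<and> \<phi> z \<le> \<Psi>) \<and> (\<forall>z. z \<notin> U \<longrightarrow> \<phi> z = 0) \<and>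
     (\<exists>\<rho>>0. \<forall>z\<in>ball a \<rho>. \<phi> z = \<Psi>) \<and> e absolutely_integrable_on UNIV \<and> integral UNIV e = 2 * pi * \<Psi> \<and>
     (\<forall>z. 0 \<le> e z) \<and> continuous_on UNIV e \<and> continuous_on UNIV q \<and> (\<forall>z. 0 \<le> q z \<and> q z \<le> 1) \<and>
     (\<forall>z. q z \<noteq> 0 \<longrightarrow> z \<in> U \<and> \<epsilon> < cmod (z - a)) \<and>
     (\<forall>z \<alpha> \<xi>. 2 * \<alpha> * Re (D z * cnj \<xi>) \<le> \<alpha>\<^sup>2 * e z + q z * (cmod \<xi>)\<^sup>2))"
proof -
  obtain \<Omega> S where O: "open \<Omega>" "bounded \<Omega>" "a \<in> \<Omega>" "closure \<Omega> \<subseteq> U" and S: "finite S" "S \<noteq> {}" "S \<inter> \<Omega> = {}"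
    and fr: "\<And>w. w \<in> frontier \<Omega> \<Longrightarrow> exp (card S * v) * (\<Prod>s\<in>S. cmod (w - s) / cmod (s - a)) < cmod (w - a) ^ card S"
    using G unfolding green_approx_def by blast
  define N where "N = card S"
  have N: "N > 0" using S by (simp add: N_def card_gt_0_iff)
  have Sa: "s \<noteq> a" if "s \<in> S" for s using that S O by auto
  define E where "E w = (\<Sum>s\<in>S. ln (cmod (w - s)) - ln (cmod (s - a))) / real N" for w
  define h where "h w = v - ln (cmod (w - a)) + E w" for w
  define H where "H w = 0 - 1 / (w - a) + (\<Sum>s\<in>S. 1 / (w - s) - 0) / of_real (real N)" for w
  have gradh: "grad h (H w) w" if "w \<in> \<Omega> - {a}" for w
  proof -
    have "w \<noteq> s" if "s \<in> S" for s using that \<open>w \<in> \<Omega> - {a}\<close> S by auto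
    then show ?thesis unfolding h_def H_def E_def using that
      by (intro grad_add grad_diff grad_divide grad_sum grad_const grad_ln_cmod S) auto
  qed
  have opa: "open (\<Omega> - {a})" using O by auto
  have contH: "continuous_on (\<Omega> - {a}) H" unfolding H_def using S N by (intro continuous_intros) auto
  have conth: "continuous_on (\<Omega> - {a}) h"
    using gradh has_derivative_continuous by (force simp: grad_def continuous_on_eq_continuous_at[OF opa])
  define W where "W = {w. exp (N * v) * (\<Prod>s\<in>S. cmod (w - s) / cmod (s - a)) < cmod (w - a) ^ N}"
  have opW: "open W" unfolding W_def using Sa by (intro open_Collect_less continuous_intros) auto
  have frW: "frontier \<Omega> \<subseteq> W" using fr by (auto simp: W_def N_def)
  have aW: "a \<notin> W" using N by (simp add: W_def prod_nonneg not_less power_0_left)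
  have hneg: "h w < 0" if w: "w \<in> W" "w \<in> \<Omega>" for w
  proof -
    have wa: "w \<noteq> a" using w aW by auto
    have ws: "w \<noteq> s" if "s \<in> S" for s using that w S by auto
    have pos: "(\<Prod>s\<in>S. cmod (w - s) / cmod (s - a)) > 0" using ws Sa by (intro prod_pos) auto
    have "ln (exp (N * v) * (\<Prod>s\<in>S. cmod (w - s) / cmod (s - a))) < ln (cmod (w - a) ^ N)"
      using w(1) pos wa by (subst ln_less_cancel_iff) (auto simp: W_def)
    then have "N * v + ln (\<Prod>s\<in>S. cmod (w - s) / cmod (s - a)) < N * ln (cmod (w - a))"
      using pos wa by (simp add: ln_mult ln_realpow)
    moreover have "ln (\<Prod>s\<in>S. cmod (w - s) / cmod (s - a)) = N * E w"
    proof -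
      have "ln (\<Prod>s\<in>S. cmod (w - s) / cmod (s - a)) = (\<Sum>s\<in>S. ln (cmod (w - s) / cmod (s - a)))"
        by (rule ln_prod) (use S(1) ws Sa in auto)
      also have "\<dots> = (\<Sum>s\<in>S. ln (cmod (w - s)) - ln (cmod (s - a)))"
        by (rule sum.cong) (use ws Sa in \<open>auto simp: ln_div\<close>)
      finally show ?thesis using N by (simp add: E_def)
    qed
    ultimately have "N * h w < 0" by (simp add: h_def algebra_simps)
    then show ?thesis using N by (simp add: mult_less_0_iff)
  qed
  have contE: "isCont E a" unfolding E_def using Sa N by (intro continuous_intros) auto
  have Ea: "E a = 0" unfolding E_def by (simp add: norm_minus_commute)
  obtain \<epsilon>1 where \<epsilon>1: "\<epsilon>1 > 0" "\<And>w. dist w a < \<epsilon>1 \<Longrightarrow> dist (E w) (E a) < \<tau> / 2"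
    using contE \<tau> unfolding continuous_at_eps_delta dist_norm by (metis half_gt_zero)
  obtain \<epsilon>2 where \<epsilon>2: "\<epsilon>2 > 0" "ball a \<epsilon>2 \<subseteq> \<Omega>" using O open_contains_ball by blast
  \<comment> \<open>The last entry makes \<open>M > \<tau>\<close>, so that the truncation levels
    \<open>\<tau> / 4\<close> and \<open>M - \<tau> / 4\<close> are in order; the first keeps
    \<open>E\<close> within \<open>\<tau> / 2\<close> of 0 on the disc.\<close>
  define \<epsilon>0 where "\<epsilon>0 = min (min \<epsilon>1 \<epsilon>2) (exp (v - 2 * \<tau>))"
  show ?thesis
  proof (rule exI[of _ \<epsilon>0], intro conjI allI impI)
    show "\<epsilon>0 > 0" using \<epsilon>1 \<epsilon>2 by (simp add: \<epsilon>0_def)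
    fix \<epsilon> :: real assume "0 < \<epsilon> \<and> \<epsilon> < \<epsilon>0"
    then have \<epsilon>: "0 < \<epsilon>" "\<epsilon> < \<epsilon>1" "\<epsilon> < \<epsilon>2" "\<epsilon> < exp (v - 2 * \<tau>)" by (auto simp: \<epsilon>0_def)
    define M where "M = v + ln (1 / \<epsilon>) - \<tau> / 2"
    have "ln \<epsilon> < v - 2 * \<tau>" using \<epsilon> by (metis exp_less_cancel_iff exp_ln)
    then have M: "M > \<tau>" using \<tau> \<epsilon> by (simp add: M_def ln_div)
    \<comment> \<open>With margin \<open>\<tau> / 4\<close> the slope vanishes up to level 0 and
      from level \<open>M\<close> on. So \<open>K (h w)\<close> is locally constant near the
      frontier of \<open>\<Omega>\<close>, where \<open>h\<close> is negative, and around
      \<open>a\<close>, where \<open>h\<close> exceeds \<open>M\<close>.\<close>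
    have t: "\<tau> / 4 < M - \<tau> / 4" "\<tau> / 4 > 0" using \<tau> M by linarith+
    obtain k K where k: "continuous_on UNIV k" "\<And>x. 0 \<le> k x" "\<And>x. k x \<le> 1"
      "\<And>x. \<tau> / 4 \<le> x \<Longrightarrow> x \<le> M - \<tau> / 4 \<Longrightarrow> k x = 1"
      "\<And>x. x \<le> \<tau> / 4 - \<tau> / 4 \<Longrightarrow> k x = 0" "\<And>x. x \<ge> (M - \<tau> / 4) + \<tau> / 4 \<Longrightarrow> k x = 0"
      and K: "\<And>x. (K has_real_derivative k x) (at x)" "K 0 = 0"
      "\<And>x. x \<le> \<tau> / 4 - \<tau> / 4 \<Longrightarrow> K x = K (\<tau> / 4 - \<tau> / 4)" "\<And>x. x \<ge> (M - \<tau> / 4) + \<tau> / 4 \<Longrightarrow> K x = K ((M - \<tau> / 4) + \<tau> / 4)"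
      "\<And>x y. x \<le> y \<Longrightarrow> K x \<le> K y" "\<And>x y. x \<le> y \<Longrightarrow> K y - K x \<le> y - x"
      "K (M - \<tau> / 4) - K (\<tau> / 4) = (M - \<tau> / 4) - \<tau> / 4"
      by (fact trapezoid_antiderivative[OF t])
    have k0: "k x = 0" if "x \<le> 0" for x using k(5)[of x] that by simp
    have kM: "k x = 0" if "x \<ge> M" for x using k(6)[of x] that by simp
    have K0: "K x = 0" if "x \<le> 0" for x using K(2) K(3)[of x] that by simp
    have KM: "K x = K M" if "x \<ge> M" for x using K(4)[of x] that by simp
    define \<Psi> where "\<Psi> = K M"
    define \<phi> where "\<phi> w = (if w \<in> \<Omega> - {a} then K (h w) else if w = a then \<Psi> else 0)" for w
    define q where "q w = (if w \<in> \<Omega> - {a} then k (h w) else 0)" for w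
    define D where "D w = of_real (q w) * H w" for w
    define e where "e w = q w * (cmod (H w))\<^sup>2" for w
    have hM: "h w > M" if "w \<noteq> a" "cmod (w - a) \<le> \<epsilon>" for w
    proof -
      have "dist w a < \<epsilon>1" using that \<epsilon> by (simp add: dist_norm)
      then have "E w > - \<tau> / 2" using \<epsilon>1(2)[of w] Ea by (simp add: dist_real_def)
      moreover have "ln (cmod (w - a)) \<le> ln \<epsilon>" using that \<epsilon> by (subst ln_le_cancel_iff) auto
      ultimately show ?thesis using \<epsilon>(1) by (simp add: h_def M_def ln_div)
    qed
    have near: "\<phi> w = \<Psi>" "q w = 0" if "cmod (w - a) \<le> \<epsilon>" for w
    proof -
      have "w \<in> \<Omega>" using that \<epsilon> \<epsilon>2(2) by (auto simp: subset_iff dist_norm norm_minus_commute)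
      moreover have "K (h w) = K M" "k (h w) = 0" if "w \<noteq> a"
        using KM[of "h w"] kM[of "h w"] hM[OF that \<open>cmod (w - a) \<le> \<epsilon>\<close>] by simp_all
      ultimately show "\<phi> w = \<Psi>" "q w = 0" by (simp_all add: \<phi>_def q_def \<Psi>_def)
    qed
    \<comment> \<open>An open set that contains everything outside \<open>\<Omega>\<close>, the
      frontier included, and on whose part inside \<open>\<Omega>\<close> the function
      \<open>h\<close> is negative. Hence \<open>\<phi>\<close> vanishes on it and stays
      differentiable across the frontier.\<close>
    define Z where "Z = W \<union> - closure \<Omega>"
    have Z0: "\<phi> w = 0" "q w = 0" if "w \<in> Z" for w
    proof -
      have "w \<noteq> a" using that aW O(3) closure_subset by (auto simp: Z_def)
      moreover have "K (h w) = 0" "k (h w) = 0" if "w \<in> \<Omega>"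
      proof -
        have "w \<in> W" using \<open>w \<in> Z\<close> that closure_subset by (auto simp: Z_def)
        then have "h w \<le> 0" using hneg[OF _ that] by (simp add: less_imp_le)
        then show "K (h w) = 0" "k (h w) = 0" using K0 k0 by blast+
      qed
      ultimately show "\<phi> w = 0" "q w = 0" by (simp_all add: \<phi>_def q_def)
    qed
    have opZ: "open Z" using opW by (auto simp: Z_def)
    have cover: "w \<in> \<Omega> - {a} \<or> w \<in> ball a \<epsilon> \<or> w \<in> Z" for w
      using \<epsilon>(1) frW O(1) by (auto simp: Z_def frontier_def interior_open)
    have out: "w \<in> Z" if "w \<notin> \<Omega>" for w using frW O(1) that by (auto simp: Z_def frontier_def interior_open)
    have gr: "grad \<phi> (D w) w" for w
      using cover[of w]
    proof (elim disjE)
      assume w: "w \<in> \<Omega> - {a}"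
      have "grad (\<lambda>w. K (h w)) (of_real (k (h w)) * H w) w" by (rule grad_compose_real[OF gradh[OF w] K(1)])
      moreover have "D w = of_real (k (h w)) * H w" using w by (simp add: D_def q_def)
      ultimately have "grad (\<lambda>w. K (h w)) (D w) w" by simp
      then show ?thesis by (rule grad_cong_open[OF _ opa w]) (simp add: \<phi>_def)
    next
      assume w: "w \<in> ball a \<epsilon>"
      have "D w = 0" using near(2)[of w] w by (simp add: D_def dist_norm norm_minus_commute)
      moreover have "grad \<phi> 0 w"
        by (rule grad_cong_open[OF grad_const open_ball w]) (simp add: near(1) dist_norm norm_minus_commute)
      ultimately show ?thesis by simp
    next
      assume w: "w \<in> Z"
      have "D w = 0" using Z0(2)[OF w] by (simp add: D_def)
      moreover have "grad \<phi> 0 w"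
        by (rule grad_cong_open[OF grad_const opZ w]) (simp add: Z0(1))
      ultimately show ?thesis by simp
    qed
    have Un: "UNIV = (\<Omega> - {a}) \<union> (ball a \<epsilon> \<union> Z)" using cover by blast
    have contq: "continuous_on (\<Omega> - {a}) q"
      by (rule continuous_on_eq[OF continuous_on_compose2[OF k(1) conth]]) (auto simp: q_def)
    have D0: "D w = 0" "e w = 0" "q w = 0" if "w \<in> ball a \<epsilon> \<union> Z" for w
      using that near(2)[of w] Z0(2)[of w] by (auto simp: D_def e_def dist_norm norm_minus_commute)
    have glob: "continuous_on UNIV F" if "continuous_on (\<Omega> - {a}) F" "\<And>w. w \<in> ball a \<epsilon> \<union> Z \<Longrightarrow> F w = 0" for F :: "complex \<Rightarrow> 'b::real_normed_vector"
    proof -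
      have "continuous_on (ball a \<epsilon> \<union> Z) F" by (rule continuous_on_eq[of _ "\<lambda>_. 0"]) (use that(2) in auto)
      then show ?thesis unfolding Un by (rule continuous_on_open_Un[OF opa open_Un[OF open_ball opZ] that(1)])
    qed
    have contD: "continuous_on UNIV D" by (rule glob) (use D0 contq contH in \<open>auto simp: D_def intro!: continuous_intros\<close>)
    have conte: "continuous_on UNIV e" by (rule glob) (use D0 contq contH in \<open>auto simp: e_def intro!: continuous_intros\<close>)
    have contq': "continuous_on UNIV q" by (rule glob) (use D0 contq in auto)
    obtain R where R: "\<And>w. w \<in> \<Omega> \<Longrightarrow> cmod w < R"
      using O(2) unfolding bounded_pos_less by blast
    have R0: "\<phi> z = 0" if "R \<le> cmod z" for z using R[of z] that out Z0 by force
    \<comment> \<open>The zeros in \<open>S\<close> lie in \<open>Z\<close>, where the test function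
      is 0, so of all the kernels in \<open>H\<close> only the one at \<open>a\<close> contributes
      to the energy.\<close>
    have intp: "(\<lambda>z. Re (D z * cnj (1 / (z - p)))) absolutely_integrable_on UNIV"
      "integral UNIV (\<lambda>z. Re (D z * cnj (1 / (z - p)))) = - 2 * pi * (if p = a then \<Psi> else 0)" if "p \<in> insert a S" for p
    proof -
      obtain \<rho> where \<rho>: "\<rho> > 0" "\<And>z. z \<in> ball p \<rho> \<Longrightarrow> \<phi> z = \<phi> p" "\<phi> p = (if p = a then \<Psi> else 0)"
      proof (cases "p = a")
        case True
        show ?thesis by (rule that[of \<epsilon>]) (use near(1) \<epsilon>(1) True in \<open>auto simp: dist_norm norm_minus_commute\<close>)
      next
        case False
        then have "p \<in> Z" using out \<open>p \<in> insert a S\<close> S by auto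
        then obtain \<rho> where "\<rho> > 0" "ball p \<rho> \<subseteq> Z" using opZ open_contains_ball by blast
        then show ?thesis using Z0(1) \<open>p \<in> Z\<close> False by (intro that[of \<rho>]) auto
      qed
      show "(\<lambda>z. Re (D z * cnj (1 / (z - p)))) absolutely_integrable_on UNIV"
        by (rule integral_log_kernel(1)[OF gr contD R0 \<rho>(1,2)])
      show "integral UNIV (\<lambda>z. Re (D z * cnj (1 / (z - p)))) = - 2 * pi * (if p = a then \<Psi> else 0)"
        using integral_log_kernel(2)[OF gr contD R0 \<rho>(1,2)] \<rho>(3) by simp
    qed
    have hi: "((\<lambda>z. Re (D z * cnj (1 / (z - p)))) has_integral - 2 * pi * (if p = a then \<Psi> else 0)) UNIV" if "p \<in> insert a S" for p
      using intp[OF that] unfolding absolutely_integrable_on_def by (auto simp: has_integral_iff)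
    have eH: "e z = Re (D z * cnj (H z))" for z
    proof -
      have "H z * cnj (H z) = of_real ((cmod (H z))\<^sup>2)" by (rule complex_norm_square[symmetric])
      then have "D z * cnj (H z) = of_real (q z * (cmod (H z))\<^sup>2)" by (simp add: D_def mult.assoc)
      then show ?thesis by (simp add: e_def)
    qed
    have eq: "e z = - Re (D z * cnj (1 / (z - a))) + (\<Sum>s\<in>S. Re (D z * cnj (1 / (z - s)))) / real N" for z
    proof -
      have "D z * cnj (H z) = - (D z * cnj (1 / (z - a))) + (\<Sum>s\<in>S. D z * cnj (1 / (z - s))) / of_real (real N)"
        unfolding H_def by (simp add: algebra_simps sum_distrib_left sum_divide_distrib)
      then show ?thesis unfolding eH by (simp add: Re_divide_of_real)
    qed
    have "((\<lambda>z. - Re (D z * cnj (1 / (z - a))) + (\<Sum>s\<in>S. Re (D z * cnj (1 / (z - s)))) / real N) has_integral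
       (- (- 2 * pi * (if a = a then \<Psi> else 0)) + (\<Sum>s\<in>S. - 2 * pi * (if s = a then \<Psi> else 0)) / real N)) UNIV"
      by (intro has_integral_add has_integral_neg has_integral_divide has_integral_sum S hi) auto
    moreover have "(\<Sum>s\<in>S. - 2 * pi * (if s = a then \<Psi> else 0)) = 0" using Sa by (intro sum.neutral) auto
    ultimately have ie: "(e has_integral 2 * pi * \<Psi>) UNIV" unfolding eq[symmetric] by simp
    have q01: "0 \<le> q w" "q w \<le> 1" for w using k(2,3) by (auto simp: q_def)
    have e0: "0 \<le> e w" for w using q01 by (simp add: e_def)
    have Psi0: "0 \<le> \<Psi>" using K(5)[of 0 M] K(2) M \<tau> by (simp add: \<Psi>_def)
    have "M - \<tau> / 2 \<le> K (M - \<tau> / 4)" using K(5)[of 0 "\<tau>/4"] K(2) K(7) \<tau> by simp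
    also have "\<dots> \<le> \<Psi>" using K(5) \<tau> by (simp add: \<Psi>_def)
    finally have Psi: "v + ln (1 / \<epsilon>) - \<tau> \<le> \<Psi>" by (simp add: M_def)
    show "\<exists>\<phi> D e q \<Psi>. v + ln (1 / \<epsilon>) - \<tau> \<le> \<Psi> \<and> 0 \<le> \<Psi> \<and>
     (\<forall>z. grad \<phi> (D z) z) \<and> continuous_on UNIV D \<and> (\<forall>z. 0 \<le> \<phi> z \<and> \<phi> z \<le> \<Psi>) \<and> (\<forall>z. z \<notin> U \<longrightarrow> \<phi> z = 0) \<and>
     (\<exists>\<rho>>0. \<forall>z\<in>ball a \<rho>. \<phi> z = \<Psi>) \<and> e absolutely_integrable_on UNIV \<and> integral UNIV e = 2 * pi * \<Psi> \<and>
     (\<forall>z. 0 \<le> e z) \<and> continuous_on UNIV e \<and> continuous_on UNIV q \<and> (\<forall>z. 0 \<le> q z \<and> q z \<le> 1) \<and>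
     (\<forall>z. q z \<noteq> 0 \<longrightarrow> z \<in> U \<and> \<epsilon> < cmod (z - a)) \<and>
     (\<forall>z \<alpha> \<xi>. 2 * \<alpha> * Re (D z * cnj \<xi>) \<le> \<alpha>\<^sup>2 * e z + q z * (cmod \<xi>)\<^sup>2)"
    proof (rule exI[of _ \<phi>], rule exI[of _ D], rule exI[of _ e], rule exI[of _ q], rule exI[of _ \<Psi>], intro conjI allI)
      show "0 \<le> \<phi> z" for z using K(5)[of 0 "h z"] K0[of "h z"] K(2) Psi0 by (cases "h z \<le> 0") (auto simp: \<phi>_def)
      show "\<phi> z \<le> \<Psi>" for z using K(5)[of "h z" M] KM[of "h z"] Psi0 by (cases "h z \<le> M") (auto simp: \<phi>_def \<Psi>_def)
      show "z \<notin> U \<longrightarrow> \<phi> z = 0" for z using O(4) closure_subset[of \<Omega>] out[of z] Z0 by auto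
      show "\<exists>\<rho>>0. \<forall>z\<in>ball a \<rho>. \<phi> z = \<Psi>" using near(1) \<epsilon>(1) by (intro exI[of _ \<epsilon>]) (auto simp: dist_norm norm_minus_commute)
      show "e absolutely_integrable_on UNIV" using ie e0 unfolding absolutely_integrable_on_def by (auto simp: integrable_on_def)
      show "integral UNIV e = 2 * pi * \<Psi>" using ie by (rule integral_unique)
      show "q z \<noteq> 0 \<longrightarrow> z \<in> U \<and> \<epsilon> < cmod (z - a)" for z
      proof
        assume "q z \<noteq> 0"
        then have "z \<in> \<Omega>" "\<not> cmod (z - a) \<le> \<epsilon>" using near(2)[of z] by (auto simp: q_def split: if_splits)
        then show "z \<in> U \<and> \<epsilon> < cmod (z - a)" using O(4) closure_subset by auto
      qed
      show "2 * \<alpha> * Re (D z * cnj \<xi>) \<le> \<alpha>\<^sup>2 * e z + q z * (cmod \<xi>)\<^sup>2" for z \<alpha> \<xi>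
      proof -
        \<comment> \<open>Multiplying this square by \<open>q\<close> charges the field only where
          the slope of the truncation is nonzero; for disjoint domains these sets are
          disjoint.\<close>
        have "0 \<le> (cmod (of_real \<alpha> * H z - \<xi>))\<^sup>2" by simp
        also have "\<dots> = \<alpha>\<^sup>2 * (cmod (H z))\<^sup>2 + (cmod \<xi>)\<^sup>2 - 2 * \<alpha> * Re (H z * cnj \<xi>)"
          unfolding cmod_power2 by (simp add: power2_eq_square algebra_simps)
        finally have "q z * (2 * \<alpha> * Re (H z * cnj \<xi>)) \<le> q z * (\<alpha>\<^sup>2 * (cmod (H z))\<^sup>2 + (cmod \<xi>)\<^sup>2)"
          using q01 by (intro mult_left_mono) auto
        moreover have "Re (D z * cnj \<xi>) = q z * Re (H z * cnj \<xi>)" by (simp add: D_def mult.assoc algebra_simps)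
        ultimately show ?thesis by (simp add: e_def algebra_simps)
      qed
    qed (use Psi Psi0 gr contD e0 conte contq' q01 in auto)
  qed
qed

section \<open>The map onto a sector\<close>

text \<open>In use, \<open>T\<close> is half of \<open>sqrt \<gamma> * \<alpha>\<close>, and
  \<open>A + B\<close>, \<open>A - B\<close> are the powers with exponent
  \<open>- 1 / \<alpha>\<close> of the moduli of the two points on the sides. The segment from
  \<open>- T\<close> to \<open>T\<close> is folded onto the two sides of a slit issuing from the
  origin, so the image is the sector minus a slit.\<close>

locale sector_param =
  fixes T A B \<alpha> \<theta> :: real
  assumes T: "0 < T" "T < 1" and AB: "A + B > 0" "A - B > 0" and \<alpha>: "0 < \<alpha>" "\<alpha> \<le> 2"
begin

lemma A_pos: "A > 0" using AB by linarith
lemma T2: "1 - T\<^sup>2 > 0" using T by (simp add: power_less_one_iff abs_square_less_1)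

text \<open>\<open>sector_map\<close> takes the upper half plane to the sector of opening \<open>\<alpha> \<pi>\<close>, sending \<open>\<plusminus> 1\<close> to the points of the configuration on its two sides and \<open>\<plusminus> T\<close> to the origin; the Moebius map \<open>slit_map\<close> adjusts the two radii.\<close>
definition root_map :: "complex \<Rightarrow> complex" where
  "root_map z = csqrt ((of_real (T\<^sup>2) - z\<^sup>2) / of_real (1 - T\<^sup>2))"

definition slit_map :: "complex \<Rightarrow> complex" where
  "slit_map p = p / (of_real A + \<i> * of_real B * p)"

definition power_map :: "complex \<Rightarrow> complex" where
  "power_map p = exp (\<i> * of_real (\<theta> + \<alpha> * pi / 2) + of_real \<alpha> * Ln (slit_map p))"

definition sector_map :: "complex \<Rightarrow> complex" where
  "sector_map z = power_map (root_map z)"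

definition potential :: "complex \<Rightarrow> real" where
  "potential z = ln (cmod (z - (-1))) - ln (cmod (z - 1)) + T * (ln (cmod (z - of_real T)) - ln (cmod (z - of_real (-T))))"

definition endpoint :: "real \<Rightarrow> complex" where
  "endpoint s = of_real ((1 / (A + s * B)) powr \<alpha>) * cis (\<theta> + \<alpha> * pi / 2 * (1 - s))"

text \<open>The constant terms in the expansions of \<open>potential\<close> against the logarithmic distance of \<open>sector_map\<close> to an endpoint and to the origin.\<close>
definition end_const :: "real \<Rightarrow> real" where
  "end_const s = ln 2 + T * (ln (1 - T) - ln (1 + T)) + ln ((1 / (A + s * B)) powr \<alpha> * \<alpha> * A / (A + s * B)) - ln (1 - T\<^sup>2)"

definition zero_const :: real where
  "zero_const = ln (1 + T) - ln (1 - T) - 2 * T * ln (2 * T) + T * ln (1 - T\<^sup>2) + 2 * T * ln A"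

section \<open>Holomorphy, image and injectivity of the sector map\<close>

lemma root_map_arg_not_nonpos:
  assumes "Im z > 0"
  shows "(of_real (T\<^sup>2) - z\<^sup>2) / of_real (1 - T\<^sup>2) \<notin> \<real>\<^sub>\<le>\<^sub>0"
proof
  assume n: "(of_real (T\<^sup>2) - z\<^sup>2) / of_real (1 - T\<^sup>2) \<in> \<real>\<^sub>\<le>\<^sub>0"
  then have "(T\<^sup>2 - Re (z\<^sup>2)) / (1 - T\<^sup>2) \<le> 0" "Im (z\<^sup>2) = 0"
    using T2 by (auto simp: complex_nonpos_Reals_iff Re_divide_of_real Im_divide_of_real simp del: of_real_diff of_real_power)
  then have "T\<^sup>2 \<le> Re (z\<^sup>2)" "Re z = 0" using T2 assms
    by (auto simp: divide_le_0_iff power2_eq_square)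
  then have "T\<^sup>2 \<le> - (Im z)\<^sup>2" by (simp add: power2_eq_square)
  moreover have "T\<^sup>2 > 0" "(Im z)\<^sup>2 > 0" using T assms by auto
  ultimately show False by linarith
qed

lemma root_map_square: "(root_map z)\<^sup>2 = (of_real (T\<^sup>2) - z\<^sup>2) / of_real (1 - T\<^sup>2)"
  by (simp add: root_map_def)

lemma root_map_holomorphic: "root_map holomorphic_on {z. Im z > 0}"
  unfolding root_map_def using root_map_arg_not_nonpos T2
  by (intro holomorphic_intros) auto

lemma Re_root_map:
  assumes "Im z > 0"
  shows "Re (root_map z) > 0"
proof (rule ccontr)
  assume "\<not> Re (root_map z) > 0"
  then have "Re (root_map z) = 0" using csqrt_principal unfolding root_map_def by blast
  then have "(root_map z)\<^sup>2 = of_real (- (Im (root_map z))\<^sup>2)"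
    by (simp add: complex_eq_iff power2_eq_square)
  moreover have "(of_real (- (Im (root_map z))\<^sup>2) :: complex) \<in> \<real>\<^sub>\<le>\<^sub>0" by (subst nonpos_Reals_of_real_iff) simp
  ultimately have "(root_map z)\<^sup>2 \<in> \<real>\<^sub>\<le>\<^sub>0" by (simp only:)
  then show False using root_map_arg_not_nonpos[OF assms] unfolding root_map_square by blast
qed

lemma denom_nonzero: "Re p > 0 \<Longrightarrow> of_real A + \<i> * of_real B * p \<noteq> 0"
proof
  assume p: "Re p > 0" and z: "of_real A + \<i> * of_real B * p = 0"
  then have "A - B * Im p = 0" "B * Re p = 0" by (auto simp: complex_eq_iff)
  then show False using p A_pos by auto
qed

text \<open>In this form the right half plane is visibly preserved: inversions, scaling by
  \<open>A > 0\<close>, and a shift along the imaginary axis.\<close>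

lemma inverse_slit_map: "Re p > 0 \<Longrightarrow> inverse (slit_map p) = of_real A / p + \<i> * of_real B"
  by (auto simp: slit_map_def add_divide_distrib)

lemma Re_slit_map:
  assumes "Re p > 0"
  shows "Re (slit_map p) > 0"
proof -
  have "Re (inverse (slit_map p)) = A * Re p / (cmod p)\<^sup>2"
    unfolding inverse_slit_map[OF assms] by (simp add: Re_divide cmod_power2)
  moreover have "A * Re p / (cmod p)\<^sup>2 > 0" using A_pos assms by (intro divide_pos_pos mult_pos_pos) auto
  ultimately have "Re (inverse (slit_map p)) > 0" by simp
  then have "Re (slit_map p) / (cmod (slit_map p))\<^sup>2 > 0" by (simp add: inverse_complex.simps(1) cmod_power2)
  then show ?thesis by (simp add: zero_less_divide_iff)
qed

lemma slit_map_not_nonpos: "Re p > 0 \<Longrightarrow> slit_map p \<notin> \<real>\<^sub>\<le>\<^sub>0"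
  using Re_slit_map by (force simp: complex_nonpos_Reals_iff)

lemma power_map_holomorphic: "power_map holomorphic_on {p. Re p > 0}"
  unfolding power_map_def
proof (intro holomorphic_intros)
  show "slit_map holomorphic_on {p. Re p > 0}" unfolding slit_map_def
    using denom_nonzero by (intro holomorphic_intros) auto
qed (use slit_map_not_nonpos in auto)

lemma sector_map_holomorphic: "sector_map holomorphic_on {z. Im z > 0}"
proof -
  have "(power_map \<circ> root_map) holomorphic_on {z. Im z > 0}"
    by (rule holomorphic_on_compose_gen[OF root_map_holomorphic power_map_holomorphic]) (use Re_root_map in auto)
  then show ?thesis by (simp add: sector_map_def[abs_def] o_def)
qed

lemma sector_map_polar:
  assumes "Im z > 0"
  obtains t where "0 < t" "t < pi" "sector_map z = of_real (cmod (slit_map (root_map z)) powr \<alpha>) * cis (\<theta> + \<alpha> * t)"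
proof -
  define \<zeta> where "\<zeta> = slit_map (root_map z)"
  have \<zeta>: "Re \<zeta> > 0" unfolding \<zeta>_def by (intro Re_slit_map Re_root_map assms)
  then have nz: "\<zeta> \<noteq> 0" by auto
  have "\<bar>Im (Ln \<zeta>)\<bar> < pi / 2" using \<zeta> Re_Ln_pos_lt nz by blast
  moreover have "sector_map z = of_real (cmod \<zeta> powr \<alpha>) * cis (\<theta> + \<alpha> * (pi / 2 + Im (Ln \<zeta>)))"
  proof -
    have "\<i> * of_real (\<theta> + \<alpha> * pi / 2) + of_real \<alpha> * Ln \<zeta> = Complex (\<alpha> * ln (cmod \<zeta>)) (\<theta> + \<alpha> * (pi / 2 + Im (Ln \<zeta>)))"
      using nz by (simp add: complex_eq_iff algebra_simps)
    then have "sector_map z = exp (Complex (\<alpha> * ln (cmod \<zeta>)) (\<theta> + \<alpha> * (pi / 2 + Im (Ln \<zeta>))))"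
      by (simp only: sector_map_def power_map_def \<zeta>_def)
    then show ?thesis using nz by (simp add: exp_eq_polar powr_def)
  qed
  ultimately show ?thesis using that[of "pi / 2 + Im (Ln \<zeta>)"] unfolding \<zeta>_def by (simp add: abs_less_iff)
qed

lemma cmod_sector_map: "Im z > 0 \<Longrightarrow> cmod (sector_map z) = cmod (slit_map (root_map z)) powr \<alpha>"
  using sector_map_polar[of z] by (metis norm_mult norm_cis mult.right_neutral norm_of_real abs_of_nonneg powr_ge_zero)

text \<open>As \<open>\<alpha> \<le> 2\<close>, the imaginary parts of two exponents differ by less
  than \<open>2 * pi\<close>, so \<open>exp\<close> can be inverted. The square in
  \<open>root_map\<close> leaves \<open>z = w\<close> or \<open>z = - w\<close>, and the upper half
  plane decides.\<close>

lemma sector_map_inj: "inj_on sector_map {z. Im z > 0}"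
proof (rule inj_onI)
  fix z w assume zw: "z \<in> {z. Im z > 0}" "w \<in> {z. Im z > 0}" "sector_map z = sector_map w"
  define \<zeta> where "\<zeta> = slit_map (root_map z)"
  define \<omega> where "\<omega> = slit_map (root_map w)"
  have pos: "Re \<zeta> > 0" "Re \<omega> > 0" "Re (root_map z) > 0" "Re (root_map w) > 0"
    unfolding \<zeta>_def \<omega>_def using zw by (auto intro!: Re_slit_map Re_root_map)
  have nz: "\<zeta> \<noteq> 0" "\<omega> \<noteq> 0" using pos by auto
  have b: "\<bar>Im (Ln \<zeta>)\<bar> < pi / 2" "\<bar>Im (Ln \<omega>)\<bar> < pi / 2" using pos Re_Ln_pos_lt nz by blast+
  have "\<i> * of_real (\<theta> + \<alpha> * pi / 2) + of_real \<alpha> * Ln \<zeta> = \<i> * of_real (\<theta> + \<alpha> * pi / 2) + of_real \<alpha> * Ln \<omega>"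
  proof (rule exp_complex_eqI)
    have "\<bar>Im (Ln \<zeta>) - Im (Ln \<omega>)\<bar> < pi" using b by linarith
    then have "\<alpha> * \<bar>Im (Ln \<zeta>) - Im (Ln \<omega>)\<bar> < \<alpha> * pi" using \<alpha> by simp
    also have "\<dots> \<le> 2 * pi" using \<alpha> by simp
    finally have "\<bar>\<alpha> * (Im (Ln \<zeta>) - Im (Ln \<omega>))\<bar> < 2 * pi" using \<alpha> by (simp add: abs_mult)
    then show "\<bar>Im (\<i> * of_real (\<theta> + \<alpha> * pi / 2) + of_real \<alpha> * Ln \<zeta>) - Im (\<i> * of_real (\<theta> + \<alpha> * pi / 2) + of_real \<alpha> * Ln \<omega>)\<bar> < 2 * pi"
      by (simp add: algebra_simps)
    show "exp (\<i> * of_real (\<theta> + \<alpha> * pi / 2) + of_real \<alpha> * Ln \<zeta>) = exp (\<i> * of_real (\<theta> + \<alpha> * pi / 2) + of_real \<alpha> * Ln \<omega>)"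
      using zw(3) by (simp only: sector_map_def power_map_def \<zeta>_def \<omega>_def)
  qed
  then have "Ln \<zeta> = Ln \<omega>" using \<alpha> by simp
  then have "\<zeta> = \<omega>" using nz by (metis exp_Ln)
  then have "of_real A / root_map z = of_real A / root_map w"
    using inverse_slit_map pos by (metis \<zeta>_def \<omega>_def add_right_cancel)
  then have "root_map z = root_map w" using A_pos pos by (auto simp: divide_simps split: if_splits)
  then have "(of_real (T\<^sup>2) - z\<^sup>2) / of_real (1 - T\<^sup>2) = (of_real (T\<^sup>2) - w\<^sup>2) / of_real (1 - T\<^sup>2)"
    by (simp only: root_map_square[symmetric])
  moreover have "(of_real (1 - T\<^sup>2) :: complex) \<noteq> 0" using T2 by (simp only: of_real_eq_0_iff)
  ultimately have "z\<^sup>2 = w\<^sup>2" by (simp only: divide_cancel_right) simp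
  then have "z = w \<or> z = - w" by (simp add: power2_eq_iff)
  then show "z = w" using zw by auto
qed

section \<open>The potential, and boundary behaviour at the preimages of the two points\<close>

lemma potential_grad: "Im z > 0 \<Longrightarrow> grad potential (model_field T z) z"
proof -
  assume z: "Im z > 0"
  have nz: "z \<noteq> -1" "z \<noteq> 1" "z \<noteq> of_real T" "z \<noteq> of_real (-T)" using z by (auto simp: complex_eq_iff)
  note d = nz[THEN grad_ln_cmod, unfolded grad_def]
  have "(potential has_derivative (\<lambda>v. Re (1 / (z - (-1)) * v) - Re (1 / (z - 1) * v) + T * (Re (1 / (z - of_real T) * v) - Re (1 / (z - of_real (-T)) * v)))) (at z)"
    unfolding potential_def[abs_def] by (intro has_derivative_add has_derivative_diff has_derivative_mult_right d)
  moreover have "Re (1 / (z - (-1)) * v) - Re (1 / (z - 1) * v) + T * (Re (1 / (z - of_real T) * v) - Re (1 / (z - of_real (-T)) * v)) = Re (model_field T z * v)" for v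
  proof -
    have "model_field T z = 1 / (z - (-1)) - 1 / (z - 1) + of_real T * (1 / (z - of_real T) - 1 / (z - of_real (-T)))"
    proof -
      have "1 / (z - 1) = - (1 / (1 - z))" by (metis minus_diff_eq minus_divide_right)
      then show ?thesis unfolding model_field_def by (simp add: algebra_simps)
    qed
    moreover have "(a - b + t * (c - d)) * v = a * v - b * v + t * (c * v - d * v)" for a b c d t :: complex
      by (simp add: algebra_simps)
    ultimately have "model_field T z * v = 1 / (z - (-1)) * v - 1 / (z - 1) * v + of_real T * (1 / (z - of_real T) * v - 1 / (z - of_real (-T)) * v)"
      by (simp only:)
    moreover have "Re (a - b + of_real T * (c - d)) = Re a - Re b + T * (Re c - Re d)" for a b c d by simp
    ultimately show ?thesis by (simp only:)
  qed
  ultimately show ?thesis by (simp only: grad_def)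
qed

lemma potential_imaginary_axis: "potential (Complex 0 y) = 0"
  by (simp add: potential_def cmod_def)

text \<open>At 1 and -1 the radicand of \<open>root_map\<close> is -1, on the cut of
  \<open>csqrt\<close>. The expansion there is replaced by the identity
  \<open>(root_map z)\<^sup>2 + 1 = (1 - z\<^sup>2) / (1 - T\<^sup>2)\<close>, factored on both
  sides.\<close>

lemma root_map_factor:
  assumes "s = 1 \<or> s = -1"
  shows "cmod (root_map z + of_real s * \<i>) * cmod (root_map z - of_real s * \<i>) = cmod (z - of_real s) * cmod (z + of_real s) / (1 - T\<^sup>2)"
proof -
  have s2: "(of_real s)\<^sup>2 = (1::complex)" using assms by auto
  have "(root_map z + of_real s * \<i>) * (root_map z - of_real s * \<i>) = (root_map z)\<^sup>2 + (of_real s)\<^sup>2"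
    by (simp add: algebra_simps power2_eq_square)
  also have "\<dots> = (root_map z)\<^sup>2 + 1" by (simp only: s2)
  also have "\<dots> = - ((z - of_real s) * (z + of_real s)) / of_real (1 - T\<^sup>2)"
  proof -
    have "(of_real (1 - T\<^sup>2) :: complex) \<noteq> 0" using T2 by (simp only: of_real_eq_0_iff)
    then have "(of_real (T\<^sup>2) - z\<^sup>2) / of_real (1 - T\<^sup>2) + 1 = (of_real (T\<^sup>2) - z\<^sup>2 + of_real (1 - T\<^sup>2)) / of_real (1 - T\<^sup>2)"
      by (metis add_divide_distrib divide_self)
    also have "of_real (T\<^sup>2) - z\<^sup>2 + of_real (1 - T\<^sup>2) = 1 - z\<^sup>2" by simp
    also have "1 - z\<^sup>2 = - ((z - of_real s) * (z + of_real s))"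
      using s2 by (simp add: algebra_simps power2_eq_square)
    finally show ?thesis by (simp only: root_map_square)
  qed
  finally have "cmod ((root_map z + of_real s * \<i>) * (root_map z - of_real s * \<i>)) = cmod (- ((z - of_real s) * (z + of_real s)) / of_real (1 - T\<^sup>2))"
    by (rule arg_cong)
  then show ?thesis using T2 by (simp only: norm_mult norm_divide norm_minus_cancel norm_of_real abs_of_pos)
qed

text \<open>Decides which of the two square roots of -1 is approached at \<open>s\<close>; the other
  factor in \<open>root_map_factor\<close> then stays at least 1 in modulus.\<close>

lemma Im_root_map_sign:
  assumes "Im z > 0" "s = 1 \<or> s = -1" "s * Re z > 0"
  shows "s * Im (root_map z) < 0"
proof -
  have "Im ((root_map z)\<^sup>2) = 2 * Re (root_map z) * Im (root_map z)" by (simp add: power2_eq_square)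
  moreover have "Im ((root_map z)\<^sup>2) = - (2 * Re z * Im z) / (1 - T\<^sup>2)"
    unfolding root_map_square by (simp add: Im_divide_of_real power2_eq_square del: of_real_diff of_real_power)
  ultimately have "2 * Re (root_map z) * Im (root_map z) = - (2 * Re z * Im z) / (1 - T\<^sup>2)" by (simp only:)
  then have "s * (2 * Re (root_map z) * Im (root_map z)) = s * (- (2 * Re z * Im z) / (1 - T\<^sup>2))" by (simp only:)
  also have "\<dots> = - (2 * (s * Re z) * Im z) / (1 - T\<^sup>2)" by (simp add: algebra_simps)
  also have "\<dots> < 0"
  proof -
    have "0 < 2 * ((s * Re z) * Im z) / (1 - T\<^sup>2)" using mult_pos_pos[OF assms(3,1)] T2 by (intro divide_pos_pos) simp_all
    then show ?thesis by (simp add: mult.assoc)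
  qed
  finally have "(2 * Re (root_map z)) * (s * Im (root_map z)) < 0" by (simp add: algebra_simps)
  then show ?thesis using Re_root_map[OF assms(1)] by (simp add: mult_less_0_iff)
qed

lemma eventually_upper: "eventually (\<lambda>z. Im z > 0) (at x within {z. Im z > 0})"
  by (simp add: eventually_at_filter)

lemma root_map_tendsto_end:
  assumes s: "s = 1 \<or> s = -1"
  shows "(root_map \<longlongrightarrow> - (of_real s * \<i>)) (at (of_real s) within {z. Im z > 0})"
proof -
  let ?F = "at (of_real s :: complex) within {z. Im z > 0}"
  have "((\<lambda>z. s * Re z) \<longlongrightarrow> s * Re (of_real s)) ?F" by (intro tendsto_intros)
  then have ev: "eventually (\<lambda>z. s * Re z > 0) ?F" by (rule order_tendstoD) (use s in auto)
  have "((\<lambda>z. root_map z - - (of_real s * \<i>)) \<longlongrightarrow> 0) ?F"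
  proof (rule Lim_null_comparison)
    have "((\<lambda>z. cmod (z - of_real s) * cmod (z + of_real s) / (1 - T\<^sup>2)) \<longlongrightarrow> cmod (of_real s - of_real s) * cmod (of_real s + of_real s) / (1 - T\<^sup>2)) ?F"
      by (intro tendsto_intros) (use T2 in auto)
    then show "((\<lambda>z. cmod (z - of_real s) * cmod (z + of_real s) / (1 - T\<^sup>2)) \<longlongrightarrow> 0) ?F" by simp
    show "\<forall>\<^sub>F z in ?F. norm (root_map z - - (of_real s * \<i>)) \<le> cmod (z - of_real s) * cmod (z + of_real s) / (1 - T\<^sup>2)"
      using ev eventually_upper
    proof eventually_elim
      case (elim z)
      have "s * Im (root_map z) < 0" by (rule Im_root_map_sign[OF elim(2) s elim(1)])
      then have "1 \<le> \<bar>Im (root_map z - of_real s * \<i>)\<bar>" using s by auto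
      then have "1 \<le> cmod (root_map z - of_real s * \<i>)" using abs_Im_le_cmod order_trans by blast
      then have "cmod (root_map z + of_real s * \<i>) * 1 \<le> cmod (root_map z + of_real s * \<i>) * cmod (root_map z - of_real s * \<i>)"
        by (intro mult_left_mono) auto
      then show ?case unfolding root_map_factor[OF s] by simp
    qed
  qed
  then show ?thesis using Lim_null by blast
qed

lemma root_map_end_ratio:
  assumes s: "s = 1 \<or> s = -1"
  shows "((\<lambda>z. ln (cmod (root_map z + of_real s * \<i>)) - ln (cmod (z - of_real s))) \<longlongrightarrow> - ln (1 - T\<^sup>2)) (at (of_real s) within {z. Im z > 0})"
proof -
  let ?F = "at (of_real s :: complex) within {z. Im z > 0}"
  have "((\<lambda>z. ln (cmod (z + of_real s)) - ln (1 - T\<^sup>2) - ln (cmod (root_map z - of_real s * \<i>))) \<longlongrightarrow>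
     ln (cmod (of_real s + of_real s)) - ln (1 - T\<^sup>2) - ln (cmod (- (of_real s * \<i>) - of_real s * \<i>))) ?F"
    by (intro tendsto_intros root_map_tendsto_end s) (use s in auto)
  moreover have "cmod (of_real s + of_real s) = 2" "cmod (- (of_real s * \<i>) - of_real s * \<i>) = 2"
    using s by (auto simp: cmod_def)
  ultimately have lim: "((\<lambda>z. ln (cmod (z + of_real s)) - ln (1 - T\<^sup>2) - ln (cmod (root_map z - of_real s * \<i>))) \<longlongrightarrow> - ln (1 - T\<^sup>2)) ?F" by simp
  show ?thesis
  proof (rule Lim_transform_eventually[OF lim])
    show "\<forall>\<^sub>F z in ?F. ln (cmod (z + of_real s)) - ln (1 - T\<^sup>2) - ln (cmod (root_map z - of_real s * \<i>)) = ln (cmod (root_map z + of_real s * \<i>)) - ln (cmod (z - of_real s))"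
      using eventually_upper
    proof eventually_elim
      case (elim z)
      have nz: "root_map z + of_real s * \<i> \<noteq> 0" "root_map z - of_real s * \<i> \<noteq> 0" "z - of_real s \<noteq> 0" "z + of_real s \<noteq> 0"
        using Re_root_map[OF elim] elim by (auto simp: complex_eq_iff)
      have "ln (cmod (root_map z + of_real s * \<i>)) + ln (cmod (root_map z - of_real s * \<i>)) = ln (cmod (z - of_real s)) + ln (cmod (z + of_real s)) - ln (1 - T\<^sup>2)"
        using arg_cong[OF root_map_factor[OF s, of z], of ln] nz T2 by (simp add: ln_mult ln_div)
      then show ?case by linarith
    qed
  qed
qed

text \<open>The two points lie on the boundary of the half plane, but \<open>slit_map\<close> only
  scales them by a positive factor, hence stays off the cut of \<open>Ln\<close>. So
  \<open>power_map\<close> is differentiable there, and \<open>cmod W\<close> is the scale that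
  enters \<open>end_const\<close>.\<close>

lemma power_map_at_end:
  assumes s: "s = 1 \<or> s = -1"
  obtains W where "power_map (- (of_real s * \<i>)) = endpoint s" "(power_map has_field_derivative W) (at (- (of_real s * \<i>)))"
    "cmod W = (1 / (A + s * B)) powr \<alpha> * \<alpha> * A / (A + s * B)"
proof -
  define p0 where "p0 = - (of_real s * \<i>)"
  define c where "c = 1 / (A + s * B)"
  have As: "A + s * B > 0" using s AB by auto
  have c: "c > 0" using As by (simp add: c_def)
  have s2: "s * s = 1" using s by auto
  have den: "of_real A + \<i> * of_real B * p0 = of_real (A + s * B)" by (simp add: p0_def complex_eq_iff)
  have sl: "slit_map p0 = of_real c * p0" unfolding slit_map_def den by (simp add: c_def divide_inverse)
  have Lnp0: "Ln p0 = - (\<i> * of_real (s * pi / 2))" using s by (auto simp: p0_def Ln_minus_ii complex_eq_iff)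
  have Ln: "Ln (slit_map p0) = of_real (ln c) - \<i> * of_real (s * pi / 2)"
    unfolding sl using Ln_times_of_real[OF c, of p0] s Lnp0 c by (auto simp: p0_def Ln_of_real)
  have val: "power_map p0 = endpoint s"
  proof -
    have "\<i> * of_real (\<theta> + \<alpha> * pi / 2) + of_real \<alpha> * Ln (slit_map p0) = Complex (\<alpha> * ln c) (\<theta> + \<alpha> * pi / 2 * (1 - s))"
      unfolding Ln using s by (auto simp: complex_eq_iff algebra_simps)
    then have "power_map p0 = exp (Complex (\<alpha> * ln c) (\<theta> + \<alpha> * pi / 2 * (1 - s)))" by (simp only: power_map_def)
    then show ?thesis using c by (simp add: exp_eq_polar endpoint_def powr_def c_def[symmetric])
  qed
  have np: "slit_map p0 \<notin> \<real>\<^sub>\<le>\<^sub>0" unfolding sl using c s by (auto simp: p0_def complex_nonpos_Reals_iff)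
  have den0: "of_real A + \<i> * of_real B * p0 \<noteq> 0" unfolding den using As by (simp only: of_real_eq_0_iff)
  define W where "W = power_map p0 * (of_real \<alpha> * ((of_real A / (of_real A + \<i> * of_real B * p0)\<^sup>2) / slit_map p0))"
  have dsl: "(slit_map has_field_derivative of_real A / (of_real A + \<i> * of_real B * p0)\<^sup>2) (at p0)"
    unfolding slit_map_def[abs_def] using den0 by (auto intro!: derivative_eq_intros simp: power2_eq_square algebra_simps)
  have d1: "((\<lambda>p. Ln (slit_map p)) has_field_derivative ((of_real A / (of_real A + \<i> * of_real B * p0)\<^sup>2) / slit_map p0)) (at p0)"
    using DERIV_chain2[OF has_field_derivative_Ln[OF np] dsl] by (simp only: divide_inverse mult.commute)
  have d2: "((\<lambda>p. \<i> * of_real (\<theta> + \<alpha> * pi / 2) + of_real \<alpha> * Ln (slit_map p)) has_field_derivative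
      (0 + of_real \<alpha> * ((of_real A / (of_real A + \<i> * of_real B * p0)\<^sup>2) / slit_map p0))) (at p0)"
    by (intro DERIV_add DERIV_const DERIV_cmult d1)
  have der: "(power_map has_field_derivative W) (at p0)"
    using DERIV_chain2[OF DERIV_exp d2] unfolding power_map_def[abs_def] W_def by (simp only: add_0)
  have cp0: "cmod p0 = 1" using s by (auto simp: p0_def)
  have "cmod W = cmod (power_map p0) * (\<alpha> * (A / (A + s * B)\<^sup>2 / c))"
    unfolding W_def den sl using \<alpha> A_pos c As cp0 by (simp only: norm_mult norm_divide norm_power norm_of_real)
  also have "cmod (power_map p0) = c powr \<alpha>" unfolding val endpoint_def by (simp add: norm_mult c_def)
  also have "A / (A + s * B)\<^sup>2 / c = A / (A + s * B)" using As by (simp add: c_def power2_eq_square)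
  finally have "cmod W = (1 / (A + s * B)) powr \<alpha> * \<alpha> * A / (A + s * B)" by (simp add: c_def)
  then show ?thesis using that[of W] val der unfolding p0_def by blast
qed

lemma sector_map_tendsto_end:
  assumes s: "s = 1 \<or> s = -1"
  shows "(sector_map \<longlongrightarrow> endpoint s) (at (of_real s) within {z. Im z > 0})"
proof -
  obtain W where W: "power_map (- (of_real s * \<i>)) = endpoint s" "(power_map has_field_derivative W) (at (- (of_real s * \<i>)))"
    using power_map_at_end[OF s] by metis
  have "isCont power_map (- (of_real s * \<i>))" by (rule DERIV_isCont[OF W(2)])
  from isCont_tendsto_compose[OF this root_map_tendsto_end[OF s]] show ?thesis
    by (simp add: sector_map_def[abs_def] W(1))
qed

text \<open>The pole of \<open>s * potential\<close> cancels: the distance of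
  \<open>sector_map z\<close> to the endpoint is asymptotically \<open>cmod W\<close> times that of
  \<open>root_map z\<close> to its limit, which in turn is asymptotically
  \<open>cmod (z - s) / (1 - T\<^sup>2)\<close> by \<open>root_map_end_ratio\<close>.\<close>

lemma end_limit:
  assumes s: "s = 1 \<or> s = -1"
  shows "((\<lambda>z. s * potential z + ln (cmod (sector_map z - endpoint s))) \<longlongrightarrow> end_const s) (at (of_real s) within {z. Im z > 0})"
proof -
  let ?F = "at (of_real s :: complex) within {z. Im z > 0}"
  obtain W where W: "power_map (- (of_real s * \<i>)) = endpoint s" "(power_map has_field_derivative W) (at (- (of_real s * \<i>)))"
     "cmod W = (1 / (A + s * B)) powr \<alpha> * \<alpha> * A / (A + s * B)"
    using power_map_at_end[OF s] by metis
  have As: "A + s * B > 0" using s AB by auto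
  have Wpos: "cmod W > 0" unfolding W(3) using As \<alpha> A_pos by simp
  have "((\<lambda>p. (power_map p - endpoint s) / (p - - (of_real s * \<i>))) \<longlongrightarrow> W) (at (- (of_real s * \<i>)))"
    using W(2) unfolding has_field_derivative_iff W(1) .
  moreover have "filterlim root_map (at (- (of_real s * \<i>))) ?F"
  proof -
    have "\<forall>\<^sub>F z in ?F. root_map z \<in> UNIV \<and> root_map z \<noteq> - (of_real s * \<i>)"
      using eventually_upper by eventually_elim (use Re_root_map in force)
    then show ?thesis using root_map_tendsto_end[OF s] unfolding filterlim_at by blast
  qed
  ultimately have "((\<lambda>z. (power_map (root_map z) - endpoint s) / (root_map z - - (of_real s * \<i>))) \<longlongrightarrow> W) ?F"
    by (rule filterlim_compose)
  then have q: "((\<lambda>z. cmod ((sector_map z - endpoint s) / (root_map z + of_real s * \<i>))) \<longlongrightarrow> cmod W) ?F"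
    unfolding sector_map_def[symmetric] by (intro tendsto_norm) simp
  have "((\<lambda>z. ln (cmod ((sector_map z - endpoint s) / (root_map z + of_real s * \<i>)))) \<longlongrightarrow> ln (cmod W)) ?F"
    by (intro tendsto_ln q) (use Wpos in auto)
  moreover have "eventually (\<lambda>z. cmod ((sector_map z - endpoint s) / (root_map z + of_real s * \<i>)) > 0) ?F"
    using order_tendstoD(1)[OF q Wpos] .
  ultimately have l1: "((\<lambda>z. ln (cmod (sector_map z - endpoint s)) - ln (cmod (root_map z + of_real s * \<i>))) \<longlongrightarrow> ln (cmod W)) ?F"
    by (elim Lim_transform_eventually eventually_mono) (auto simp: norm_divide ln_div)
  have "((\<lambda>z. ln (cmod (z + of_real s)) + s * (T * (ln (cmod (z - of_real T)) - ln (cmod (z - of_real (-T)))))) \<longlongrightarrow>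
     ln (cmod (of_real s + of_real s)) + s * (T * (ln (cmod (of_real s - of_real T)) - ln (cmod (of_real s - of_real (-T)))))) ?F"
    by (intro tendsto_intros) (use s T in \<open>auto simp: complex_eq_iff\<close>)
  moreover have "ln (cmod (of_real s + of_real s)) + s * (T * (ln (cmod (of_real s - of_real T)) - ln (cmod (of_real s - of_real (-T))))) = ln 2 + T * (ln (1 - T) - ln (1 + T))"
  proof -
    have "cmod (of_real s + of_real s) = \<bar>s + s\<bar>" "cmod (of_real s - of_real T) = \<bar>s - T\<bar>" "cmod (of_real s - of_real (-T)) = \<bar>s + T\<bar>"
      by (metis norm_of_real of_real_add, metis norm_of_real of_real_diff, metis norm_of_real of_real_diff diff_minus_eq_add)
    then show ?thesis using s T by (auto simp: algebra_simps)
  qed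
  ultimately have l2: "((\<lambda>z. ln (cmod (z + of_real s)) + s * (T * (ln (cmod (z - of_real T)) - ln (cmod (z - of_real (-T)))))) \<longlongrightarrow> ln 2 + T * (ln (1 - T) - ln (1 + T))) ?F" by simp
  have "((\<lambda>z. (ln (cmod (z + of_real s)) + s * (T * (ln (cmod (z - of_real T)) - ln (cmod (z - of_real (-T)))))) +
     (ln (cmod (sector_map z - endpoint s)) - ln (cmod (root_map z + of_real s * \<i>))) + (ln (cmod (root_map z + of_real s * \<i>)) - ln (cmod (z - of_real s))))
     \<longlongrightarrow> (ln 2 + T * (ln (1 - T) - ln (1 + T))) + ln (cmod W) + - ln (1 - T\<^sup>2)) ?F"
    by (intro tendsto_add l2 l1 root_map_end_ratio s)
  moreover have "(ln (cmod (z + of_real s)) + s * (T * (ln (cmod (z - of_real T)) - ln (cmod (z - of_real (-T)))))) +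
     (ln (cmod (sector_map z - endpoint s)) - ln (cmod (root_map z + of_real s * \<i>))) + (ln (cmod (root_map z + of_real s * \<i>)) - ln (cmod (z - of_real s)))
     = s * potential z + ln (cmod (sector_map z - endpoint s))" for z
    using s by (auto simp: potential_def algebra_simps)
  moreover have "(ln 2 + T * (ln (1 - T) - ln (1 + T))) + ln (cmod W) + - ln (1 - T\<^sup>2) = end_const s"
    unfolding end_const_def W(3) by simp
  ultimately show ?thesis by (simp only:)
qed

section \<open>Boundary behaviour at the preimages of the origin\<close>

lemma root_map_tendsto_zero:
  assumes s: "s = 1 \<or> s = -1"
  shows "(root_map \<longlongrightarrow> 0) (at (of_real (s * T)) within {z. Im z > 0})"
proof -
  let ?F = "at (of_real (s * T) :: complex) within {z. Im z > 0}"
  have "((\<lambda>z. sqrt (cmod ((of_real (T\<^sup>2) - z\<^sup>2) / of_real (1 - T\<^sup>2)))) \<longlongrightarrow> sqrt (cmod ((of_real (T\<^sup>2) - (of_real (s * T))\<^sup>2) / of_real (1 - T\<^sup>2)))) ?F"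
    by (intro tendsto_intros) (use T2 in \<open>simp only: of_real_eq_0_iff\<close>)
  moreover have "(of_real (T\<^sup>2) - (of_real (s * T))\<^sup>2 :: complex) = 0" using s by auto
  ultimately have "((\<lambda>z. sqrt (cmod ((of_real (T\<^sup>2) - z\<^sup>2) / of_real (1 - T\<^sup>2)))) \<longlongrightarrow> 0) ?F" by (simp only:) simp
  then have "((\<lambda>z. cmod (root_map z)) \<longlongrightarrow> 0) ?F" unfolding root_map_def by (simp only: norm_csqrt)
  then show ?thesis by (rule tendsto_norm_zero_cancel)
qed

text \<open>The squared modulus of \<open>root_map z\<close> is
  \<open>cmod (z - T) * cmod (z + T) / (1 - T\<^sup>2)\<close>, so the pole of the potential, of
  weight \<open>T\<close>, is matched by \<open>2 * T / \<alpha>\<close> times the logarithm of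
  \<open>cmod (sector_map z)\<close>. This identity is exact; only the regular remaining terms are
  passed to the limit.\<close>

lemma zero_limit:
  assumes s: "s = 1 \<or> s = -1"
  shows "((\<lambda>z. s * potential z - (2 * T / \<alpha>) * ln (cmod (sector_map z))) \<longlongrightarrow> zero_const) (at (of_real (s * T)) within {z. Im z > 0})"
proof -
  let ?F = "at (of_real (s * T) :: complex) within {z. Im z > 0}"
  have "((\<lambda>z. s * (ln (cmod (z - (-1))) - ln (cmod (z - 1))) - 2 * T * ln (cmod (z + of_real (s * T))) + T * ln (1 - T\<^sup>2) + 2 * T * ln (cmod (of_real A + \<i> * of_real B * root_map z)))
    \<longlongrightarrow> s * (ln (cmod (of_real (s * T) - (-1))) - ln (cmod (of_real (s * T) - 1))) - 2 * T * ln (cmod (of_real (s * T) + of_real (s * T))) + T * ln (1 - T\<^sup>2) + 2 * T * ln (cmod (of_real A + \<i> * of_real B * 0))) ?F"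
    by (intro tendsto_intros root_map_tendsto_zero s) (use s T A_pos in \<open>auto simp: complex_eq_iff\<close>)
  moreover have "s * (ln (cmod (of_real (s * T) - (-1))) - ln (cmod (of_real (s * T) - 1))) - 2 * T * ln (cmod (of_real (s * T) + of_real (s * T))) + T * ln (1 - T\<^sup>2) + 2 * T * ln (cmod (of_real A + \<i> * of_real B * 0)) = zero_const"
  proof -
    have "cmod (of_real (s * T) - (-1)) = \<bar>s * T + 1\<bar>" "cmod (of_real (s * T) - 1) = \<bar>s * T - 1\<bar>" 
      using s T by (auto simp: cmod_def)
    moreover have "cmod (of_real (s * T) + of_real (s * T)) = \<bar>s * T + s * T\<bar>" by (metis norm_of_real of_real_add)
    ultimately show ?thesis using s T A_pos by (auto simp: zero_const_def algebra_simps)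
  qed
  ultimately have lim: "((\<lambda>z. s * (ln (cmod (z - (-1))) - ln (cmod (z - 1))) - 2 * T * ln (cmod (z + of_real (s * T))) + T * ln (1 - T\<^sup>2) + 2 * T * ln (cmod (of_real A + \<i> * of_real B * root_map z))) \<longlongrightarrow> zero_const) ?F"
    by simp
  show ?thesis
  proof (rule Lim_transform_eventually[OF lim])
    show "\<forall>\<^sub>F z in ?F. s * (ln (cmod (z - (-1))) - ln (cmod (z - 1))) - 2 * T * ln (cmod (z + of_real (s * T))) + T * ln (1 - T\<^sup>2) + 2 * T * ln (cmod (of_real A + \<i> * of_real B * root_map z)) = s * potential z - (2 * T / \<alpha>) * ln (cmod (sector_map z))"
      using eventually_upper
    proof eventually_elim
      case (elim z)
      have p: "Re (root_map z) > 0" by (rule Re_root_map[OF elim])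
      then have p0: "root_map z \<noteq> 0" by auto
      have zT: "z - of_real T \<noteq> 0" "z - of_real (-T) \<noteq> 0" using elim by (auto simp: complex_eq_iff)
      have d: "of_real A + \<i> * of_real B * root_map z \<noteq> 0" by (rule denom_nonzero[OF p])
      have "ln (cmod (sector_map z)) = \<alpha> * ln (cmod (slit_map (root_map z)))"
        unfolding cmod_sector_map[OF elim] by (rule ln_powr)
      also have "ln (cmod (slit_map (root_map z))) = ln (cmod (root_map z)) - ln (cmod (of_real A + \<i> * of_real B * root_map z))"
        using p0 d by (simp add: slit_map_def norm_divide ln_div)
      finally have g: "(2 * T / \<alpha>) * ln (cmod (sector_map z)) = T * (2 * ln (cmod (root_map z))) - 2 * T * ln (cmod (of_real A + \<i> * of_real B * root_map z))"
        using \<alpha> by (simp add: right_diff_distrib)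
      have "2 * ln (cmod (root_map z)) = ln ((cmod (root_map z))\<^sup>2)" using p0 by (simp add: ln_realpow)
      also have "(cmod (root_map z))\<^sup>2 = cmod (z - of_real T) * cmod (z - of_real (-T)) / (1 - T\<^sup>2)"
      proof -
        have "(of_real (T\<^sup>2) - z\<^sup>2) = - ((z - of_real T) * (z - of_real (-T)))" by (simp add: algebra_simps power2_eq_square)
        then have "cmod ((root_map z)\<^sup>2) = cmod (- ((z - of_real T) * (z - of_real (-T))) / of_real (1 - T\<^sup>2))" by (simp only: root_map_square)
        then show ?thesis using T2 by (simp only: norm_power norm_divide norm_minus_cancel norm_mult norm_of_real abs_of_pos)
      qed
      also have "ln \<dots> = ln (cmod (z - of_real T)) + ln (cmod (z - of_real (-T))) - ln (1 - T\<^sup>2)"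
        using zT T2 by (simp add: ln_mult ln_div)
      finally have "(2 * T / \<alpha>) * ln (cmod (sector_map z)) = T * (ln (cmod (z - of_real T)) + ln (cmod (z - of_real (-T))) - ln (1 - T\<^sup>2)) - 2 * T * ln (cmod (of_real A + \<i> * of_real B * root_map z))"
        using g by simp
      then show ?case using s by (auto simp: potential_def algebra_simps)
    qed
  qed
qed

lemma sector_map_tendsto_zero:
  assumes s: "s = 1 \<or> s = -1"
  shows "(sector_map \<longlongrightarrow> 0) (at (of_real (s * T)) within {z. Im z > 0})"
proof -
  let ?F = "at (of_real (s * T) :: complex) within {z. Im z > 0}"
  have "((\<lambda>z. cmod (slit_map (root_map z))) \<longlongrightarrow> cmod (0 / (of_real A + \<i> * of_real B * 0))) ?F"
    unfolding slit_map_def by (intro tendsto_intros root_map_tendsto_zero s) (use A_pos in auto)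
  then have "((\<lambda>z. cmod (slit_map (root_map z)) powr \<alpha>) \<longlongrightarrow> 0 powr \<alpha>) ?F"
    using \<alpha> by (intro tendsto_powr') auto
  then have lim: "((\<lambda>z. cmod (slit_map (root_map z)) powr \<alpha>) \<longlongrightarrow> 0) ?F" using \<alpha> by simp
  have "((\<lambda>z. cmod (sector_map z)) \<longlongrightarrow> 0) ?F"
    by (rule Lim_transform_eventually[OF lim]) (use eventually_upper in \<open>eventually_elim, simp add: cmod_sector_map\<close>)
  then show ?thesis by (rule tendsto_norm_zero_cancel)
qed

section \<open>Levels of the potential outside small discs\<close>

lemma potential_split:
  assumes "s = 1 \<or> s = -1"
  shows "s * potential z = (ln (cmod (z + of_real s)) - ln (cmod (z - of_real s))) + T * (ln (cmod (z - of_real (s * T))) - ln (cmod (z + of_real (s * T))))"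
  using assms by (auto simp: potential_def algebra_simps)

lemma potential_near_end:
  assumes s: "s = 1 \<or> s = -1"
  shows "eventually (\<lambda>z. X \<le> s * potential z) (at (of_real s) within {z. Im z > 0})"
proof -
  let ?F = "at (of_real s :: complex) within {z. Im z > 0}"
  define l where "l = ln (cmod (of_real s + of_real s)) + T * (ln (cmod (of_real s - of_real (s * T))) - ln (cmod (of_real s + of_real (s * T))))"
  have "((\<lambda>z. ln (cmod (z + of_real s)) + T * (ln (cmod (z - of_real (s * T))) - ln (cmod (z + of_real (s * T))))) \<longlongrightarrow> l) ?F"
    unfolding l_def by (intro tendsto_intros) (use s T in \<open>auto simp: complex_eq_iff\<close>)
  then have 1: "eventually (\<lambda>z. l - 1 < ln (cmod (z + of_real s)) + T * (ln (cmod (z - of_real (s * T))) - ln (cmod (z + of_real (s * T))))) ?F"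
    by (rule order_tendstoD) simp
  have "((\<lambda>z. cmod (z - of_real s)) \<longlongrightarrow> cmod (of_real s - of_real s)) ?F" by (intro tendsto_intros)
  then have 2: "eventually (\<lambda>z. cmod (z - of_real s) < exp (l - 1 - X)) ?F" by (rule order_tendstoD) simp
  show ?thesis using 1 2 eventually_upper
  proof eventually_elim
    case (elim z)
    have "z \<noteq> of_real s" using elim(3) by auto
    then have "ln (cmod (z - of_real s)) < l - 1 - X" using elim(2) by (metis exp_less_cancel_iff exp_ln right_minus_eq zero_less_norm_iff)
    then show ?case unfolding potential_split[OF s] using elim(1) by linarith
  qed
qed

lemma potential_near_zero:
  assumes s: "s = 1 \<or> s = -1"
  shows "eventually (\<lambda>z. s * potential z \<le> X) (at (of_real (s * T)) within {z. Im z > 0})"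
proof -
  let ?F = "at (of_real (s * T) :: complex) within {z. Im z > 0}"
  define l where "l = ln (cmod (of_real (s * T) + of_real s)) - ln (cmod (of_real (s * T) - of_real s)) - T * ln (cmod (of_real (s * T) + of_real (s * T)))"
  have "((\<lambda>z. ln (cmod (z + of_real s)) - ln (cmod (z - of_real s)) - T * ln (cmod (z + of_real (s * T)))) \<longlongrightarrow> l) ?F"
    unfolding l_def by (intro tendsto_intros) (use s T in \<open>auto simp: complex_eq_iff\<close>)
  then have 1: "eventually (\<lambda>z. ln (cmod (z + of_real s)) - ln (cmod (z - of_real s)) - T * ln (cmod (z + of_real (s * T))) < l + 1) ?F"
    by (rule order_tendstoD) simp
  have "((\<lambda>z. cmod (z - of_real (s * T))) \<longlongrightarrow> cmod (of_real (s * T) - of_real (s * T))) ?F" by (intro tendsto_intros)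
  then have 2: "eventually (\<lambda>z. cmod (z - of_real (s * T)) < exp ((X - l - 1) / T)) ?F" by (rule order_tendstoD) simp
  show ?thesis using 1 2 eventually_upper
  proof eventually_elim
    case (elim z)
    have "z \<noteq> of_real (s * T)" using elim(3) by auto
    then have "ln (cmod (z - of_real (s * T))) < (X - l - 1) / T" using elim(2) by (metis exp_less_cancel_iff exp_ln right_minus_eq zero_less_norm_iff)
    then have "T * ln (cmod (z - of_real (s * T))) < X - l - 1" using T by (simp add: field_simps)
    then show ?case unfolding potential_split[OF s] right_diff_distrib using elim(1) by linarith
  qed
qed

lemma cmod_reflect_le:
  assumes "s * Re z \<ge> 0" "s = 1 \<or> s = -1" "c \<ge> 0"
  shows "cmod (z - of_real (s * c)) \<le> cmod (z + of_real (s * c))"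
proof -
  have "(cmod (z + of_real (s * c)))\<^sup>2 - (cmod (z - of_real (s * c)))\<^sup>2 = 4 * (c * (s * Re z))"
    unfolding cmod_power2 by (simp add: power2_eq_square algebra_simps)
  moreover have "0 \<le> c * (s * Re z)" using assms by simp
  ultimately have "(cmod (z - of_real (s * c)))\<^sup>2 \<le> (cmod (z + of_real (s * c)))\<^sup>2" by linarith
  then show ?thesis by (rule power2_le_imp_le) simp
qed

text \<open>Beyond either level, the logarithm of one pole alone forces \<open>z\<close> so close to
  that pole that the expansion of \<open>end_limit\<close> or \<open>zero_limit\<close> applies, and
  this contradicts the image being outside the disc. The condition \<open>s * Re z \<ge> 0\<close>
  fixes the sign of the other logarithm, which can then be dropped.\<close>

lemma sector_containment:
  assumes s: "s = 1 \<or> s = -1" and \<tau>: "\<tau> > 0"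
  shows "\<exists>\<epsilon>0>0. \<forall>\<epsilon> z. 0 < \<epsilon> \<and> \<epsilon> < \<epsilon>0 \<and> Im z > 0 \<and> s * Re z \<ge> 0 \<and> \<epsilon> < cmod (sector_map z - endpoint s) \<and> \<epsilon> < cmod (sector_map z) \<longrightarrow>
     s * potential z \<le> ln (1 / \<epsilon>) + end_const s + \<tau> \<and> - ((2 * T / \<alpha>) * ln (1 / \<epsilon>) - zero_const + \<tau>) \<le> s * potential z"
proof -
  have "eventually (\<lambda>z. s * potential z + ln (cmod (sector_map z - endpoint s)) < end_const s + \<tau>) (at (of_real s) within {z. Im z > 0})"
    using end_limit[OF s] by (rule order_tendstoD) (use \<tau> in simp)
  then obtain d1 where d1: "d1 > 0" "\<And>z. Im z > 0 \<Longrightarrow> cmod (z - of_real s) < d1 \<Longrightarrow> s * potential z + ln (cmod (sector_map z - endpoint s)) < end_const s + \<tau>"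
    unfolding eventually_at dist_norm by (metis Im_complex_of_real less_irrefl mem_Collect_eq)
  have "eventually (\<lambda>z. zero_const - \<tau> < s * potential z - (2 * T / \<alpha>) * ln (cmod (sector_map z))) (at (of_real (s * T)) within {z. Im z > 0})"
    using zero_limit[OF s] by (rule order_tendstoD) (use \<tau> in simp)
  then obtain d2 where d2: "d2 > 0" "\<And>z. Im z > 0 \<Longrightarrow> cmod (z - of_real (s * T)) < d2 \<Longrightarrow> zero_const - \<tau> < s * potential z - (2 * T / \<alpha>) * ln (cmod (sector_map z))"
    unfolding eventually_at dist_norm by (metis Im_complex_of_real less_irrefl mem_Collect_eq)
  \<comment> \<open>From \<open>|z - c| < exp E * |z + c|\<close>,
    \<open>|z + c| \<le> |z - c| + 2\<close> and \<open>exp E \<le> 1 / 2\<close>. The entries with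
    denominators 2 and 4 in \<open>\<epsilon>0\<close> below supply the two hypotheses on
    \<open>exp E\<close>.\<close>
  have close: "cmod (z - of_real c) < d" if "ln (cmod (z + of_real c)) - ln (cmod (z - of_real c)) > - E" "exp E \<le> 1 / 2" "4 * exp E \<le> d" "Im z > 0" "\<bar>c\<bar> \<le> 1" for z c E d
  proof -
    have nz: "cmod (z - of_real c) > 0" "cmod (z + of_real c) > 0" using that(4) by (auto simp: complex_eq_iff)
    have "ln (cmod (z - of_real c)) < ln (exp E * cmod (z + of_real c))" using that(1) nz by (simp add: ln_mult)
    then have "cmod (z - of_real c) < exp E * cmod (z + of_real c)" using nz by (subst (asm) ln_less_cancel_iff) auto
    also have "cmod (z + of_real c) \<le> cmod (z - of_real c) + 2"
    proof -
      have "cmod (z + of_real c) \<le> cmod (z - of_real c) + cmod (of_real (2 * c))"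
      proof -
        have "z + of_real c = (z - of_real c) + of_real (2 * c)" by simp
        then show ?thesis by (metis norm_triangle_ineq)
      qed
      then show ?thesis using that(5) unfolding norm_of_real by linarith
    qed
    finally have "cmod (z - of_real c) < exp E * (cmod (z - of_real c) + 2)" by simp
    moreover have "exp E * cmod (z - of_real c) \<le> 1/2 * cmod (z - of_real c)" using that(2) nz by (intro mult_right_mono) auto
    ultimately have "cmod (z - of_real c) < 4 * exp E" by (simp add: algebra_simps)
    then show ?thesis using that(3) by linarith
  qed
  define \<mu>1 where "\<mu>1 = exp (end_const s + \<tau>)"
  define \<mu>2 where "\<mu>2 = exp (- (zero_const - \<tau>) / T)"
  define \<epsilon>0 where "\<epsilon>0 = Min {1, \<mu>1 / 2, \<mu>1 * d1 / 4, \<mu>2 / 2, \<mu>2 * d2 / 4}"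
  show ?thesis
  proof (rule exI[of _ \<epsilon>0], intro conjI allI impI)
    show "\<epsilon>0 > 0" using d1 d2 by (simp add: \<epsilon>0_def \<mu>1_def \<mu>2_def)
    fix \<epsilon> z assume H: "0 < \<epsilon> \<and> \<epsilon> < \<epsilon>0 \<and> Im z > 0 \<and> s * Re z \<ge> 0 \<and> \<epsilon> < cmod (sector_map z - endpoint s) \<and> \<epsilon> < cmod (sector_map z)"
    then have \<epsilon>: "0 < \<epsilon>" "\<epsilon> < 1" "\<epsilon> < \<mu>1 / 2" "\<epsilon> < \<mu>1 * d1 / 4" "\<epsilon> < \<mu>2 / 2" "\<epsilon> < \<mu>2 * d2 / 4" by (auto simp: \<epsilon>0_def)
    have nz: "cmod (z - of_real (s * T)) > 0" "cmod (z - of_real s) > 0" using H by (auto simp: complex_eq_iff)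
    have le1: "ln (cmod (z - of_real (s * T))) - ln (cmod (z + of_real (s * T))) \<le> 0"
      using cmod_reflect_le[of s z T] H s T nz by (simp add: ln_mono)
    have le2: "ln (cmod (z + of_real s)) - ln (cmod (z - of_real s)) \<ge> 0"
      using cmod_reflect_le[of s z 1] H s nz by (simp add: ln_mono)
    show "s * potential z \<le> ln (1 / \<epsilon>) + end_const s + \<tau>"
    proof (rule ccontr)
      assume n: "\<not> ?thesis"
      have "T * (ln (cmod (z - of_real (s * T))) - ln (cmod (z + of_real (s * T)))) \<le> 0" using le1 T by (simp add: mult_le_0_iff)
      then have big: "ln (cmod (z + of_real s)) - ln (cmod (z - of_real s)) > - (ln \<epsilon> - (end_const s + \<tau>))"
        using n \<epsilon>(1) unfolding potential_split[OF s] by (simp add: ln_div)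
      have ex: "exp (ln \<epsilon> - (end_const s + \<tau>)) = \<epsilon> / \<mu>1" using \<epsilon>(1) by (simp add: exp_diff \<mu>1_def)
      have mu: "\<mu>1 > 0" by (simp add: \<mu>1_def)
      have "\<epsilon> / \<mu>1 \<le> 1 / 2" "4 * (\<epsilon> / \<mu>1) \<le> d1" using \<epsilon> mu by (simp_all add: field_simps)
      from close[OF big, unfolded ex, OF this] have "cmod (z - of_real s) < d1" using H s by auto
      then have "s * potential z + ln (cmod (sector_map z - endpoint s)) < end_const s + \<tau>" using d1(2) H by blast
      moreover have "ln (cmod (sector_map z - endpoint s)) > ln \<epsilon>" using H by (subst ln_less_cancel_iff) auto
      ultimately show False using n \<epsilon>(1) by (simp add: ln_div)
    qed
    show "- ((2 * T / \<alpha>) * ln (1 / \<epsilon>) - zero_const + \<tau>) \<le> s * potential z"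
    proof (rule ccontr)
      assume n: "\<not> ?thesis"
      then have "T * (ln (cmod (z - of_real (s * T))) - ln (cmod (z + of_real (s * T)))) < - ((2 * T / \<alpha>) * ln (1 / \<epsilon>) - zero_const + \<tau>)"
        using le2 unfolding potential_split[OF s] by linarith
      also have "\<dots> = T * ((2 / \<alpha>) * ln \<epsilon> + (zero_const - \<tau>) / T)"
      proof -
        have "T * ((zero_const - \<tau>) / T) = zero_const - \<tau>" using T by simp
        moreover have "T * ((2 / \<alpha>) * ln \<epsilon>) = - ((2 * T / \<alpha>) * ln (1 / \<epsilon>))" using \<epsilon>(1) by (simp add: ln_div)
        ultimately show ?thesis unfolding distrib_left by linarith
      qed
      finally have "ln (cmod (z - of_real (s * T))) - ln (cmod (z + of_real (s * T))) < (2 / \<alpha>) * ln \<epsilon> + (zero_const - \<tau>) / T"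
        using T by simp
      \<comment> \<open>As \<open>\<epsilon> < 1\<close> and \<open>\<alpha> \<le> 2\<close>, the
        power of \<epsilon> with exponent \<open>2 / \<alpha>\<close> is at most \<epsilon> itself,
        which leads to thresholds linear in \<epsilon>.\<close>
      also have "\<dots> \<le> ln \<epsilon> + (zero_const - \<tau>) / T"
      proof -
        have "ln \<epsilon> \<le> 0" using \<epsilon> by simp
        moreover have "1 \<le> 2 / \<alpha>" using \<alpha> by simp
        ultimately show ?thesis using mult_right_mono_neg[of 1 "2 / \<alpha>" "ln \<epsilon>"] by simp
      qed
      finally have big: "ln (cmod (z + of_real (s * T))) - ln (cmod (z - of_real (s * T))) > - (ln \<epsilon> + (zero_const - \<tau>) / T)" by linarith
      have ex: "exp (ln \<epsilon> + (zero_const - \<tau>) / T) = \<epsilon> / \<mu>2"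
      proof -
        have "- (zero_const - \<tau>) / T = - ((zero_const - \<tau>) / T)" by (rule minus_divide_left[symmetric])
        then have "\<mu>2 = inverse (exp ((zero_const - \<tau>) / T))" unfolding \<mu>2_def by (simp only: exp_minus)
        then show ?thesis using \<epsilon>(1) by (simp add: exp_add divide_inverse)
      qed
      have mu: "\<mu>2 > 0" by (simp add: \<mu>2_def)
      have "\<epsilon> / \<mu>2 \<le> 1 / 2" "4 * (\<epsilon> / \<mu>2) \<le> d2" using \<epsilon> mu by (simp_all add: field_simps)
      from close[OF big, unfolded ex, OF this] have "cmod (z - of_real (s * T)) < d2" using H s T by auto
      then have "zero_const - \<tau> < s * potential z - (2 * T / \<alpha>) * ln (cmod (sector_map z))" using d2(2) H by blast
      moreover have "ln (cmod (sector_map z)) > ln \<epsilon>" using H by (subst ln_less_cancel_iff) auto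
      then have "(2 * T / \<alpha>) * ln (cmod (sector_map z)) \<ge> (2 * T / \<alpha>) * ln \<epsilon>" using T \<alpha> by (intro mult_left_mono) auto
      ultimately show False using n \<epsilon>(1) by (simp add: ln_div)
    qed
  qed
qed

end

section \<open>Energy of the model field in a sector\<close>

lemma quads_split:
  fixes F :: "complex \<Rightarrow> real"
  assumes F: "continuous_on {z. Im z > 0} F" and n: "n \<ge> 1"
  shows "integral (cbox (Complex (- real n) (1 / (real n)\<^sup>2)) (Complex (real n) (real n))) F = integral (lquad n) F + integral (rquad n) F"
proof -
  have d: "0 < 1 / (real n)\<^sup>2" using n by simp
  have c: "continuous_on (cbox (Complex x (1 / (real n)\<^sup>2)) (Complex y (real n))) F" for x y
    by (rule continuous_on_subset[OF F]) (auto simp: in_cbox_complex_iff intro: less_le_trans[OF d])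
  define G where "G x = integral {1 / (real n)\<^sup>2..real n} (\<lambda>y. F (Complex x y))" for x
  have "continuous_on (cbox (- real n) (real n) \<times> cbox (1 / (real n)\<^sup>2) (real n)) (\<lambda>u. F (Complex (fst u) (snd u)))"
    by (rule continuous_on_compose2[OF F])
       (auto intro!: linear_continuous_on linear_linear[THEN iffD2, OF Complex_pair_iso(1)[OF refl refl]] less_le_trans[OF d])
  then have "continuous_on (cbox (- real n) (real n)) (\<lambda>x. integral (cbox (1 / (real n)\<^sup>2) (real n)) (\<lambda>y. F (Complex x y)))"
    by (intro integral_continuous_on_param) (simp add: case_prod_beta)
  then have "G integrable_on {- real n..real n}" unfolding G_def by (intro integrable_continuous_real) simp
  then have "integral {- real n..0} G + integral {0..real n} G = integral {- real n..real n} G"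
    by (intro Henstock_Kurzweil_Integration.integral_combine) auto
  then show ?thesis unfolding integral_complex_cbox_iterated[OF c] G_def by simp
qed

text \<open>Conformal invariance of the Dirichlet energy: each summand is the integral of the
  nonnegative \<open>e\<close> over the image of a rectangle, and the images are disjoint.\<close>

lemma sum_over_disjoint_images:
  fixes e :: "complex \<Rightarrow> real"
  assumes J: "finite J" and g: "\<And>j. j \<in> J \<Longrightarrow> g j holomorphic_on {z. Im z > 0}" "\<And>j. j \<in> J \<Longrightarrow> inj_on (g j) {z. Im z > 0}"
    and disj: "\<And>i j z w. i \<in> J \<Longrightarrow> j \<in> J \<Longrightarrow> i \<noteq> j \<Longrightarrow> Im z > 0 \<Longrightarrow> Im w > 0 \<Longrightarrow> g i z \<noteq> g j w"
    and e: "e absolutely_integrable_on UNIV" "\<And>z. 0 \<le> e z" "continuous_on UNIV e" and n: "n \<ge> 1"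
  shows "(\<Sum>j\<in>J. integral (lquad n) (\<lambda>z. e (g j z) * (cmod (deriv (g j) z))\<^sup>2) + integral (rquad n) (\<lambda>z. e (g j z) * (cmod (deriv (g j) z))\<^sup>2)) \<le> integral UNIV e"
proof -
  let ?H = "{z. Im z > 0}"
  have oH: "open ?H" by (simp add: open_halfspace_Im_gt)
  define a b where "a = Complex (- real n) (1 / (real n)\<^sup>2)" and "b = Complex (real n) (real n)"
  have d: "0 < 1 / (real n)\<^sup>2" using n by simp
  have sub: "cbox a b \<subseteq> ?H" by (auto simp: a_def b_def in_cbox_complex_iff intro: less_le_trans[OF d])
  then have subo: "box a b \<subseteq> ?H" using box_subset_cbox by blast
  have one: "(e has_integral integral (lquad n) (\<lambda>z. e (g j z) * (cmod (deriv (g j) z))\<^sup>2) + integral (rquad n) (\<lambda>z. e (g j z) * (cmod (deriv (g j) z))\<^sup>2)) (g j ` box a b)" if j: "j \<in> J" for j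
  proof -
    let ?F = "\<lambda>z. (cmod (deriv (g j) z))\<^sup>2 * e (g j z)"
    have cg: "continuous_on ?H (g j)" "continuous_on ?H (deriv (g j))"
      using g(1)[OF j] oH by (auto intro!: holomorphic_on_imp_continuous_on holomorphic_deriv)
    have cF: "continuous_on ?H ?F" by (intro continuous_intros cg continuous_on_compose2[OF e(3) cg(1)]) auto
    have "?F absolutely_integrable_on cbox a b" by (rule absolutely_integrable_continuous[OF continuous_on_subset[OF cF sub]])
    then have "?F absolutely_integrable_on box a b" by (rule set_integrable_subset) (auto simp: box_subset_cbox)
    moreover have "integral (box a b) ?F = integral (cbox a b) ?F" by (rule integral_open_interval)
    moreover have "(g j has_field_derivative deriv (g j) z) (at z)" if "z \<in> box a b" for z
      using g(1)[OF j] oH subo that by (auto intro: holomorphic_derivI)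
    moreover have "inj_on (g j) (box a b)" using g(2)[OF j] subo inj_on_subset by blast
    ultimately have "e absolutely_integrable_on g j ` box a b \<and> integral (g j ` box a b) e = integral (cbox a b) ?F"
      using complex_change_of_variables[OF open_box, where g="g j" and g'="deriv (g j)" and f=e and b="integral (cbox a b) ?F"] by blast
    then have "(e has_integral integral (cbox a b) ?F) (g j ` box a b)"
      unfolding absolutely_integrable_on_def by (auto simp: has_integral_iff)
    then show ?thesis using quads_split[OF cF n] by (simp add: a_def b_def mult.commute)
  qed
  have "(e has_integral (\<Sum>j\<in>J. integral (lquad n) (\<lambda>z. e (g j z) * (cmod (deriv (g j) z))\<^sup>2) + integral (rquad n) (\<lambda>z. e (g j z) * (cmod (deriv (g j) z))\<^sup>2))) (\<Union>j\<in>J. g j ` box a b)"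
  proof (rule has_integral_UN[OF J one])
    show "pairwise (\<lambda>i i'. negligible (g i ` box a b \<inter> g i' ` box a b)) J"
    proof (rule pairwiseI)
      fix i i' assume i: "i \<in> J" "i' \<in> J" "i \<noteq> i'"
      have "g i ` box a b \<inter> g i' ` box a b = {}"
      proof (rule equals0I)
        fix w assume "w \<in> g i ` box a b \<inter> g i' ` box a b"
        then obtain z z' where "z \<in> box a b" "z' \<in> box a b" "g i z = g i' z'" by auto
        then show False using disj[OF i, of z z'] subo by auto
      qed
      then show "negligible (g i ` box a b \<inter> g i' ` box a b)" by simp
    qed
  qed
  moreover have "(e has_integral integral UNIV e) UNIV" using e(1) unfolding absolutely_integrable_on_def by (auto simp: has_integral_iff)
  ultimately show ?thesis by (rule has_integral_subset_le[OF subset_UNIV]) (use e(2) in auto)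
qed

lemma eventually_within_ball:
  assumes "eventually P (at (of_real c) within {z. Im z > 0})"
  obtains \<rho> where "\<rho> > 0" "\<And>z. Im z > 0 \<Longrightarrow> z \<in> ball (of_real c) \<rho> \<Longrightarrow> P z"
proof -
  obtain d where d: "d > 0" "\<And>z. z \<in> {z. Im z > 0} \<Longrightarrow> z \<noteq> of_real c \<Longrightarrow> dist z (of_real c) < d \<Longrightarrow> P z"
    using assms unfolding eventually_at by blast
  show ?thesis
  proof (rule that[OF d(1)])
    fix z assume z: "Im z > 0" "z \<in> ball (of_real c) d"
    then have "z \<noteq> of_real c" by auto
    then show "P z" using d(2)[of z] z by (simp add: dist_commute)
  qed
qed

text \<open>Only the signs 1 and -1 are meant; every value other than 1 selects the left
  half.\<close>

definition hquad :: "real \<Rightarrow> nat \<Rightarrow> complex set" where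
  "hquad s n = (if s = 1 then rquad n else lquad n)"

context sector_param
begin

abbreviation pulled_grad :: "(complex \<Rightarrow> complex) \<Rightarrow> complex \<Rightarrow> complex" where
  "pulled_grad D z \<equiv> D (sector_map z) * deriv sector_map z"

lemma open_upper: "open {z. Im z > 0}" by (simp add: open_halfspace_Im_gt)

lemma sector_map_continuous: "continuous_on {z. Im z > 0} sector_map" "continuous_on {z. Im z > 0} (deriv sector_map)"
  using sector_map_holomorphic open_upper by (auto intro!: holomorphic_on_imp_continuous_on holomorphic_deriv)

lemma model_field_continuous: "continuous_on {z. Im z > 0} (model_field T)"
  by (rule holomorphic_on_imp_continuous_on[OF model_field_holomorphic])

lemma pulled_grad: 
  assumes "\<And>w. grad \<phi> (D w) w" "continuous_on UNIV D"
  shows "Im z > 0 \<Longrightarrow> grad (\<lambda>z. \<phi> (sector_map z)) (pulled_grad D z) z" "continuous_on {z. Im z > 0} (pulled_grad D)"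
proof -
  show "grad (\<lambda>z. \<phi> (sector_map z)) (pulled_grad D z) z" if "Im z > 0"
    by (rule grad_compose_holomorphic[OF assms(1)]) (use sector_map_holomorphic open_upper that in \<open>auto intro: holomorphic_derivI\<close>)
  show "continuous_on {z. Im z > 0} (pulled_grad D)"
    by (intro continuous_intros sector_map_continuous continuous_on_compose2[OF assms(2) sector_map_continuous(1)]) auto
qed

lemma const_near_end:
  assumes "s = 1 \<or> s = -1" "\<rho> > 0" "\<And>w. w \<in> ball (endpoint s) \<rho> \<Longrightarrow> \<phi> w = c"
  obtains r where "r > 0" "\<And>z. Im z > 0 \<Longrightarrow> z \<in> ball (of_real s) r \<Longrightarrow> \<phi> (sector_map z) = c"
proof -
  have "eventually (\<lambda>z. dist (sector_map z) (endpoint s) < \<rho>) (at (of_real s) within {z. Im z > 0})"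
    using sector_map_tendsto_end[OF assms(1)] assms(2) by (rule tendstoD)
  then have "eventually (\<lambda>z. \<phi> (sector_map z) = c) (at (of_real s) within {z. Im z > 0})"
    by eventually_elim (use assms(3) in \<open>auto simp: dist_commute\<close>)
  then show ?thesis by (rule eventually_within_ball) (rule that)
qed

lemma const_near_zero:
  assumes "s = 1 \<or> s = -1" "\<rho> > 0" "\<And>w. w \<in> ball 0 \<rho> \<Longrightarrow> \<phi> w = c"
  obtains r where "r > 0" "\<And>z. Im z > 0 \<Longrightarrow> z \<in> ball (of_real (s * T)) r \<Longrightarrow> \<phi> (sector_map z) = c"
proof -
  have "eventually (\<lambda>z. dist (sector_map z) 0 < \<rho>) (at (of_real (s * T)) within {z. Im z > 0})"
    using sector_map_tendsto_zero[OF assms(1)] assms(2) by (rule tendstoD)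
  then have "eventually (\<lambda>z. \<phi> (sector_map z) = c) (at (of_real (s * T)) within {z. Im z > 0})"
    by eventually_elim (use assms(3) in \<open>auto simp: dist_commute\<close>)
  then show ?thesis by (rule eventually_within_ball) (rule that)
qed

text \<open>The contribution of the common side of the two quadrants; it enters their fluxes with
  opposite signs.\<close>

definition axis_term :: "(complex \<Rightarrow> real) \<Rightarrow> nat \<Rightarrow> real" where
  "axis_term \<phi> n = integral {1 / (real n)\<^sup>2..real n} (\<lambda>y. \<phi> (sector_map (Complex 0 y)) * Re (model_field T (Complex 0 y)))"

lemma sector_flux:
  assumes D: "\<And>w. grad \<phi> (D w) w" "continuous_on UNIV D" and bd: "\<And>w. \<bar>\<phi> w\<bar> \<le> Bd"
    and \<rho>: "\<rho> > 0" "\<And>w. w \<in> ball (endpoint 1) \<rho> \<Longrightarrow> \<phi> w = c1" "\<And>w. w \<in> ball (endpoint (-1)) \<rho> \<Longrightarrow> \<phi> w = c2"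
      "\<And>w. w \<in> ball 0 \<rho> \<Longrightarrow> \<phi> w = c0"
  shows "(\<lambda>n. integral (rquad n) (\<lambda>z. Re (pulled_grad D z * cnj (model_field T z))) + axis_term \<phi> n) \<longlonglongrightarrow> pi * (c1 - T * c0)"
    "(\<lambda>n. integral (lquad n) (\<lambda>z. Re (pulled_grad D z * cnj (model_field T z))) - axis_term \<phi> n) \<longlonglongrightarrow> - pi * (c2 - T * c0)"
proof -
  obtain r1 where r1: "r1 > 0" "\<And>z. Im z > 0 \<Longrightarrow> z \<in> ball (of_real 1) r1 \<Longrightarrow> \<phi> (sector_map z) = c1"
    by (rule const_near_end[of 1, OF _ \<rho>(1,2)]) auto
  obtain r2 where r2: "r2 > 0" "\<And>z. Im z > 0 \<Longrightarrow> z \<in> ball (of_real (-1)) r2 \<Longrightarrow> \<phi> (sector_map z) = c2"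
    by (rule const_near_end[of "-1", OF _ \<rho>(1,3)]) auto
  obtain r3 where r3: "r3 > 0" "\<And>z. Im z > 0 \<Longrightarrow> z \<in> ball (of_real (1 * T)) r3 \<Longrightarrow> \<phi> (sector_map z) = c0"
    by (rule const_near_zero[of 1, OF _ \<rho>(1,4)]) auto
  obtain r4 where r4: "r4 > 0" "\<And>z. Im z > 0 \<Longrightarrow> z \<in> ball (of_real (-1 * T)) r4 \<Longrightarrow> \<phi> (sector_map z) = c0"
    by (rule const_near_zero[of "-1", OF _ \<rho>(1,4)]) auto
  define r where "r = Min {r1, r2, r3, r4}"
  have r: "r > 0" "r \<le> r1" "r \<le> r2" "r \<le> r3" "r \<le> r4" using r1 r2 r3 r4 by (auto simp: r_def)
  show "(\<lambda>n. integral (rquad n) (\<lambda>z. Re (pulled_grad D z * cnj (model_field T z))) + axis_term \<phi> n) \<longlonglongrightarrow> pi * (c1 - T * c0)"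
    unfolding axis_term_def
    by (rule quadrant_flux[OF T pulled_grad(1)[OF D] pulled_grad(2)[OF D] bd r(1)]) (use r1(2) r3(2) r in auto)
  show "(\<lambda>n. integral (lquad n) (\<lambda>z. Re (pulled_grad D z * cnj (model_field T z))) - axis_term \<phi> n) \<longlonglongrightarrow> - pi * (c2 - T * c0)"
    unfolding axis_term_def
    by (rule quadrant_flux_left[OF T pulled_grad(1)[OF D] pulled_grad(2)[OF D] bd r(1)]) (use r2(2) r4(2) r in auto)
qed


lemma axis_term_nonneg:
  assumes "\<And>w. 0 \<le> \<phi> w" "n \<ge> 1"
  shows "0 \<le> axis_term \<phi> n"
proof -
  let ?h = "\<lambda>y. \<phi> (sector_map (Complex 0 y)) * Re (model_field T (Complex 0 y))"
  have d: "0 < 1 / (real n)\<^sup>2" using assms(2) by simp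
  have "0 \<le> ?h y" if "y \<in> {1 / (real n)\<^sup>2..real n}" for y
    using assms(1) model_field_imaginary_axis[of y T] T less_le_trans[OF d, of y] that by simp
  \<comment> \<open>If the integrand were not integrable, the integral would be 0 by
    convention.\<close>
  then show ?thesis unfolding axis_term_def
    by (cases "?h integrable_on {1 / (real n)\<^sup>2..real n}")
       (auto intro!: Henstock_Kurzweil_Integration.integral_nonneg simp: not_integrable_integral)
qed

lemma hquad_upper: "n \<ge> 1 \<Longrightarrow> hquad s n \<subseteq> {z. Im z > 0}"
proof -
  assume "n \<ge> 1"
  then have d: "0 < 1 / (real n)\<^sup>2" by simp
  show ?thesis by (auto simp: hquad_def in_cbox_complex_iff intro: less_le_trans[OF d] split: if_splits)
qed

lemma hquad_integrable: "continuous_on {z. Im z > 0} F \<Longrightarrow> n \<ge> 1 \<Longrightarrow> (F :: complex \<Rightarrow> real) integrable_on hquad s n"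
  using hquad_upper[of n s] unfolding hquad_def
  by (cases "s = 1") (auto intro!: integrable_continuous intro: continuous_on_subset)

text \<open>The pointwise inequality is applied with the field rotated by the argument of
  \<open>deriv sector_map\<close>, and with \<beta> multiplied by the modulus of this derivative.
  The density \<open>e\<close> then receives the squared modulus of the derivative, as a pulled-back
  energy must, while the field keeps its modulus.\<close>

lemma sector_amgm:
  assumes D: "continuous_on UNIV D" and e: "continuous_on UNIV e" and q: "continuous_on UNIV q"
    and pw: "\<And>w \<alpha> \<xi>. 2 * \<alpha> * Re (D w * cnj \<xi>) \<le> \<alpha>\<^sup>2 * e w + q w * (cmod \<xi>)\<^sup>2"
    and n: "n \<ge> 1"
  shows "2 * \<beta> * integral (hquad s n) (\<lambda>z. Re (pulled_grad D z * cnj (model_field T z))) \<le>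
    \<beta>\<^sup>2 * integral (hquad s n) (\<lambda>z. e (sector_map z) * (cmod (deriv sector_map z))\<^sup>2)
    + integral (hquad s n) (\<lambda>z. q (sector_map z) * (cmod (model_field T z))\<^sup>2)"
proof -
  note sc = sector_map_continuous model_field_continuous
  have c1: "continuous_on {z. Im z > 0} (\<lambda>z. Re (pulled_grad D z * cnj (model_field T z)))"
    by (intro continuous_intros sc continuous_on_compose2[OF D sc(1)]) auto
  have c2: "continuous_on {z. Im z > 0} (\<lambda>z. e (sector_map z) * (cmod (deriv sector_map z))\<^sup>2)"
    by (intro continuous_intros sc continuous_on_compose2[OF e sc(1)]) auto
  have c3: "continuous_on {z. Im z > 0} (\<lambda>z. q (sector_map z) * (cmod (model_field T z))\<^sup>2)"
    by (intro continuous_intros sc continuous_on_compose2[OF q sc(1)]) auto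
  have pt: "2 * \<beta> * Re (pulled_grad D z * cnj (model_field T z)) \<le> \<beta>\<^sup>2 * (e (sector_map z) * (cmod (deriv sector_map z))\<^sup>2) + q (sector_map z) * (cmod (model_field T z))\<^sup>2" for z
  proof (cases "deriv sector_map z = 0")
    case True
    have "0 \<le> q (sector_map z) * (cmod (model_field T z))\<^sup>2" using pw[of 0 "sector_map z" "model_field T z"] by simp
    then show ?thesis using True by simp
  next
    case False
    define G where "G = deriv sector_map z"
    define f where "f = model_field T z"
    define w where "w = sector_map z"
    have G: "G \<noteq> 0" "cmod G \<noteq> 0" using False by (auto simp: G_def)
    have 1: "D w * cnj (f * cnj G / of_real (cmod G)) = D w * G * cnj f / of_real (cmod G)" by simp
    have "2 * (\<beta> * cmod G) * Re (D w * cnj (f * cnj G / of_real (cmod G))) = 2 * \<beta> * Re (D w * G * cnj f)"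
      unfolding 1 Re_divide_of_real using G by simp
    moreover have "cmod (f * cnj G / of_real (cmod G)) = cmod f" using G by (simp add: norm_divide norm_mult)
    ultimately show ?thesis using pw[of "\<beta> * cmod G" w "f * cnj G / of_real (cmod G)"]
      unfolding G_def[symmetric] f_def[symmetric] w_def[symmetric] by (simp add: power_mult_distrib mult_ac)
  qed
  have "2 * \<beta> * integral (hquad s n) (\<lambda>z. Re (pulled_grad D z * cnj (model_field T z))) = integral (hquad s n) (\<lambda>z. 2 * \<beta> * Re (pulled_grad D z * cnj (model_field T z)))"
    by simp
  also have "\<dots> \<le> integral (hquad s n) (\<lambda>z. \<beta>\<^sup>2 * (e (sector_map z) * (cmod (deriv sector_map z))\<^sup>2) + q (sector_map z) * (cmod (model_field T z))\<^sup>2)"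
    by (rule integral_le) (intro hquad_integrable[OF _ n] continuous_on_add continuous_on_mult continuous_on_const c1 c2 c3 | rule pt)+
  also have "\<dots> = integral (hquad s n) (\<lambda>z. \<beta>\<^sup>2 * (e (sector_map z) * (cmod (deriv sector_map z))\<^sup>2)) + integral (hquad s n) (\<lambda>z. q (sector_map z) * (cmod (model_field T z))\<^sup>2)"
    by (rule Henstock_Kurzweil_Integration.integral_add; rule hquad_integrable[OF _ n]) (intro continuous_on_mult continuous_on_const c2 c3)+
  finally show ?thesis by simp
qed

text \<open>The energy of the field is itself a flux: pairing the field with the gradient of the
  truncated potential gives \<open>s * \<kappa>\<close> times its squared modulus. The potential
  vanishes on the imaginary axis, and with it the axis term, so the quadrant flux has a limit given
  by the two truncation levels. By \<open>sector_containment\<close> the cutoff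
  \<open>\<kappa>\<close> is 1 outside the discs.\<close>

lemma sector_energy:
  assumes s: "s = 1 \<or> s = -1" and \<tau>: "\<tau> > 0"
  shows "\<exists>\<epsilon>0>0. \<forall>\<epsilon>. 0 < \<epsilon> \<and> \<epsilon> < \<epsilon>0 \<longrightarrow> (\<exists>\<kappa> l. continuous_on {z. Im z > 0} \<kappa> \<and> (\<forall>z. 0 \<le> \<kappa> z) \<and>
     (\<forall>z. Im z > 0 \<and> s * Re z \<ge> 0 \<and> \<epsilon> < cmod (sector_map z - endpoint s) \<and> \<epsilon> < cmod (sector_map z) \<longrightarrow> \<kappa> z = 1) \<and>
     l \<le> pi * (ln (1 / \<epsilon>) + end_const s + 2 * \<tau> + T * ((2 * T / \<alpha>) * ln (1 / \<epsilon>) - zero_const + 2 * \<tau>)) \<and>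
     (\<lambda>n. integral (hquad s n) (\<lambda>z. \<kappa> z * (cmod (model_field T z))\<^sup>2)) \<longlonglongrightarrow> l)"
proof -
  obtain \<epsilon>1 where \<epsilon>1: "\<epsilon>1 > 0" "\<And>\<epsilon> z. 0 < \<epsilon> \<Longrightarrow> \<epsilon> < \<epsilon>1 \<Longrightarrow> Im z > 0 \<Longrightarrow> s * Re z \<ge> 0 \<Longrightarrow> \<epsilon> < cmod (sector_map z - endpoint s) \<Longrightarrow> \<epsilon> < cmod (sector_map z) \<Longrightarrow>
     s * potential z \<le> ln (1 / \<epsilon>) + end_const s + \<tau> \<and> - ((2 * T / \<alpha>) * ln (1 / \<epsilon>) - zero_const + \<tau>) \<le> s * potential z"
    using sector_containment[OF s \<tau>] by blast
  \<comment> \<open>The last two entries make \<open>M\<close> and \<open>L\<close> positive, so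
    that 0, where \<open>K\<close> vanishes, lies between the truncation levels.\<close>
  define \<epsilon>0 where "\<epsilon>0 = Min {\<epsilon>1, exp (end_const s), exp (- (zero_const * \<alpha> / (2 * T)))}"
  show ?thesis
  proof (rule exI[of _ \<epsilon>0], intro conjI allI impI)
    show "\<epsilon>0 > 0" using \<epsilon>1 by (simp add: \<epsilon>0_def)
    fix \<epsilon> assume "0 < \<epsilon> \<and> \<epsilon> < \<epsilon>0"
    then have \<epsilon>: "0 < \<epsilon>" "\<epsilon> < \<epsilon>1" "\<epsilon> < exp (end_const s)" "\<epsilon> < exp (- (zero_const * \<alpha> / (2 * T)))" by (auto simp: \<epsilon>0_def)
    define M where "M = ln (1 / \<epsilon>) + end_const s + \<tau>"
    define L where "L = (2 * T / \<alpha>) * ln (1 / \<epsilon>) - zero_const + \<tau>"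
    have "ln \<epsilon> < end_const s" using \<epsilon> by (metis exp_less_cancel_iff exp_ln)
    then have M: "M > 0" using \<tau> \<epsilon>(1) by (simp add: M_def ln_div)
    have "ln \<epsilon> < - (zero_const * \<alpha> / (2 * T))" using \<epsilon> by (metis exp_less_cancel_iff exp_ln)
    then have "zero_const * \<alpha> / (2 * T) < ln (1 / \<epsilon>)" using \<epsilon>(1) by (simp add: ln_div)
    then have "(2 * T / \<alpha>) * (zero_const * \<alpha> / (2 * T)) \<le> (2 * T / \<alpha>) * ln (1 / \<epsilon>)" using T \<alpha> by (intro mult_left_mono) auto
    moreover have "(2 * T / \<alpha>) * (zero_const * \<alpha> / (2 * T)) = zero_const" using T \<alpha> by simp
    ultimately have L: "L > 0" using \<tau> by (simp add: L_def)
    have t: "- L < M" using L M by linarith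
    obtain k K where k: "continuous_on UNIV k" "\<And>x. 0 \<le> k x" "\<And>x. k x \<le> 1"
      "\<And>x. - L \<le> x \<Longrightarrow> x \<le> M \<Longrightarrow> k x = 1"
      "\<And>x. x \<le> - L - \<tau> \<Longrightarrow> k x = 0" "\<And>x. x \<ge> M + \<tau> \<Longrightarrow> k x = 0"
      and K: "\<And>x. (K has_real_derivative k x) (at x)" "K 0 = 0"
      "\<And>x. x \<le> - L - \<tau> \<Longrightarrow> K x = K (- L - \<tau>)" "\<And>x. x \<ge> M + \<tau> \<Longrightarrow> K x = K (M + \<tau>)"
      "\<And>x y. x \<le> y \<Longrightarrow> K x \<le> K y" "\<And>x y. x \<le> y \<Longrightarrow> K y - K x \<le> y - x"
      "K M - K (- L) = M - - L"
      by (fact trapezoid_antiderivative[OF t \<tau>])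
    define \<phi> where "\<phi> z = K (s * potential z)" for z
    define \<kappa> where "\<kappa> z = k (s * potential z)" for z
    define D where "D z = of_real (\<kappa> z) * (of_real s * model_field T z)" for z
    have gr: "grad \<phi> (D z) z" if "Im z > 0" for z
    proof -
      have "grad (\<lambda>z. s * potential z) (of_real s * model_field T z) z"
        by (rule grad_compose_real[OF potential_grad[OF that]]) (auto intro!: derivative_eq_intros)
      from grad_compose_real[OF this K(1)] show ?thesis by (simp only: \<phi>_def[abs_def] D_def \<kappa>_def)
    qed
    have cV: "continuous_on {z. Im z > 0} potential"
      using potential_grad has_derivative_continuous by (force simp: grad_def continuous_on_eq_continuous_at[OF open_upper])
    have c\<kappa>: "continuous_on {z. Im z > 0} \<kappa>" unfolding \<kappa>_def
      by (rule continuous_on_compose2[OF k(1)]) (auto intro!: continuous_intros cV)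
    have cD: "continuous_on {z. Im z > 0} D" unfolding D_def by (intro continuous_intros c\<kappa> model_field_continuous)
    have bd: "\<bar>\<phi> z\<bar> \<le> \<bar>K (- L - \<tau>)\<bar> + \<bar>K (M + \<tau>)\<bar>" for z
    proof -
      have "K (- L - \<tau>) \<le> K x \<and> K x \<le> K (M + \<tau>)" for x
        using K(3)[of x] K(4)[of x] K(5)[of x "M + \<tau>"] K(5)[of "- L - \<tau>" x] K(5)[of "- L - \<tau>" "M + \<tau>"] t \<tau> by linarith
      from this[of "s * potential z"] show ?thesis unfolding \<phi>_def by linarith
    qed
    have ax: "\<phi> (Complex 0 y) = 0" for y by (simp add: \<phi>_def potential_imaginary_axis K(2))
    obtain r1 where r1: "r1 > 0" "\<And>z. Im z > 0 \<Longrightarrow> z \<in> ball (of_real s) r1 \<Longrightarrow> M + \<tau> \<le> s * potential z"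
      by (rule eventually_within_ball[OF potential_near_end[OF s, of "M + \<tau>"]]) blast
    obtain r2 where r2: "r2 > 0" "\<And>z. Im z > 0 \<Longrightarrow> z \<in> ball (of_real (s * T)) r2 \<Longrightarrow> s * potential z \<le> - L - \<tau>"
      by (rule eventually_within_ball[OF potential_near_zero[OF s, of "- L - \<tau>"]]) blast
    define r where "r = min r1 r2"
    have r: "r > 0" "\<And>z. Im z > 0 \<Longrightarrow> z \<in> ball (of_real s) r \<Longrightarrow> \<phi> z = K (M + \<tau>)"
       "\<And>z. Im z > 0 \<Longrightarrow> z \<in> ball (of_real (s * T)) r \<Longrightarrow> \<phi> z = K (- L - \<tau>)"
    proof -
      show "r > 0" using r1(1) r2(1) by (simp add: r_def)
      show "\<phi> z = K (M + \<tau>)" if "Im z > 0" "z \<in> ball (of_real s) r" for z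
        unfolding \<phi>_def by (rule K(4), rule r1(2)) (use that in \<open>simp_all add: r_def\<close>)
      show "\<phi> z = K (- L - \<tau>)" if "Im z > 0" "z \<in> ball (of_real (s * T)) r" for z
        unfolding \<phi>_def by (rule K(3), rule r2(2)) (use that in \<open>simp_all add: r_def\<close>)
    qed
    define l where "l = pi * (K (M + \<tau>) - T * K (- L - \<tau>))"
    have int: "Re (D z * cnj (model_field T z)) = s * (\<kappa> z * (cmod (model_field T z))\<^sup>2)" for z
    proof -
      have "D z * cnj (model_field T z) = of_real (s * (\<kappa> z * (cmod (model_field T z))\<^sup>2))"
        unfolding D_def of_real_mult complex_norm_square by (simp add: mult_ac)
      then show ?thesis by (simp only: Re_complex_of_real)
    qed
    have lim: "(\<lambda>n. integral (hquad s n) (\<lambda>z. \<kappa> z * (cmod (model_field T z))\<^sup>2)) \<longlonglongrightarrow> l"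
    proof (cases "s = 1")
      case True
      have "(\<lambda>n. integral (rquad n) (\<lambda>z. Re (D z * cnj (model_field T z))) + integral {1 / (real n)\<^sup>2..real n} (\<lambda>y. \<phi> (Complex 0 y) * Re (model_field T (Complex 0 y)))) \<longlonglongrightarrow> pi * (K (M + \<tau>) - T * K (- L - \<tau>))"
        by (rule quadrant_flux[OF T gr cD bd r(1)]) (use r(2,3) True in auto)
      then show ?thesis unfolding int ax using True by (simp add: l_def hquad_def)
    next
      case False
      then have s1: "s = -1" using s by simp
      have "(\<lambda>n. integral (lquad n) (\<lambda>z. Re (D z * cnj (model_field T z))) - integral {1 / (real n)\<^sup>2..real n} (\<lambda>y. \<phi> (Complex 0 y) * Re (model_field T (Complex 0 y)))) \<longlonglongrightarrow> - pi * (K (M + \<tau>) - T * K (- L - \<tau>))"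
        by (rule quadrant_flux_left[OF T gr cD bd r(1)]) (use r(2,3) s1 in auto)
      then have "(\<lambda>n. - integral (lquad n) (\<lambda>z. \<kappa> z * (cmod (model_field T z))\<^sup>2)) \<longlonglongrightarrow> - l" unfolding int ax using s1 by (simp add: l_def)
      from tendsto_minus[OF this] show ?thesis using s1 by (simp add: hquad_def)
    qed
    have "l \<le> pi * (M + \<tau> + T * (L + \<tau>))"
    proof -
      have "K (M + \<tau>) \<le> M + \<tau>" using K(6)[of 0 "M + \<tau>"] K(2) M \<tau> by simp
      moreover have "- K (- L - \<tau>) \<le> L + \<tau>" using K(6)[of "- L - \<tau>" 0] K(2) L \<tau> by simp
      then have "T * (- K (- L - \<tau>)) \<le> T * (L + \<tau>)" using T by (intro mult_left_mono) auto
      ultimately show ?thesis unfolding l_def by (intro mult_left_mono) auto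
    qed
    then have lle: "l \<le> pi * (ln (1 / \<epsilon>) + end_const s + 2 * \<tau> + T * ((2 * T / \<alpha>) * ln (1 / \<epsilon>) - zero_const + 2 * \<tau>))"
      by (simp only: M_def L_def add.assoc mult_2)
    have one: "\<kappa> z = 1" if "Im z > 0" "s * Re z \<ge> 0" "\<epsilon> < cmod (sector_map z - endpoint s)" "\<epsilon> < cmod (sector_map z)" for z
      using \<epsilon>1(2)[OF \<epsilon>(1,2) that] k(4) unfolding \<kappa>_def M_def L_def by blast
    show "\<exists>\<kappa> l. continuous_on {z. Im z > 0} \<kappa> \<and> (\<forall>z. 0 \<le> \<kappa> z) \<and>
     (\<forall>z. Im z > 0 \<and> s * Re z \<ge> 0 \<and> \<epsilon> < cmod (sector_map z - endpoint s) \<and> \<epsilon> < cmod (sector_map z) \<longrightarrow> \<kappa> z = 1) \<and>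
     l \<le> pi * (ln (1 / \<epsilon>) + end_const s + 2 * \<tau> + T * ((2 * T / \<alpha>) * ln (1 / \<epsilon>) - zero_const + 2 * \<tau>)) \<and>
     (\<lambda>n. integral (hquad s n) (\<lambda>z. \<kappa> z * (cmod (model_field T z))\<^sup>2)) \<longlonglongrightarrow> l"
    proof (rule exI[of _ \<kappa>], rule exI[of _ l], intro conjI allI impI)
      show "0 \<le> \<kappa> z" for z unfolding \<kappa>_def by (rule k(2))
      show "\<kappa> z = 1" if "Im z > 0 \<and> s * Re z \<ge> 0 \<and> \<epsilon> < cmod (sector_map z - endpoint s) \<and> \<epsilon> < cmod (sector_map z)" for z
        using one[of z] that by blast
    qed (fact c\<kappa> lle lim)+
  qed
qed

end

section \<open>The sector inequality\<close>

lemma tendsto_sum_le_limit: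
  fixes a :: "nat \<Rightarrow> real"
  assumes "a \<longlonglongrightarrow> x" "b \<longlonglongrightarrow> y" "\<And>n. n \<ge> 1 \<Longrightarrow> a n \<le> b n"
  shows "x \<le> y"
  by (rule LIMSEQ_le[OF assms(1,2)]) (use assms(3) in blast)

text \<open>Index \<open>m\<close> repeats index 0 after a full turn, so every sector lies between
  \<open>j\<close> and \<open>Suc j\<close>, the last one included. \<open>small\<close> is the
  condition \<open>TT j < 1\<close> of \<open>sector_param\<close>.\<close>

locale sector_family =
  fixes m :: nat and \<theta> r :: "nat \<Rightarrow> real" and \<gamma> :: real
  assumes m: "m \<ge> 2" and \<gamma>: "\<gamma> > 0" and \<theta>: "\<And>j. j < m \<Longrightarrow> \<theta> j < \<theta> (Suc j)" "\<theta> m = \<theta> 0 + 2 * pi"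
    and r: "\<And>j. j \<le> m \<Longrightarrow> r j > 0" "r m = r 0"
    and small: "\<And>j. j < m \<Longrightarrow> sqrt \<gamma> * (\<theta> (Suc j) - \<theta> j) < 2 * pi"
begin

definition "al j = (\<theta> (Suc j) - \<theta> j) / pi"
text \<open>Chosen so that \<open>2 * TT j / al j\<close> is \<open>sqrt \<gamma>\<close> in every
  sector: all fields have the same strength at the origin, and the \<open>TT j\<close> sum to
  \<open>sqrt \<gamma>\<close>.\<close>

definition "TT j = sqrt \<gamma> * al j / 2"
definition "AA j = (1 / r j powr (1 / al j) + 1 / r (Suc j) powr (1 / al j)) / 2"
definition "BB j = (1 / r j powr (1 / al j) - 1 / r (Suc j) powr (1 / al j)) / 2"
definition "pt j = of_real (r j) * cis (\<theta> j)"
definition "nx j = (if Suc j < m then Suc j else 0)"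
definition "pr j = (if j = 0 then m - 1 else j - 1)"
abbreviation "sm j \<equiv> sector_param.sector_map (TT j) (AA j) (BB j) (al j) (\<theta> j)"
abbreviation "ep j \<equiv> sector_param.endpoint (AA j) (BB j) (al j) (\<theta> j)"
abbreviation "ec j \<equiv> sector_param.end_const (TT j) (AA j) (BB j) (al j)"
abbreviation "zc j \<equiv> sector_param.zero_const (TT j) (AA j)"

lemma theta_mono: "i \<le> j \<Longrightarrow> j \<le> m \<Longrightarrow> \<theta> i \<le> \<theta> j"
proof (induction j)
  case (Suc j)
  show ?case
  proof (cases "i = Suc j")
    case False
    then have "\<theta> i \<le> \<theta> j" using Suc by simp
    then show ?thesis using \<theta>(1)[of j] Suc.prems by simp
  qed simp
qed simp

lemma al_pos: "j < m \<Longrightarrow> al j > 0"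
  using \<theta>(1) by (simp add: al_def)

lemma al_le: "j < m \<Longrightarrow> al j \<le> 2"
  using theta_mono[of 0 j] theta_mono[of "Suc j" m] \<theta>(2) by (simp add: al_def divide_le_eq)

lemma sum_al: "(\<Sum>j<m. al j) = 2"
proof -
  have "(\<Sum>j<m. al j) = (\<Sum>j<m. \<theta> (Suc j) - \<theta> j) / pi" by (simp add: al_def sum_divide_distrib)
  also have "(\<Sum>j<m. \<theta> (Suc j) - \<theta> j) = \<theta> m - \<theta> 0" by (rule sum_lessThan_telescope)
  finally show ?thesis using \<theta>(2) by simp
qed

lemma AB_sum: "AA j + BB j = 1 / r j powr (1 / al j)" "AA j - BB j = 1 / r (Suc j) powr (1 / al j)"
  by (simp_all add: AA_def BB_def field_simps)

lemma sp: "j < m \<Longrightarrow> sector_param (TT j) (AA j) (BB j) (al j)"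
proof
  assume j: "j < m"
  show "0 < TT j" using al_pos[OF j] \<gamma> by (simp add: TT_def)
  show "TT j < 1" using small[OF j] by (simp add: TT_def al_def field_simps)
  show "0 < AA j + BB j" "0 < AA j - BB j" unfolding AB_sum using r(1)[of j] r(1)[of "Suc j"] j by auto
  show "0 < al j" "al j \<le> 2" using al_pos al_le j by auto
qed

lemma ep_eq:
  assumes j: "j < m"
  shows "ep j 1 = pt j" "ep j (-1) = pt (nx j)"
proof -
  have al: "al j \<noteq> 0" using al_pos[OF j] by simp
  have pw: "(1 / (1 / x powr (1 / al j))) powr al j = x" if "x > 0" for x
    using that al by (simp add: powr_powr)
  have "ep j 1 = of_real (r j) * cis (\<theta> j)"
    using pw[OF r(1)[of j]] j by (simp add: sector_param.endpoint_def[OF sp[OF j]] AB_sum)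
  then show "ep j 1 = pt j" by (simp add: pt_def)
  have "ep j (-1) = of_real ((1 / (AA j - BB j)) powr al j) * cis (\<theta> j + al j * pi)"
    by (simp add: sector_param.endpoint_def[OF sp[OF j]])
  also have "\<theta> j + al j * pi = \<theta> (Suc j)" by (simp add: al_def)
  also have "(1 / (AA j - BB j)) powr al j = r (Suc j)" unfolding AB_sum by (rule pw[OF r(1)]) (use j in simp)
  finally have e: "ep j (-1) = of_real (r (Suc j)) * cis (\<theta> (Suc j))" .
  show "ep j (-1) = pt (nx j)"
  proof (cases "Suc j < m")
    case True then show ?thesis using e by (simp add: pt_def nx_def)
  next
    case False
    then have "Suc j = m" using j by simp
    moreover have "cis (\<theta> 0 + 2 * pi) = cis (\<theta> 0)" by (simp add: cis_mult[symmetric])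
    ultimately show ?thesis using e r(2) \<theta>(2) by (simp add: pt_def nx_def)
  qed
qed

lemma nx_pr: "k < m \<Longrightarrow> pr k < m" "k < m \<Longrightarrow> nx (pr k) = k" "k < m \<Longrightarrow> pr k \<noteq> k" "j < m \<Longrightarrow> nx j < m" "j < m \<Longrightarrow> nx j = k \<longleftrightarrow> j = pr k \<and> k < m"
  "j < m \<Longrightarrow> nx j \<noteq> j"
  using m by (auto simp: nx_def pr_def split: if_splits)

text \<open>The arguments of the images lie in the open intervals from \<open>\<theta> j\<close> to
  \<open>\<theta> (Suc j)\<close>, which are disjoint and fill one full turn.\<close>

lemma sm_disjoint:
  assumes ij: "i < m" "j < m" "i \<noteq> j" and z: "Im z > 0" "Im w > 0"
  shows "sm i z \<noteq> sm j w"
proof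
  assume eq: "sm i z = sm j w"
  have *: "False" if ij: "i < j" "j < m" and z: "Im z > 0" "Im w > 0" and eq: "sm i z = sm j w" for i j z w
  proof -
    have i: "i < m" using ij by simp
    note si = sp[OF i] and sj = sp[OF ij(2)]
    obtain t where t: "0 < t" "t < pi" "sm i z = of_real (cmod (sector_param.slit_map (AA i) (BB i) (sector_param.root_map (TT i) z)) powr al i) * cis (\<theta> i + al i * t)"
      by (rule sector_param.sector_map_polar[OF si z(1)])
    obtain u where u: "0 < u" "u < pi" "sm j w = of_real (cmod (sector_param.slit_map (AA j) (BB j) (sector_param.root_map (TT j) w)) powr al j) * cis (\<theta> j + al j * u)"
      by (rule sector_param.sector_map_polar[OF sj z(2)])
    define x where "x = cmod (sector_param.slit_map (AA i) (BB i) (sector_param.root_map (TT i) z)) powr al i"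
    define y where "y = cmod (sector_param.slit_map (AA j) (BB j) (sector_param.root_map (TT j) w)) powr al j"
    have x: "x > 0" unfolding x_def using sector_param.Re_slit_map[OF si sector_param.Re_root_map[OF si z(1)]] by (auto intro!: powr_gt_zero[THEN iffD2])
    have y: "y \<ge> 0" by (simp add: y_def)
    have e: "of_real x * cis (\<theta> i + al i * t) = of_real y * cis (\<theta> j + al j * u)" using eq t(3) u(3) by (simp only: x_def y_def)
    then have "cmod (of_real x * cis (\<theta> i + al i * t)) = cmod (of_real y * cis (\<theta> j + al j * u))" by (simp only:)
    then have "x = y" using x y by (simp add: norm_mult)
    then have "cis (\<theta> i + al i * t) = cis (\<theta> j + al j * u)" using e x by simp
    then have "exp (\<i> * of_real (\<theta> i + al i * t)) = exp (\<i> * of_real (\<theta> j + al j * u))" by (simp only: cis_conv_exp)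
    moreover have b: "\<theta> i + al i * t < \<theta> j + al j * u" "\<theta> j + al j * u < \<theta> i + al i * t + 2 * pi"
    proof -
      have "al i * t < al i * pi" "0 < al i * t" using t al_pos[OF i] by simp_all
      then have 1: "\<theta> i < \<theta> i + al i * t" "\<theta> i + al i * t < \<theta> (Suc i)" by (simp_all add: al_def)
      have "al j * u < al j * pi" "0 < al j * u" using u al_pos[OF ij(2)] by simp_all
      then have 2: "\<theta> j < \<theta> j + al j * u" "\<theta> j + al j * u < \<theta> (Suc j)" by (simp_all add: al_def)
      have "\<theta> (Suc i) \<le> \<theta> j" "\<theta> (Suc j) \<le> \<theta> m" "\<theta> 0 \<le> \<theta> i" using ij by (auto intro!: theta_mono)
      then show "\<theta> i + al i * t < \<theta> j + al j * u" "\<theta> j + al j * u < \<theta> i + al i * t + 2 * pi" using 1 2 \<theta>(2) by linarith+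
    qed
    moreover have "\<bar>Im (\<i> * complex_of_real (\<theta> i + al i * t)) - Im (\<i> * of_real (\<theta> j + al j * u))\<bar> < 2 * pi"
      using b unfolding Im_i_times Re_complex_of_real abs_less_iff by linarith
    ultimately have "\<i> * complex_of_real (\<theta> i + al i * t) = \<i> * of_real (\<theta> j + al j * u)"
      using exp_complex_eqI by blast
    then have "complex_of_real (\<theta> i + al i * t) = of_real (\<theta> j + al j * u)" by simp
    then show False using b(1) by (simp only: of_real_eq_iff)
  qed
  show False
  proof (cases "i < j")
    case True then show ?thesis using * ij z eq by blast
  next
    case False then have "j < i" using ij by simp
    then show ?thesis using *[of j i w z] ij z eq by simp
  qed
qed

text \<open>With \<open>W\<close> the weighted sum of the levels \<open>\<Psi> k\<close>, twice the
  signed pairings add up to \<open>4 * pi * W\<close> in the limit, while the weighted energies of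
  the test functions amount to at most \<open>2 * pi * W\<close>. The surplus
  \<open>2 * pi * W\<close> is therefore bounded by the energy of the fields outside discs of radius
  \<epsilon>, in which \<open>ln (1 / \<epsilon>)\<close> has the same coefficient
  \<open>2 * pi * (m + \<gamma>)\<close>.\<close>

theorem sector_inequality:
  assumes U: "\<And>k. k \<le> m \<Longrightarrow> open (U k)" and disj: "\<And>k l. k \<le> m \<Longrightarrow> l \<le> m \<Longrightarrow> k \<noteq> l \<Longrightarrow> U k \<inter> U l = {}"
    and c: "\<And>k. k \<le> m \<Longrightarrow> c k \<in> U k" "\<And>k. k < m \<Longrightarrow> c k = pt k" "c m = 0"
    and v: "\<And>k. k \<le> m \<Longrightarrow> green_approx (U k) (c k) (v k)"
  shows "\<gamma> * v m + (\<Sum>k<m. v k) \<le> (\<Sum>j<m. (ec j 1 + ec j (-1) - 2 * TT j * zc j) / 2)"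
proof (rule field_le_epsilon)
  fix \<eta> :: real assume \<eta>: "\<eta> > 0"
  \<comment> \<open>The total coefficient of \<open>\<tau>\<close> in the final estimate.\<close>
  define CC where "CC = (\<gamma> + m) + (\<Sum>j<m. 2 + 2 * TT j)"
  have T0: "TT j > 0" "TT j < 1" if "j < m" for j using sp[OF that] sector_param.T by auto
  have "0 \<le> (\<Sum>j<m. 2 + 2 * TT j)" using T0 by (intro sum_nonneg) (auto simp: less_imp_le)
  then have CC: "CC > 0" using \<gamma> m by (simp add: CC_def)
  define \<tau> where "\<tau> = \<eta> / CC"
  have \<tau>: "\<tau> > 0" "\<tau> * CC = \<eta>" using \<eta> CC by (simp_all add: \<tau>_def)
  define wt where "wt k = (if k < m then 1 else sqrt \<gamma>)" for k

  \<comment> \<open>Test functions and field cutoffs at a common radius\<close>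
  define TF where "TF k \<epsilon> \<phi> D e q \<Psi> \<longleftrightarrow> v k + ln (1 / \<epsilon>) - \<tau> \<le> \<Psi> \<and> 0 \<le> \<Psi> \<and>
     (\<forall>z. grad \<phi> (D z) z) \<and> continuous_on UNIV D \<and> (\<forall>z. 0 \<le> \<phi> z \<and> \<phi> z \<le> \<Psi>) \<and> (\<forall>z. z \<notin> U k \<longrightarrow> \<phi> z = 0) \<and>
     (\<exists>\<rho>>0. \<forall>z\<in>ball (c k) \<rho>. \<phi> z = \<Psi>) \<and> e absolutely_integrable_on UNIV \<and> integral UNIV e = 2 * pi * \<Psi> \<and>
     (\<forall>z. 0 \<le> e z) \<and> continuous_on UNIV e \<and> continuous_on UNIV q \<and> (\<forall>z. 0 \<le> q z \<and> q z \<le> 1) \<and>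
     (\<forall>z. q z \<noteq> 0 \<longrightarrow> z \<in> U k \<and> \<epsilon> < cmod (z - c k)) \<and>
     (\<forall>z \<alpha> \<xi>. 2 * \<alpha> * Re (D z * cnj \<xi>) \<le> \<alpha>\<^sup>2 * e z + q z * (cmod \<xi>)\<^sup>2)"
    for k \<epsilon> and \<phi> :: "complex \<Rightarrow> real" and D :: "complex \<Rightarrow> complex" and e q :: "complex \<Rightarrow> real" and \<Psi> :: real
  define EN where "EN j s \<epsilon> \<kappa> l \<longleftrightarrow> continuous_on {z. Im z > 0} \<kappa> \<and> (\<forall>z. 0 \<le> \<kappa> z) \<and>
     (\<forall>z. Im z > 0 \<and> s * Re z \<ge> 0 \<and> \<epsilon> < cmod (sm j z - ep j s) \<and> \<epsilon> < cmod (sm j z) \<longrightarrow> \<kappa> z = 1) \<and>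
     l \<le> pi * (ln (1 / \<epsilon>) + ec j s + 2 * \<tau> + TT j * ((2 * TT j / al j) * ln (1 / \<epsilon>) - zc j + 2 * \<tau>)) \<and>
     (\<lambda>n. integral (hquad s n) (\<lambda>z. \<kappa> z * (cmod (model_field (TT j) z))\<^sup>2)) \<longlonglongrightarrow> l"
    for j s \<epsilon> and \<kappa> :: "complex \<Rightarrow> real" and l
  have er: "(\<exists>\<epsilon>0>0. \<forall>\<epsilon>. 0 < \<epsilon> \<and> \<epsilon> < \<epsilon>0 \<longrightarrow> P \<epsilon>) \<Longrightarrow> eventually P (at_right (0::real))" for P
    unfolding eventually_at_right_field by blast
  have ev1: "eventually (\<lambda>\<epsilon>. \<forall>k\<in>{..m}. \<exists>\<phi> D e q \<Psi>. TF k \<epsilon> \<phi> D e q \<Psi>) (at_right 0)"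
  proof (rule eventually_ball_finite, simp, rule ballI)
    fix k assume "k \<in> {..m}"
    then have "k \<le> m" by simp
    show "eventually (\<lambda>\<epsilon>. \<exists>\<phi> D e q \<Psi>. TF k \<epsilon> \<phi> D e q \<Psi>) (at_right 0)"
      unfolding TF_def by (rule er[OF green_approx_test_function[OF v[OF \<open>k \<le> m\<close>] \<tau>(1)]])
  qed
  have ev2: "eventually (\<lambda>\<epsilon>. \<forall>j\<in>{..<m}. \<exists>\<kappa> l. EN j s \<epsilon> \<kappa> l) (at_right 0)" if s: "s = 1 \<or> s = -1" for s
  proof (rule eventually_ball_finite, simp, rule ballI)
    fix j assume "j \<in> {..<m}"
    then have "j < m" by simp
    show "eventually (\<lambda>\<epsilon>. \<exists>\<kappa> l. EN j s \<epsilon> \<kappa> l) (at_right 0)"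
      unfolding EN_def by (rule er[OF sector_param.sector_energy[OF sp[OF \<open>j < m\<close>] s \<tau>(1)]])
  qed
  have ev3: "eventually (\<lambda>\<epsilon>. \<forall>k\<in>{..m}. cball (c k) \<epsilon> \<subseteq> U k) (at_right 0)"
  proof (rule eventually_ball_finite, simp, rule ballI, rule er)
    fix k assume "k \<in> {..m}"
    then obtain d where "d > 0" "ball (c k) d \<subseteq> U k" using U[of k] c(1)[of k] open_contains_ball by (metis atMost_iff)
    then show "\<exists>\<epsilon>0>0. \<forall>\<epsilon>. 0 < \<epsilon> \<and> \<epsilon> < \<epsilon>0 \<longrightarrow> cball (c k) \<epsilon> \<subseteq> U k"
      by (intro exI[of _ d]) (auto simp: subset_iff)
  qed
  have ev4: "eventually (\<lambda>\<epsilon>. \<epsilon> > 0) (at_right (0::real))" by (rule eventually_at_right_less)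
  obtain \<epsilon> where \<epsilon>: "\<epsilon> > 0" "\<forall>k\<in>{..m}. \<exists>\<phi> D e q \<Psi>. TF k \<epsilon> \<phi> D e q \<Psi>" "\<forall>j\<in>{..<m}. \<exists>\<kappa> l. EN j 1 \<epsilon> \<kappa> l"
     "\<forall>j\<in>{..<m}. \<exists>\<kappa> l. EN j (-1) \<epsilon> \<kappa> l" "\<forall>k\<in>{..m}. cball (c k) \<epsilon> \<subseteq> U k"
    using eventually_happens'[OF trivial_limit_at_right_real eventually_conj[OF ev4 eventually_conj[OF ev1 eventually_conj[OF ev2[of 1] eventually_conj[OF ev2[of "-1"] ev3]]]]] by auto
  obtain \<phi> D e q \<Psi> where TF: "\<And>k. k \<le> m \<Longrightarrow> TF k \<epsilon> (\<phi> k) (D k) (e k) (q k) (\<Psi> k)"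
    using \<epsilon>(2) by (metis atMost_iff)
  obtain \<kappa>1 l1 where E1: "\<And>j. j < m \<Longrightarrow> EN j 1 \<epsilon> (\<kappa>1 j) (l1 j)" using \<epsilon>(3) by (metis lessThan_iff)
  obtain \<kappa>2 l2 where E2: "\<And>j. j < m \<Longrightarrow> EN j (-1) \<epsilon> (\<kappa>2 j) (l2 j)" using \<epsilon>(4) by (metis lessThan_iff)
  have tPsi: "v k + ln (1 / \<epsilon>) - \<tau> \<le> \<Psi> k" and tPsi0: "0 \<le> \<Psi> k" and tgr: "\<And>z. grad (\<phi> k) (D k z) z" and tcD: "continuous_on UNIV (D k)"
    and tphi: "\<And>z. 0 \<le> \<phi> k z" "\<And>z. \<phi> k z \<le> \<Psi> k" and tout: "\<And>z. z \<notin> U k \<Longrightarrow> \<phi> k z = 0" and tnear: "\<exists>\<rho>>0. \<forall>z\<in>ball (c k) \<rho>. \<phi> k z = \<Psi> k"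
    and tei: "e k absolutely_integrable_on UNIV" "integral UNIV (e k) = 2 * pi * \<Psi> k" and te0: "\<And>z. 0 \<le> e k z" and tce: "continuous_on UNIV (e k)"
    and tcq: "continuous_on UNIV (q k)" and tq: "\<And>z. 0 \<le> q k z" "\<And>z. q k z \<le> 1" and tq0: "\<And>z. q k z \<noteq> 0 \<Longrightarrow> z \<in> U k \<and> \<epsilon> < cmod (z - c k)"
    and tam: "\<And>z \<alpha> \<xi>. 2 * \<alpha> * Re (D k z * cnj \<xi>) \<le> \<alpha>\<^sup>2 * e k z + q k z * (cmod \<xi>)\<^sup>2"
    if "k \<le> m" for k
    using TF[OF that] unfolding TF_def by blast+

  \<comment> \<open>Pairings with the fields on the half sectors\<close>
  define F where "F j = model_field (TT j)" for j
  define IR where "IR k j n = integral (rquad n) (\<lambda>z. Re (D k (sm j z) * deriv (sm j) z * cnj (F j z)))" for k j n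
  define IL where "IL k j n = integral (lquad n) (\<lambda>z. Re (D k (sm j z) * deriv (sm j) z * cnj (F j z)))" for k j n
  define XR where "XR k j n = integral (rquad n) (\<lambda>z. e k (sm j z) * (cmod (deriv (sm j) z))\<^sup>2)" for k j n
  define XL where "XL k j n = integral (lquad n) (\<lambda>z. e k (sm j z) * (cmod (deriv (sm j) z))\<^sup>2)" for k j n
  define QR where "QR k j n = integral (rquad n) (\<lambda>z. q k (sm j z) * (cmod (F j z))\<^sup>2)" for k j n
  define QL where "QL k j n = integral (lquad n) (\<lambda>z. q k (sm j z) * (cmod (F j z))\<^sup>2)" for k j n
  define ax where "ax k j n = sector_param.axis_term (TT j) (AA j) (BB j) (al j) (\<theta> j) (\<phi> k) n" for k j n
  \<comment> \<open>Signs on the right and left half of sector \<open>j\<close>. Point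
    \<open>k\<close> sits at 1 in sector \<open>k\<close> and at -1 in the preceding sector, where
    the flux is reversed; both halves get the same sign, so the axis terms cancel. For the origin
    the sign changes across the axis, so that the fluxes at \<open>TT j\<close> and
    \<open>- TT j\<close> add up; the axis terms add up too, with a sign that lets them be
    dropped.\<close>
  define bR where "bR k j = (if k = m then - sqrt \<gamma> else if j = k then 1 else if j = pr k then -1 else 0)" for k j
  define bL where "bL k j = (if k = m then sqrt \<gamma> else if j = k then 1 else if j = pr k then -1 else 0)" for k j
  have b2: "(bR k j)\<^sup>2 \<le> (wt k)\<^sup>2" "(bL k j)\<^sup>2 \<le> (wt k)\<^sup>2" "bR k j \<le> bL k j" if "k \<le> m" for k j
    using that \<gamma> by (auto simp: bR_def bL_def wt_def)
  have const: "\<exists>\<rho>>0. (\<forall>w\<in>ball (pt j) \<rho>. \<phi> k w = (if k = j then \<Psi> k else 0)) \<and> (\<forall>w\<in>ball (pt (nx j)) \<rho>. \<phi> k w = (if k = nx j then \<Psi> k else 0))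
     \<and> (\<forall>w\<in>ball 0 \<rho>. \<phi> k w = (if k = m then \<Psi> k else 0))" if k: "k \<le> m" and j: "j < m" for k j
  proof -
    have one: "\<exists>\<rho>>0. \<forall>w\<in>ball (c i) \<rho>. \<phi> k w = (if k = i then \<Psi> k else 0)" if i: "i \<le> m" for i
    proof (cases "k = i")
      case True then show ?thesis using tnear[OF k] by simp
    next
      case False
      then have "\<phi> k w = 0" if "w \<in> cball (c i) \<epsilon>" for w using tout[OF k, of w] \<epsilon>(5) i that disj[OF k i] by fastforce
      then show ?thesis using False \<epsilon>(1) by (intro exI[of _ \<epsilon>]) auto
    qed
    obtain \<rho>1 where \<rho>1: "\<rho>1 > 0" "\<forall>w\<in>ball (pt j) \<rho>1. \<phi> k w = (if k = j then \<Psi> k else 0)" using one[of j] j c(2)[of j] by auto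
    obtain \<rho>2 where \<rho>2: "\<rho>2 > 0" "\<forall>w\<in>ball (pt (nx j)) \<rho>2. \<phi> k w = (if k = nx j then \<Psi> k else 0)" using one[of "nx j"] nx_pr(4)[OF j] c(2)[of "nx j"] by auto
    obtain \<rho>3 where \<rho>3: "\<rho>3 > 0" "\<forall>w\<in>ball 0 \<rho>3. \<phi> k w = (if k = m then \<Psi> k else 0)" using one[of m] c(3) by auto
    show ?thesis using \<rho>1 \<rho>2 \<rho>3 by (intro exI[of _ "min \<rho>1 (min \<rho>2 \<rho>3)"]) auto
  qed
  have flux: "(\<lambda>n. IR k j n + ax k j n) \<longlonglongrightarrow> pi * ((if k = j then \<Psi> k else 0) - TT j * (if k = m then \<Psi> k else 0))"
    "(\<lambda>n. IL k j n - ax k j n) \<longlonglongrightarrow> - pi * ((if k = nx j then \<Psi> k else 0) - TT j * (if k = m then \<Psi> k else 0))" if k: "k \<le> m" and j: "j < m" for k j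
  proof -
    obtain \<rho> where \<rho>: "\<rho> > 0" "\<forall>w\<in>ball (pt j) \<rho>. \<phi> k w = (if k = j then \<Psi> k else 0)" "\<forall>w\<in>ball (pt (nx j)) \<rho>. \<phi> k w = (if k = nx j then \<Psi> k else 0)"
     "\<forall>w\<in>ball 0 \<rho>. \<phi> k w = (if k = m then \<Psi> k else 0)" using const[OF k j] by blast
    have bd: "\<bar>\<phi> k w\<bar> \<le> \<Psi> k" for w using tphi[OF k, of w] by simp
    note SF = sector_param.sector_flux[OF sp[OF j], of "\<phi> k" "D k" "\<Psi> k" \<rho> "\<theta> j" "if k = j then \<Psi> k else 0" "if k = nx j then \<Psi> k else 0" "if k = m then \<Psi> k else 0",
        OF tgr[OF k] tcD[OF k] bd \<rho>(1), unfolded ep_eq[OF j]]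
    show "(\<lambda>n. IR k j n + ax k j n) \<longlonglongrightarrow> pi * ((if k = j then \<Psi> k else 0) - TT j * (if k = m then \<Psi> k else 0))"
      unfolding IR_def ax_def F_def by (rule SF(1)) (use \<rho>(2-4) in blast)+
    show "(\<lambda>n. IL k j n - ax k j n) \<longlonglongrightarrow> - pi * ((if k = nx j then \<Psi> k else 0) - TT j * (if k = m then \<Psi> k else 0))"
      unfolding IL_def ax_def F_def by (rule SF(2)) (use \<rho>(2-4) in blast)+
  qed
  have ax0: "0 \<le> ax k j n" if "k \<le> m" "j < m" "n \<ge> 1" for k j n
    unfolding ax_def by (rule sector_param.axis_term_nonneg[OF sp[OF that(2)] tphi(1)[OF that(1)] that(3)])
  have am: "2 * \<beta> * IR k j n \<le> \<beta>\<^sup>2 * XR k j n + QR k j n" "2 * \<beta> * IL k j n \<le> \<beta>\<^sup>2 * XL k j n + QL k j n"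
    if k: "k \<le> m" and j: "j < m" and n: "n \<ge> 1" for k j n \<beta>
    using sector_param.sector_amgm[OF sp[OF j] tcD[OF k] tce[OF k] tcq[OF k] tam[OF k] n, of \<beta> 1 "\<theta> j"]
      sector_param.sector_amgm[OF sp[OF j] tcD[OF k] tce[OF k] tcq[OF k] tam[OF k] n, of \<beta> "-1" "\<theta> j"]
    unfolding hquad_def IR_def IL_def XR_def XL_def QR_def QL_def F_def by simp_all
  have Xpos: "0 \<le> XR k j n" "0 \<le> XL k j n" if k: "k \<le> m" and j: "j < m" and n: "n \<ge> 1" for k j n
  proof -
    have nn: "0 \<le> integral A g" if "\<And>z. 0 \<le> g z" for g :: "complex \<Rightarrow> real" and A
      by (cases "g integrable_on A") (auto intro!: Henstock_Kurzweil_Integration.integral_nonneg simp: that not_integrable_integral)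
    show "0 \<le> XR k j n" "0 \<le> XL k j n" unfolding XR_def XL_def by (intro nn mult_nonneg_nonneg te0[OF k] zero_le_power2)+
  qed
  have Xsum: "(\<Sum>j<m. XL k j n + XR k j n) \<le> 2 * pi * \<Psi> k" if k: "k \<le> m" and n: "n \<ge> 1" for k n
    unfolding XL_def XR_def tei(2)[OF k, symmetric]
  proof (rule sum_over_disjoint_images[OF _ _ _ _ tei(1)[OF k] te0[OF k] tce[OF k] n])
    show "sm j holomorphic_on {z. 0 < Im z}" if "j \<in> {..<m}" for j using sector_param.sector_map_holomorphic[OF sp] that by simp
    show "inj_on (sm j) {z. 0 < Im z}" if "j \<in> {..<m}" for j using sector_param.sector_map_inj[OF sp] that by simp
  qed (use sm_disjoint in auto)

  \<comment> \<open>The cutoffs of all domains against the energy of the fields\<close>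
  define GR where "GR j n = integral (rquad n) (\<lambda>z. \<kappa>1 j z * (cmod (F j z))\<^sup>2)" for j n
  define GL where "GL j n = integral (lquad n) (\<lambda>z. \<kappa>2 j z * (cmod (F j z))\<^sup>2)" for j n
  \<comment> \<open>The domains are disjoint and contain the closed \<epsilon>-discs around their
    centres. So at most one cutoff is nonzero at \<open>w\<close>, and then \<open>w\<close> is
    outside all the discs, where the bound is 1.\<close>
  have qsum: "(\<Sum>k\<le>m. q k w) \<le> x" if x: "0 \<le> x" "(\<forall>k\<le>m. \<epsilon> < cmod (w - c k)) \<Longrightarrow> x = 1" for w x
  proof (cases "\<exists>k\<le>m. q k w \<noteq> 0")
    case False then show ?thesis using x(1) by simp
  next
    case True
    then obtain k where k: "k \<le> m" "q k w \<noteq> 0" by blast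
    then have wk: "w \<in> U k" "\<epsilon> < cmod (w - c k)" using tq0 by auto
    have other: "q l w = 0" if "l \<le> m" "l \<noteq> k" for l using tq0[OF that(1), of w] disj[OF that(1) k(1) that(2)] wk(1) by blast
    have "(\<Sum>l\<le>m. q l w) = (\<Sum>l\<in>{k}. q l w)" by (rule sum.mono_neutral_right) (use k other in auto)
    then have "(\<Sum>l\<le>m. q l w) \<le> 1" using tq(2)[OF k(1), of w] by simp
    moreover have "\<forall>l\<le>m. \<epsilon> < cmod (w - c l)"
    proof (intro allI impI)
      fix l assume l: "l \<le> m"
      show "\<epsilon> < cmod (w - c l)"
      proof (cases "l = k")
        case True then show ?thesis using wk by simp
      next
        case False
        then have "w \<notin> cball (c l) \<epsilon>" using \<epsilon>(5) l disj[OF l k(1)] wk(1) by blast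
        then show ?thesis by (simp add: dist_norm norm_minus_commute)
      qed
    qed
    ultimately show ?thesis using x(2) by simp
  qed
  have Qsum: "(\<Sum>k\<le>m. QR k j n) \<le> GR j n" "(\<Sum>k\<le>m. QL k j n) \<le> GL j n" if j: "j < m" and n: "n \<ge> 1" for j n
  proof -
    note csm = sector_param.sector_map_continuous(1)[OF sp[OF j], of "\<theta> j"]
    have cF: "continuous_on {z. Im z > 0} (F j)" unfolding F_def by (rule sector_param.model_field_continuous[OF sp[OF j]])
    have cq: "continuous_on {z. Im z > 0} (\<lambda>z. q k (sm j z) * (cmod (F j z))\<^sup>2)" if "k \<le> m" for k
      by (intro continuous_intros cF continuous_on_compose2[OF tcq[OF that] csm]) auto
    have ck: "continuous_on {z. Im z > 0} (\<lambda>z. \<kappa>1 j z * (cmod (F j z))\<^sup>2)" "continuous_on {z. Im z > 0} (\<lambda>z. \<kappa>2 j z * (cmod (F j z))\<^sup>2)"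
      using E1[OF j] E2[OF j] unfolding EN_def by (auto intro!: continuous_intros cF)
    note hq = sector_param.hquad_integrable[OF sp[OF j] _ n] and hu = sector_param.hquad_upper[OF sp[OF j] n]
    have pos: "Im z > 0" "s * Re z \<ge> 0" if "z \<in> hquad s n" "s = 1 \<or> s = -1" for z s
      using hu[of s] that by (auto simp: hquad_def in_cbox_complex_iff)
    have "(\<Sum>k\<le>m. QR k j n) = integral (hquad 1 n) (\<lambda>z. \<Sum>k\<le>m. q k (sm j z) * (cmod (F j z))\<^sup>2)"
      unfolding QR_def hquad_def using hq[OF cq, of _ 1] by (subst integral_sum) (auto simp: hquad_def)
    also have "\<dots> \<le> integral (hquad 1 n) (\<lambda>z. \<kappa>1 j z * (cmod (F j z))\<^sup>2)"
    proof (rule integral_le)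
      fix z assume z: "z \<in> hquad 1 n"
      have "(\<Sum>k\<le>m. q k (sm j z)) \<le> \<kappa>1 j z"
      proof (rule qsum)
        show "0 \<le> \<kappa>1 j z" using E1[OF j] unfolding EN_def by blast
        assume A: "\<forall>k\<le>m. \<epsilon> < cmod (sm j z - c k)"
        have "\<epsilon> < cmod (sm j z - ep j 1)" using A[rule_format, of j] j c(2)[OF j] ep_eq(1)[OF j] by simp
        moreover have "\<epsilon> < cmod (sm j z)" using A[rule_format, of m] c(3) by simp
        ultimately show "\<kappa>1 j z = 1" using E1[OF j] pos[OF z] unfolding EN_def by blast
      qed
      then show "(\<Sum>k\<le>m. q k (sm j z) * (cmod (F j z))\<^sup>2) \<le> \<kappa>1 j z * (cmod (F j z))\<^sup>2"
        unfolding sum_distrib_right[symmetric] by (rule mult_right_mono) simp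
    qed (use hq cq ck in \<open>auto intro!: integrable_sum\<close>)
    finally show "(\<Sum>k\<le>m. QR k j n) \<le> GR j n" by (simp add: GR_def hquad_def)
    have "(\<Sum>k\<le>m. QL k j n) = integral (hquad (-1) n) (\<lambda>z. \<Sum>k\<le>m. q k (sm j z) * (cmod (F j z))\<^sup>2)"
      unfolding QL_def hquad_def using hq[OF cq, of _ "-1"] by (subst integral_sum) (auto simp: hquad_def)
    also have "\<dots> \<le> integral (hquad (-1) n) (\<lambda>z. \<kappa>2 j z * (cmod (F j z))\<^sup>2)"
    proof (rule integral_le)
      fix z assume z: "z \<in> hquad (-1) n"
      have "(\<Sum>k\<le>m. q k (sm j z)) \<le> \<kappa>2 j z"
      proof (rule qsum)
        show "0 \<le> \<kappa>2 j z" using E2[OF j] unfolding EN_def by blast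
        assume A: "\<forall>k\<le>m. \<epsilon> < cmod (sm j z - c k)"
        have "\<epsilon> < cmod (sm j z - ep j (-1))" using A[rule_format, of "nx j"] nx_pr(4)[OF j] c(2)[OF nx_pr(4)[OF j]] ep_eq(2)[OF j] by simp
        moreover have "\<epsilon> < cmod (sm j z)" using A[rule_format, of m] c(3) by simp
        ultimately show "\<kappa>2 j z = 1" using E2[OF j] pos[OF z] unfolding EN_def by blast
      qed
      then show "(\<Sum>k\<le>m. q k (sm j z) * (cmod (F j z))\<^sup>2) \<le> \<kappa>2 j z * (cmod (F j z))\<^sup>2"
        unfolding sum_distrib_right[symmetric] by (rule mult_right_mono) simp
    qed (use hq cq ck in \<open>auto intro!: integrable_sum\<close>)
    finally show "(\<Sum>k\<le>m. QL k j n) \<le> GL j n" by (simp add: GL_def hquad_def)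
  qed

  \<comment> \<open>Summation over domains and sectors, and passage to the limit\<close>
  define LHS where "LHS n = (\<Sum>k\<le>m. \<Sum>j<m. 2 * (bR k j * (IR k j n + ax k j n) + bL k j * (IL k j n - ax k j n)))" for n
  define W where "W = (\<Sum>k\<le>m. (wt k)\<^sup>2 * \<Psi> k)"
  have step: "LHS n \<le> 2 * pi * W + (\<Sum>j<m. GR j n + GL j n)" if n: "n \<ge> 1" for n
  proof -
    have "LHS n \<le> (\<Sum>k\<le>m. \<Sum>j<m. (wt k)\<^sup>2 * (XL k j n + XR k j n) + (QR k j n + QL k j n))"
      unfolding LHS_def
    proof (intro sum_mono)
      fix k j assume "k \<in> {..m}" "j \<in> {..<m}"
      then have k: "k \<le> m" and j: "j < m" by auto
      have "bR k j * ax k j n \<le> bL k j * ax k j n" using ax0[OF k j n] b2(3)[OF k] by (intro mult_right_mono) auto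
      moreover have "(bR k j)\<^sup>2 * XR k j n \<le> (wt k)\<^sup>2 * XR k j n" "(bL k j)\<^sup>2 * XL k j n \<le> (wt k)\<^sup>2 * XL k j n"
        using Xpos[OF k j n] b2[OF k] by (auto intro!: mult_right_mono)
      ultimately show "2 * (bR k j * (IR k j n + ax k j n) + bL k j * (IL k j n - ax k j n)) \<le> (wt k)\<^sup>2 * (XL k j n + XR k j n) + (QR k j n + QL k j n)"
        using am(1)[OF k j n, of "bR k j"] am(2)[OF k j n, of "bL k j"] by (simp add: algebra_simps)
    qed
    also have "\<dots> = (\<Sum>k\<le>m. (wt k)\<^sup>2 * (\<Sum>j<m. XL k j n + XR k j n)) + (\<Sum>j<m. (\<Sum>k\<le>m. QR k j n) + (\<Sum>k\<le>m. QL k j n))"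
      unfolding sum.distrib sum_distrib_left[symmetric] by (simp only: sum.swap[of _ "{..m}"])
    also have "\<dots> \<le> (\<Sum>k\<le>m. (wt k)\<^sup>2 * (2 * pi * \<Psi> k)) + (\<Sum>j<m. GR j n + GL j n)"
      by (intro add_mono sum_mono mult_left_mono Xsum n Qsum) auto
    also have "(\<Sum>k\<le>m. (wt k)\<^sup>2 * (2 * pi * \<Psi> k)) = 2 * pi * W" by (simp add: W_def sum_distrib_left mult_ac)
    finally show ?thesis .
  qed
  have limL: "LHS \<longlonglongrightarrow> 4 * pi * W"
  proof -
    have "LHS \<longlonglongrightarrow> (\<Sum>k\<le>m. \<Sum>j<m. 2 * (bR k j * (pi * ((if k = j then \<Psi> k else 0) - TT j * (if k = m then \<Psi> k else 0)))
        + bL k j * (- pi * ((if k = nx j then \<Psi> k else 0) - TT j * (if k = m then \<Psi> k else 0)))))"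
      unfolding LHS_def by (intro tendsto_sum tendsto_mult_left tendsto_add flux) auto
    moreover have "(\<Sum>j<m. 2 * (bR k j * (pi * ((if k = j then \<Psi> k else 0) - TT j * (if k = m then \<Psi> k else 0)))
        + bL k j * (- pi * ((if k = nx j then \<Psi> k else 0) - TT j * (if k = m then \<Psi> k else 0))))) = 4 * pi * ((wt k)\<^sup>2 * \<Psi> k)" if k: "k \<le> m" for k
    proof (cases "k = m")
      case True
      have "(\<Sum>j<m. 2 * (bR k j * (pi * ((if k = j then \<Psi> k else 0) - TT j * (if k = m then \<Psi> k else 0)))
        + bL k j * (- pi * ((if k = nx j then \<Psi> k else 0) - TT j * (if k = m then \<Psi> k else 0))))) = (\<Sum>j<m. 4 * pi * sqrt \<gamma> * \<Psi> k * TT j)"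
      proof (rule sum.cong)
        fix j assume "j \<in> {..<m}"
        then have "k \<noteq> j" "k \<noteq> nx j" using True nx_pr(4)[of j] by auto
        then show "2 * (bR k j * (pi * ((if k = j then \<Psi> k else 0) - TT j * (if k = m then \<Psi> k else 0))) + bL k j * (- pi * ((if k = nx j then \<Psi> k else 0) - TT j * (if k = m then \<Psi> k else 0)))) = 4 * pi * sqrt \<gamma> * \<Psi> k * TT j"
          using True by (simp add: bR_def bL_def algebra_simps)
      qed simp
      \<comment> \<open>Here the sum of the openings enters: the \<open>TT j\<close> sum to
        \<open>sqrt \<gamma>\<close>, and the level at the origin receives the weight
        \<gamma>.\<close>
      also have "\<dots> = 4 * pi * sqrt \<gamma> * \<Psi> k * (sqrt \<gamma> * (\<Sum>j<m. al j) / 2)"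
        by (simp add: TT_def sum_distrib_left sum_divide_distrib)
      also have "\<dots> = 4 * pi * ((wt k)\<^sup>2 * \<Psi> k)" unfolding sum_al using True \<gamma> by (simp add: wt_def)
      finally show ?thesis .
    next
      case False
      then have k: "k < m" using k by simp
      have "(\<Sum>j<m. 2 * (bR k j * (pi * ((if k = j then \<Psi> k else 0) - TT j * (if k = m then \<Psi> k else 0)))
        + bL k j * (- pi * ((if k = nx j then \<Psi> k else 0) - TT j * (if k = m then \<Psi> k else 0))))) = (\<Sum>j<m. (if j = k then 2 * pi * \<Psi> k else 0) + (if j = pr k then 2 * pi * \<Psi> k else 0))"
      proof (rule sum.cong)
        fix j assume "j \<in> {..<m}"
        then have "k = nx j \<longleftrightarrow> j = pr k" "pr k \<noteq> k" using nx_pr(3,5) k by (auto simp: eq_commute)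
        then show "2 * (bR k j * (pi * ((if k = j then \<Psi> k else 0) - TT j * (if k = m then \<Psi> k else 0))) + bL k j * (- pi * ((if k = nx j then \<Psi> k else 0) - TT j * (if k = m then \<Psi> k else 0)))) = (if j = k then 2 * pi * \<Psi> k else 0) + (if j = pr k then 2 * pi * \<Psi> k else 0)"
          using False by (auto simp: bR_def bL_def)
      qed simp
      also have "\<dots> = 4 * pi * \<Psi> k" using k nx_pr(1)[OF k] by (simp add: sum.distrib)
      finally show ?thesis using k by (simp add: wt_def)
    qed
    ultimately show ?thesis by (simp add: W_def sum_distrib_left)
  qed
  have limG: "(\<lambda>n. 2 * pi * W + (\<Sum>j<m. GR j n + GL j n)) \<longlonglongrightarrow> 2 * pi * W + (\<Sum>j<m. l1 j + l2 j)"
  proof (intro tendsto_add tendsto_const tendsto_sum)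
    fix j assume "j \<in> {..<m}"
    then have j: "j < m" by simp
    show "GR j \<longlonglongrightarrow> l1 j" using E1[OF j] by (simp add: EN_def GR_def[abs_def] F_def hquad_def)
    show "GL j \<longlonglongrightarrow> l2 j" using E2[OF j] by (simp add: EN_def GL_def[abs_def] F_def hquad_def)
  qed
  have main: "4 * pi * W \<le> 2 * pi * W + (\<Sum>j<m. l1 j + l2 j)"
    by (rule tendsto_sum_le_limit[OF limL limG step])
  define \<Lambda> where "\<Lambda> = ln (1 / \<epsilon>)"
  have "(\<Sum>j<m. l1 j + l2 j) \<le> (\<Sum>j<m. pi * (2 * \<Lambda> + 2 * sqrt \<gamma> * \<Lambda> * TT j + (ec j 1 + ec j (-1) - 2 * TT j * zc j) + 2 * \<tau> * (2 + 2 * TT j)))"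
  proof (rule sum_mono)
    fix j assume "j \<in> {..<m}"
    then have j: "j < m" by simp
    have g: "2 * TT j / al j = sqrt \<gamma>" using al_pos[OF j] by (simp add: TT_def)
    have "l1 j \<le> pi * (\<Lambda> + ec j 1 + 2 * \<tau> + TT j * (sqrt \<gamma> * \<Lambda> - zc j + 2 * \<tau>))" using E1[OF j] unfolding EN_def g \<Lambda>_def by blast
    moreover have "l2 j \<le> pi * (\<Lambda> + ec j (-1) + 2 * \<tau> + TT j * (sqrt \<gamma> * \<Lambda> - zc j + 2 * \<tau>))" using E2[OF j] unfolding EN_def g \<Lambda>_def by blast
    ultimately show "l1 j + l2 j \<le> pi * (2 * \<Lambda> + 2 * sqrt \<gamma> * \<Lambda> * TT j + (ec j 1 + ec j (-1) - 2 * TT j * zc j) + 2 * \<tau> * (2 + 2 * TT j))"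
      by (simp add: algebra_simps)
  qed
  also have "\<dots> = 2 * pi * (m * \<Lambda> + \<gamma> * \<Lambda> + (\<Sum>j<m. (ec j 1 + ec j (-1) - 2 * TT j * zc j) / 2) + \<tau> * (\<Sum>j<m. 2 + 2 * TT j))"
  proof -
    have "(\<Sum>j<m. TT j) = sqrt \<gamma>" using sum_al by (simp add: TT_def sum_distrib_left[symmetric] sum_divide_distrib[symmetric])
    then have g: "(\<Sum>j<m. 2 * sqrt \<gamma> * \<Lambda> * TT j) = 2 * \<gamma> * \<Lambda>" using \<gamma> by (simp add: sum_distrib_left[symmetric])
    have s2: "(\<Sum>j<m. ec j 1 + ec j (-1) - 2 * TT j * zc j) = 2 * (\<Sum>j<m. (ec j 1 + ec j (-1) - 2 * TT j * zc j) / 2)"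
      by (simp add: sum_divide_distrib[symmetric])
    have "(\<Sum>j<m. pi * (2 * \<Lambda> + 2 * sqrt \<gamma> * \<Lambda> * TT j + (ec j 1 + ec j (-1) - 2 * TT j * zc j) + 2 * \<tau> * (2 + 2 * TT j)))
      = pi * ((\<Sum>j<m. 2 * \<Lambda>) + (\<Sum>j<m. 2 * sqrt \<gamma> * \<Lambda> * TT j) + (\<Sum>j<m. ec j 1 + ec j (-1) - 2 * TT j * zc j) + 2 * \<tau> * (\<Sum>j<m. 2 + 2 * TT j))"
      by (simp only: sum_distrib_left[symmetric] sum.distrib)
    then show ?thesis unfolding g s2 by (simp add: algebra_simps)
  qed
  finally have up: "2 * pi * W \<le> 2 * pi * (m * \<Lambda> + \<gamma> * \<Lambda> + (\<Sum>j<m. (ec j 1 + ec j (-1) - 2 * TT j * zc j) / 2) + \<tau> * (\<Sum>j<m. 2 + 2 * TT j))"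
    using main by linarith
  then have W1: "W \<le> m * \<Lambda> + \<gamma> * \<Lambda> + (\<Sum>j<m. (ec j 1 + ec j (-1) - 2 * TT j * zc j) / 2) + \<tau> * (\<Sum>j<m. 2 + 2 * TT j)" by simp
  \<comment> \<open>Every level is at least \<open>v k + \<Lambda> - \<tau>\<close>; the terms
    \<open>(m + \<gamma>) * \<Lambda>\<close> occur on both sides and cancel.\<close>
  have "(\<Sum>k\<le>m. (wt k)\<^sup>2 * (v k + \<Lambda> - \<tau>)) \<le> W" unfolding W_def \<Lambda>_def by (intro sum_mono mult_left_mono tPsi) auto
  moreover have "(\<Sum>k\<le>m. (wt k)\<^sup>2 * (v k + \<Lambda> - \<tau>)) = (\<Sum>k<m. v k) + m * (\<Lambda> - \<tau>) + \<gamma> * (v m + \<Lambda> - \<tau>)"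
  proof -
    have "(\<Sum>k\<le>m. (wt k)\<^sup>2 * (v k + \<Lambda> - \<tau>)) = (\<Sum>k<m. (wt k)\<^sup>2 * (v k + \<Lambda> - \<tau>)) + (wt m)\<^sup>2 * (v m + \<Lambda> - \<tau>)"
      by (simp only: lessThan_Suc_atMost[symmetric] sum.lessThan_Suc)
    also have "(\<Sum>k<m. (wt k)\<^sup>2 * (v k + \<Lambda> - \<tau>)) = (\<Sum>k<m. v k + (\<Lambda> - \<tau>))" by (rule sum.cong) (auto simp: wt_def)
    finally show ?thesis using \<gamma> by (simp add: sum.distrib wt_def)
  qed
  ultimately have "(\<Sum>k<m. v k) + \<gamma> * v m \<le> (\<Sum>j<m. (ec j 1 + ec j (-1) - 2 * TT j * zc j) / 2) + \<tau> * ((\<gamma> + m) + (\<Sum>j<m. 2 + 2 * TT j))"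
    using W1 by (simp add: algebra_simps)
  then show "\<gamma> * v m + (\<Sum>k<m. v k) \<le> (\<Sum>j<m. (ec j 1 + ec j (-1) - 2 * TT j * zc j) / 2) + \<eta>"
    using \<tau>(2) by (simp add: CC_def)
qed

end

section \<open>Two disjoint open sets\<close>

lemma strip_exp_neq_1:
  assumes "0 < Im s" "Im s < 2 * pi"
  shows "exp s \<noteq> 1"
proof
  assume "exp s = 1"
  then obtain n :: int where "Im s = of_int (2 * n) * pi" by (auto simp: exp_eq_1)
  moreover from this have "0 < n" using assms(1) by (simp add: zero_less_mult_iff)
  ultimately have "2 * pi \<le> Im s" by simp
  then show False using assms by simp
qed

text \<open>The constant field 1 sees only the derivative along \<open>Re z\<close>, which is
  integrated on each horizontal segment between the two constant boundary values.\<close>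

lemma horizontal_flux:
  fixes G D :: "complex \<Rightarrow> complex"
  assumes S: "open S" "cbox (Complex x0 y0) (Complex x1 y1) \<subseteq> S" and le: "x0 \<le> x1" "y0 \<le> y1"
    and G: "G holomorphic_on S" and D: "\<And>w. grad \<phi> (D w) w" "continuous_on UNIV D"
    and ends: "\<And>y. y0 \<le> y \<Longrightarrow> y \<le> y1 \<Longrightarrow> \<phi> (G (Complex x0 y)) = cl" "\<And>y. y0 \<le> y \<Longrightarrow> y \<le> y1 \<Longrightarrow> \<phi> (G (Complex x1 y)) = cr"
  shows "integral (cbox (Complex x0 y0) (Complex x1 y1)) (\<lambda>z. Re (D (G z) * deriv G z)) = (cr - cl) * (y1 - y0)"
proof -
  have cG: "continuous_on S G" "continuous_on S (deriv G)"
    using G S(1) by (auto intro!: holomorphic_on_imp_continuous_on holomorphic_deriv)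
  have c: "continuous_on (cbox (Complex x0 y0) (Complex x1 y1)) (\<lambda>z. Re (D (G z) * deriv G z))"
    by (rule continuous_on_subset[OF _ S(2)]) (intro continuous_intros cG continuous_on_compose2[OF D(2) cG(1)], auto)
  have "integral {x0..x1} (\<lambda>x. Re (D (G (Complex x y)) * deriv G (Complex x y))) = cr - cl" if y: "y0 \<le> y" "y \<le> y1" for y
  proof -
    have "((\<lambda>x. Re (D (G (Complex x y)) * deriv G (Complex x y))) has_integral \<phi> (G (Complex x1 y)) - \<phi> (G (Complex x0 y))) {x0..x1}"
    proof (rule fundamental_theorem_of_calculus[OF le(1)])
      fix x assume "x \<in> {x0..x1}"
      then have z: "Complex x y \<in> S" using y S(2) by (auto simp: in_cbox_complex_iff)
      then have "grad (\<lambda>z. \<phi> (G z)) (D (G (Complex x y)) * deriv G (Complex x y)) (Complex x y)"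
        using G S(1) by (intro grad_compose_holomorphic[OF D(1)]) (auto intro: holomorphic_derivI)
      from grad_partial(1)[OF this]
      show "((\<lambda>x. \<phi> (G (Complex x y))) has_vector_derivative Re (D (G (Complex x y)) * deriv G (Complex x y))) (at x within {x0..x1})"
        unfolding has_real_derivative_iff_has_vector_derivative by (rule has_vector_derivative_at_within)
    qed
    then show ?thesis using ends[OF y] by (simp add: integral_unique)
  qed
  then have "integral {y0..y1} (\<lambda>y. integral {x0..x1} (\<lambda>x. Re (D (G (Complex x y)) * deriv G (Complex x y)))) = integral {y0..y1} (\<lambda>y. cr - cl)"
    by (intro Henstock_Kurzweil_Integration.integral_cong) auto
  then show ?thesis unfolding integral_complex_cbox_iterated2[OF c] using le by simp
qed

text \<open>The argument of \<open>sector_amgm\<close> for the constant field 1, with the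
  pulled-back energy already bounded by the energy in the whole plane.\<close>

lemma pulled_amgm:
  fixes G D :: "complex \<Rightarrow> complex"
  assumes S: "open S" "cbox a b \<subseteq> S" and G: "G holomorphic_on S" "inj_on G S" and D: "continuous_on UNIV D"
    and e: "continuous_on UNIV e" "e absolutely_integrable_on UNIV" "\<And>w. 0 \<le> e w" and q: "continuous_on UNIV q"
    and pw: "\<And>w \<alpha> \<xi>. 2 * \<alpha> * Re (D w * cnj \<xi>) \<le> \<alpha>\<^sup>2 * e w + q w * (cmod \<xi>)\<^sup>2"
  shows "2 * \<beta> * integral (cbox a b) (\<lambda>z. Re (D (G z) * deriv G z)) \<le> \<beta>\<^sup>2 * integral UNIV e + integral (cbox a b) (\<lambda>z. q (G z))"
proof -
  have cG: "continuous_on S G" "continuous_on S (deriv G)"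
    using G S(1) by (auto intro!: holomorphic_on_imp_continuous_on holomorphic_deriv)
  let ?F = "\<lambda>z. (cmod (deriv G z))\<^sup>2 * e (G z)"
  have c1: "continuous_on (cbox a b) (\<lambda>z. Re (D (G z) * deriv G z))"
    by (rule continuous_on_subset[OF _ S(2)]) (intro continuous_intros cG continuous_on_compose2[OF D cG(1)], auto)
  have c2: "continuous_on (cbox a b) ?F"
    by (rule continuous_on_subset[OF _ S(2)]) (intro continuous_intros cG continuous_on_compose2[OF e(1) cG(1)], auto)
  have c3: "continuous_on (cbox a b) (\<lambda>z. q (G z))"
    by (rule continuous_on_subset[OF _ S(2)]) (intro continuous_on_compose2[OF q cG(1)], auto)
  have pt: "2 * \<beta> * Re (D (G z) * deriv G z) \<le> \<beta>\<^sup>2 * ?F z + q (G z)" for z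
  proof (cases "deriv G z = 0")
    case True
    then show ?thesis using pw[of 0 "G z" 1] by simp
  next
    case False
    define g where "g = deriv G z"
    define w where "w = G z"
    have g: "cmod g \<noteq> 0" using False by (auto simp: g_def)
    have 1: "D w * cnj (cnj g / of_real (cmod g)) = D w * g / of_real (cmod g)" by simp
    have "2 * (\<beta> * cmod g) * Re (D w * cnj (cnj g / of_real (cmod g))) = 2 * \<beta> * Re (D w * g)"
      unfolding 1 Re_divide_of_real using g by simp
    moreover have "cmod (cnj g / of_real (cmod g)) = 1" using g by (simp add: norm_divide)
    ultimately show ?thesis using pw[of "\<beta> * cmod g" w "cnj g / of_real (cmod g)"]
      unfolding g_def[symmetric] w_def[symmetric] by (simp add: power_mult_distrib mult_ac)
  qed
  have "integral (cbox a b) ?F \<le> integral UNIV e"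
  proof -
    have sb: "box a b \<subseteq> S" using S(2) box_subset_cbox by blast
    have "?F absolutely_integrable_on cbox a b" by (rule absolutely_integrable_continuous[OF c2])
    then have "?F absolutely_integrable_on box a b" by (rule set_integrable_subset) (auto simp: box_subset_cbox)
    moreover have "integral (box a b) ?F = integral (cbox a b) ?F" by (rule integral_open_interval)
    moreover have "(G has_field_derivative deriv G z) (at z)" if "z \<in> box a b" for z
      using G(1) S(1) sb that by (auto intro: holomorphic_derivI)
    moreover have "inj_on G (box a b)" using G(2) sb inj_on_subset by blast
    ultimately have "e absolutely_integrable_on G ` box a b \<and> integral (G ` box a b) e = integral (cbox a b) ?F"
      using complex_change_of_variables[OF open_box, where g=G and g'="deriv G" and f=e and b="integral (cbox a b) ?F"] by blast
    then have "(e has_integral integral (cbox a b) ?F) (G ` box a b)"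
      unfolding absolutely_integrable_on_def by (auto simp: has_integral_iff)
    moreover have "(e has_integral integral UNIV e) UNIV" using e(2) unfolding absolutely_integrable_on_def by (auto simp: has_integral_iff)
    ultimately show ?thesis by (rule has_integral_subset_le[OF subset_UNIV]) (use e(3) in auto)
  qed
  then have X: "\<beta>\<^sup>2 * integral (cbox a b) ?F \<le> \<beta>\<^sup>2 * integral UNIV e" by (rule mult_left_mono) simp
  have "2 * \<beta> * integral (cbox a b) (\<lambda>z. Re (D (G z) * deriv G z)) = integral (cbox a b) (\<lambda>z. 2 * \<beta> * Re (D (G z) * deriv G z))"
    by simp
  also have "\<dots> \<le> integral (cbox a b) (\<lambda>z. \<beta>\<^sup>2 * ?F z + q (G z))"
    by (rule integral_le) (intro integrable_continuous continuous_on_add continuous_on_mult continuous_on_const c1 c2 c3 | rule pt)+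
  also have "\<dots> = integral (cbox a b) (\<lambda>z. \<beta>\<^sup>2 * ?F z) + integral (cbox a b) (\<lambda>z. q (G z))"
    by (rule Henstock_Kurzweil_Integration.integral_add; rule integrable_continuous) (intro continuous_on_mult continuous_on_const c2 c3)+
  finally show ?thesis using X by simp
qed

text \<open>\<open>G\<close> inverts a branch of the logarithm of \<open>w / (w - a)\<close>, which
  has opposite logarithmic poles at 0 and \<open>a\<close>. The strip corresponds to the plane
  without the two rays that the segment from 0 to \<open>a\<close> leaves on its line. The last two
  bounds confine \<open>Re s\<close> to an explicit interval when \<open>G s\<close> is outside the
  \<epsilon>-discs around 0 and \<open>a\<close>.\<close>

lemma
  fixes a s :: complex
  defines "G \<equiv> \<lambda>s. a * exp s / (exp s - 1)"
  assumes a: "a \<noteq> 0"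
  shows strip_map_holomorphic: "G holomorphic_on {s. 0 < Im s \<and> Im s < 2 * pi}"
    and strip_map_inj: "inj_on G {s. 0 < Im s \<and> Im s < 2 * pi}"
    and strip_map_left: "0 < \<epsilon> \<Longrightarrow> exp s \<noteq> 1 \<Longrightarrow> \<epsilon> < cmod (G s) \<Longrightarrow> - ln ((cmod a + \<epsilon>) / \<epsilon>) < Re s"
    and strip_map_right: "0 < \<epsilon> \<Longrightarrow> exp s \<noteq> 1 \<Longrightarrow> \<epsilon> < cmod (G s - a) \<Longrightarrow> Re s < ln ((cmod a + \<epsilon>) / \<epsilon>)"
proof -
  have ne: "exp s \<noteq> 1" if "s \<in> {s. 0 < Im s \<and> Im s < 2 * pi}" for s using strip_exp_neq_1 that by auto
  show "G holomorphic_on {s. 0 < Im s \<and> Im s < 2 * pi}"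
    unfolding G_def by (intro holomorphic_intros) (use ne in auto)
  have Gd: "G s - a = a / (exp s - 1)" if "exp s \<noteq> 1" for s using that by (simp add: G_def field_simps)
  show "inj_on G {s. 0 < Im s \<and> Im s < 2 * pi}"
  proof (rule inj_onI)
    fix s t assume s: "s \<in> {s. 0 < Im s \<and> Im s < 2 * pi}" and t: "t \<in> {s. 0 < Im s \<and> Im s < 2 * pi}" and eq: "G s = G t"
    have "a / (exp s - 1) = a / (exp t - 1)" using Gd[OF ne[OF s]] Gd[OF ne[OF t]] eq by metis
    then have "exp s = exp t" using a ne[OF s] ne[OF t] by (auto simp: field_simps)
    moreover have "\<bar>Im s - Im t\<bar> < 2 * pi" using s t by auto
    ultimately show "s = t" by (rule exp_complex_eqI[rotated])
  qed
  { assume e: "0 < \<epsilon>" "exp s \<noteq> 1" "\<epsilon> < cmod (G s)"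
    have d: "0 < cmod (exp s - 1)" using e(2) by simp
    have "\<epsilon> < cmod a * exp (Re s) / cmod (exp s - 1)" using e(3) by (simp add: G_def norm_divide norm_mult)
    then have "\<epsilon> * cmod (exp s - 1) < cmod a * exp (Re s)" using d by (simp add: field_simps)
    moreover have "1 - exp (Re s) \<le> cmod (exp s - 1)" using norm_triangle_ineq2[of 1 "exp s"] by (simp add: norm_minus_commute)
    then have "\<epsilon> * (1 - exp (Re s)) \<le> \<epsilon> * cmod (exp s - 1)" using e(1) by (intro mult_left_mono) auto
    ultimately have "\<epsilon> < (cmod a + \<epsilon>) * exp (Re s)" by (simp add: algebra_simps)
    then have "\<epsilon> / (cmod a + \<epsilon>) < exp (Re s)" using a e(1) by (simp add: field_simps add_pos_pos)
    then have "ln (\<epsilon> / (cmod a + \<epsilon>)) < Re s" using a e(1) by (subst exp_less_cancel_iff[symmetric]) (simp add: add_pos_pos)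
    then show "- ln ((cmod a + \<epsilon>) / \<epsilon>) < Re s" using a e(1) by (simp add: ln_div add_pos_pos add_nonneg_eq_0_iff) }
  { assume e: "0 < \<epsilon>" "exp s \<noteq> 1" "\<epsilon> < cmod (G s - a)"
    have d: "0 < cmod (exp s - 1)" using e(2) by simp
    have "\<epsilon> < cmod a / cmod (exp s - 1)" using e(3) unfolding Gd[OF e(2)] by (simp add: norm_divide)
    then have "\<epsilon> * cmod (exp s - 1) < cmod a" using d by (simp add: field_simps)
    moreover have "exp (Re s) - 1 \<le> cmod (exp s - 1)" using norm_triangle_ineq2[of "exp s" 1] by simp
    then have "\<epsilon> * (exp (Re s) - 1) \<le> \<epsilon> * cmod (exp s - 1)" using e(1) by (intro mult_left_mono) auto
    ultimately have "\<epsilon> * exp (Re s) < cmod a + \<epsilon>" by (simp add: algebra_simps)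
    then have "exp (Re s) < (cmod a + \<epsilon>) / \<epsilon>" using e(1) by (simp add: field_simps)
    then show "Re s < ln ((cmod a + \<epsilon>) / \<epsilon>)" using e(1) by (subst exp_less_cancel_iff[symmetric]) (simp add: add_nonneg_pos) }
qed

text \<open>The same argument with the constant field on the strip \<open>0 < Im s < 2 \<pi>\<close>, whose ends correspond to \<open>0\<close> and \<open>a\<close>.\<close>
theorem pair_inequality:
  assumes U: "open U0" "open U1" "U0 \<inter> U1 = {}" and a: "a \<noteq> 0" and c: "0 \<in> U0" "a \<in> U1"
    and v: "green_approx U0 0 v0" "green_approx U1 a v1"
  shows "v0 + v1 \<le> 2 * ln (cmod a)"
proof -
  define G where "G s = a * exp s / (exp s - 1)" for s
  define S where "S = {s::complex. 0 < Im s \<and> Im s < 2 * pi}"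
  note Gh = strip_map_holomorphic[OF a, folded G_def[abs_def] S_def] and Gi = strip_map_inj[OF a, folded G_def[abs_def] S_def]
    and Gl = strip_map_left[OF a, folded G_def] and Gr = strip_map_right[OF a, folded G_def]
  have oS: "open S" unfolding S_def by (intro open_Collect_conj open_Collect_less continuous_intros)
  have main: "eventually (\<lambda>\<epsilon>. v0 + v1 \<le> 2 * ln (cmod a + \<epsilon>) + 4 * \<tau>) (at_right 0)" if \<tau>: "\<tau> > 0" for \<tau>
  proof -
    obtain d0 where d0: "d0 > 0" "ball 0 d0 \<subseteq> U0" using U(1) c(1) open_contains_ball by blast
    obtain d1 where d1: "d1 > 0" "ball a d1 \<subseteq> U1" using U(2) c(2) open_contains_ball by blast
    obtain \<epsilon>0 where \<epsilon>0: "\<epsilon>0 > 0" and t0: "\<And>\<epsilon>. 0 < \<epsilon> \<and> \<epsilon> < \<epsilon>0 \<Longrightarrow> \<exists>\<phi> D e q \<Psi>. v0 + ln (1 / \<epsilon>) - \<tau> \<le> \<Psi> \<and> 0 \<le> \<Psi> \<and>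
     (\<forall>z. grad \<phi> (D z) z) \<and> continuous_on UNIV D \<and> (\<forall>z. 0 \<le> \<phi> z \<and> \<phi> z \<le> \<Psi>) \<and> (\<forall>z. z \<notin> U0 \<longrightarrow> \<phi> z = 0) \<and>
     (\<exists>\<rho>>0. \<forall>z\<in>ball 0 \<rho>. \<phi> z = \<Psi>) \<and> e absolutely_integrable_on UNIV \<and> integral UNIV e = 2 * pi * \<Psi> \<and>
     (\<forall>z. 0 \<le> e z) \<and> continuous_on UNIV e \<and> continuous_on UNIV q \<and> (\<forall>z. 0 \<le> q z \<and> q z \<le> 1) \<and>
     (\<forall>z. q z \<noteq> 0 \<longrightarrow> z \<in> U0 \<and> \<epsilon> < cmod (z - 0)) \<and>
     (\<forall>z \<alpha> \<xi>. 2 * \<alpha> * Re (D z * cnj \<xi>) \<le> \<alpha>\<^sup>2 * e z + q z * (cmod \<xi>)\<^sup>2)"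
      using green_approx_test_function[OF v(1) \<tau>] by blast
    obtain \<epsilon>1 where \<epsilon>1: "\<epsilon>1 > 0" and t1: "\<And>\<epsilon>. 0 < \<epsilon> \<and> \<epsilon> < \<epsilon>1 \<Longrightarrow> \<exists>\<phi> D e q \<Psi>. v1 + ln (1 / \<epsilon>) - \<tau> \<le> \<Psi> \<and> 0 \<le> \<Psi> \<and>
     (\<forall>z. grad \<phi> (D z) z) \<and> continuous_on UNIV D \<and> (\<forall>z. 0 \<le> \<phi> z \<and> \<phi> z \<le> \<Psi>) \<and> (\<forall>z. z \<notin> U1 \<longrightarrow> \<phi> z = 0) \<and>
     (\<exists>\<rho>>0. \<forall>z\<in>ball a \<rho>. \<phi> z = \<Psi>) \<and> e absolutely_integrable_on UNIV \<and> integral UNIV e = 2 * pi * \<Psi> \<and>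
     (\<forall>z. 0 \<le> e z) \<and> continuous_on UNIV e \<and> continuous_on UNIV q \<and> (\<forall>z. 0 \<le> q z \<and> q z \<le> 1) \<and>
     (\<forall>z. q z \<noteq> 0 \<longrightarrow> z \<in> U1 \<and> \<epsilon> < cmod (z - a)) \<and>
     (\<forall>z \<alpha> \<xi>. 2 * \<alpha> * Re (D z * cnj \<xi>) \<le> \<alpha>\<^sup>2 * e z + q z * (cmod \<xi>)\<^sup>2)"
      using green_approx_test_function[OF v(2) \<tau>] by blast
    show ?thesis unfolding eventually_at_right_field
    proof (rule exI[of _ "min (min \<epsilon>0 \<epsilon>1) (min d0 d1)"], intro conjI allI impI)
      show "0 < min (min \<epsilon>0 \<epsilon>1) (min d0 d1)" using \<epsilon>0 \<epsilon>1 d0 d1 by simp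
      fix \<epsilon> assume pos: "0 < \<epsilon>" and "\<epsilon> < min (min \<epsilon>0 \<epsilon>1) (min d0 d1)"
      then have \<epsilon>: "0 < \<epsilon> \<and> \<epsilon> < \<epsilon>0" "0 < \<epsilon> \<and> \<epsilon> < \<epsilon>1" "\<epsilon> < d0" "\<epsilon> < d1" by auto
      obtain \<phi>0 D0 e0 q0 \<Psi>0 where A: "v0 + ln (1 / \<epsilon>) - \<tau> \<le> \<Psi>0" "0 \<le> \<Psi>0"
        "\<And>z. grad \<phi>0 (D0 z) z" "continuous_on UNIV D0" "\<And>z. z \<notin> U0 \<Longrightarrow> \<phi>0 z = 0" "\<exists>\<rho>>0. \<forall>z\<in>ball 0 \<rho>. \<phi>0 z = \<Psi>0"
        "e0 absolutely_integrable_on UNIV" "integral UNIV e0 = 2 * pi * \<Psi>0" "\<And>z. 0 \<le> e0 z" "continuous_on UNIV e0" "continuous_on UNIV q0"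
        "\<And>z. 0 \<le> q0 z" "\<And>z. q0 z \<le> 1" "\<And>z. q0 z \<noteq> 0 \<Longrightarrow> z \<in> U0" "\<And>z. q0 z \<noteq> 0 \<Longrightarrow> \<epsilon> < cmod (z - 0)"
        "\<And>z \<alpha> \<xi>. 2 * \<alpha> * Re (D0 z * cnj \<xi>) \<le> \<alpha>\<^sup>2 * e0 z + q0 z * (cmod \<xi>)\<^sup>2"
        using t0[OF \<epsilon>(1)] by blast
      obtain \<phi>1 D1 e1 q1 \<Psi>1 where B: "v1 + ln (1 / \<epsilon>) - \<tau> \<le> \<Psi>1" "0 \<le> \<Psi>1"
        "\<And>z. grad \<phi>1 (D1 z) z" "continuous_on UNIV D1" "\<And>z. z \<notin> U1 \<Longrightarrow> \<phi>1 z = 0" "\<exists>\<rho>>0. \<forall>z\<in>ball a \<rho>. \<phi>1 z = \<Psi>1"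
        "e1 absolutely_integrable_on UNIV" "integral UNIV e1 = 2 * pi * \<Psi>1" "\<And>z. 0 \<le> e1 z" "continuous_on UNIV e1" "continuous_on UNIV q1"
        "\<And>z. 0 \<le> q1 z" "\<And>z. q1 z \<le> 1" "\<And>z. q1 z \<noteq> 0 \<Longrightarrow> z \<in> U1" "\<And>z. q1 z \<noteq> 0 \<Longrightarrow> \<epsilon> < cmod (z - a)"
        "\<And>z \<alpha> \<xi>. 2 * \<alpha> * Re (D1 z * cnj \<xi>) \<le> \<alpha>\<^sup>2 * e1 z + q1 z * (cmod \<xi>)\<^sup>2"
        using t1[OF \<epsilon>(2)] by blast
      obtain \<rho>0 where \<rho>0: "\<rho>0 > 0" "\<And>z. z \<in> ball 0 \<rho>0 \<Longrightarrow> \<phi>0 z = \<Psi>0" using A(6) by blast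
      obtain \<rho>1 where \<rho>1: "\<rho>1 > 0" "\<And>z. z \<in> ball a \<rho>1 \<Longrightarrow> \<phi>1 z = \<Psi>1" using B(6) by blast
      define \<rho> where "\<rho> = min (min \<rho>0 d0) (min \<rho>1 d1) / 2"
      have \<rho>: "\<rho> > 0" "\<rho> < \<rho>0" "\<rho> < \<rho>1" "\<rho> < d0" "\<rho> < d1" using \<rho>0 \<rho>1 d0 d1 by (auto simp: \<rho>_def min_def)
      \<comment> \<open>\<open>Z\<close> bounds the modulus of \<open>Re s\<close> outside the
        \<epsilon>-discs and equals \<open>ln (cmod a + \<epsilon>) + ln (1 / \<epsilon>)\<close>.
        \<open>X\<close> plays the same role for the discs of radius \<open>\<rho>\<close>, on which
        both test functions are constant.\<close>
      define Z where "Z = ln ((cmod a + \<epsilon>) / \<epsilon>)"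
      define X where "X = ln ((cmod a + \<rho>) / \<rho>)"
      have Z: "Z > 0" unfolding Z_def using a pos by (intro ln_gt_zero) (simp add: field_simps)
      have X: "X > 0" unfolding X_def using a \<rho> by (intro ln_gt_zero) (simp add: field_simps)
      have near0: "cmod (G s) \<le> \<rho>" if "s \<in> S" "Re s = - X" for s
        using Gl[OF \<rho>(1) strip_exp_neq_1, of s] that by (force simp: S_def X_def)
      have near1: "cmod (G s - a) \<le> \<rho>" if "s \<in> S" "Re s = X" for s
        using Gr[OF \<rho>(1) strip_exp_neq_1, of s] that by (force simp: S_def X_def)
      have end0: "\<phi>0 (G s) = \<Psi>0" "\<phi>1 (G s) = 0" if "s \<in> S" "Re s = - X" for s
      proof -
        have "cmod (G s) \<le> \<rho>" by (rule near0[OF that])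
        then have "G s \<in> ball 0 \<rho>0" "G s \<in> ball 0 d0" using \<rho> by auto
        then show "\<phi>0 (G s) = \<Psi>0" "\<phi>1 (G s) = 0" using \<rho>0(2) B(5)[of "G s"] d0(2) U(3) by blast+
      qed
      have end1: "\<phi>1 (G s) = \<Psi>1" "\<phi>0 (G s) = 0" if "s \<in> S" "Re s = X" for s
      proof -
        have "cmod (G s - a) \<le> \<rho>" by (rule near1[OF that])
        then have "G s \<in> ball a \<rho>1" "G s \<in> ball a d1" using \<rho> by (auto simp: dist_norm norm_minus_commute)
        then show "\<phi>1 (G s) = \<Psi>1" "\<phi>0 (G s) = 0" using \<rho>1(2) A(5)[of "G s"] d1(2) U(3) by blast+
      qed
      have t: "- Z < Z" using Z by simp
      obtain k K where k: "continuous_on UNIV k" "\<And>x. 0 \<le> k x" "\<And>x. k x \<le> 1"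
        "\<And>x. - Z \<le> x \<Longrightarrow> x \<le> Z \<Longrightarrow> k x = 1"
        "\<And>x. x \<le> - Z - \<tau> \<Longrightarrow> k x = 0" "\<And>x. x \<ge> Z + \<tau> \<Longrightarrow> k x = 0"
        and K: "\<And>x. (K has_real_derivative k x) (at x)" "K 0 = 0"
        "\<And>x. x \<le> - Z - \<tau> \<Longrightarrow> K x = K (- Z - \<tau>)" "\<And>x. x \<ge> Z + \<tau> \<Longrightarrow> K x = K (Z + \<tau>)"
        "\<And>x y. x \<le> y \<Longrightarrow> K x \<le> K y" "\<And>x y. x \<le> y \<Longrightarrow> K y - K x \<le> y - x"
        "K Z - K (- Z) = Z - - Z"
        by (fact trapezoid_antiderivative[OF t \<tau>])
      have KX: "K X - K (- X) \<le> 2 * Z + 2 * \<tau>"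
      proof -
        have "K X \<le> K (Z + \<tau>)" using K(4)[of X] K(5)[of X "Z + \<tau>"] by linarith
        moreover have "K (- Z - \<tau>) \<le> K (- X)" using K(3)[of "- X"] K(5)[of "- Z - \<tau>" "- X"] by linarith
        moreover have "K (Z + \<tau>) - K (- Z - \<tau>) \<le> 2 * Z + 2 * \<tau>" using K(6)[of "- Z - \<tau>" "Z + \<tau>"] Z \<tau> by linarith
        ultimately show ?thesis by linarith
      qed
      have qk: "q0 (G s) + q1 (G s) \<le> k (Re s)" if s: "s \<in> S" for s
      proof -
        have ne: "exp s \<noteq> 1" using s strip_exp_neq_1 by (auto simp: S_def)
        have w0: "\<epsilon> < cmod (w - a)" if "w \<in> U0" for w
        proof (rule ccontr)
          assume "\<not> \<epsilon> < cmod (w - a)"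
          then have "w \<in> ball a d1" using \<epsilon>(4) by (auto simp: dist_norm norm_minus_commute)
          then show False using d1(2) U(3) that by blast
        qed
        have w1: "\<epsilon> < cmod w" if "w \<in> U1" for w
        proof (rule ccontr)
          assume "\<not> \<epsilon> < cmod w"
          then have "w \<in> ball 0 d0" using \<epsilon>(3) by auto
          then show False using d0(2) U(3) that by blast
        qed
        have one: "k (Re s) = 1" if "\<epsilon> < cmod (G s)" "\<epsilon> < cmod (G s - a)"
          using Gl[OF pos ne that(1)] Gr[OF pos ne that(2)] by (intro k(4)) (simp_all add: Z_def)
        show ?thesis
        proof (cases "q0 (G s) = 0")
          case True
          show ?thesis
          proof (cases "q1 (G s) = 0")
            case False
            then have "k (Re s) = 1" using one w1[OF B(14)] B(15) by blast
            then show ?thesis using True B(13)[of "G s"] by simp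
          qed (use True k(2) in simp)
        next
          case False
          then have "k (Re s) = 1" using one[OF _ w0[OF A(14)]] A(15)[of "G s"] by simp
          moreover have "q1 (G s) = 0" using A(14)[OF False] B(14)[of "G s"] U(3) by blast
          ultimately show ?thesis using A(13)[of "G s"] by simp
        qed
      qed
      \<comment> \<open>The strip is narrowed by \<open>\<delta>\<close> on both sides to obtain a
        closed rectangle inside the domain of \<open>G\<close>; \<open>\<delta>\<close> tends to 0
        afterwards.\<close>
      have ineq: "2 * (\<Psi>0 + \<Psi>1) * (2 * pi - 2 * \<delta>) - 2 * pi * (\<Psi>0 + \<Psi>1) \<le> (2 * pi - 2 * \<delta>) * (2 * Z + 2 * \<tau>)"
        if \<delta>: "0 < \<delta>" "\<delta> < pi" for \<delta>
      proof -
        define R where "R = cbox (Complex (-X) \<delta>) (Complex X (2 * pi - \<delta>))"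
        have RS: "R \<subseteq> S" using \<delta> by (auto simp: R_def S_def in_cbox_complex_iff)
        have inS: "Complex x y \<in> S" if "\<delta> \<le> y" "y \<le> 2 * pi - \<delta>" for x y using that \<delta> by (simp add: S_def)
        have le: "- X \<le> X" "\<delta> \<le> 2 * pi - \<delta>" using X \<delta> by auto
        have f0: "integral R (\<lambda>z. Re (D0 (G z) * deriv G z)) = (0 - \<Psi>0) * ((2 * pi - \<delta>) - \<delta>)"
          unfolding R_def by (rule horizontal_flux[OF oS RS[unfolded R_def] le Gh A(3,4)]) (use end0 end1 inS in auto)
        have f1: "integral R (\<lambda>z. Re (D1 (G z) * deriv G z)) = (\<Psi>1 - 0) * ((2 * pi - \<delta>) - \<delta>)"
          unfolding R_def by (rule horizontal_flux[OF oS RS[unfolded R_def] le Gh B(3,4)]) (use end0 end1 inS in auto)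
        have "2 * (-1) * integral R (\<lambda>z. Re (D0 (G z) * deriv G z)) \<le> (-1)\<^sup>2 * integral UNIV e0 + integral R (\<lambda>z. q0 (G z))"
          unfolding R_def by (rule pulled_amgm[OF oS RS[unfolded R_def] Gh Gi A(4,10,7,9,11,16)])
        moreover have "2 * 1 * integral R (\<lambda>z. Re (D1 (G z) * deriv G z)) \<le> 1\<^sup>2 * integral UNIV e1 + integral R (\<lambda>z. q1 (G z))"
          unfolding R_def by (rule pulled_amgm[OF oS RS[unfolded R_def] Gh Gi B(4,10,7,9,11,16)])
        moreover have "integral R (\<lambda>z. q0 (G z)) + integral R (\<lambda>z. q1 (G z)) \<le> (2 * pi - 2 * \<delta>) * (2 * Z + 2 * \<tau>)"
        proof -
          have cG: "continuous_on R G" using holomorphic_on_imp_continuous_on[OF Gh] RS continuous_on_subset by blast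
          have i: "(\<lambda>z. q (G z)) integrable_on R" if "continuous_on UNIV q" for q :: "complex \<Rightarrow> real"
            using continuous_on_compose2[OF that cG] unfolding R_def by (intro integrable_continuous) auto
          have ck: "continuous_on R (\<lambda>z. k (Re z))" by (rule continuous_on_compose2[OF k(1)]) (auto intro: continuous_intros)
          have "integral R (\<lambda>z. q0 (G z)) + integral R (\<lambda>z. q1 (G z)) = integral R (\<lambda>z. q0 (G z) + q1 (G z))"
            by (rule Henstock_Kurzweil_Integration.integral_add[symmetric]; rule i; fact)
          also have "\<dots> \<le> integral R (\<lambda>z. k (Re z))"
          proof (rule integral_le)
            show "(\<lambda>z. q0 (G z) + q1 (G z)) integrable_on R" by (rule integrable_add; rule i; fact)
            show "(\<lambda>z. k (Re z)) integrable_on R" using ck unfolding R_def by (rule integrable_continuous)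
          qed (use qk RS in blast)
          also have "\<dots> = integral {\<delta>..2 * pi - \<delta>} (\<lambda>y. integral {- X..X} k)"
            unfolding R_def by (subst integral_complex_cbox_iterated2) (use ck in \<open>simp_all add: R_def\<close>)
          also have "integral {- X..X} k = K X - K (- X)"
            by (rule integral_unique, rule fundamental_theorem_of_calculus)
               (use le K(1) in \<open>auto simp: has_real_derivative_iff_has_vector_derivative intro: has_vector_derivative_at_within\<close>)
          also have "integral {\<delta>..2 * pi - \<delta>} (\<lambda>y. K X - K (- X)) = (2 * pi - 2 * \<delta>) * (K X - K (- X))" using le by simp
          also have "\<dots> \<le> (2 * pi - 2 * \<delta>) * (2 * Z + 2 * \<tau>)" using KX \<delta> by (intro mult_left_mono) auto
          finally show ?thesis .
        qed
        ultimately show ?thesis unfolding f0 f1 A(8) B(8) by (simp add: algebra_simps)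
      qed
      have "2 * (\<Psi>0 + \<Psi>1) * (2 * pi - 2 * 0) - 2 * pi * (\<Psi>0 + \<Psi>1) \<le> (2 * pi - 2 * 0) * (2 * Z + 2 * \<tau>)"
      proof (rule tendsto_le[OF trivial_limit_at_right_real])
        show "((\<lambda>\<delta>. (2 * pi - 2 * \<delta>) * (2 * Z + 2 * \<tau>)) \<longlongrightarrow> (2 * pi - 2 * 0) * (2 * Z + 2 * \<tau>)) (at_right 0)" by (intro tendsto_intros)
        show "((\<lambda>\<delta>. 2 * (\<Psi>0 + \<Psi>1) * (2 * pi - 2 * \<delta>) - 2 * pi * (\<Psi>0 + \<Psi>1)) \<longlongrightarrow> 2 * (\<Psi>0 + \<Psi>1) * (2 * pi - 2 * 0) - 2 * pi * (\<Psi>0 + \<Psi>1)) (at_right 0)" by (intro tendsto_intros)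
        show "eventually (\<lambda>\<delta>. 2 * (\<Psi>0 + \<Psi>1) * (2 * pi - 2 * \<delta>) - 2 * pi * (\<Psi>0 + \<Psi>1) \<le> (2 * pi - 2 * \<delta>) * (2 * Z + 2 * \<tau>)) (at_right 0)"
          unfolding eventually_at_right_field by (rule exI[of _ pi]) (use ineq in simp)
      qed
      then have "2 * pi * (\<Psi>0 + \<Psi>1) \<le> 2 * pi * (2 * Z + 2 * \<tau>)" by (simp add: algebra_simps)
      then have "\<Psi>0 + \<Psi>1 \<le> 2 * Z + 2 * \<tau>" by simp
      moreover have "Z = ln (cmod a + \<epsilon>) + ln (1 / \<epsilon>)" using a pos by (simp add: Z_def ln_div add_pos_pos add_nonneg_eq_0_iff)
      ultimately show "v0 + v1 \<le> 2 * ln (cmod a + \<epsilon>) + 4 * \<tau>" using A(1) B(1) by linarith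
    qed
  qed
  have fin: "v0 + v1 \<le> 2 * ln (cmod a) + 4 * \<tau>" if \<tau>: "\<tau> > 0" for \<tau>
  proof (rule tendsto_lowerbound[OF _ main[OF \<tau>] trivial_limit_at_right_real])
    have "((\<lambda>\<epsilon>. 2 * ln (cmod a + \<epsilon>) + 4 * \<tau>) \<longlongrightarrow> 2 * ln (cmod a + 0) + 4 * \<tau>) (at_right 0)"
      by (intro tendsto_intros) (use a in simp)
    then show "((\<lambda>\<epsilon>. 2 * ln (cmod a + \<epsilon>) + 4 * \<tau>) \<longlongrightarrow> 2 * ln (cmod a) + 4 * \<tau>) (at_right 0)" by simp
  qed
  show ?thesis
  proof (rule field_le_epsilon)
    fix \<eta> :: real assume "\<eta> > 0"
    then show "v0 + v1 \<le> 2 * ln (cmod a) + \<eta>" using fin[of "\<eta> / 4"] by simp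
  qed
qed

section \<open>Elementary inequalities\<close>

lemma has_real_derivative_nonneg_le:
  fixes f :: "real \<Rightarrow> real"
  assumes "a \<le> b" "\<And>x. a \<le> x \<Longrightarrow> x \<le> b \<Longrightarrow> (f has_real_derivative f' x) (at x)" "\<And>x. a \<le> x \<Longrightarrow> x \<le> b \<Longrightarrow> 0 \<le> f' x"
  shows "f a \<le> f b"
  by (rule DERIV_nonneg_imp_nondecreasing[OF assms(1)]) (use assms(2,3) in blast)

lemma ln_ratio_deriv:
  fixes t :: real
  assumes "0 \<le> t" "t < 1"
  shows "((\<lambda>t. ln (1 + t) - ln (1 - t)) has_real_derivative 2 / (1 - t\<^sup>2)) (at t)"
proof -
  have "((\<lambda>t. ln (1 + t) - ln (1 - t)) has_real_derivative 1 / (1 + t) - (- 1) / (1 - t)) (at t)"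
    using assms by (auto intro!: derivative_eq_intros)
  moreover have "1 - t\<^sup>2 = (1 + t) * (1 - t)" by (simp add: power2_eq_square algebra_simps)
  then have "1 / (1 + t) - (- 1) / (1 - t) = 2 / (1 - t\<^sup>2)" using assms by (simp add: divide_simps)
  ultimately show ?thesis by simp
qed

text \<open>The derivatives compare because
  \<open>(2 + 12 / 5 * t\<^sup>2) * (1 - t\<^sup>2) - 2\<close> equals
  \<open>2 / 5 * t\<^sup>2 * (1 - 6 * t\<^sup>2)\<close>; hence the condition
  \<open>6 * x\<^sup>2 \<le> 1\<close>.\<close>

lemma ln_ratio_upper:
  fixes x :: real
  assumes "0 \<le> x" "6 * x\<^sup>2 \<le> 1"
  shows "ln (1 + x) - ln (1 - x) \<le> 2 * x + 4 / 5 * x ^ 3"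
proof -
  have "(2 * 0 + 4 / 5 * 0 ^ 3) - (ln (1 + 0) - ln (1 - 0)) \<le> (2 * x + 4 / 5 * x ^ 3) - (ln (1 + x) - ln (1 - x))"
  proof (rule has_real_derivative_nonneg_le[where f'="\<lambda>t. (2 + 12 / 5 * t\<^sup>2) - 2 / (1 - t\<^sup>2)", OF assms(1)])
    fix t assume t: "0 \<le> t" "t \<le> x"
    have "t\<^sup>2 \<le> x\<^sup>2" by (rule power_mono[OF t(2) t(1)])
    then have t2: "6 * t\<^sup>2 \<le> 1" using assms(2) by simp
    have t1: "t < 1"
    proof (rule ccontr)
      assume "\<not> t < 1"
      then have "1 \<le> t\<^sup>2" by (intro one_le_power) simp
      then show False using t2 by simp
    qed
    have "((\<lambda>t. 2 * t + 4 / 5 * t ^ 3) has_real_derivative 2 + 12 / 5 * t\<^sup>2) (at t)" by (auto intro!: derivative_eq_intros)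
    from DERIV_diff[OF this ln_ratio_deriv[OF t(1) t1]]
    show "((\<lambda>t. (2 * t + 4 / 5 * t ^ 3) - (ln (1 + t) - ln (1 - t))) has_real_derivative (2 + 12 / 5 * t\<^sup>2) - 2 / (1 - t\<^sup>2)) (at t)" .
    have "0 \<le> t\<^sup>2 * (1 - 6 * t\<^sup>2)" using t2 by simp
    then have "2 \<le> (2 + 12 / 5 * t\<^sup>2) * (1 - t\<^sup>2)" by (simp add: algebra_simps)
    then have "2 / (1 - t\<^sup>2) \<le> 2 + 12 / 5 * t\<^sup>2" using t2 by (simp add: pos_divide_le_eq)
    then show "0 \<le> (2 + 12 / 5 * t\<^sup>2) - 2 / (1 - t\<^sup>2)" by simp
  qed
  then show ?thesis by simp
qed

lemma ln_ratio_lower: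
  fixes x :: real
  assumes "0 \<le> x" "x < 1"
  shows "2 * x + 2 / 3 * x ^ 3 \<le> ln (1 + x) - ln (1 - x)"
proof -
  have "(ln (1 + 0) - ln (1 - 0)) - (2 * 0 + 2 / 3 * 0 ^ 3) \<le> (ln (1 + x) - ln (1 - x)) - (2 * x + 2 / 3 * x ^ 3)"
  proof (rule has_real_derivative_nonneg_le[where f'="\<lambda>t. 2 / (1 - t\<^sup>2) - (2 + 2 * t\<^sup>2)", OF assms(1)])
    fix t assume t: "0 \<le> t" "t \<le> x"
    then have t1: "t < 1" using assms by simp
    have "((\<lambda>t. 2 * t + 2 / 3 * t ^ 3) has_real_derivative 2 + 2 * t\<^sup>2) (at t)" by (auto intro!: derivative_eq_intros)
    from DERIV_diff[OF ln_ratio_deriv[OF t(1) t1] this]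
    show "((\<lambda>t. (ln (1 + t) - ln (1 - t)) - (2 * t + 2 / 3 * t ^ 3)) has_real_derivative 2 / (1 - t\<^sup>2) - (2 + 2 * t\<^sup>2)) (at t)" .
    have "t\<^sup>2 < 1" using t t1 by (simp add: power_less_one_iff)
    moreover have "0 \<le> t\<^sup>2 * t\<^sup>2" by simp
    then have "(2 + 2 * t\<^sup>2) * (1 - t\<^sup>2) \<le> 2" by (simp add: algebra_simps)
    ultimately have "2 + 2 * t\<^sup>2 \<le> 2 / (1 - t\<^sup>2)" by (simp add: pos_le_divide_eq)
    then show "0 \<le> 2 / (1 - t\<^sup>2) - (2 + 2 * t\<^sup>2)" by simp
  qed
  then show ?thesis by simp
qed

text \<open>\<open>ln 2\<close> is the ratio logarithm at 1/3, for which the cubic lower bound is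
  56/81.\<close>

lemma ln4_ge: "ln (4::real) \<ge> 69 / 50"
proof -
  have "ln (1 + 1 / 3) - ln (1 - 1 / 3 :: real) = ln 2" using ln_div[of "4 / 3 :: real" "2 / 3"] by simp
  moreover have "ln (4::real) = 2 * ln 2" using ln_realpow[of 2 2] by simp
  ultimately show ?thesis using ln_ratio_lower[of "1 / 3"] by (simp add: eval_nat_numeral)
qed

lemma ln_one_minus_series:
  fixes p :: real
  assumes "0 \<le> p" "p < 1"
  shows "p + p ^ 2 / 2 + p ^ 3 / 3 + p ^ 4 / 4 + p ^ 5 / 5 + p ^ 6 / 6 \<le> - ln (1 - p)"
proof -
  have "- ln (1 - 0) - (0 + 0 ^ 2 / 2 + 0 ^ 3 / 3 + 0 ^ 4 / 4 + 0 ^ 5 / 5 + 0 ^ 6 / 6) \<le> - ln (1 - p) - (p + p ^ 2 / 2 + p ^ 3 / 3 + p ^ 4 / 4 + p ^ 5 / 5 + p ^ 6 / 6)"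
  proof (rule has_real_derivative_nonneg_le[where f'="\<lambda>t. 1 / (1 - t) - (1 + t + t ^ 2 + t ^ 3 + t ^ 4 + t ^ 5)", OF assms(1)])
    fix t assume t: "0 \<le> t" "t \<le> p"
    then have t1: "t < 1" using assms by simp
    show "((\<lambda>t. - ln (1 - t) - (t + t ^ 2 / 2 + t ^ 3 / 3 + t ^ 4 / 4 + t ^ 5 / 5 + t ^ 6 / 6)) has_real_derivative 1 / (1 - t) - (1 + t + t ^ 2 + t ^ 3 + t ^ 4 + t ^ 5)) (at t)"
      using t1 by (auto intro!: derivative_eq_intros simp: field_simps)
    have "1 / (1 - t) - (1 + t + t ^ 2 + t ^ 3 + t ^ 4 + t ^ 5) = t ^ 6 / (1 - t)" using t1
      by (simp add: divide_simps) (simp add: eval_nat_numeral algebra_simps)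
    then show "0 \<le> 1 / (1 - t) - (1 + t + t ^ 2 + t ^ 3 + t ^ 4 + t ^ 5)" using t t1 by simp
  qed
  then show ?thesis by simp
qed

lemma ln_le_half_diff:
  fixes x :: real
  assumes "1 \<le> x"
  shows "ln x \<le> (x - 1 / x) / 2"
proof -
  have "(1 - 1 / 1) / 2 - ln 1 \<le> (x - 1 / x) / 2 - ln x"
  proof (rule has_real_derivative_nonneg_le[where f'="\<lambda>t. (1 - 1 / t)\<^sup>2 / 2", OF assms])
    fix t assume t: "1 \<le> t" "t \<le> x"
    then show "((\<lambda>t. (t - 1 / t) / 2 - ln t) has_real_derivative (1 - 1 / t)\<^sup>2 / 2) (at t)"
      by (auto intro!: derivative_eq_intros simp: field_simps power2_eq_square)
  qed simp
  then show ?thesis by simp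
qed

text \<open>After multiplication by \<open>10 ^ 15\<close>, all coefficients in the variable
  \<open>w = 10 * \<mu> - 13\<close> are positive, as the Horner form shows.\<close>

lemma large_case_polynomial:
  fixes \<mu> :: real
  assumes "\<mu> \<ge> 13 / 10"
  shows "0 < 50 * \<mu> ^ 0 + 60 * \<mu> ^ 1 + 75 * \<mu> ^ 2 + 100 * \<mu> ^ 3 + 100 * \<mu> ^ 4 + 990 * \<mu> ^ 5 - 350 * \<mu> ^ 6 - 910 * \<mu> ^ 7 - 225 * \<mu> ^ 8 + 350 * \<mu> ^ 9 - 400 * \<mu> ^ 10 - 90 * \<mu> ^ 11 + 489 * \<mu> ^ 12 - 800 * \<mu> ^ 13 + 150 * \<mu> ^ 14 + 300 * \<mu> ^ 15"
proof -
  define w where "w = 10 * \<mu> - 13"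
  have w: "w \<ge> 0" using assms by (simp add: w_def)
  have "0 < 209846712995829600 + w * (3921896152557889500 + w * (3853029741454872000 + w * (1729139531336578500 + w * (477221506056480000 + w * (91248878019419100 + w * (12814942269468000 + w * (1361746689270500 + w * (110971624284000 + w * (6951895152500 + w * (332400451200 + w * (11916115500 + w * (309928000 + w * (5516500 + w * (60000 + w * (300)))))))))))))))"
    using w by (intro add_pos_nonneg mult_nonneg_nonneg add_nonneg_nonneg) simp_all
  also have "\<dots> = 10 ^ 15 * (50 * \<mu> ^ 0 + 60 * \<mu> ^ 1 + 75 * \<mu> ^ 2 + 100 * \<mu> ^ 3 + 100 * \<mu> ^ 4 + 990 * \<mu> ^ 5 - 350 * \<mu> ^ 6 - 910 * \<mu> ^ 7 - 225 * \<mu> ^ 8 + 350 * \<mu> ^ 9 - 400 * \<mu> ^ 10 - 90 * \<mu> ^ 11 + 489 * \<mu> ^ 12 - 800 * \<mu> ^ 13 + 150 * \<mu> ^ 14 + 300 * \<mu> ^ 15)"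
    unfolding w_def by algebra
  finally show ?thesis by (simp only: zero_less_mult_iff) simp
qed

text \<open>The factor \<open>300 * \<mu> ^ 10\<close> clears the denominators:
  \<open>p ^ 10\<close> is the highest power of \<open>p\<close> that occurs, and 300 is the least
  common multiple of 60, from the series, and 50.\<close>

lemma large_case_rational:
  fixes \<mu> p :: real
  assumes "\<mu> \<ge> 13 / 10" and p: "p = 1 / \<mu>"
  shows "0 < (1 - p ^ 4) * ((\<mu> ^ 6 - 1) * (p + p ^ 2 / 2 + p ^ 3 / 3 + p ^ 4 / 4 + p ^ 5 / 5 + p ^ 6 / 6) - 1)
      - (\<mu> - p) / 2 * (5 * (1 - p ^ 4) + 6 * \<mu>\<^sup>2 + 10 * p ^ 4) + 69 / 50 * \<mu>\<^sup>2 - 7 / 4 * p ^ 4" (is "0 < ?d")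
proof -
  have mu: "\<mu> > 0" "\<mu> \<noteq> 0" using assms by auto
  have "300 * \<mu> ^ 10 * ?d = 50 * \<mu> ^ 0 + 60 * \<mu> ^ 1 + 75 * \<mu> ^ 2 + 100 * \<mu> ^ 3 + 100 * \<mu> ^ 4 + 990 * \<mu> ^ 5 - 350 * \<mu> ^ 6 - 910 * \<mu> ^ 7 - 225 * \<mu> ^ 8 + 350 * \<mu> ^ 9 - 400 * \<mu> ^ 10 - 90 * \<mu> ^ 11 + 489 * \<mu> ^ 12 - 800 * \<mu> ^ 13 + 150 * \<mu> ^ 14 + 300 * \<mu> ^ 15"
    unfolding p using mu by (simp add: divide_simps) (simp add: eval_nat_numeral algebra_simps)
  then have "0 < 300 * \<mu> ^ 10 * ?d" using large_case_polynomial[OF assms(1)] by linarith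
  then show ?thesis using mu by (simp only: zero_less_mult_iff) simp
qed

section \<open>The entropy sums\<close>

text \<open>The contribution of the opening of a sector to the bound: \<open>x\<close> is \<open>\<surd>\<gamma> \<alpha> / 2\<close>.\<close>
definition efun :: "real \<Rightarrow> real" where
  "efun x = 2 * x\<^sup>2 * ln (2 * x) - (1 + x)\<^sup>2 * ln (1 + x) - (1 - x)\<^sup>2 * ln (1 - x)"

definition efun' :: "real \<Rightarrow> real" where
  "efun' x = 4 * x * ln (2 * x) - 2 * (1 + x) * ln (1 + x) + 2 * (1 - x) * ln (1 - x)"

lemma efun_deriv:
  assumes "0 < x" "x < 1"
  shows "(efun has_real_derivative efun' x) (at x)"
proof -
  have 1: "((\<lambda>x. 2 * x\<^sup>2 * ln (2 * x)) has_real_derivative 4 * x * ln (2 * x) + 2 * x) (at x)"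
    using assms by (auto intro!: derivative_eq_intros simp: power2_eq_square)
  have 2: "((\<lambda>x. (1 + x)\<^sup>2 * ln (1 + x)) has_real_derivative 2 * (1 + x) * ln (1 + x) + (1 + x)) (at x)"
    using assms by (auto intro!: derivative_eq_intros simp: power2_eq_square)
  have 3: "((\<lambda>x. (1 - x)\<^sup>2 * ln (1 - x)) has_real_derivative - 2 * (1 - x) * ln (1 - x) - (1 - x)) (at x)"
    using assms by (auto intro!: derivative_eq_intros simp: power2_eq_square)
  show ?thesis using DERIV_diff[OF DERIV_diff[OF 1 2] 3] unfolding efun_def[abs_def] efun'_def
    by (rule DERIV_cong) (simp add: algebra_simps)
qed

lemma efun'_deriv:
  assumes "0 < x" "x < 1"
  shows "(efun' has_real_derivative 2 * ln (4 * x\<^sup>2 / (1 - x\<^sup>2))) (at x)"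
proof -
  have 1: "((\<lambda>x. 4 * x * ln (2 * x)) has_real_derivative 4 * ln (2 * x) + 4) (at x)"
    using assms by (auto intro!: derivative_eq_intros)
  have 2: "((\<lambda>x. 2 * (1 + x) * ln (1 + x)) has_real_derivative 2 * ln (1 + x) + 2) (at x)"
    using assms by (auto intro!: derivative_eq_intros) (simp add: field_simps)
  have 3: "((\<lambda>x. 2 * (1 - x) * ln (1 - x)) has_real_derivative - 2 * ln (1 - x) - 2) (at x)"
    using assms by (auto intro!: derivative_eq_intros) (simp add: field_simps)
  have "4 * x\<^sup>2 / (1 - x\<^sup>2) = (2 * x)\<^sup>2 / ((1 + x) * (1 - x))" by (simp add: power2_eq_square algebra_simps)
  then have "ln (4 * x\<^sup>2 / (1 - x\<^sup>2)) = 2 * ln (2 * x) - (ln (1 + x) + ln (1 - x))"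
    using assms ln_realpow[of 2 2] by (simp add: ln_div ln_mult ln_realpow)
  then show ?thesis using DERIV_add[OF DERIV_diff[OF 1 2] 3] unfolding efun'_def[abs_def]
    by (elim DERIV_cong) (simp add: algebra_simps)
qed

text \<open>Comparing \<open>1 - x\<close> and \<open>2 * x\<close> with \<open>1 + x\<close> inside
  the logarithms is enough.\<close>

lemma efun'_nonpos:
  assumes "0 < x" "x < 1"
  shows "efun' x \<le> 0"
proof -
  have "(1 - x) * ln (1 - x) \<le> (1 - x) * ln (1 + x)" using assms by (intro mult_left_mono) auto
  moreover have "x * ln (2 * x) \<le> x * ln (1 + x)" using assms by (intro mult_left_mono) auto
  ultimately have "4 * (x * ln (2 * x)) - 2 * ((1 - x) * ln (1 + x)) - 4 * (x * ln (1 + x)) + 2 * ((1 - x) * ln (1 - x)) \<le> 0"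
    by linarith
  then show ?thesis by (simp add: efun'_def algebra_simps)
qed

lemma efun_antimono:
  assumes "0 < x" "x \<le> y" "y < 1"
  shows "efun y \<le> efun x"
  by (rule DERIV_nonpos_imp_nonincreasing[OF assms(2)]) (use efun_deriv efun'_nonpos assms in \<open>meson le_less_trans less_le_trans\<close>)

text \<open>The bound 31/50 is where two estimates meet: up to there \<open>1 / t\<^sup>2\<close> is
  at least 26/10, and the logarithm in the second derivative is at most 13/10, since its argument is
  at most \<open>5 / 2 \<le> exp (13 / 10)\<close>.\<close>

lemma ln_efun_slope_antimono:
  assumes "0 < x" "x \<le> y" "y \<le> 31 / 50"
  shows "1 / y + efun' y \<le> 1 / x + efun' x"
proof (rule DERIV_nonpos_imp_nonincreasing[OF assms(2)])
  fix t assume t: "x \<le> t" "t \<le> y"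
  then have t0: "0 < t" "t \<le> 31 / 50" using assms by auto
  then have t2: "t\<^sup>2 \<le> (31 / 50)\<^sup>2" by (intro power_mono) auto
  then have t3: "t\<^sup>2 \<le> 961 / 2500" by (simp add: power2_eq_square)
  have d: "((\<lambda>t. 1 / t + efun' t) has_real_derivative - 1 / t\<^sup>2 + 2 * ln (4 * t\<^sup>2 / (1 - t\<^sup>2))) (at t)"
    by (rule DERIV_add[OF _ efun'_deriv]) (use t0 in \<open>auto intro!: derivative_eq_intros simp: power2_eq_square\<close>)
  have "4 * t\<^sup>2 / (1 - t\<^sup>2) \<le> 5 / 2" using t3 by (simp add: divide_le_eq)
  moreover have "(5 / 2 :: real) \<le> exp (13 / 10)" using exp_lower_Taylor_quadratic[of "13 / 10"] by (simp add: power2_eq_square)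
  moreover have "0 < 4 * t\<^sup>2 / (1 - t\<^sup>2)" using t0 t3 by simp
  ultimately have "ln (4 * t\<^sup>2 / (1 - t\<^sup>2)) \<le> ln (exp (13 / 10))" by (subst ln_le_cancel_iff) linarith+
  then have "ln (4 * t\<^sup>2 / (1 - t\<^sup>2)) \<le> 13 / 10" by simp
  moreover have "26 / 10 \<le> 1 / t\<^sup>2" using t0 t3 by (simp add: le_divide_eq)
  ultimately have "- 1 / t\<^sup>2 + 2 * ln (4 * t\<^sup>2 / (1 - t\<^sup>2)) \<le> 0" by simp
  then show "\<exists>y. ((\<lambda>t. 1 / t + efun' t) has_real_derivative y) (at t) \<and> y \<le> 0" using d by blast
qed

text \<open>Beyond 31/50 monotonicity is replaced by \<open>efun' y \<le> 0\<close>: the slope is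
  then at most 50/31, which is below the slope at 53/200.\<close>

lemma ln_efun_slope_le:
  assumes x: "0 < x" "x \<le> 53 / 200" and y: "x \<le> y" "y < 1"
  shows "1 / y + efun' y \<le> 1 / x + efun' x"
proof (cases "y \<le> 31 / 50")
  case True
  then show ?thesis using ln_efun_slope_antimono x y by simp
next
  case False
  then have "1 / y \<le> 50 / 31" by (simp add: field_simps)
  then have "1 / y + efun' y \<le> 50 / 31" using efun'_nonpos[of y] x y by simp
  also have "\<dots> \<le> 1 / (53 / 200) + efun' (53 / 200)"
  proof -
    have "ln (1 + 53 / 200 :: real) \<le> 53 / 200" using ln_add_one_self_le_self[of "53 / 200"] by simp
    moreover have "1 - 1 / (147 / 200) \<le> ln (147 / 200 :: real)" using ln_le_minus_one[of "200 / 147"] ln_inverse[of "147 / 200 :: real"] by simp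
    moreover have "1 - 1 / (53 / 100) \<le> ln (53 / 100 :: real)" using ln_le_minus_one[of "100 / 53"] ln_inverse[of "53 / 100 :: real"] by simp
    ultimately show ?thesis by (simp add: efun'_def)
  qed
  also have "\<dots> \<le> 1 / x + efun' x" using x by (intro ln_efun_slope_antimono) auto
  finally show ?thesis .
qed

text \<open>Concavity is available only up to \<open>0.62\<close>, but tangents at points below \<open>0.265\<close> stay above the function on the whole interval.\<close>
lemma ln_efun_tangent:
  assumes x: "0 < x" "x \<le> 53 / 200" and y: "0 < y" "y < 1"
  shows "ln y + efun y \<le> ln x + efun x + (1 / x + efun' x) * (y - x)"
proof -
  define f where "f t = ln t + efun t - (1 / x + efun' x) * t" for t
  have d: "(f has_real_derivative 1 / t + efun' t - (1 / x + efun' x)) (at t)" if "0 < t" "t < 1" for t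
    unfolding f_def[abs_def] using that by (auto intro!: derivative_eq_intros efun_deriv)
  have "f y \<le> f x"
  proof (cases "x \<le> y")
    case True
    show ?thesis
    proof (rule DERIV_nonpos_imp_nonincreasing[OF True])
      fix t assume t: "x \<le> t" "t \<le> y"
      then show "\<exists>y. (f has_real_derivative y) (at t) \<and> y \<le> 0" using d[of t] ln_efun_slope_le[OF x t(1)] x y by force
    qed
  next
    case False
    then have yx: "y \<le> x" by simp
    show ?thesis
    proof (rule DERIV_nonneg_imp_nondecreasing[OF yx])
      fix t assume t: "y \<le> t" "t \<le> x"
      then have "1 / x + efun' x \<le> 1 / t + efun' t" using x y by (intro ln_efun_slope_antimono) auto
      then show "\<exists>y. (f has_real_derivative y) (at t) \<and> 0 \<le> y" using d[of t] t x y by force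
    qed
  qed
  then show ?thesis using x by (simp add: f_def algebra_simps diff_divide_distrib)
qed

text \<open>7/4 exceeds \<open>4 - 1 - 69 / 50 + 3 / 5 * x\<^sup>2\<close> in the given range; the 4
  stems from the ratio logarithm, the 1 from \<open>ln (1 - x\<^sup>2) \<le> - x\<^sup>2\<close>,
  the fraction 69/50 from \<open>ln 4\<close>.\<close>

lemma neg_efun_le:
  assumes x: "0 < x" "x\<^sup>2 \<le> 13 / 160"
  shows "- efun x \<le> x\<^sup>2 * (7 / 4 - 2 * ln x)"
proof -
  have x1: "x < 1"
  proof (rule ccontr)
    assume "\<not> x < 1"
    then have "1 \<le> x\<^sup>2" by (intro one_le_power) simp
    then show False using x by simp
  qed
  define l where "l = ln (1 + x) - ln (1 - x)"
  define s where "s = ln (1 + x) + ln (1 - x)"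
  have "1 - x\<^sup>2 = (1 + x) * (1 - x)" by (simp add: power2_eq_square algebra_simps)
  then have "s = ln (1 - x\<^sup>2)" using x x1 by (simp add: s_def ln_mult)
  also have "\<dots> \<le> - x\<^sup>2" using ln_le_minus_one[of "1 - x\<^sup>2"] x by simp
  finally have "(1 + x\<^sup>2) * s \<le> (1 + x\<^sup>2) * - x\<^sup>2" by (intro mult_left_mono) auto
  moreover have "2 * x * l \<le> 2 * x * (2 * x + 4 / 5 * x ^ 3)" unfolding l_def using x by (intro mult_left_mono ln_ratio_upper) auto
  moreover have "- efun x = (1 + x\<^sup>2) * s + 2 * x * l - 2 * x\<^sup>2 * ln (2 * x)" by (simp add: efun_def s_def l_def power2_eq_square algebra_simps)
  moreover have "x\<^sup>2 * (69 / 50) \<le> x\<^sup>2 * ln 4" using ln4_ge by (intro mult_left_mono) auto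
  moreover have "2 * ln (2 * x) = ln 4 + 2 * ln x" using x ln_realpow[of 2 2] by (simp add: ln_mult)
  then have "x\<^sup>2 * (2 * ln (2 * x)) = x\<^sup>2 * (ln 4 + 2 * ln x)" by (simp only:)
  then have "2 * x\<^sup>2 * ln (2 * x) = x\<^sup>2 * ln 4 + x\<^sup>2 * (2 * ln x)" by (simp only: distrib_left mult_ac)
  moreover have "x\<^sup>2 * x\<^sup>2 \<le> x\<^sup>2 * (13 / 160)" using x by (intro mult_left_mono) auto
  moreover have "(1 + x\<^sup>2) * - x\<^sup>2 = - x\<^sup>2 - x\<^sup>2 * x\<^sup>2" "2 * x * (2 * x + 4 / 5 * x ^ 3) = 4 * x\<^sup>2 + 8 / 5 * (x\<^sup>2 * x\<^sup>2)"
    by (simp_all add: eval_nat_numeral algebra_simps)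
  moreover have "x\<^sup>2 * (7 / 4 - 2 * ln x) = 7 / 4 * x\<^sup>2 - x\<^sup>2 * (2 * ln x)" by (simp add: algebra_simps)
  moreover have "0 \<le> x\<^sup>2" by simp
  ultimately show ?thesis by linarith
qed

text \<open>The tangent of \<open>ln_efun_tangent\<close> is taken at the mean
  \<open>x = sqrt \<gamma> / m\<close> of the arguments; the linear terms cancel in the sum because
  the openings sum to 2.\<close>

lemma main_case_sum:
  fixes \<alpha> :: "nat \<Rightarrow> real" and m :: nat
  assumes m: "m \<ge> 5" and \<gamma>: "0 < \<gamma>" "\<gamma> ^ 3 \<le> real m"
    and \<alpha>: "\<And>j. j < m \<Longrightarrow> 0 < \<alpha> j" "(\<Sum>j<m. \<alpha> j) = 2" "\<And>j. j < m \<Longrightarrow> sqrt \<gamma> * \<alpha> j < 2"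
  shows "(\<Sum>j<m. ln (2 * \<alpha> j) + efun (sqrt \<gamma> * \<alpha> j / 2)) \<le> m * ln (4 / m) + m * efun (sqrt \<gamma> / m)"
proof -
  define x where "x = sqrt \<gamma> / m"
  have x0: "0 < x" using \<gamma> m by (simp add: x_def)
  \<comment> \<open>The hypotheses give \<open>x ^ 6 \<le> 1 / m ^ 5 \<le> 1 / 5 ^ 5\<close>, that
    is \<open>x\<close> at most about 0.2615; 53/200 is a rational number just above.\<close>
  have "x ^ 6 \<le> (53 / 200) ^ 6"
  proof -
    have "sqrt \<gamma> ^ 6 = (sqrt \<gamma> ^ 2) ^ 3" by (simp add: power_mult[symmetric])
    then have "x ^ 6 = \<gamma> ^ 3 / real m ^ 6" using \<gamma> by (simp add: x_def power_divide)
    also have "\<dots> \<le> real m / real m ^ 6" using \<gamma> by (intro divide_right_mono) auto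
    also have "\<dots> = 1 / real m ^ 5" using m by (simp add: field_simps eval_nat_numeral)
    also have "\<dots> \<le> 1 / 5 ^ 5"
    proof -
      have "(5::real) ^ 5 \<le> real m ^ 5" using m by (intro power_mono) auto
      then show ?thesis using m by (intro divide_left_mono) auto
    qed
    also have "\<dots> \<le> (53 / 200) ^ 6" by (simp add: power_divide)
    finally show ?thesis .
  qed
  then have x1: "x \<le> 53 / 200" by (rule power_le_imp_le_base[of _ 5, simplified]) simp
  have eq: "ln (2 * \<alpha> j) + efun (sqrt \<gamma> * \<alpha> j / 2) = ln (4 / sqrt \<gamma>) + (ln (sqrt \<gamma> * \<alpha> j / 2) + efun (sqrt \<gamma> * \<alpha> j / 2))" if "j < m" for j
  proof -
    have "2 * \<alpha> j = 4 / sqrt \<gamma> * (sqrt \<gamma> * \<alpha> j / 2)" using \<gamma> by simp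
    then have "ln (2 * \<alpha> j) = ln (4 / sqrt \<gamma>) + ln (sqrt \<gamma> * \<alpha> j / 2)" using \<gamma> \<alpha>(1)[OF that] by (metis ln_mult_pos mult_pos_pos divide_pos_pos real_sqrt_gt_zero zero_less_numeral)
    then show ?thesis by simp
  qed
  have "(\<Sum>j<m. ln (2 * \<alpha> j) + efun (sqrt \<gamma> * \<alpha> j / 2)) \<le> (\<Sum>j<m. ln (4 / sqrt \<gamma>) + (ln x + efun x + (1 / x + efun' x) * (sqrt \<gamma> * \<alpha> j / 2 - x)))"
  proof (rule sum_mono)
    fix j assume "j \<in> {..<m}"
    then have j: "j < m" by simp
    show "ln (2 * \<alpha> j) + efun (sqrt \<gamma> * \<alpha> j / 2) \<le> ln (4 / sqrt \<gamma>) + (ln x + efun x + (1 / x + efun' x) * (sqrt \<gamma> * \<alpha> j / 2 - x))"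
      unfolding eq[OF j] using ln_efun_tangent[OF x0 x1, of "sqrt \<gamma> * \<alpha> j / 2"] \<alpha>(1,3)[OF j] \<gamma> by simp
  qed
  also have "\<dots> = m * (ln (4 / sqrt \<gamma>) + ln x + efun x) + (1 / x + efun' x) * (sqrt \<gamma> * (\<Sum>j<m. \<alpha> j) / 2 - m * x)"
    by (simp add: sum.distrib sum_subtractf sum_distrib_left[symmetric] sum_divide_distrib[symmetric] algebra_simps)
  also have "sqrt \<gamma> * (\<Sum>j<m. \<alpha> j) / 2 - m * x = 0" unfolding \<alpha>(2) using m by (simp add: x_def)
  also have "ln (4 / sqrt \<gamma>) + ln x = ln (4 / m)" using \<gamma> m by (simp add: x_def ln_div)
  finally show ?thesis by (simp add: x_def algebra_simps)
qed

text \<open>Tangents of \<open>ln\<close> are taken at the extremal distribution: at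
  \<open>p\<close> for the large weight and at \<open>c = (1 - p) / (m - 1)\<close> for the others.
  What remains is \<open>w i - p\<close> times \<open>1 / p - 1 / c\<close>, and this factor is
  nonpositive since the third condition on \<open>p\<close> says \<open>c \<le> p\<close>.\<close>

lemma sum_ln_le_of_large_term:
  fixes w :: "nat \<Rightarrow> real"
  assumes w: "\<And>j. j < m \<Longrightarrow> 0 < w j" "(\<Sum>j<m. w j) = 1" and i: "i < m" "p \<le> w i" and p: "0 < p" "p < 1" "1 - p \<le> p * (real m - 1)" and m: "m \<ge> 2"
  shows "(\<Sum>j<m. ln (w j)) \<le> ln p + (real m - 1) * ln ((1 - p) / (real m - 1))"
proof -
  define c where "c = (1 - p) / (real m - 1)"
  have c: "0 < c" using p m by (simp add: c_def)
  have tan: "ln x \<le> ln y + (x / y - 1)" if "0 < x" "0 < y" for x y :: real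
    using ln_le_minus_one[of "x / y"] that by (simp add: ln_div)
  have split: "(\<Sum>j<m. f j) = f i + (\<Sum>j\<in>{..<m} - {i}. f j)" for f :: "nat \<Rightarrow> real" using i by (intro sum.remove) auto
  have "(\<Sum>j\<in>{..<m} - {i}. ln (w j)) \<le> (\<Sum>j\<in>{..<m} - {i}. ln c + (w j / c - 1))"
    by (intro sum_mono tan w c) auto
  also have "\<dots> = (real m - 1) * (ln c - 1) + (\<Sum>j\<in>{..<m} - {i}. w j) / c"
    using i by (simp add: sum.distrib sum_subtractf sum_divide_distrib of_nat_diff algebra_simps)
  also have "(\<Sum>j\<in>{..<m} - {i}. w j) = 1 - w i" using split[of w] w(2) by simp
  finally have "(\<Sum>j<m. ln (w j)) \<le> ln p + (w i / p - 1) + (real m - 1) * (ln c - 1) + (1 - w i) / c"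
    using split[of "\<lambda>j. ln (w j)"] tan[OF w(1)[OF i(1)] p(1)] by linarith
  moreover have "(w i / p - 1) - (real m - 1) + (1 - w i) / c \<le> 0"
  proof -
    have "(1 - w i) / c = (real m - 1) * ((1 - w i) / (1 - p))" by (simp add: c_def)
    moreover have "(1 - w i) / (1 - p) = 1 - (w i - p) / (1 - p)" using p by (simp add: field_simps)
    moreover have "w i / p - 1 = (w i - p) / p" using p by (simp add: field_simps)
    moreover have "(w i - p) / p \<le> (w i - p) * ((real m - 1) / (1 - p))"
    proof -
      have "1 / p \<le> (real m - 1) / (1 - p)" using p by (simp add: field_simps)
      from mult_left_mono[OF this, of "w i - p"] i show ?thesis by simp
    qed
    ultimately show ?thesis by (simp add: algebra_simps)
  qed
  ultimately show ?thesis unfolding c_def[symmetric] by (simp add: algebra_simps)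
qed

text \<open>With \<open>m = \<mu>\<^sup>6\<close> and \<open>\<gamma> \<le> \<mu>\<^sup>2\<close>, one opening at least \<open>2 / \<mu>\<close> makes the entropy \<open>\<Sum> ln (2 \<alpha>\<^sub>j)\<close> so small that a rational inequality in \<open>\<mu> \<ge> 1.3\<close> remains.\<close>
lemma large_case_sum:
  fixes \<alpha> :: "nat \<Rightarrow> real" and m :: nat
  assumes m: "m \<ge> 5" and \<gamma>: "0 < \<gamma>" "\<gamma> ^ 3 \<le> real m"
    and \<alpha>: "\<And>j. j < m \<Longrightarrow> 0 < \<alpha> j" "(\<Sum>j<m. \<alpha> j) = 2" and i: "i < m" "2 \<le> sqrt \<gamma> * \<alpha> i"
  shows "(1 - \<gamma> / m) * (\<Sum>j<m. ln (2 * \<alpha> j)) \<le> m * ln (4 / m) + m * efun (sqrt \<gamma> / m)"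
proof -
  define \<mu> where "\<mu> = root 6 (real m)"
  define p where "p = 1 / \<mu>"
  define t where "t = ln \<mu>"
  define M where "M = real m"
  have M5: "M \<ge> 5" using m by (simp add: M_def)
  have M: "M = \<mu> ^ 6" "\<mu> > 0" using m by (simp_all add: \<mu>_def M_def)
  \<comment> \<open>Because \<open>(13 / 10) ^ 6 < 5 \<le> m\<close>.\<close>
  have mu: "\<mu> \<ge> 13 / 10"
  proof (rule power_le_imp_le_base)
    show "(13 / 10) ^ Suc 5 \<le> \<mu> ^ Suc 5" using M5 M by (simp add: power_divide)
  qed (use M in simp)
  have g2: "\<gamma> \<le> \<mu>\<^sup>2"
  proof (rule power_le_imp_le_base)
    show "\<gamma> ^ Suc 2 \<le> (\<mu>\<^sup>2) ^ Suc 2" using \<gamma> M by (simp add: power_mult[symmetric] M_def eval_nat_numeral)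
  qed simp
  then have sg: "sqrt \<gamma> \<le> \<mu>" using M(2) real_le_lsqrt \<gamma>(1) by (simp add: real_le_lsqrt)
  have p: "0 < p" "p \<le> 10 / 13" "p < 1" using mu by (auto simp: p_def field_simps)
  have pm: "p * \<mu> = 1" using M(2) by (simp add: p_def)
  have lM: "ln M = 6 * t" using M by (simp add: t_def ln_realpow)
  \<comment> \<open>This replaces the remaining logarithm \<open>t = ln \<mu>\<close> by a rational
    function of \<open>\<mu>\<close>.\<close>
  have t: "0 \<le> t" "t \<le> (\<mu> - p) / 2" using mu ln_le_half_diff[of \<mu>] by (auto simp: t_def p_def)
  \<comment> \<open>The deficit of the sum of \<open>ln (2 * \<alpha> j)\<close> against equal
    openings, forced by one opening of at least \<open>2 * p\<close>; see \<open>S\<close>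
    below.\<close>
  define b where "b = - ln p - (M - 1) * ln ((1 - p) / (M - 1)) - M * ln M"
  define s where "s = p + p ^ 2 / 2 + p ^ 3 / 3 + p ^ 4 / 4 + p ^ 5 / 5 + p ^ 6 / 6"
  have b: "b \<ge> (M - 1) * s - 5 * t - 1"
  proof -
    have "(M - 1) * s \<le> (M - 1) * (- ln (1 - p))" unfolding s_def using M5 p by (intro mult_left_mono ln_one_minus_series) auto
    moreover have "ln ((1 - p) / (M - 1)) = ln (1 - p) - ln (M - 1)" using p M5 by (simp add: ln_div)
    then have "(M - 1) * ln ((1 - p) / (M - 1)) = (M - 1) * (ln (1 - p) - ln (M - 1))" by (simp only:)
    moreover have "ln p = - t" using M(2) by (simp add: p_def t_def ln_div)
    moreover have "(M - 1) * (ln M - ln (M - 1)) \<le> 1"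
    proof -
      have "ln M - ln (M - 1) = ln (M / (M - 1))" using M5 by (simp add: ln_div)
      also have "\<dots> \<le> M / (M - 1) - 1" using M5 by (intro ln_le_minus_one) simp
      finally have "(M - 1) * (ln M - ln (M - 1)) \<le> (M - 1) * (M / (M - 1) - 1)" using M5 by (intro mult_left_mono) auto
      also have "\<dots> = 1" using M5 by (simp add: field_simps)
      finally show ?thesis .
    qed
    ultimately show ?thesis using lM unfolding b_def by (simp add: algebra_simps)
  qed
  have E: "- (M * efun (sqrt \<gamma> / M)) \<le> p ^ 4 * (7 / 4 + 10 * t)"
  proof -
    have p5: "p ^ 5 = \<mu> / M" unfolding M(1) p_def using M(2) by (simp add: field_simps eval_nat_numeral)
    have "(p ^ 5)\<^sup>2 \<le> (10 / 13) ^ 10" using power_mono[OF p(2), of 10] p(1) by (simp add: power_mult[symmetric])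
    also have "\<dots> \<le> 13 / 160" by (simp add: power_divide)
    finally have "- efun (p ^ 5) \<le> (p ^ 5)\<^sup>2 * (7 / 4 - 2 * ln (p ^ 5))" using p by (intro neg_efun_le) auto
    also have "ln (p ^ 5) = - 5 * t" using p by (simp add: ln_realpow) (simp add: p_def t_def ln_div)
    finally have "M * - efun (p ^ 5) \<le> M * ((p ^ 5)\<^sup>2 * (7 / 4 - 2 * (- 5 * t)))" using M5 by (intro mult_left_mono) auto
    also have "\<dots> = p ^ 4 * (7 / 4 + 10 * t)"
    proof -
      have "M * (p ^ 5)\<^sup>2 = (p * \<mu>) ^ 6 * p ^ 4" unfolding M(1) by (simp add: eval_nat_numeral algebra_simps)
      then have *: "M * (p ^ 5)\<^sup>2 = p ^ 4" by (simp add: pm)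
      show ?thesis unfolding mult.assoc[symmetric] * by simp
    qed
    finally have "- (M * efun (p ^ 5)) \<le> p ^ 4 * (7 / 4 + 10 * t)" by simp
    \<comment> \<open>\<open>efun\<close> decreases, so \<gamma> may be replaced by its upper bound
      \<open>\<mu>\<^sup>2\<close>, for which the argument \<open>sqrt \<gamma> / M\<close> becomes
      \<open>p ^ 5\<close>.\<close>
    moreover have "efun (p ^ 5) \<le> efun (sqrt \<gamma> / M)"
    proof (rule efun_antimono)
      show "sqrt \<gamma> / M \<le> p ^ 5" unfolding p5 using sg M5 by (intro divide_right_mono) auto
      show "p ^ 5 < 1" using p by (simp add: power_less_one_iff)
    qed (use \<gamma> M5 in simp)
    then have "M * efun (p ^ 5) \<le> M * efun (sqrt \<gamma> / M)" using M5 by (intro mult_left_mono) auto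
    ultimately show ?thesis by linarith
  qed
  have fin: "p ^ 4 * (7 / 4 + 10 * t) + \<mu>\<^sup>2 * (6 * t - 69 / 50) \<le> (1 - p ^ 4) * ((M - 1) * s - 5 * t - 1)"
  proof -
    have p4: "p ^ 4 < 1" using p by (simp add: power_less_one_iff)
    have "0 < (1 - p ^ 4) * ((M - 1) * s - 1) - (\<mu> - p) / 2 * (5 * (1 - p ^ 4) + 6 * \<mu>\<^sup>2 + 10 * p ^ 4) + 69 / 50 * \<mu>\<^sup>2 - 7 / 4 * p ^ 4"
      using large_case_rational[OF mu p_def] unfolding M(1) s_def .
    moreover have "t * (5 * (1 - p ^ 4) + 6 * \<mu>\<^sup>2 + 10 * p ^ 4) \<le> (\<mu> - p) / 2 * (5 * (1 - p ^ 4) + 6 * \<mu>\<^sup>2 + 10 * p ^ 4)"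
      using p4 p by (intro mult_right_mono t) auto
    ultimately have "0 < (1 - p ^ 4) * ((M - 1) * s - 1) - t * (5 * (1 - p ^ 4) + 6 * \<mu>\<^sup>2 + 10 * p ^ 4) + 69 / 50 * \<mu>\<^sup>2 - 7 / 4 * p ^ 4" by linarith
    then show ?thesis by (simp add: algebra_simps)
  qed
  have ln4: "ln 4 \<le> 6 * t" unfolding lM[symmetric] using M5 by simp
  have "\<gamma> * (6 * t - ln 4) \<le> \<mu>\<^sup>2 * (6 * t - ln 4)" using g2 ln4 by (intro mult_right_mono) auto
  also have "\<dots> \<le> \<mu>\<^sup>2 * (6 * t - 69 / 50)" using ln4_ge by (intro mult_left_mono) auto
  finally have g3: "\<gamma> * (6 * t - ln 4) \<le> \<mu>\<^sup>2 * (6 * t - 69 / 50)" .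
  have p4: "p ^ 4 < 1" using p by (simp add: power_less_one_iff)
  have "0 \<le> \<gamma> * (6 * t - ln 4)" using \<gamma> ln4 by simp
  then have "0 \<le> \<mu>\<^sup>2 * (6 * t - 69 / 50)" using g3 by linarith
  moreover have "0 \<le> p ^ 4 * (7 / 4 + 10 * t)" using p t by simp
  ultimately have "0 \<le> (1 - p ^ 4) * ((M - 1) * s - 5 * t - 1)" using fin by linarith
  then have "0 \<le> (M - 1) * s - 5 * t - 1" using p4 by (simp add: zero_le_mult_iff)
  then have b0: "0 \<le> b" using b by linarith
  have gM: "\<gamma> / M \<le> p ^ 4"
  proof -
    have "\<gamma> / M \<le> \<mu>\<^sup>2 / M" using g2 M5 by (intro divide_right_mono) auto
    also have "\<mu>\<^sup>2 / M = p ^ 4" unfolding M(1) p_def using M(2) by (simp add: field_simps eval_nat_numeral)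
    finally show ?thesis .
  qed
  have "(1 - p ^ 4) * ((M - 1) * s - 5 * t - 1) \<le> (1 - p ^ 4) * b" using p4 b by (intro mult_left_mono) auto
  also have "\<dots> \<le> (1 - \<gamma> / M) * b" using gM b0 by (intro mult_right_mono) auto
  finally have B: "(1 - p ^ 4) * ((M - 1) * s - 5 * t - 1) \<le> (1 - \<gamma> / M) * b" .
  have S: "(\<Sum>j<m. ln (2 * \<alpha> j)) \<le> M * ln (4 / M) - b"
  proof -
    have "(\<Sum>j<m. ln (\<alpha> j / 2)) \<le> ln p + (real m - 1) * ln ((1 - p) / (real m - 1))"
    proof (rule sum_ln_le_of_large_term)
      show "(\<Sum>j<m. \<alpha> j / 2) = 1" using \<alpha>(2) by (simp add: sum_divide_distrib[symmetric])
      have "sqrt \<gamma> * \<alpha> i \<le> \<mu> * \<alpha> i" using sg \<alpha>(1)[OF i(1)] by (intro mult_right_mono) auto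
      then have "2 \<le> \<mu> * \<alpha> i" using i by linarith
      then show "p \<le> \<alpha> i / 2" using M(2) by (simp add: p_def field_simps)
      have "1 \<le> p * M"
      proof -
        have "p * M = (p * \<mu>) * \<mu> ^ 5" unfolding M(1) by (simp add: eval_nat_numeral)
        also have "\<dots> \<ge> 1" unfolding pm using mu by (simp add: one_le_power)
        finally show ?thesis .
      qed
      then show "1 - p \<le> p * (real m - 1)" by (simp add: M_def algebra_simps)
    qed (use \<alpha>(1) i m p in auto)
    moreover have "(\<Sum>j<m. ln (2 * \<alpha> j)) = (\<Sum>j<m. ln 4 + ln (\<alpha> j / 2))"
    proof (rule sum.cong)
      fix j assume "j \<in> {..<m}"
      then have "\<alpha> j > 0" using \<alpha>(1) by simp
      then show "ln (2 * \<alpha> j) = ln 4 + ln (\<alpha> j / 2)" by (subst ln_mult_pos[symmetric]) auto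
    qed simp
    ultimately have "(\<Sum>j<m. ln (2 * \<alpha> j)) \<le> M * ln 4 + ln p + (M - 1) * ln ((1 - p) / (M - 1))" by (simp add: sum.distrib M_def)
    moreover have "M * ln (4 / M) = M * ln 4 - M * ln M" using M5 by (simp add: ln_div algebra_simps)
    ultimately show ?thesis by (simp add: b_def)
  qed
  have "\<gamma> / M \<le> 1" using gM p4 by linarith
  then have "(1 - \<gamma> / M) * (\<Sum>j<m. ln (2 * \<alpha> j)) \<le> (1 - \<gamma> / M) * (M * ln (4 / M) - b)" by (intro mult_left_mono S) auto
  also have "\<dots> = M * ln (4 / M) + \<gamma> * (6 * t - ln 4) - (1 - \<gamma> / M) * b"
    using M5 lM by (simp add: ln_div field_simps)
  also have "\<dots> \<le> M * ln (4 / M) + M * efun (sqrt \<gamma> / M)" using g3 fin E B by linarith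
  finally show ?thesis by (simp add: M_def)
qed

section \<open>The inequality for one coordinate\<close>

text \<open>A single zero at distance \<open>2 * \<rho>\<close> from \<open>a\<close> suffices. The
  suprema of the Robin constants are thereby taken over nonempty sets.\<close>

lemma green_approx_exists:
  assumes U: "open U" "a \<in> U"
  shows "\<exists>v. green_approx U a v"
proof -
  obtain \<rho> where \<rho>: "\<rho> > 0" "cball a \<rho> \<subseteq> U" using U open_contains_cball by blast
  define s where "s = a + of_real (2 * \<rho>)"
  have sa: "cmod (s - a) = 2 * \<rho>" using \<rho> by (simp add: s_def)
  have "exp (ln (\<rho> / 2)) * (cmod (w - s) / cmod (s - a)) < cmod (w - a)" if w: "w \<in> frontier (ball a \<rho>)" for w
  proof -
    have wa: "cmod (w - a) = \<rho>" using w \<rho> by (simp add: frontier_ball dist_norm norm_minus_commute)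
    have "cmod (w - s) \<le> cmod (w - a) + cmod (s - a)" by (metis norm_triangle_ineq4 diff_diff_eq2 diff_add_cancel)
    then have "cmod (w - s) / cmod (s - a) \<le> 3 / 2" using \<rho> unfolding wa sa by (simp add: divide_le_eq)
    from mult_left_mono[OF this, of "\<rho> / 2"] show ?thesis using \<rho> unfolding wa by simp
  qed
  moreover have "s \<notin> ball a \<rho>" using \<rho> sa by (simp add: dist_norm norm_minus_commute)
  ultimately have "green_approx U a (ln (\<rho> / 2))"
    unfolding green_approx_def using \<rho> by (intro exI[of _ "ball a \<rho>"] exI[of _ "{s}"]) auto
  then show ?thesis by blast
qed

text \<open>Freezing all entries but one bounds the corresponding set. In the application the
  finiteness of each inner radius thus comes out of the inequality for the whole
  configuration.\<close>

lemma weighted_sum_Sup_le: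
  fixes V :: "'i \<Rightarrow> real set" and w :: "'i \<Rightarrow> real"
  assumes I: "finite I" and w: "\<And>k. k \<in> I \<Longrightarrow> 0 < w k" and V: "\<And>k. k \<in> I \<Longrightarrow> V k \<noteq> {}"
    and le: "\<And>v. (\<And>k. k \<in> I \<Longrightarrow> v k \<in> V k) \<Longrightarrow> (\<Sum>k\<in>I. w k * v k) \<le> C"
  shows "(\<forall>k\<in>I. bdd_above (V k)) \<and> (\<Sum>k\<in>I. w k * Sup (V k)) \<le> C"
proof (intro conjI ballI)
  have "\<forall>k. \<exists>x. k \<in> I \<longrightarrow> x \<in> V k" using V by blast
  then obtain u where u: "\<And>k. k \<in> I \<Longrightarrow> u k \<in> V k" by metis
  show "bdd_above (V k)" if k: "k \<in> I" for k
  proof (rule bdd_aboveI)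
    fix x assume x: "x \<in> V k"
    have "(\<Sum>i\<in>I. w i * (u(k := x)) i) \<le> C" by (rule le) (use u x in auto)
    also have "(\<Sum>i\<in>I. w i * (u(k := x)) i) = w k * x + (\<Sum>i\<in>I - {k}. w i * u i)"
      using I k by (subst sum.remove[of I k]) (auto intro!: sum.cong)
    finally show "x \<le> (C - (\<Sum>i\<in>I - {k}. w i * u i)) / w k" using w[OF k] by (simp add: pos_le_divide_eq mult.commute)
  qed
  show "(\<Sum>k\<in>I. w k * Sup (V k)) \<le> C"
  proof (rule field_le_epsilon)
    fix \<eta> :: real assume \<eta>: "\<eta> > 0"
    define W where "W = (\<Sum>k\<in>I. w k) + 1"
    have "0 \<le> (\<Sum>k\<in>I. w k)" using w by (intro sum_nonneg) (auto intro: less_imp_le)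
    then have W: "W > 0" "(\<Sum>k\<in>I. w k) \<le> W" by (auto simp: W_def)
    have "\<forall>k. \<exists>x. k \<in> I \<longrightarrow> x \<in> V k \<and> Sup (V k) - \<eta> / W < x"
    proof
      fix k
      have "k \<in> I \<Longrightarrow> \<exists>x\<in>V k. Sup (V k) - \<eta> / W < x"
        using less_cSupE[of "Sup (V k) - \<eta> / W" "V k"] V[of k] \<eta> W by auto
      then show "\<exists>x. k \<in> I \<longrightarrow> x \<in> V k \<and> Sup (V k) - \<eta> / W < x" by blast
    qed
    then obtain v where v: "\<And>k. k \<in> I \<Longrightarrow> v k \<in> V k" "\<And>k. k \<in> I \<Longrightarrow> Sup (V k) - \<eta> / W < v k" by metis
    have "(\<Sum>k\<in>I. w k * Sup (V k)) \<le> (\<Sum>k\<in>I. w k * v k + w k * (\<eta> / W))"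
    proof (rule sum_mono)
      fix k assume k: "k \<in> I"
      have "Sup (V k) \<le> v k + \<eta> / W" using v(2)[OF k] by simp
      from mult_left_mono[OF this, of "w k"] show "w k * Sup (V k) \<le> w k * v k + w k * (\<eta> / W)"
        using w[OF k] by (simp add: distrib_left)
    qed
    also have "\<dots> = (\<Sum>k\<in>I. w k * v k) + (\<Sum>k\<in>I. w k) * (\<eta> / W)" by (simp only: sum.distrib sum_distrib_right)
    also have "(\<Sum>k\<in>I. w k) * (\<eta> / W) \<le> W * (\<eta> / W)" using W \<eta> by (intro mult_right_mono) auto
    also have "W * (\<eta> / W) = \<eta>" using W by simp
    also have "(\<Sum>k\<in>I. w k * v k) \<le> C" by (rule le) (rule v)
    finally show "(\<Sum>k\<in>I. w k * Sup (V k)) \<le> C + \<eta>" by simp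
  qed
qed

text \<open>The logarithm of \<open>Lgam\<close>, with points indexed from 0; the index \<open>m\<close> repeats the index 0 after a full turn.\<close>
definition log_L :: "real \<Rightarrow> nat \<Rightarrow> (nat \<Rightarrow> real) \<Rightarrow> (nat \<Rightarrow> real) \<Rightarrow> real" where
  "log_L g m \<theta> r =
     (\<Sum>j<m. (1 - g / 2 * ((\<theta> (Suc j) - \<theta> j) / pi)\<^sup>2) * ln (chi ((r j / r (Suc j)) powr (1 / (2 * ((\<theta> (Suc j) - \<theta> j) / pi))))))
   + (\<Sum>j<m. (1 + g / 4 * ((\<theta> (Suc j) - \<theta> j) / pi + (\<theta> (Suc (if j = 0 then m - 1 else j - 1)) - \<theta> (if j = 0 then m - 1 else j - 1)) / pi)) * ln (r j))"

text \<open>Makes the limit of \<open>log_L g\<close> as g tends to 0 explicit.\<close>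

lemma log_L_affine: "log_L g m \<theta> r = log_L 0 m \<theta> r + g * (log_L 1 m \<theta> r - log_L 0 m \<theta> r)"
  unfolding log_L_def by (simp add: sum_distrib_left sum.distrib[symmetric] sum_subtractf[symmetric] algebra_simps)

lemma chi_ge_1: "0 < t \<Longrightarrow> 1 \<le> chi t"
proof -
  assume t: "0 < t"
  have "0 \<le> (t - 1)\<^sup>2" by simp
  then have "2 * t \<le> t * t + 1" by (simp add: power2_eq_square algebra_simps)
  then show ?thesis using t by (simp add: chi_def field_simps)
qed

text \<open>A crude majorant that vanishes at 0, for the limit of the sector inequality as \<gamma>
  tends to 0.\<close>

lemma efun_le:
  assumes "0 < x" "2 * x \<le> 1"
  shows "efun x \<le> x"
proof -
  have "2 * x\<^sup>2 * ln (2 * x) \<le> 0" using assms by (simp add: mult_nonneg_nonpos)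
  moreover have "0 \<le> (1 + x)\<^sup>2 * ln (1 + x)" using assms by simp
  moreover have "- ((1 - x)\<^sup>2 * ln (1 - x)) \<le> x"
  proof -
    have "- ln (1 - x) \<le> x / (1 - x)" using ln_le_minus_one[of "1 / (1 - x)"] assms by (simp add: ln_div field_simps)
    from mult_left_mono[OF this, of "(1 - x)\<^sup>2"]
    have "- ((1 - x)\<^sup>2 * ln (1 - x)) \<le> (1 - x) * x" using assms by (simp add: power2_eq_square)
    also have "\<dots> \<le> 1 * x" using assms by (intro mult_right_mono) auto
    finally show ?thesis by simp
  qed
  ultimately show ?thesis unfolding efun_def by linarith
qed

context sector_family
begin

text \<open>\<open>AA j\<close> is an arithmetic mean of two powers, and dividing it by their
  geometric mean gives \<open>chi\<close>; this is how \<open>chi\<close> enters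
  \<open>Lgam\<close>. The exponents come from \<open>TT j = sqrt \<gamma> * al j / 2\<close>, and
  the logarithms of \<open>1 + T\<close>, \<open>1 - T\<close> and \<open>2 * T\<close> assemble to
  \<open>efun\<close>.\<close>

lemma sector_term:
  assumes j: "j < m"
  shows "(ec j 1 + ec j (-1) - 2 * TT j * zc j) / 2 = ln (2 * al j) + efun (TT j)
     + (1 - \<gamma> / 2 * (al j)\<^sup>2) * ln (chi ((r j / r (Suc j)) powr (1 / (2 * al j)))) + (1 / 2 + \<gamma> / 4 * al j) * (ln (r j) + ln (r (Suc j)))"
proof -
  define T where "T = TT j"
  define a where "a = al j"
  define x y where "x = ln (r j)" and "y = ln (r (Suc j))"
  note s = sp[OF j]
  have r0: "r j > 0" "r (Suc j) > 0" using r(1)[of j] r(1)[of "Suc j"] j by auto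
  have a: "a > 0" using al_pos[OF j] by (simp add: a_def)
  have T: "0 < T" "T < 1" using sector_param.T[OF s] by (simp_all add: T_def)
  have A: "AA j > 0" by (rule sector_param.A_pos[OF s])
  have rho: "r j = exp x" "r (Suc j) = exp y" using r0 by (simp_all add: x_def y_def)
  have pw: "exp u powr c = exp (c * u)" for u c :: real by (simp add: powr_def)
  have i: "1 / (AA j + BB j) = exp (x / a)" "1 / (AA j - BB j) = exp (y / a)"
    unfolding AB_sum rho pw by (simp_all add: a_def exp_minus)
  have lnA: "ln (AA j) = ln (chi ((r j / r (Suc j)) powr (1 / (2 * a)))) - (x + y) / (2 * a)"
  proof -
    have "chi ((r j / r (Suc j)) powr (1 / (2 * a))) = AA j * exp ((x + y) / (2 * a))"
    proof -
      have q: "(r j / r (Suc j)) powr (1 / (2 * a)) = exp ((x - y) / (2 * a))" unfolding rho exp_diff[symmetric] pw by simp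
      have A2: "AA j = (exp (- (x / a)) + exp (- (y / a))) / 2" unfolding AA_def rho pw by (simp add: a_def exp_minus inverse_eq_divide)
      have e: "exp (- (x / a)) * exp ((x + y) / (2 * a)) = exp (- ((x - y) / (2 * a)))" "exp (- (y / a)) * exp ((x + y) / (2 * a)) = exp ((x - y) / (2 * a))"
        unfolding mult_exp_exp using a by (simp_all add: field_simps)
      have "AA j * exp ((x + y) / (2 * a)) = (exp (- (x / a)) * exp ((x + y) / (2 * a)) + exp (- (y / a)) * exp ((x + y) / (2 * a))) / 2"
        unfolding A2 by (simp only: distrib_right times_divide_eq_left)
      then show ?thesis unfolding e q chi_def by (simp add: exp_minus inverse_eq_divide)
    qed
    then show ?thesis using A by (simp add: ln_mult_pos)
  qed
  have e1: "ec j 1 = ln 2 + T * (ln (1 - T) - ln (1 + T)) + (x + ln a + ln (AA j) + x / a) - ln (1 - T\<^sup>2)"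
  proof -
    have "(1 / (AA j + 1 * BB j)) powr al j * al j * AA j / (AA j + 1 * BB j) = exp x * a * AA j * exp (x / a)"
      using i(1) a by (simp add: pw a_def[symmetric]) (metis divide_inverse inverse_eq_divide)
    moreover have "ln (exp x * a * AA j * exp (x / a)) = x + ln a + ln (AA j) + x / a" using a A by (simp add: ln_mult_pos)
    ultimately show ?thesis unfolding sector_param.end_const_def[OF s] unfolding T_def[symmetric] by simp
  qed
  have e2: "ec j (-1) = ln 2 + T * (ln (1 - T) - ln (1 + T)) + (y + ln a + ln (AA j) + y / a) - ln (1 - T\<^sup>2)"
  proof -
    have "(1 / (AA j + (-1) * BB j)) powr al j * al j * AA j / (AA j + (-1) * BB j) = exp y * a * AA j * exp (y / a)"
      using i(2) a by (simp add: pw a_def[symmetric]) (metis divide_inverse inverse_eq_divide)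
    moreover have "ln (exp y * a * AA j * exp (y / a)) = y + ln a + ln (AA j) + y / a" using a A by (simp add: ln_mult_pos)
    ultimately show ?thesis unfolding sector_param.end_const_def[OF s] unfolding T_def[symmetric] by simp
  qed
  have z: "zc j = ln (1 + T) - ln (1 - T) - 2 * T * ln (2 * T) + T * ln (1 - T\<^sup>2) + 2 * T * ln (AA j)"
    unfolding sector_param.zero_const_def[OF s] unfolding T_def[symmetric] ..
  have "1 - T\<^sup>2 = (1 + T) * (1 - T)" by (simp add: power2_eq_square algebra_simps)
  then have l: "ln (1 - T\<^sup>2) = ln (1 + T) + ln (1 - T)" using T by (simp add: ln_mult_pos)
  have Ta: "2 * T\<^sup>2 = \<gamma> / 2 * a\<^sup>2" using \<gamma> by (simp add: T_def a_def TT_def power2_eq_square)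
  then have T2: "T\<^sup>2 = \<gamma> / 4 * a\<^sup>2" by simp
  have Ta': "T\<^sup>2 * ((x + y) / a) = \<gamma> / 4 * a * (x + y)" unfolding T2 using a by (simp add: power2_eq_square)
  have l2: "ln (2 * a) = ln 2 + ln a" using a by (simp add: ln_mult_pos)
  define d q where "d = x / a" and "q = (x + y) / a"
  have yq: "y / a = q - d" by (simp add: d_def q_def add_divide_distrib)
  have "(ec j 1 + ec j (-1) - 2 * T * zc j) / 2 = ln 2 + ln a + (2 * T\<^sup>2 * ln (2 * T) - (1 + T)\<^sup>2 * ln (1 + T) - (1 - T)\<^sup>2 * ln (1 - T))
      + (1 - 2 * T\<^sup>2) * (ln (AA j) + q / 2) + (x + y) / 2 + T\<^sup>2 * q"
    unfolding e1 e2 z l yq d_def[symmetric] by (simp add: field_simps power2_eq_square)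
  also have "ln (AA j) + q / 2 = ln (chi ((r j / r (Suc j)) powr (1 / (2 * a))))" unfolding lnA q_def by simp
  finally show ?thesis unfolding efun_def[symmetric] unfolding q_def Ta Ta' T_def[symmetric] a_def[symmetric] x_def[symmetric] y_def[symmetric] l2 by (simp add: algebra_simps)
qed

text \<open>Every point borders two sectors; a cyclic shift of the index collects its two
  contributions into the exponent \<open>1 + \<gamma> / 4 * (al j + al (pr j))\<close>.\<close>

lemma sum_sector_terms:
  "(\<Sum>j<m. (ec j 1 + ec j (-1) - 2 * TT j * zc j) / 2) = (\<Sum>j<m. ln (2 * al j) + efun (TT j)) + log_L \<gamma> m \<theta> r"
proof -
  have lr: "(\<Sum>j<m. c j * ln (r (Suc j))) = (\<Sum>j<m. c (pr j) * ln (r j))" for c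
  proof -
    obtain n where n: "m = Suc n" using m by (cases m) auto
    have p: "pr 0 = n" "pr (Suc i) = i" for i unfolding pr_def using n by simp_all
    have "(\<Sum>j<m. c (pr j) * ln (r j)) = (\<Sum>j<Suc n. c (pr j) * ln (r j))" by (simp only: n)
    also have "\<dots> = c n * ln (r 0) + (\<Sum>j<n. c j * ln (r (Suc j)))"
      unfolding sum.lessThan_Suc_shift p ..
    finally show ?thesis using r(2) n by simp
  qed
  have "(\<Sum>j<m. (ec j 1 + ec j (-1) - 2 * TT j * zc j) / 2) = (\<Sum>j<m. ln (2 * al j) + efun (TT j)
     + (1 - \<gamma> / 2 * (al j)\<^sup>2) * ln (chi ((r j / r (Suc j)) powr (1 / (2 * al j)))) + (1 / 2 + \<gamma> / 4 * al j) * (ln (r j) + ln (r (Suc j))))"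
    by (rule sum.cong) (auto simp only: sector_term lessThan_iff)
  also have "\<dots> = (\<Sum>j<m. ln (2 * al j) + efun (TT j)) + (\<Sum>j<m. (1 - \<gamma> / 2 * (al j)\<^sup>2) * ln (chi ((r j / r (Suc j)) powr (1 / (2 * al j)))))
      + ((\<Sum>j<m. (1 / 2 + \<gamma> / 4 * al j) * ln (r j)) + (\<Sum>j<m. (1 / 2 + \<gamma> / 4 * al j) * ln (r (Suc j))))"
    by (simp only: sum.distrib distrib_left)
  also have "(\<Sum>j<m. (1 / 2 + \<gamma> / 4 * al j) * ln (r j)) + (\<Sum>j<m. (1 / 2 + \<gamma> / 4 * al j) * ln (r (Suc j))) = (\<Sum>j<m. (1 + \<gamma> / 4 * (al j + al (pr j))) * ln (r j))"
    unfolding lr sum.distrib[symmetric] by (rule sum.cong) (simp_all add: algebra_simps)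
  finally show ?thesis unfolding log_L_def al_def pr_def by simp
qed

end

theorem configuration_inequality:
  fixes m :: nat and \<theta> r :: "nat \<Rightarrow> real" and \<gamma> :: real and U :: "nat \<Rightarrow> complex set" and c :: "nat \<Rightarrow> complex" and v :: "nat \<Rightarrow> real"
  assumes m: "m \<ge> 5" and \<gamma>: "0 < \<gamma>" "\<gamma> ^ 3 \<le> real m"
    and \<theta>: "\<And>j. j < m \<Longrightarrow> \<theta> j < \<theta> (Suc j)" "\<theta> m = \<theta> 0 + 2 * pi" and r: "\<And>j. j \<le> m \<Longrightarrow> r j > 0" "r m = r 0"
    and L: "log_L \<gamma> m \<theta> r = 0" "log_L 0 m \<theta> r = 0"
    and U: "\<And>k. k \<le> m \<Longrightarrow> open (U k)" and disj: "\<And>k l. k \<le> m \<Longrightarrow> l \<le> m \<Longrightarrow> k \<noteq> l \<Longrightarrow> U k \<inter> U l = {}"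
    and c: "\<And>k. k \<le> m \<Longrightarrow> c k \<in> U k" "\<And>k. k < m \<Longrightarrow> c k = of_real (r k) * cis (\<theta> k)" "c m = 0"
    and v: "\<And>k. k \<le> m \<Longrightarrow> green_approx (U k) (c k) (v k)"
  shows "\<gamma> * v m + (\<Sum>k<m. v k) \<le> m * ln (4 / m) + m * efun (sqrt \<gamma> / m)"
proof -
  define \<alpha> where "\<alpha> j = (\<theta> (Suc j) - \<theta> j) / pi" for j
  have \<alpha>0: "0 < \<alpha> j" if "j < m" for j using \<theta>(1)[OF that] by (simp add: \<alpha>_def)
  have sum\<alpha>: "(\<Sum>j<m. \<alpha> j) = 2"
  proof -
    have "(\<Sum>j<m. \<alpha> j) = (\<Sum>j<m. \<theta> (Suc j) - \<theta> j) / pi" by (simp add: \<alpha>_def sum_divide_distrib)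
    also have "(\<Sum>j<m. \<theta> (Suc j) - \<theta> j) = \<theta> m - \<theta> 0" by (rule sum_lessThan_telescope)
    finally show ?thesis using \<theta>(2) by simp
  qed
  have sector: "g * v m + (\<Sum>k<m. v k) \<le> (\<Sum>j<m. ln (2 * \<alpha> j) + efun (sqrt g * \<alpha> j / 2)) + log_L g m \<theta> r"
    if g: "0 < g" "\<And>j. j < m \<Longrightarrow> sqrt g * \<alpha> j < 2" for g
  proof -
    interpret sector_family m \<theta> r g
    proof
      show "sqrt g * (\<theta> (Suc j) - \<theta> j) < 2 * pi" if "j < m" for j using g(2)[OF that] by (simp add: \<alpha>_def field_simps)
    qed (use m g \<theta> r in auto)
    have cp: "c k = pt k" if "k < m" for k using c(2)[OF that] unfolding pt_def .
    have "g * v m + (\<Sum>k<m. v k) \<le> (\<Sum>j<m. (ec j 1 + ec j (-1) - 2 * TT j * zc j) / 2)"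
      by (rule sector_inequality[where U=U and c=c and v=v, OF U disj c(1) cp c(3) v])
    then show ?thesis unfolding sum_sector_terms unfolding TT_def al_def \<alpha>_def .
  qed
  \<comment> \<open>The sector map needs \<open>T < 1\<close>. If some opening violates this, interpolate between the limit \<open>\<gamma> \<rightarrow> 0\<close> of the sector inequality and the averaged pair inequality.\<close>
  show ?thesis
  proof (cases "\<forall>j<m. sqrt \<gamma> * \<alpha> j < 2")
    case True
    then show ?thesis using sector[OF \<gamma>(1)] main_case_sum[OF m \<gamma> \<alpha>0 sum\<alpha>] L(1) by force
  next
    case False
    then obtain i where i: "i < m" "2 \<le> sqrt \<gamma> * \<alpha> i" by force
    have S: "(\<Sum>k<m. v k) \<le> (\<Sum>j<m. ln (2 * \<alpha> j))"
    proof -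
      have sq: "((\<lambda>g. sqrt g * \<alpha> j) \<longlongrightarrow> sqrt 0 * \<alpha> j) (at_right 0)" for j by (intro tendsto_intros)
      have ev: "eventually (\<lambda>g. \<forall>j\<in>{..<m}. sqrt g * \<alpha> j < 1) (at_right 0)"
      proof (rule eventually_ball_finite, simp, rule ballI)
        show "eventually (\<lambda>g. sqrt g * \<alpha> j < 1) (at_right 0)" for j by (rule order_tendstoD(2)[OF sq]) simp
      qed
      have lim: "eventually (\<lambda>g. g * v m + (\<Sum>k<m. v k) \<le> (\<Sum>j<m. ln (2 * \<alpha> j) + sqrt g * \<alpha> j / 2) + (log_L 0 m \<theta> r + g * (log_L 1 m \<theta> r - log_L 0 m \<theta> r))) (at_right 0)"
        using ev eventually_at_right_less[of 0]
      proof eventually_elim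
        case (elim g)
        have "g * v m + (\<Sum>k<m. v k) \<le> (\<Sum>j<m. ln (2 * \<alpha> j) + efun (sqrt g * \<alpha> j / 2)) + log_L g m \<theta> r"
          by (rule sector) (use elim in force)+
        also have "(\<Sum>j<m. ln (2 * \<alpha> j) + efun (sqrt g * \<alpha> j / 2)) \<le> (\<Sum>j<m. ln (2 * \<alpha> j) + sqrt g * \<alpha> j / 2)"
          by (intro sum_mono add_left_mono efun_le) (use elim \<alpha>0 in \<open>auto intro: less_imp_le\<close>)
        finally show ?case unfolding log_L_affine[of g] by simp
      qed
      have "0 * v m + (\<Sum>k<m. v k) \<le> (\<Sum>j<m. ln (2 * \<alpha> j) + sqrt 0 * \<alpha> j / 2) + (log_L 0 m \<theta> r + 0 * (log_L 1 m \<theta> r - log_L 0 m \<theta> r))"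
        by (rule tendsto_le[OF trivial_limit_at_right_real _ _ lim]; intro tendsto_intros) simp_all
      then show ?thesis using L(2) by simp
    qed
    \<comment> \<open>The pair inequality summed over all points. As \<open>chi\<close> is at least
      1, the condition on L(0) makes the product of the moduli \<open>r k\<close> at most 1.\<close>
    have P: "m * v m + (\<Sum>k<m. v k) \<le> 0"
    proof -
      have "v m + v k \<le> 2 * ln (r k)" if k: "k < m" for k
      proof -
        have n: "cmod (c k) = r k" using c(2)[OF k] r(1)[of k] k by (simp add: norm_mult)
        have "v m + v k \<le> 2 * ln (cmod (c k))"
          using pair_inequality[of "U m" "U k" "c k" "v m" "v k"] U[of m] U[of k] disj[of m k] c(1)[of m] c(1)[of k] c(3) v[of m] v[of k] k n r(1)[of k] by force
        then show ?thesis unfolding n .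
      qed
      then have "(\<Sum>k<m. v m + v k) \<le> (\<Sum>k<m. 2 * ln (r k))" by (intro sum_mono) auto
      then have "m * v m + (\<Sum>k<m. v k) \<le> 2 * (\<Sum>k<m. ln (r k))" by (simp add: sum.distrib sum_distrib_left)
      moreover have "(\<Sum>k<m. ln (r k)) \<le> 0"
      proof -
        have "0 \<le> (\<Sum>j<m. ln (chi ((r j / r (Suc j)) powr (1 / (2 * \<alpha> j)))))"
        proof (rule sum_nonneg)
          fix j assume "j \<in> {..<m}"
          then have "0 < (r j / r (Suc j)) powr (1 / (2 * \<alpha> j))" using r(1)[of j] r(1)[of "Suc j"] by auto
          then show "0 \<le> ln (chi ((r j / r (Suc j)) powr (1 / (2 * \<alpha> j))))" using chi_ge_1 by simp
        qed
        then show ?thesis using L(2) unfolding log_L_def \<alpha>_def by simp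
      qed
      ultimately show ?thesis by linarith
    qed
    have g1: "\<gamma> / m \<le> 1"
    proof (rule ccontr)
      assume "\<not> \<gamma> / m \<le> 1"
      then have "real m < \<gamma>" using m by (simp add: field_simps)
      then have "real m < \<gamma> * 1" "1 \<le> \<gamma>\<^sup>2" using m by (auto intro!: one_le_power)
      then have "real m < \<gamma> * \<gamma>\<^sup>2" using mult_left_mono[of 1 "\<gamma>\<^sup>2" \<gamma>] \<gamma> by linarith
      then show False using \<gamma>(2) by (simp add: eval_nat_numeral)
    qed
    \<comment> \<open>The weight \<open>\<gamma> / m\<close> on \<open>P\<close> is the one that
      gives \<open>v m\<close> the coefficient \<gamma>; the remaining weight goes to
      \<open>S\<close>.\<close>
    have "\<gamma> * v m + (\<Sum>k<m. v k) = (1 - \<gamma> / m) * (\<Sum>k<m. v k) + \<gamma> / m * (m * v m + (\<Sum>k<m. v k))" using m by (simp add: field_simps)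
    also have "\<dots> \<le> (1 - \<gamma> / m) * (\<Sum>j<m. ln (2 * \<alpha> j)) + 0"
      using g1 S P \<gamma> by (intro add_mono mult_left_mono mult_nonneg_nonpos) auto
    also have "\<dots> \<le> m * ln (4 / m) + m * efun (sqrt \<gamma> / m)"
      using large_case_sum[OF m \<gamma> \<alpha>0 sum\<alpha> i] by simp
    finally show ?thesis .
  qed
qed

section \<open>Polycylindrical domains\<close>

lemma arg0_range: "0 \<le> arg0 z" "arg0 z < 2 * pi"
  using Arg_bounded[of z] pi_gt_zero by (auto simp: arg0_def)

lemma cmod_cis_arg0: "of_real (cmod z) * cis (arg0 z) = z"
proof -
  have "cis (arg0 z) = cis (Arg z)" by (simp add: arg0_def cis_mult[symmetric])
  then show ?thesis using rcis_cmod_Arg[of z] by (simp add: rcis_def)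
qed

lemma inner_radius_nonneg: "0 \<le> inner_radius B a"
  unfolding inner_radius_def by (rule Inf_greatest) auto

text \<open>Adding a full turn at index \<open>m\<close> turns the exceptional last opening of
  \<open>Lgam\<close> into an ordinary difference of consecutive angles.\<close>

lemma Lgam_eq_exp_log_L:
  fixes a :: "nat \<Rightarrow> complex"
  assumes m: "m \<ge> 2" and a: "\<And>k. k \<in> {1..m} \<Longrightarrow> a k \<noteq> 0"
  defines "\<theta> \<equiv> \<lambda>j. if j < m then arg0 (a (Suc j)) else arg0 (a 1) + 2 * pi"
    and "r \<equiv> \<lambda>j. if j < m then cmod (a (Suc j)) else cmod (a 1)"
  shows "Lgam g m a = exp (log_L g m \<theta> r)"
proof -
  define nx where "nx k = (if k < m then a (Suc k) else a 1)" for k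
  define al where "al k = (if k < m then (arg0 (a (Suc k)) - arg0 (a k)) / pi else (2 * pi + arg0 (a 1) - arg0 (a m)) / pi)" for k
  define pr where "pr k = (if k = 1 then al m else al (k - 1))" for k
  define be where "be j = (\<theta> (Suc j) - \<theta> j) / pi" for j
  have r0: "r j > 0" if "j \<le> m" for j using a m that by (auto simp: r_def)
  have al: "al (Suc j) = be j" if "j < m" for j
    using that by (auto simp: al_def be_def \<theta>_def not_less algebra_simps dest!: le_antisym[OF _ Suc_leI])
  have nx: "cmod (nx (Suc j)) = r (Suc j)" if "j < m" for j using that by (simp add: nx_def r_def)
  have aj: "cmod (a (Suc j)) = r j" if "j < m" for j using that by (simp add: r_def)
  have pr: "pr (Suc j) = be (if j = 0 then m - 1 else j - 1)" if "j < m" for j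
  proof (cases "j = 0")
    case True
    then show ?thesis using al[of "m - 1"] m by (simp add: pr_def)
  next
    case False
    then show ?thesis using al[of "j - 1"] that by (simp add: pr_def)
  qed
  have pe: "x powr c = exp (c * ln x)" if "x > 0" for x c :: real using that by (simp add: powr_def)
  have "Lgam g m a = (\<Prod>k=1..m. (chi ((cmod (a k / nx k)) powr (1 / (2 * al k)))) powr (1 - g / 2 * (al k)\<^sup>2))
      * (\<Prod>k=1..m. (cmod (a k)) powr (1 + g / 4 * (al k + pr k)))"
    unfolding Lgam_def Let_def nx_def al_def pr_def by simp
  also have "(\<Prod>k=1..m. (chi ((cmod (a k / nx k)) powr (1 / (2 * al k)))) powr (1 - g / 2 * (al k)\<^sup>2))
     = (\<Prod>j<m. exp ((1 - g / 2 * (be j)\<^sup>2) * ln (chi ((r j / r (Suc j)) powr (1 / (2 * be j))))))"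
    unfolding prod.atLeast1_atMost_eq[folded One_nat_def]
  proof (rule prod.cong)
    fix j assume "j \<in> {..<m}"
    then have j: "j < m" by simp
    have "0 < (r j / r (Suc j)) powr (1 / (2 * be j))" using r0[of j] r0[of "Suc j"] j by auto
    then have "0 < chi ((r j / r (Suc j)) powr (1 / (2 * be j)))" using chi_ge_1 by (meson less_le_trans zero_less_one)
    from pe[OF this] show "chi (cmod (a (Suc j) / nx (Suc j)) powr (1 / (2 * al (Suc j)))) powr (1 - g / 2 * (al (Suc j))\<^sup>2)
       = exp ((1 - g / 2 * (be j)\<^sup>2) * ln (chi ((r j / r (Suc j)) powr (1 / (2 * be j)))))"
      unfolding norm_divide al[OF j] nx[OF j] aj[OF j] .
  qed simp
  also have "(\<Prod>k=1..m. (cmod (a k)) powr (1 + g / 4 * (al k + pr k)))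
     = (\<Prod>j<m. exp ((1 + g / 4 * (be j + be (if j = 0 then m - 1 else j - 1))) * ln (r j)))"
    unfolding prod.atLeast1_atMost_eq[folded One_nat_def]
  proof (rule prod.cong)
    fix j assume "j \<in> {..<m}"
    then have j: "j < m" by simp
    have "0 < r j" using r0[of j] j by simp
    from pe[OF this] show "cmod (a (Suc j)) powr (1 + g / 4 * (al (Suc j) + pr (Suc j))) = exp ((1 + g / 4 * (be j + be (if j = 0 then m - 1 else j - 1))) * ln (r j))"
      unfolding al[OF j] pr[OF j] aj[OF j] .
  qed simp
  finally show ?thesis unfolding log_L_def be_def exp_sum[OF finite_lessThan, symmetric] exp_add[symmetric] .
qed

lemma coordinate_inequality:
  fixes m :: nat and \<gamma> :: real and a :: "nat \<Rightarrow> complex" and B :: "nat \<Rightarrow> complex option set"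
  assumes m: "m \<ge> 5" and \<gamma>: "0 < \<gamma>" "\<gamma> ^ 3 \<le> real m"
    and a0: "a 0 = 0" and a: "\<And>k. k \<in> {1..m} \<Longrightarrow> a k \<noteq> 0"
    and arg: "\<And>k. k \<in> {1..<m} \<Longrightarrow> arg0 (a k) < arg0 (a (Suc k))"
    and L: "Lgam \<gamma> m a = 1" "Lgam 0 m a = 1"
    and B: "\<And>k. k \<le> m \<Longrightarrow> ext_domain (B k)" "\<And>k. k \<le> m \<Longrightarrow> Some (a k) \<in> B k"
    and disj: "\<And>k j. k \<le> m \<Longrightarrow> j \<le> m \<Longrightarrow> k \<noteq> j \<Longrightarrow> B k \<inter> B j = {}"
  obtains s where "\<And>k. k \<le> m \<Longrightarrow> inner_radius (B k) (a k) \<le> ereal (exp (s k))"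
    "\<gamma> * s 0 + (\<Sum>k=1..m. s k) \<le> m * ln (4 / m) + m * efun (sqrt \<gamma> / m)"
proof -
  define \<theta> where "\<theta> = (\<lambda>j. if j < m then arg0 (a (Suc j)) else arg0 (a 1) + 2 * pi)"
  define r where "r = (\<lambda>j. if j < m then cmod (a (Suc j)) else cmod (a 1))"
  \<comment> \<open>Moves the origin from index 0 to index \<open>m\<close>, where
    \<open>configuration_inequality\<close> expects it.\<close>
  define \<iota> where "\<iota> j = (if j < m then Suc j else 0)" for j
  define U where "U j = finpart (B (\<iota> j))" for j
  define c where "c j = a (\<iota> j)" for j
  define w where "w j = (if j < m then 1 else \<gamma>)" for j
  define V where "V j = {v. green_approx (U j) (c j) v}" for j
  have \<iota>: "\<iota> j \<le> m" for j by (simp add: \<iota>_def)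
  have logL: "log_L g m \<theta> r = 0" if "Lgam g m a = 1" for g
    using Lgam_eq_exp_log_L[of m a g] a m that unfolding \<theta>_def r_def by simp
  have th: "\<theta> j < \<theta> (Suc j)" if "j < m" for j
  proof (cases "Suc j < m")
    case True
    then show ?thesis using arg[of "Suc j"] by (simp add: \<theta>_def)
  next
    case False
    then show ?thesis using that arg0_range(2)[of "a (Suc j)"] arg0_range(1)[of "a 1"] by (simp add: \<theta>_def)
  qed
  have th2: "\<theta> m = \<theta> 0 + 2 * pi" "r m = r 0" using m by (simp_all add: \<theta>_def r_def)
  have r0: "r j > 0" if "j \<le> m" for j using a m that by (auto simp: r_def)
  have oU: "open (U j)" for j using B(1)[OF \<iota>] by (simp add: U_def ext_domain_def)
  have cU: "c j \<in> U j" for j using B(2)[OF \<iota>] by (simp add: U_def c_def finpart_def)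
  have dU: "U k \<inter> U l = {}" if "k \<le> m" "l \<le> m" "k \<noteq> l" for k l
  proof -
    have "\<iota> k \<noteq> \<iota> l" using that by (auto simp: \<iota>_def split: if_splits)
    then have "B (\<iota> k) \<inter> B (\<iota> l) = {}" by (rule disj[OF \<iota> \<iota>])
    then show ?thesis by (auto simp: U_def finpart_def)
  qed
  have cp: "c k = of_real (r k) * cis (\<theta> k)" if "k < m" for k
    using that cmod_cis_arg0[of "a (Suc k)"] by (simp add: c_def \<iota>_def r_def \<theta>_def)
  have cm: "c m = 0" using a0 by (simp add: c_def \<iota>_def)
  have split: "(\<Sum>k\<le>m. w k * f k) = \<gamma> * f m + (\<Sum>k<m. f k)" for f
    by (simp add: lessThan_Suc_atMost[symmetric] w_def)
  have "(\<forall>k\<in>{..m}. bdd_above (V k)) \<and> (\<Sum>k\<le>m. w k * Sup (V k)) \<le> m * ln (4 / m) + m * efun (sqrt \<gamma> / m)"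
  proof (rule weighted_sum_Sup_le)
    fix v assume "\<And>k. k \<in> {..m} \<Longrightarrow> v k \<in> V k"
    then have "green_approx (U k) (c k) (v k)" if "k \<le> m" for k using that by (simp add: V_def)
    from configuration_inequality[OF m \<gamma> th th2(1) r0 th2(2) logL[OF L(1)] logL[OF L(2)] oU dU cU cp cm this]
    show "(\<Sum>k\<le>m. w k * v k) \<le> m * ln (4 / m) + m * efun (sqrt \<gamma> / m)" unfolding split .
  qed (use \<gamma> green_approx_exists[OF oU cU] in \<open>auto simp: w_def V_def\<close>)
  then have bd: "\<And>k. k \<le> m \<Longrightarrow> bdd_above (V k)" and S: "\<gamma> * Sup (V m) + (\<Sum>k<m. Sup (V k)) \<le> m * ln (4 / m) + m * efun (sqrt \<gamma> / m)"
    unfolding split by auto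
  have R: "inner_radius (B (\<iota> j)) (a (\<iota> j)) \<le> ereal (exp (Sup (V j)))" if "j \<le> m" for j
    unfolding c_def[symmetric]
    by (rule inner_radius_le_exp[OF oU cU]) (use bd[OF that] in \<open>auto simp: U_def V_def intro: cSup_upper\<close>)
  show ?thesis
  proof (rule that[of "\<lambda>k. if k = 0 then Sup (V m) else Sup (V (k - 1))"])
    show "inner_radius (B k) (a k) \<le> ereal (exp (if k = 0 then Sup (V m) else Sup (V (k - 1))))" if "k \<le> m" for k
    proof (cases "k = 0")
      case True
      then show ?thesis using R[of m] by (simp add: \<iota>_def)
    next
      case False
      then obtain j where "k = Suc j" by (cases k) auto
      then show ?thesis using R[of j] that by (simp add: \<iota>_def)
    qed
    show "\<gamma> * (if 0 = (0::nat) then Sup (V m) else Sup (V (0 - 1))) + (\<Sum>k=1..m. if k = 0 then Sup (V m) else Sup (V (k - 1))) \<le> m * ln (4 / m) + m * efun (sqrt \<gamma> / m)"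
      unfolding sum.atLeast1_atMost_eq[folded One_nat_def] using S by simp
  qed
qed

text \<open>In terms of \<open>x = sqrt \<gamma> / m\<close> all exponents are multiples of
  \<open>m\<close>, and the logarithms of \<open>2 * x\<close>, \<open>1 + x\<close> and
  \<open>1 - x\<close> collect to \<open>efun x\<close>.\<close>

lemma exp_bound:
  fixes m :: nat and \<gamma> :: real
  assumes m: "m > 0" and \<gamma>: "0 < \<gamma>" "sqrt \<gamma> / m < 1"
  shows "exp (m * ln (4 / m) + m * efun (sqrt \<gamma> / m)) = (4 / real m) ^ m * (4 * \<gamma> / (real m)\<^sup>2) powr (\<gamma> / real m)
         / (1 - \<gamma> / (real m)\<^sup>2) powr (real m + \<gamma> / real m)
         * ((1 - sqrt \<gamma> / real m) / (1 + sqrt \<gamma> / real m)) powr (2 * sqrt \<gamma>)"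
proof -
  define x where "x = sqrt \<gamma> / m"
  have x: "0 < x" "x < 1" using m \<gamma> by (simp_all add: x_def)
  have g: "\<gamma> / (real m)\<^sup>2 = x\<^sup>2" "4 * \<gamma> / (real m)\<^sup>2 = (2 * x)\<^sup>2" "\<gamma> / real m = m * x\<^sup>2" "sqrt \<gamma> = m * x"
    using m \<gamma> by (simp_all add: x_def power_divide power_mult_distrib power2_eq_square)
  have x2: "0 < 1 - x\<^sup>2" using x by (simp add: power_less_one_iff)
  have p: "(4 / real m) ^ m = exp (m * ln (4 / m))" using m by (simp add: exp_of_nat_mult)
  have pw: "u powr c = exp (c * ln u)" if "u > 0" for u c :: real using that by (simp add: powr_def)
  have l: "ln ((2 * x)\<^sup>2) = 2 * ln (2 * x)" "ln ((1 - x) / (1 + x)) = ln (1 - x) - ln (1 + x)" using x ln_realpow[of "2 * x" 2] by (simp_all add: ln_div)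
  have "1 - x\<^sup>2 = (1 + x) * (1 - x)" by (simp add: power2_eq_square algebra_simps)
  then have l3: "ln (1 - x\<^sup>2) = ln (1 + x) + ln (1 - x)" using x by (simp add: ln_mult_pos)
  have "(4 / real m) ^ m * (4 * \<gamma> / (real m)\<^sup>2) powr (\<gamma> / real m) / (1 - \<gamma> / (real m)\<^sup>2) powr (real m + \<gamma> / real m)
         * ((1 - sqrt \<gamma> / real m) / (1 + sqrt \<gamma> / real m)) powr (2 * sqrt \<gamma>)
     = exp (m * ln (4 / m)) * exp (m * x\<^sup>2 * ln ((2 * x)\<^sup>2)) / exp ((m + m * x\<^sup>2) * ln (1 - x\<^sup>2)) * exp (2 * (m * x) * ln ((1 - x) / (1 + x)))"
    unfolding p x_def[symmetric] g(1,2,3) pw[OF x2] using x by (simp add: pw g(4))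
  also have "\<dots> = exp (m * ln (4 / m) + m * efun x)"
    unfolding exp_add[symmetric] exp_diff[symmetric] l l3 efun_def by (rule arg_cong[where f=exp]) (simp add: power2_eq_square algebra_simps)
  finally show ?thesis by (simp add: x_def)
qed

text \<open>\<open>real_of_ereal\<close> sends infinity to 0, so the finiteness of all inner radii
  is asserted beside the inequality; it ensures that the product has the intended meaning. The
  exponents are bounded coordinate by coordinate, and the geometric mean over the coordinates turns
  into the arithmetic mean of these bounds.\<close>

theorem theorem1:
  fixes m n :: nat and \<gamma> :: real
    and A :: "nat \<Rightarrow> nat \<Rightarrow> complex"
    and B :: "nat \<Rightarrow> nat \<Rightarrow> complex option set"
  assumes "m \<ge> 5" and "n \<ge> 1"
    and "0 < \<gamma>" and "\<gamma> \<le> root 3 (real m)"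
    and "\<forall>p\<in>{1..n}. A 0 p = 0"
    and "\<forall>p\<in>{1..n}. A 1 p = 1"
    and "\<forall>p\<in>{1..n}. \<forall>k\<in>{1..m}. A k p \<noteq> 0"
    and "\<forall>p\<in>{1..n}. arg0 (A 1 p) = 0"
    and "\<forall>p\<in>{1..n}. \<forall>k\<in>{1..<m}. arg0 (A k p) < arg0 (A (Suc k) p)"
    and "\<forall>p\<in>{1..n}. Lgam \<gamma> m (\<lambda>k. A k p) = 1"
    and "\<forall>p\<in>{1..n}. Lgam 0 m (\<lambda>k. A k p) = 1"
    and "\<forall>k\<in>{0..m}. \<forall>p\<in>{1..n}. ext_domain (B k p) \<and> Some (A k p) \<in> B k p"
    and "\<forall>p\<in>{1..n}. \<forall>k\<in>{0..m}. \<forall>j\<in>{0..m}. k \<noteq> j \<longrightarrow> B k p \<inter> B j p = {}"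
  shows "(\<forall>k\<in>{0..m}. \<forall>p\<in>{1..n}. inner_radius (B k p) (A k p) \<noteq> \<infinity>) \<and>
    (gen_inner_radius n (B 0) (A 0)) powr \<gamma> * (\<Prod>k=1..m. gen_inner_radius n (B k) (A k))
      \<le> (4 / real m) ^ m * (4 * \<gamma> / (real m)\<^sup>2) powr (\<gamma> / real m)
         / (1 - \<gamma> / (real m)\<^sup>2) powr (real m + \<gamma> / real m)
         * ((1 - sqrt \<gamma> / real m) / (1 + sqrt \<gamma> / real m)) powr (2 * sqrt \<gamma>)"
proof -
  have g3: "\<gamma> ^ 3 \<le> real m"
  proof -
    have "\<gamma> ^ 3 \<le> root 3 (real m) ^ 3" using assms(3,4) by (intro power_mono) auto
    then show ?thesis by simp
  qed
  have gm: "sqrt \<gamma> / m < 1"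
  proof -
    have "\<gamma> < (real m)\<^sup>2"
    proof (rule ccontr)
      assume "\<not> \<gamma> < (real m)\<^sup>2"
      then have "((real m)\<^sup>2) ^ 3 \<le> \<gamma> ^ 3" by (intro power_mono) auto
      then have "((real m)\<^sup>2) ^ 3 \<le> real m" using g3 by linarith
      moreover have "real m ^ 1 < real m ^ 6" using assms(1) by (intro power_strict_increasing) auto
      moreover have "((real m)\<^sup>2) ^ 3 = real m ^ 6" unfolding power_mult[symmetric] by simp
      ultimately show False by simp
    qed
    then have "sqrt \<gamma> < real m" by (intro real_less_lsqrt) (use assms(1,3) in auto)
    then show ?thesis using assms(1) by simp
  qed
  define K where "K = m * ln (4 / m) + m * efun (sqrt \<gamma> / m)"
  have "\<forall>p. \<exists>s. p \<in> {1..n} \<longrightarrow> (\<forall>k\<le>m. inner_radius (B k p) (A k p) \<le> ereal (exp (s k))) \<and> \<gamma> * s 0 + (\<Sum>k=1..m. s k) \<le> K"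
  proof
    fix p
    show "\<exists>s. p \<in> {1..n} \<longrightarrow> (\<forall>k\<le>m. inner_radius (B k p) (A k p) \<le> ereal (exp (s k))) \<and> \<gamma> * s 0 + (\<Sum>k=1..m. s k) \<le> K"
    proof (cases "p \<in> {1..n}")
      case p: True
      obtain s where "\<And>k. k \<le> m \<Longrightarrow> inner_radius (B k p) (A k p) \<le> ereal (exp (s k))" "\<gamma> * s 0 + (\<Sum>k=1..m. s k) \<le> K"
        unfolding K_def
        by (rule coordinate_inequality[OF assms(1,3) g3, of "\<lambda>k. A k p" "\<lambda>k. B k p"]) (use p assms(5-13) in auto)
      then show ?thesis by blast
    qed blast
  qed
  then obtain s where s: "\<And>p k. p \<in> {1..n} \<Longrightarrow> k \<le> m \<Longrightarrow> inner_radius (B k p) (A k p) \<le> ereal (exp (s p k))"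
    "\<And>p. p \<in> {1..n} \<Longrightarrow> \<gamma> * s p 0 + (\<Sum>k=1..m. s p k) \<le> K" by metis
  have R: "0 \<le> real_of_ereal (inner_radius (B k p) (A k p)) \<and> real_of_ereal (inner_radius (B k p) (A k p)) \<le> exp (s p k) \<and> inner_radius (B k p) (A k p) \<noteq> \<infinity>"
    if "p \<in> {1..n}" "k \<le> m" for k p
    using s(1)[OF that] inner_radius_nonneg[of "B k p" "A k p"] by (cases "inner_radius (B k p) (A k p)") auto
  define \<sigma> where "\<sigma> k = (\<Sum>p=1..n. s p k) / n" for k
  have gen: "0 \<le> gen_inner_radius n (B k) (A k) \<and> gen_inner_radius n (B k) (A k) \<le> exp (\<sigma> k)" if k: "k \<le> m" for k
  proof -
    have "(\<Prod>p=1..n. real_of_ereal (inner_radius (B k p) (A k p))) \<le> (\<Prod>p=1..n. exp (s p k))"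
      by (rule prod_mono) (use R k in blast)
    also have "\<dots> = exp (\<Sum>p=1..n. s p k)" by (simp add: exp_sum)
    finally have "(\<Prod>p=1..n. real_of_ereal (inner_radius (B k p) (A k p))) powr (1 / n) \<le> exp (\<Sum>p=1..n. s p k) powr (1 / n)"
      by (intro powr_mono2 prod_nonneg) (use R k in auto)
    also have "\<dots> = exp (\<sigma> k)" by (simp add: powr_def \<sigma>_def)
    finally show ?thesis by (simp add: gen_inner_radius_def)
  qed
  have "(gen_inner_radius n (B 0) (A 0)) powr \<gamma> * (\<Prod>k=1..m. gen_inner_radius n (B k) (A k)) \<le> exp (\<sigma> 0) powr \<gamma> * (\<Prod>k=1..m. exp (\<sigma> k))"
    by (intro mult_mono powr_mono2 prod_mono prod_nonneg) (use gen assms(3) in auto)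
  also have "\<dots> = exp (\<gamma> * \<sigma> 0 + (\<Sum>k=1..m. \<sigma> k))" by (simp add: powr_def exp_add exp_sum)
  also have "\<gamma> * \<sigma> 0 + (\<Sum>k=1..m. \<sigma> k) = (\<Sum>p=1..n. \<gamma> * s p 0 + (\<Sum>k=1..m. s p k)) / n"
    unfolding \<sigma>_def sum_divide_distrib[symmetric] sum.distrib sum.swap[of _ "{1..m}"] by (simp add: add_divide_distrib sum_distrib_left)
  also have "\<dots> \<le> (\<Sum>p=1..n. K) / n" using s(2) by (intro divide_right_mono sum_mono) auto
  also have "(\<Sum>p=1..n. K) / n = K" using assms(2) by simp
  finally have "(gen_inner_radius n (B 0) (A 0)) powr \<gamma> * (\<Prod>k=1..m. gen_inner_radius n (B k) (A k)) \<le> exp K" by simp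
  then show ?thesis unfolding K_def exp_bound[OF _ assms(3) gm, of, OF less_le_trans[OF _ assms(1)], simplified] using R by auto
qed

end
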